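(* Let $K=K_+=\{\mu\in\mathbb{R}^n:\mu\ge0\}$ and consider $n\to\infty$ with $m=m_n$, $\sigma\in(0,\infty)$ fixed, and $Y=X\mu_0+\xi$ as in the context. Suppose $m/n>1/2$, and that the coordinates of $\mu_0=(\mu_{0,i})\in K_+$ are i.i.d. copies of a non-negative random variable $U$ with $\mathbb{E}U^2<\infty$ ($\mu_0$ being independent of $X,\xi$). For $x\ge 0$ let $$\mathsf{G}(x)=\Phi(x)-x\varphi(x)+x^2\Phi(-x),\qquad \mathsf{H}(x)=\Phi(x)-\mathsf{G}(x)=x\varphi(x)-x^2\Phi(-x),$$ with $\varphi,\Phi$ the standard normal density and distribution function. The following hold for any sequence of near minimizers $\hat\mu(\sigma)\in K_+$. (1) The fixed point equation $$\omega_{m/n}^2(r)\cdot\mathbb{E}\,\mathsf{G}\Big(\frac{U}{\omega_{m/n}(r)}\Big)=r^2$$ admits a unique solution $r_{n,+}\in(0,\infty)$. If furthermore $\liminf_n m/n>1/2$ and $$\frac1{\sigma^2}\limsup_n\;\omega_{m/n}^2(r_{n,+})\,\mathbb{E}\,\mathsf{H}\Big(\frac{U}{\omega_{m/n}(r_{n,+})}\Big)<1,$$ then $n^{-1}\|\hat\mu(\sigma)-\mu_0\|^2/r_{n,+}^2\to1$ in probability. (2) Suppose $m/n\to\delta\in(1/2,\infty)$. Then the fixed point equation in (1) with $m/n$ replaced by $\delta$ admits a unique solution $\mathsf{r}_+(\delta)\in(0,\infty)$; the map $\delta\mapsto\mathsf{r}_+(\delta)$ is non-increasing on $(1/2,\infty)$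 with $\lim_{\delta\uparrow\infty}\mathsf{r}_+(\delta)=0$ and $\lim_{\delta\downarrow1/2}\mathsf{r}_+(\delta)=\infty$. Furthermore, if $\omega_\delta^2(\mathsf{r}_+(\delta))\,\mathbb{E}\,\mathsf{H}\big(U/\omega_\delta(\mathsf{r}_+(\delta))\big)<\sigma^2$, then $n^{-1}\|\hat\mu(\sigma)-\mu_0\|^2\to\mathsf{r}_+^2(\delta)$ in probability. (3) Suppose $m/n\to\infty$. Then, with $p_0=\mathbb{P}(U=0)$, $n^{-1}\|\hat\mu(\sigma)-\mu_0\|^2\big/\big\{(1-p_0/2)\sigma^2 n/m\big\}\to1$ in probability. The convergences in probability are with respect to all the randomness, including that of $\mu_0$.
   Context: Model: $X\in\mathbb{R}^{m\times n}$ has i.i.d. $\mathcal{N}(0,1/n)$ entries; $\xi\in\mathbb{R}^m$ is independent of $X$ with i.i.d. coordinates of mean $0$ and variance $\sigma^2$, with common law not depending on $n$. $\omega_\delta(r)=\sqrt{(r^2+\sigma^2)/\delta}$. $\|\cdot\|$ is the Euclidean norm. Near minimizers: $\hat\mu(\sigma)\in K_+$ with $m^{-1}\|Y-X\hat\mu(\sigma)\|^2\le\min_{\mu\in K_+}m^{-1}\|Y-X\mu\|^2+\mathfrak{o}_{\mathbf P}(r_n^2)$, where (given $\mu_0$) $r_n\in(0,\infty)$ is the unique solution of $n^{-1}\mathbb{E}_h\|\Pi_{K_+}(\mu_0+\omega_{m/n}(r)h)-\mu_0\|^2=r^2$, $h\sim\mathcal{N}(0,I_n)$, and $\Pi_{K_+}$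 is the metric projection onto $K_+$. *)

theory Defs
  imports "HOL-Probability.Probability"
begin

text \<open>
  A vector in the Euclidean space of dimension \<open>n\<close> is a function on \<open>{..<n}\<close>, normalised to be
  \<open>undefined\<close> elsewhere, and an \<open>m\<close> by \<open>n\<close> matrix is such a function on \<open>{..<m} \<times> {..<n}\<close>;
  these are exactly the points of the product spaces \<open>PiM\<close>.  The Euclidean norm is \<open>L2_set\<close>.
\<close>

definition Kplus :: "nat \<Rightarrow> (nat \<Rightarrow> real) set" where
  "Kplus n = ({..<n} \<rightarrow>\<^sub>E {0..})"

definition metric_proj :: "nat \<Rightarrow> (nat \<Rightarrow> real) set \<Rightarrow> (nat \<Rightarrow> real) \<Rightarrow> (nat \<Rightarrow> real)" where
  "metric_proj n K x = arg_min_on (\<lambda>y. L2_set (\<lambda>i. x i - y i) {..<n}) K"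

definition omega :: "real \<Rightarrow> real \<Rightarrow> real \<Rightarrow> real" where
  "omega \<sigma> \<delta> r = sqrt ((r\<^sup>2 + \<sigma>\<^sup>2) / \<delta>)"

abbreviation std_normal_cdf :: "real \<Rightarrow> real" where
  "std_normal_cdf \<equiv> cdf std_normal_distribution"

definition G_fun :: "real \<Rightarrow> real" where
  "G_fun x = std_normal_cdf x - x * std_normal_density x + x\<^sup>2 * std_normal_cdf (- x)"

definition H_fun :: "real \<Rightarrow> real" where
  "H_fun x = std_normal_cdf x - G_fun x"

text \<open>
  In the following, \<open>D\<close> is the probability space carrying the random variable \<open>U\<close>.
\<close>

definition is_fixed_point :: "'b measure \<Rightarrow> ('b \<Rightarrow> real) \<Rightarrow> real \<Rightarrow> real \<Rightarrow> real \<Rightarrow> bool" where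
  "is_fixed_point D U \<sigma> \<delta> r \<longleftrightarrow>
     (omega \<sigma> \<delta> r)\<^sup>2 * (\<integral>u. G_fun (U u / omega \<sigma> \<delta> r) \<partial>D) = r\<^sup>2"

definition r_plus :: "'b measure \<Rightarrow> ('b \<Rightarrow> real) \<Rightarrow> real \<Rightarrow> real \<Rightarrow> real" where
  "r_plus D U \<sigma> \<delta> = (THE r. 0 < r \<and> is_fixed_point D U \<sigma> \<delta> r)"

definition omega2_EH :: "'b measure \<Rightarrow> ('b \<Rightarrow> real) \<Rightarrow> real \<Rightarrow> real \<Rightarrow> real" where
  "omega2_EH D U \<sigma> \<delta> =
     (let w = omega \<sigma> \<delta> (r_plus D U \<sigma> \<delta>) in w\<^sup>2 * (\<integral>u. H_fun (U u / w) \<partial>D))"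

text \<open>The radius \<open>r\<^sub>n\<close> attached to a given signal \<open>\<mu>0\<close>, with aspect ratio \<open>\<delta> = m / n\<close>.\<close>

definition r_signal :: "nat \<Rightarrow> real \<Rightarrow> real \<Rightarrow> (nat \<Rightarrow> real) \<Rightarrow> real" where
  "r_signal n \<sigma> \<delta> \<mu>0 = (THE r. 0 < r \<and>
     (1 / real n) *
       (\<integral>h. (L2_set (\<lambda>i. metric_proj n (Kplus n) (\<lambda>j. \<mu>0 j + omega \<sigma> \<delta> r * h j) i - \<mu>0 i) {..<n})\<^sup>2
          \<partial>(\<Pi>\<^sub>M i\<in>{..<n}. std_normal_distribution))
     = r\<^sup>2)"

definition mat_vec :: "nat \<Rightarrow> (nat \<times> nat \<Rightarrow> real) \<Rightarrow> (nat \<Rightarrow> real) \<Rightarrow> nat \<Rightarrow> real" where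
  "mat_vec n A v i = (\<Sum>j<n. A (i, j) * v j)"

definition avg_loss ::
  "nat \<Rightarrow> nat \<Rightarrow> (nat \<times> nat \<Rightarrow> real) \<Rightarrow> (nat \<Rightarrow> real) \<Rightarrow> (nat \<Rightarrow> real) \<Rightarrow> real" where
  "avg_loss m n A y \<mu> = (1 / real m) * (L2_set (\<lambda>i. y i - mat_vec n A \<mu> i) {..<m})\<^sup>2"

abbreviation borel_vec :: "'i set \<Rightarrow> ('i \<Rightarrow> real) measure" where
  "borel_vec I \<equiv> (\<Pi>\<^sub>M i\<in>I. (borel :: real measure))"

definition iid_with_law :: "'a measure \<Rightarrow> 'i set \<Rightarrow> ('a \<Rightarrow> 'i \<Rightarrow> real) \<Rightarrow> real measure \<Rightarrow> bool" where
  "iid_with_law M I Z L \<longleftrightarrow>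
     prob_space.indep_vars M (\<lambda>_. borel) (\<lambda>i \<omega>. Z \<omega> i) I \<and>
     (\<forall>i\<in>I. distr M borel (\<lambda>\<omega>. Z \<omega> i) = L)"

text \<open>
  The library's \<open>indep_var\<close> forces both random elements to have values in the same type.
\<close>

definition indep_elements ::
  "'a measure \<Rightarrow> 'c measure \<Rightarrow> ('a \<Rightarrow> 'c) \<Rightarrow> 'd measure \<Rightarrow> ('a \<Rightarrow> 'd) \<Rightarrow> bool" where
  "indep_elements M A Z B W \<longleftrightarrow>
     Z \<in> M \<rightarrow>\<^sub>M A \<and> W \<in> M \<rightarrow>\<^sub>M B \<and>
     prob_space.indep_set M
       {Z -` S \<inter> space M | S. S \<in> sets A} {W -` S \<inter> space M | S. S \<in> sets B}"

text \<open>Convergence in probability; the random variables may live on different spaces \<open>M n\<close>.\<close>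

definition converges_in_prob :: "(nat \<Rightarrow> 'a measure) \<Rightarrow> (nat \<Rightarrow> 'a \<Rightarrow> real) \<Rightarrow> real \<Rightarrow> bool" where
  "converges_in_prob M Z c \<longleftrightarrow>
     (\<forall>\<epsilon>>0. (\<lambda>n. measure (M n) {\<omega> \<in> space (M n). \<bar>Z n \<omega> - c\<bar> > \<epsilon>}) \<longlonglongrightarrow> 0)"

text \<open>
  \<open>L\<close> is the common law of the noise coordinates and \<open>L0\<close> that of the signal coordinates.
\<close>

definition linear_model ::
  "nat \<Rightarrow> nat \<Rightarrow> real measure \<Rightarrow> real measure \<Rightarrow> 'a measure \<Rightarrow> ('a \<Rightarrow> nat \<times> nat \<Rightarrow> real) \<Rightarrow>
   ('a \<Rightarrow> nat \<Rightarrow> real) \<Rightarrow> ('a \<Rightarrow> nat \<Rightarrow> real) \<Rightarrow> ('a \<Rightarrow> nat \<Rightarrow> real) \<Rightarrow> bool" where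
  "linear_model m n L L0 M X \<xi> \<mu>0 Y \<longleftrightarrow>
     prob_space M \<and>
     iid_with_law M ({..<m} \<times> {..<n}) X (density lborel (normal_density 0 (sqrt (1 / real n)))) \<and>
     iid_with_law M {..<m} \<xi> L \<and>
     iid_with_law M {..<n} \<mu>0 L0 \<and>
     indep_elements M (borel_vec ({..<m} \<times> {..<n})) X (borel_vec {..<m}) \<xi> \<and>
     indep_elements M
       (borel_vec ({..<m} \<times> {..<n}) \<Otimes>\<^sub>M borel_vec {..<m}) (\<lambda>\<omega>. (X \<omega>, \<xi> \<omega>))
       (borel_vec {..<n}) \<mu>0 \<and>
     (\<forall>\<omega>\<in>space M. \<forall>i<m. Y \<omega> i = mat_vec n (X \<omega>) (\<mu>0 \<omega>) i + \<xi> \<omega> i)"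

text \<open>
  The random variables \<open>\<eta> n\<close> below converge to zero in probability, so \<open>\<eta> n * r\<^sub>n\<^sup>2\<close> is the error
  term \<open>o\<^sub>P(r\<^sub>n\<^sup>2)\<close>; since \<open>r\<^sub>n\<close> depends on \<open>\<mu>0\<close>, it is random as well.
\<close>

definition near_minimizers ::
  "(nat \<Rightarrow> nat) \<Rightarrow> real \<Rightarrow> (nat \<Rightarrow> 'a measure) \<Rightarrow> (nat \<Rightarrow> 'a \<Rightarrow> nat \<times> nat \<Rightarrow> real) \<Rightarrow>
   (nat \<Rightarrow> 'a \<Rightarrow> nat \<Rightarrow> real) \<Rightarrow> (nat \<Rightarrow> 'a \<Rightarrow> nat \<Rightarrow> real) \<Rightarrow> (nat \<Rightarrow> 'a \<Rightarrow> nat \<Rightarrow> real) \<Rightarrow> bool" where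
  "near_minimizers m \<sigma> M X \<mu>0 Y \<mu>hat \<longleftrightarrow>
     (\<forall>n\<ge>1. \<mu>hat n \<in> M n \<rightarrow>\<^sub>M borel_vec {..<n} \<and> (AE \<omega> in M n. \<mu>hat n \<omega> \<in> Kplus n)) \<and>
     (\<exists>\<eta>. (\<forall>n\<ge>1. \<eta> n \<in> borel_measurable (M n)) \<and> converges_in_prob M \<eta> 0 \<and>
       (\<forall>n\<ge>1. AE \<omega> in M n.
          avg_loss (m n) n (X n \<omega>) (Y n \<omega>) (\<mu>hat n \<omega>)
          \<le> (INF \<mu>\<in>Kplus n. avg_loss (m n) n (X n \<omega>) (Y n \<omega>) \<mu>)
             + \<eta> n \<omega> * (r_signal n \<sigma> (real (m n) / real n) (\<mu>0 n \<omega>))\<^sup>2))"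

definition risk :: "nat \<Rightarrow> (nat \<Rightarrow> real) \<Rightarrow> (nat \<Rightarrow> real) \<Rightarrow> real" where
  "risk n \<mu> \<mu>0 = (1 / real n) * (L2_set (\<lambda>i. \<mu> i - \<mu>0 i) {..<n})\<^sup>2"

end

theory Submission
  imports Defs
begin

text \<open>
  The least squares problem is the saddle point problem of minimising over \<open>w\<close> and maximising over
  unit vectors \<open>u\<close> the bilinear Gaussian form \<open>u \<bullet> (X w - \<xi>)\<close>.  Gordon's comparison inequality, obtained
  by a Lindeberg argument for a smooth surrogate of the min-max event, and convex duality transfer
  probability bounds to the objective \<open>\<parallel>\<parallel>w\<parallel> g - \<xi>\<parallel> + h \<bullet> w\<close> with two independent Gaussian vectors.  Over
  the cone, the latter is explicit: it is minimised near the displacement of the projection of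
  \<open>\<mu>0 - \<omega> h\<close>, whose normalised length concentrates at the fixed point \<open>r\<close>, and it exceeds
  its minimum by a definite gap as soon as the norm of \<open>w\<close> leaves a neighbourhood of \<open>r\<close>.  The condition on
  \<open>H\<close> says that the limiting minimum is positive, so that errors of the squared loss can be compared with errors of the loss.
\<close>

section \<open>Gaussian comparison\<close>

text \<open>The estimate for fixed n sees the ratio m/n only through upper bounds on \<omega> and on
  the H term, so one inequality serves all three limits. The hard case is m/n to infinity, where r
  tends to 0: the gap between the band and its complement is of order r^2, and an error of size e
  would swamp it. Hence every error is kept of order e t^2, with t the value of \<omega> at the
  fixed point, comparable to r. For the same reason the reference value \<open>base\<close> contains
  the empirical noise level s: s - \<sigma> is small, but not compared with t^2, and it cancels in
  differences of losses. Gordon's inequality is one-sided. It gives lower bounds on the loss over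
  any set, in particular off the band. The upper bound comes from the dual: a large minimum over a
  bounded convex set yields a separating unit vector u, again an event of the form "some u for all
  w", with the roles exchanged and the sign reversed. Separation needs a positive distance, a second
  use of the positivity of the limiting minimum.\<close>

abbreviation gauss :: "'i set \<Rightarrow> ('i \<Rightarrow> real) measure" where
  "gauss I \<equiv> (\<Pi>\<^sub>M i\<in>I. std_normal_distribution)"

abbreviation borel_fun :: "('k \<Rightarrow> real) measure" where
  "borel_fun \<equiv> (\<Pi>\<^sub>M i\<in>UNIV. borel)"

interpretation std_normal: prob_space std_normal_distribution
  by (rule prob_space_normal_density) simp

interpretation std_normal_prod: product_prob_space "\<lambda>_. std_normal_distribution" UNIV
  by unfold_locales

lemma prob_space_gauss: "prob_space (gauss I)"
  by (intro prob_space_PiM std_normal.prob_space_axioms)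

lemma measurable_borel_fun:
  assumes "\<And>k. (\<lambda>w. f w k) \<in> borel_measurable M"
  shows "f \<in> M \<rightarrow>\<^sub>M borel_fun"
  using measurable_PiM_single'[of UNIV "\<lambda>k w. f w k" M "\<lambda>_. borel"] assms by simp

lemma measurable_borel_fun_component [measurable]: "(\<lambda>x. x k) \<in> borel_measurable borel_fun"
  by simp

section \<open>Rotation invariance of Gaussian product measures\<close>

lemma distr_scaled_std_normal:
  assumes "0 < s"
  shows "distr std_normal_distribution borel (\<lambda>z. s * z) = density lborel (normal_density 0 s)"
proof -
  have "distributed std_normal_distribution lborel (\<lambda>x. x) std_normal_density"
    by (auto simp: distributed_def) (metis distr_id2 sets_density sets_lborel)
  from std_normal.normal_density_affine[OF this, of s 0] assms
  have "distributed std_normal_distribution lborel (\<lambda>x. s * x) (normal_density 0 s)"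
    by simp
  then have "distr std_normal_distribution lborel (\<lambda>x. s * x) = density lborel (normal_density 0 s)"
    by (simp add: distributed_def)
  then show ?thesis
    by (subst distr_cong[OF refl, of borel lborel _ "\<lambda>x. s * x"]) auto
qed

text \<open>The law of s y + t z on one Borel set, with y integrated last, because this is the
  factor that Fubini leaves for each coordinate of a box. For positive s and t it is the convolution
  of two centred normal densities; a zero coefficient has no density, hence the case split.\<close>

lemma std_normal_rotation:
  assumes st: "0 \<le> s" "0 \<le> t" and A: "A \<in> sets borel"
  shows "(\<integral>\<^sup>+ y. emeasure std_normal_distribution {z. s * y + t * z \<in> A} \<partial>std_normal_distribution)
    = emeasure (distr std_normal_distribution borel (\<lambda>z. sqrt (s\<^sup>2 + t\<^sup>2) * z)) A"
proof -
  let ?N = "std_normal_distribution"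
  note A [measurable]
  consider "t = 0" | "s = 0" | "0 < s" "0 < t" using st by force
  then show ?thesis
  proof cases
    case 1
    have "(\<integral>\<^sup>+ y. emeasure ?N {z. s * y + t * z \<in> A} \<partial>?N) = (\<integral>\<^sup>+ y. indicator {z. s * z \<in> A} y \<partial>?N)"
      using 1 std_normal.emeasure_space_1
      by (intro nn_integral_cong) (auto simp: indicator_def)
    also have "\<dots> = emeasure ?N {z. s * z \<in> A}"
      by (subst nn_integral_indicator) auto
    finally show ?thesis using 1 st by (simp add: emeasure_distr vimage_def)
  next
    case 2
    then show ?thesis using st std_normal.emeasure_space_1 by (simp add: emeasure_distr vimage_def)
  next
    case 3
    let ?S = "density lborel (normal_density 0 s)" and ?T = "density lborel (normal_density 0 t)"
    interpret S: prob_space ?S by (rule prob_space_normal_density) fact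
    interpret T: prob_space ?T by (rule prob_space_normal_density) fact
    have "emeasure (?S \<star> ?T) A = (\<integral>\<^sup>+x. emeasure ?T {a. a + x \<in> A} \<partial>?S)"
      by (intro convolution_emeasure)
        (auto intro: S.finite_measure_axioms T.finite_measure_axioms)
    also have "\<dots> = (\<integral>\<^sup>+y. emeasure ?T {a. a + s * y \<in> A} \<partial>?N)"
      unfolding distr_scaled_std_normal[OF 3(1), symmetric]
      by (subst nn_integral_distr) auto
    also have "\<dots> = (\<integral>\<^sup>+y. emeasure ?N {z. s * y + t * z \<in> A} \<partial>?N)"
      unfolding distr_scaled_std_normal[OF 3(2), symmetric]
      by (intro nn_integral_cong, subst emeasure_distr) (auto simp: vimage_def add.commute)
    finally have 1: "emeasure (?S \<star> ?T) A = (\<integral>\<^sup>+y. emeasure ?N {z. s * y + t * z \<in> A} \<partial>?N)" .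
    have "?S \<star> ?T = density lborel (\<lambda>x. \<integral>\<^sup>+y. ennreal (normal_density 0 s (x - y)) * ennreal (normal_density 0 t y) \<partial>lborel)"
      by (intro convolution_density) (auto intro: S.finite_measure_axioms T.finite_measure_axioms)
    also have "\<dots> = density lborel (normal_density 0 (sqrt (s\<^sup>2 + t\<^sup>2)))"
      using conv_normal_density_zero_mean[OF 3]
      by (simp add: fun_eq_iff ennreal_mult'' normal_density_nonneg)
    also have "\<dots> = distr ?N borel (\<lambda>z. sqrt (s\<^sup>2 + t\<^sup>2) * z)"
      using 3 by (subst distr_scaled_std_normal) (auto simp: sum_power2_gt_zero_iff)
    finally show ?thesis using 1 by simp
  qed
qed

lemma distr_gauss_scaled:
  assumes I: "finite I"
  shows "distr (gauss I) (borel_vec I) (\<lambda>z. \<lambda>i\<in>I. c * z i)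
    = (\<Pi>\<^sub>M i\<in>I. distr std_normal_distribution borel (\<lambda>z. c * z))"
proof -
  let ?D = "distr std_normal_distribution borel (\<lambda>z. c * z)"
  interpret D: prob_space ?D by (rule std_normal.prob_space_distr) simp
  have c: "(\<lambda>z. \<lambda>i\<in>I. c * z i) = compose I (\<lambda>z. c * z)"
    by (simp add: compose_def fun_eq_iff)
  have s: "sets (borel_vec I) = sets (\<Pi>\<^sub>M i\<in>I. ?D)"
    by (intro sets_PiM_cong) auto
  show ?thesis
    using distr_PiM_finite_prob_space'[of I "\<lambda>_. std_normal_distribution" "\<lambda>_. ?D" "\<lambda>z. c * z"] I
      std_normal.prob_space_axioms D.prob_space_axioms
    unfolding c by (subst distr_cong[OF refl s refl]) (simp add: distr_distr cong: distr_cong)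
qed

text \<open>The right side is a product measure, so it is enough to compare the two on boxes; there
  the integral splits into one-dimensional factors.\<close>

lemma gauss_rotation:
  assumes st: "0 \<le> s" "0 \<le> t" and I: "finite I"
  shows "distr (gauss I \<Otimes>\<^sub>M gauss I) (\<Pi>\<^sub>M i\<in>I. borel) (\<lambda>(y, z). \<lambda>i\<in>I. s * y i + t * z i)
    = distr (gauss I) (\<Pi>\<^sub>M i\<in>I. borel) (\<lambda>z. \<lambda>i\<in>I. sqrt (s\<^sup>2 + t\<^sup>2) * z i)" (is "?L = ?R")
proof -
  let ?N = "std_normal_distribution"
  let ?r = "sqrt (s\<^sup>2 + t\<^sup>2)"
  let ?D = "distr ?N borel (\<lambda>z. ?r * z)"
  interpret P: prob_space "gauss I" by (rule prob_space_gauss)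
  interpret D: prob_space ?D by (rule std_normal.prob_space_distr) simp
  interpret product_sigma_finite "\<lambda>_. ?D" by unfold_locales
  have R: "?R = (\<Pi>\<^sub>M i\<in>I. ?D)" by (rule distr_gauss_scaled[OF I])
  have "?L = (\<Pi>\<^sub>M i\<in>I. ?D)"
  proof (rule PiM_eqI[OF I])
    show "sets ?L = sets (\<Pi>\<^sub>M i\<in>I. ?D)"
      by (simp add: sets_PiM_cong[of I I "\<lambda>_. ?D" "\<lambda>_. borel"])
    fix A :: "'a \<Rightarrow> real set" assume A: "\<And>i. i \<in> I \<Longrightarrow> A i \<in> sets ?D"
    then have A' [measurable]: "\<And>i. i \<in> I \<Longrightarrow> A i \<in> sets borel" by simp
    have meas [measurable]: "(\<lambda>(y, z). \<lambda>i\<in>I. s * y i + t * z i) \<in> gauss I \<Otimes>\<^sub>M gauss I \<rightarrow>\<^sub>M (\<Pi>\<^sub>M i\<in>I. borel)"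
      by measurable
    have box: "Pi\<^sub>E I A \<in> sets (\<Pi>\<^sub>M i\<in>I. borel)"
      using I A' by (intro sets_PiM_I_finite) auto
    let ?E = "(\<lambda>(y, z). \<lambda>i\<in>I. s * y i + t * z i) -` (Pi\<^sub>E I A) \<inter> space (gauss I \<Otimes>\<^sub>M gauss I)"
    have "emeasure ?L (Pi\<^sub>E I A) = emeasure (gauss I \<Otimes>\<^sub>M gauss I) ?E"
      using box meas by (rule emeasure_distr[rotated])
    also have "\<dots> = (\<integral>\<^sup>+ y. emeasure (gauss I) (Pair y -` ?E) \<partial>gauss I)"
      by (rule P.emeasure_pair_measure_alt) (use measurable_sets[OF meas box] in simp)
    also have "\<dots> = (\<integral>\<^sup>+ y. emeasure (gauss I) (Pi\<^sub>E I (\<lambda>i. {z. s * y i + t * z \<in> A i})) \<partial>gauss I)"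
      by (intro nn_integral_cong arg_cong[where f="emeasure (gauss I)"])
        (auto simp: space_pair_measure space_PiM PiE_iff)
    also have "\<dots> = (\<integral>\<^sup>+ y. (\<Prod>i\<in>I. emeasure ?N {z. s * y i + t * z \<in> A i}) \<partial>gauss I)"
      using I A' by (intro nn_integral_cong std_normal_prod.emeasure_PiM) (auto intro!: measurable_sets)
    also have "\<dots> = (\<Prod>i\<in>I. \<integral>\<^sup>+ y. emeasure ?N {z. s * y + t * z \<in> A i} \<partial>?N)"
    proof (rule std_normal_prod.product_nn_integral_prod[OF I])
      fix i assume "i \<in> I"
      then have [measurable]: "A i \<in> sets borel" by (rule A')
      have [measurable]: "Measurable.pred (?N \<Otimes>\<^sub>M ?N) (\<lambda>w. s * fst w + t * snd w \<in> A i)"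
        by measurable
      show "(\<lambda>y. emeasure ?N {z. s * y + t * z \<in> A i}) \<in> borel_measurable ?N"
        using std_normal.measurable_emeasure_Pair[of "{w \<in> space (?N \<Otimes>\<^sub>M ?N). s * fst w + t * snd w \<in> A i}" ?N]
        by (simp add: vimage_def space_pair_measure)
    qed
    also have "\<dots> = (\<Prod>i\<in>I. emeasure ?D (A i))"
      using A' st by (intro prod.cong refl std_normal_rotation) auto
    finally show "emeasure ?L (Pi\<^sub>E I A) = (\<Prod>i\<in>I. emeasure ?D (A i))" .
  qed
  with R show ?thesis by simp
qed

section \<open>Gaussian fields and Lindeberg replacement\<close>

text \<open>A centred Gaussian field over the index type \<open>'k\<close>, coded as a linear image
  of finitely many independent standard normals. Its covariance is \<open>gcov I c\<close>, and
  rotation invariance of the normals becomes the semigroup property of the field.\<close>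

definition gauss_lin :: "'i set \<Rightarrow> ('i \<Rightarrow> 'k \<Rightarrow> real) \<Rightarrow> ('k \<Rightarrow> real) measure" where
  "gauss_lin I c = distr (gauss I) borel_fun (\<lambda>z k. \<Sum>i\<in>I. c i k * z i)"

lemma measurable_gauss_component [measurable (raw)]:
  assumes "i \<in> I" shows "(\<lambda>z. z i) \<in> borel_measurable (gauss I)"
  using measurable_component_singleton[OF assms, of "\<lambda>_. std_normal_distribution"]
  by (simp add: measurable_cong_sets[OF refl, of std_normal_distribution borel])

lemma measurable_lin [measurable]: "(\<lambda>z k. \<Sum>i\<in>I. c i k * z i) \<in> (gauss I) \<rightarrow>\<^sub>M borel_fun"
  by (intro measurable_borel_fun borel_measurable_sum borel_measurable_times borel_measurable_const)
    (auto intro: measurable_gauss_component)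

lemma sets_gauss_lin [measurable_cong, simp]: "sets (gauss_lin I c) = sets borel_fun"
  by (simp add: gauss_lin_def)

lemma space_gauss_lin [simp]: "space (gauss_lin I c) = UNIV"
  by (simp add: gauss_lin_def space_PiM)

lemma prob_space_gauss_lin: "prob_space (gauss_lin I c)"
  unfolding gauss_lin_def by (intro prob_space.prob_space_distr prob_space_gauss) simp

lemma integral_gauss_lin:
  fixes f :: "('k \<Rightarrow> real) \<Rightarrow> real"
  assumes "f \<in> borel_measurable borel_fun"
  shows "(\<integral>x. f x \<partial>gauss_lin I c) = (\<integral>z. f (\<lambda>k. \<Sum>i\<in>I. c i k * z i) \<partial>gauss I)"
  unfolding gauss_lin_def by (rule integral_distr[OF measurable_lin assms])

lemma measurable_affine_fun [measurable (raw)]: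
  assumes "f \<in> M \<rightarrow>\<^sub>M borel_fun" "g \<in> M \<rightarrow>\<^sub>M borel_fun"
  shows "(\<lambda>w k. s * f w k + t * g w k) \<in> M \<rightarrow>\<^sub>M borel_fun"
  using measurable_compose[OF assms(1) measurable_borel_fun_component]
    measurable_compose[OF assms(2) measurable_borel_fun_component]
  by (intro measurable_borel_fun) simp

text \<open>A field of variance s^2 + t^2 is a sum of independent pieces of variances s^2 and t^2.
  In the comparison this splits a small piece off one field and merges a small piece into the
  other.\<close>

lemma gauss_lin_rotation:
  fixes f :: "('k \<Rightarrow> real) \<Rightarrow> real"
  assumes I: "finite I" and f [measurable]: "f \<in> borel_measurable borel_fun"
    and b: "\<And>x. \<bar>f x\<bar> \<le> B" and st: "0 \<le> s" "0 \<le> t"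
  shows "(\<integral>x. f (\<lambda>k. sqrt (s\<^sup>2 + t\<^sup>2) * x k) \<partial>gauss_lin I c)
    = (\<integral>x. (\<integral>y. f (\<lambda>k. s * x k + t * y k) \<partial>gauss_lin I c) \<partial>gauss_lin I c)"
proof -
  let ?r = "sqrt (s\<^sup>2 + t\<^sup>2)"
  interpret G: prob_space "gauss I" by (rule prob_space_gauss)
  interpret GG: pair_prob_space "gauss I" "gauss I" by unfold_locales
  define F where "F z = f (\<lambda>k. \<Sum>i\<in>I. c i k * z i)" for z
  have F [measurable]: "F \<in> borel_measurable (\<Pi>\<^sub>M i\<in>I. borel)"
    unfolding F_def
    by (rule measurable_compose[OF _ f], rule measurable_borel_fun) measurable
  have m1 [measurable]: "(\<lambda>x k. a * x k) \<in> borel_fun \<rightarrow>\<^sub>M borel_fun" for a :: real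
    by (rule measurable_borel_fun) measurable
  have "(\<integral>x. f (\<lambda>k. ?r * x k) \<partial>gauss_lin I c) = (\<integral>z. f (\<lambda>k. ?r * (\<Sum>i\<in>I. c i k * z i)) \<partial>gauss I)"
    unfolding gauss_lin_def by (subst integral_distr) auto
  also have "\<dots> = (\<integral>z. F (\<lambda>i\<in>I. ?r * z i) \<partial>gauss I)"
    by (intro Bochner_Integration.integral_cong refl) (simp add: F_def sum_distrib_left mult.left_commute)
  also have "\<dots> = (\<integral>z. F z \<partial>distr (gauss I) (\<Pi>\<^sub>M i\<in>I. borel) (\<lambda>z. \<lambda>i\<in>I. ?r * z i))"
    by (subst integral_distr) auto
  also have "\<dots> = (\<integral>z. F z \<partial>distr (gauss I \<Otimes>\<^sub>M gauss I) (\<Pi>\<^sub>M i\<in>I. borel) (\<lambda>(y, z). \<lambda>i\<in>I. s * y i + t * z i))"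
    by (subst gauss_rotation[OF st I]) simp
  also have "\<dots> = (\<integral>w. F (\<lambda>i\<in>I. s * fst w i + t * snd w i) \<partial>(gauss I \<Otimes>\<^sub>M gauss I))"
    by (subst integral_distr) (auto simp: case_prod_beta)
  also have "\<dots> = (\<integral>y. (\<integral>z. F (\<lambda>i\<in>I. s * y i + t * z i) \<partial>gauss I) \<partial>gauss I)"
  proof -
    have "integrable (gauss I \<Otimes>\<^sub>M gauss I) (\<lambda>w. F (\<lambda>i\<in>I. s * fst w i + t * snd w i))"
      by (rule GG.integrable_const_bound[where B=B], simp add: F_def b, measurable)
    from GG.integral_fst'[OF this] show ?thesis by simp
  qed
  also have "\<dots> = (\<integral>y. (\<integral>z. f (\<lambda>k. s * (\<Sum>i\<in>I. c i k * y i) + t * (\<Sum>i\<in>I. c i k * z i)) \<partial>gauss I) \<partial>gauss I)"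
    by (simp add: F_def sum_distrib_left algebra_simps sum.distrib)
  also have "\<dots> = (\<integral>y. (\<integral>x. f (\<lambda>k. s * (\<Sum>i\<in>I. c i k * y i) + t * x k) \<partial>gauss_lin I c) \<partial>gauss I)"
    unfolding gauss_lin_def
  proof (rule Bochner_Integration.integral_cong[OF refl])
    fix y
    have [measurable]: "(\<lambda>x. f (\<lambda>k. s * (\<Sum>i\<in>I. c i k * y i) + t * x k)) \<in> borel_measurable borel_fun"
      by (rule measurable_compose[OF _ f], rule measurable_borel_fun) measurable
    show "(\<integral>z. f (\<lambda>k. s * (\<Sum>i\<in>I. c i k * y i) + t * (\<Sum>i\<in>I. c i k * z i)) \<partial>gauss I)
      = (\<integral>x. f (\<lambda>k. s * (\<Sum>i\<in>I. c i k * y i) + t * x k) \<partial>distr (gauss I) borel_fun (\<lambda>z k. \<Sum>i\<in>I. c i k * z i))"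
      by (subst integral_distr) auto
  qed
  also have "\<dots> = (\<integral>x. (\<integral>y. f (\<lambda>k. s * x k + t * y k) \<partial>gauss_lin I c) \<partial>gauss_lin I c)"
  proof -
    interpret L: prob_space "gauss_lin I c" by (rule prob_space_gauss_lin)
    have [measurable]: "(\<lambda>w. f (\<lambda>k. s * fst w k + t * snd w k)) \<in> borel_measurable (borel_fun \<Otimes>\<^sub>M gauss_lin I c)"
      by measurable
    have "(\<lambda>x. \<integral>y. f (\<lambda>k. s * x k + t * y k) \<partial>gauss_lin I c) \<in> borel_measurable borel_fun"
      by measurable
    from integral_gauss_lin[OF this, of I c] show ?thesis by simp
  qed
  finally show ?thesis .
qed

text \<open>Cut both fields into N independent pieces of variance 1 / N and exchange them one at a
  time. An exchange costs C / N^(3/2) by \<open>step\<close>, all of them C / sqrt N, which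
  vanishes. So F has to be compared only up to second order in the increments.\<close>

lemma lindeberg_comparison:
  fixes F :: "('k \<Rightarrow> real) \<Rightarrow> real"
  assumes I: "finite I" and J: "finite J"
    and F [measurable]: "F \<in> borel_measurable borel_fun" and b: "\<And>x. \<bar>F x\<bar> \<le> B"
    and step: "\<And>x e. 0 \<le> e \<Longrightarrow>
      (\<integral>y. F (\<lambda>k. x k + e * y k) \<partial>gauss_lin I c) \<le> (\<integral>y. F (\<lambda>k. x k + e * y k) \<partial>gauss_lin J d) + C * e ^ 3"
  shows "(\<integral>x. F x \<partial>gauss_lin I c) \<le> (\<integral>x. F x \<partial>gauss_lin J d)"
proof -
  let ?X = "gauss_lin I c" and ?Y = "gauss_lin J d"
  interpret X: prob_space ?X by (rule prob_space_gauss_lin)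
  interpret Y: prob_space ?Y by (rule prob_space_gauss_lin)
  interpret XY: pair_prob_space ?X ?Y by unfold_locales
  \<comment> \<open>The mean of F at s X + t Y with X and Y independent; the exchange leads from
    \<open>V 1 0\<close> to \<open>V 0 1\<close>.\<close>
  define V where "V s t = (\<integral>x. (\<integral>y. F (\<lambda>k. s * x k + t * y k) \<partial>?Y) \<partial>?X)" for s t
  \<comment> \<open>A non-integrable function has integral 0 by convention, which obeys the bound as
    well; this saves measurability arguments for the iterated integrals.\<close>
  have bI: "\<bar>\<integral>y. f y \<partial>M\<bar> \<le> B" if "prob_space M" "\<And>x. \<bar>f x\<bar> \<le> B" for M :: "('k \<Rightarrow> real) measure" and f
  proof -
    interpret prob_space M by fact
    have B: "0 \<le> B" using that(2)[of "\<lambda>_. 0"] by linarith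
    show ?thesis
    proof (cases "integrable M f")
      case True
      have "\<bar>\<integral>y. f y \<partial>M\<bar> \<le> (\<integral>y. \<bar>f y\<bar> \<partial>M)" by (rule integral_abs_bound)
      also have "\<dots> \<le> B" using that(2) True
        by (intro integral_le_const) auto
      finally show ?thesis .
    qed (use B in \<open>simp add: not_integrable_integral_eq\<close>)
  qed
  \<comment> \<open>Move a piece of variance e^2 from X to Y: split it off X, interchange the
    integrals so that it is innermost, apply \<open>step\<close> to it, and merge the new piece with
    the Y part.\<close>
  have inner: "V (sqrt (s\<^sup>2 + e\<^sup>2)) t \<le> V s (sqrt (t\<^sup>2 + e\<^sup>2)) + C * e ^ 3"
    if "0 \<le> s" "0 \<le> t" "0 \<le> e" for s t e
  proof -
    have m1 [measurable]: "(\<lambda>x. \<integral>y. F (\<lambda>k. x k + t * y k) \<partial>?Y) \<in> borel_measurable borel_fun"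
    proof -
      have [measurable]: "(\<lambda>w. F (\<lambda>k. 1 * fst w k + t * snd w k)) \<in> borel_measurable (borel_fun \<Otimes>\<^sub>M ?Y)"
        by measurable
      have "(\<lambda>x. \<integral>y. F (\<lambda>k. 1 * x k + t * y k) \<partial>?Y) \<in> borel_measurable borel_fun"
        by measurable
      then show ?thesis by simp
    qed
    have "V (sqrt (s\<^sup>2 + e\<^sup>2)) t = (\<integral>x. (\<integral>x'. (\<integral>y. F (\<lambda>k. (s * x k + e * x' k) + t * y k) \<partial>?Y) \<partial>?X) \<partial>?X)"
      unfolding V_def
      by (rule gauss_lin_rotation[OF I m1 bI[OF Y.prob_space_axioms] that(1,3)]) (rule b)
    also have "\<dots> = (\<integral>x. (\<integral>y. (\<integral>x'. F (\<lambda>k. (s * x k + t * y k) + e * x' k) \<partial>?X) \<partial>?Y) \<partial>?X)"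
    proof (rule Bochner_Integration.integral_cong[OF refl])
      fix x :: "'k \<Rightarrow> real"
      have m: "(\<lambda>w k. (s * x k + e * fst w k) + t * snd w k) \<in> ?X \<Otimes>\<^sub>M ?Y \<rightarrow>\<^sub>M borel_fun"
        by (rule measurable_borel_fun) measurable
      have [measurable]: "(\<lambda>w. F (\<lambda>k. (s * x k + e * fst w k) + t * snd w k)) \<in> borel_measurable (?X \<Otimes>\<^sub>M ?Y)"
        by (rule measurable_compose[OF m F])
      have int: "integrable (?X \<Otimes>\<^sub>M ?Y) (\<lambda>(x', y). F (\<lambda>k. (s * x k + e * x' k) + t * y k))"
        by (rule XY.integrable_const_bound[where B=B]) (auto simp: b case_prod_beta)
      show "(\<integral>x'. (\<integral>y. F (\<lambda>k. (s * x k + e * x' k) + t * y k) \<partial>?Y) \<partial>?X)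
        = (\<integral>y. (\<integral>x'. F (\<lambda>k. (s * x k + t * y k) + e * x' k) \<partial>?X) \<partial>?Y)"
        using XY.Fubini_integral[OF int] by (simp add: add_ac)
    qed
    also have "\<dots> \<le> (\<integral>x. (\<integral>y. (\<integral>y'. F (\<lambda>k. (s * x k + t * y k) + e * y' k) \<partial>?Y) + C * e ^ 3 \<partial>?Y) \<partial>?X)"
    proof -
      have q: "integrable M (\<lambda>y. \<integral>x'. F (\<lambda>k. z k + t * y k + e * x' k) \<partial>N)"
        if "prob_space M" "prob_space N" "sets M = sets borel_fun" "sets N = sets borel_fun" for M N z
      proof -
        interpret M: prob_space M by fact
        interpret N: prob_space N by fact
        note that(3,4) [measurable_cong]
        have m: "(\<lambda>w k. z k + t * fst w k + e * snd w k) \<in> M \<Otimes>\<^sub>M N \<rightarrow>\<^sub>M borel_fun"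
          by (rule measurable_borel_fun) measurable
        have [measurable]: "(\<lambda>w. F (\<lambda>k. z k + t * fst w k + e * snd w k)) \<in> borel_measurable (M \<Otimes>\<^sub>M N)"
          by (rule measurable_compose[OF m F])
        show ?thesis
          by (rule M.integrable_const_bound[where B=B]) (auto intro!: bI that b simp: b)
      qed
      have q2: "integrable ?X (\<lambda>x. \<integral>y. (\<integral>x'. F (\<lambda>k. s * x k + t * y k + e * x' k) \<partial>N) \<partial>?Y)"
        if "prob_space N" "sets N = sets borel_fun" for N
      proof -
        interpret N: prob_space N by fact
        note that(2) [measurable_cong]
        have m: "(\<lambda>w k. s * fst (fst w) k + t * snd (fst w) k + e * snd w k) \<in> (?X \<Otimes>\<^sub>M ?Y) \<Otimes>\<^sub>M N \<rightarrow>\<^sub>M borel_fun"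
          by (rule measurable_borel_fun) measurable
        have [measurable]: "(\<lambda>w. F (\<lambda>k. s * fst (fst w) k + t * snd (fst w) k + e * snd w k)) \<in> borel_measurable ((?X \<Otimes>\<^sub>M ?Y) \<Otimes>\<^sub>M N)"
          by (rule measurable_compose[OF m F])
        show ?thesis
          by (rule X.integrable_const_bound[where B=B]) (auto intro!: bI that b Y.prob_space_axioms simp: b)
      qed
      show ?thesis
        using q[OF Y.prob_space_axioms X.prob_space_axioms] q[OF Y.prob_space_axioms Y.prob_space_axioms]
          q2[OF X.prob_space_axioms] q2[OF Y.prob_space_axioms]
        by (intro integral_mono)  (auto intro!: step \<open>0 \<le> e\<close> simp: Y.prob_space)
    qed
    also have "\<dots> = (\<integral>x. (\<integral>y. (\<integral>y'. F (\<lambda>k. (s * x k + t * y k) + e * y' k) \<partial>?Y) \<partial>?Y) \<partial>?X) + C * e ^ 3"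
    proof -
      have m: "(\<lambda>w k. s * fst (fst w) k + t * snd (fst w) k + e * snd w k) \<in> (?X \<Otimes>\<^sub>M ?Y) \<Otimes>\<^sub>M ?Y \<rightarrow>\<^sub>M borel_fun"
        by (rule measurable_borel_fun) measurable
      have [measurable]: "(\<lambda>w. F (\<lambda>k. s * fst (fst w) k + t * snd (fst w) k + e * snd w k)) \<in> borel_measurable ((?X \<Otimes>\<^sub>M ?Y) \<Otimes>\<^sub>M ?Y)"
        by (rule measurable_compose[OF m F])
      have i1: "integrable ?X (\<lambda>x. \<integral>y. (\<integral>x'. F (\<lambda>k. s * x k + t * y k + e * x' k) \<partial>?Y) \<partial>?Y)"
        by (rule X.integrable_const_bound[where B=B]) (auto intro!: bI b Y.prob_space_axioms simp: b)
      have i2: "integrable ?Y (\<lambda>y. \<integral>x'. F (\<lambda>k. s * x k + t * y k + e * x' k) \<partial>?Y)" for x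
      proof -
        have m: "(\<lambda>w k. s * x k + t * fst w k + e * snd w k) \<in> ?Y \<Otimes>\<^sub>M ?Y \<rightarrow>\<^sub>M borel_fun"
          by (rule measurable_borel_fun) measurable
        have [measurable]: "(\<lambda>w. F (\<lambda>k. s * x k + t * fst w k + e * snd w k)) \<in> borel_measurable (?Y \<Otimes>\<^sub>M ?Y)"
          by (rule measurable_compose[OF m F])
        show ?thesis
          by (rule Y.integrable_const_bound[where B=B]) (auto intro!: bI b Y.prob_space_axioms simp: b)
      qed
      show ?thesis using i1 i2 X.prob_space Y.prob_space by simp
    qed
    also have "(\<integral>x. (\<integral>y. (\<integral>y'. F (\<lambda>k. (s * x k + t * y k) + e * y' k) \<partial>?Y) \<partial>?Y) \<partial>?X) = V s (sqrt (t\<^sup>2 + e\<^sup>2))"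
      unfolding V_def
    proof (rule Bochner_Integration.integral_cong[OF refl])
      fix x :: "'k \<Rightarrow> real"
      have m: "(\<lambda>y. F (\<lambda>k. s * x k + y k)) \<in> borel_measurable borel_fun"
        by (rule measurable_compose[OF _ F], rule measurable_borel_fun) measurable
      show "(\<integral>y. (\<integral>y'. F (\<lambda>k. (s * x k + t * y k) + e * y' k) \<partial>?Y) \<partial>?Y) = (\<integral>y. F (\<lambda>k. s * x k + sqrt (t\<^sup>2 + e\<^sup>2) * y k) \<partial>?Y)"
        using gauss_lin_rotation[OF J m b, of t e d] that by (simp add: add.assoc)
    qed
    finally show ?thesis .
  qed
  \<comment> \<open>Induction from the end where Y carries all the variance: X has variance j / N,
    and the accumulated cost is that of j exchanges with e = 1 / sqrt N.\<close>
  have chain: "V (sqrt (real j / real N)) (sqrt (real (N - j) / real N)) \<le> V 0 1 + real j * (C * (1 / sqrt (real N)) ^ 3)"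
    if "0 < N" "j \<le> N" for N j
    using that(2)
  proof (induction j)
    case 0
    then show ?case using \<open>0 < N\<close> by simp
  next
    case (Suc j)
    let ?e = "1 / sqrt (real N)"
    have e: "(sqrt (real j / real N))\<^sup>2 + ?e\<^sup>2 = real (Suc j) / real N"
      "(sqrt (real (N - Suc j) / real N))\<^sup>2 + ?e\<^sup>2 = real (N - j) / real N"
      using Suc.prems that(1) by (auto simp: power_divide add_divide_distrib[symmetric] of_nat_diff)
    have "V (sqrt (real (Suc j) / real N)) (sqrt (real (N - Suc j) / real N))
      \<le> V (sqrt (real j / real N)) (sqrt (real (N - j) / real N)) + C * ?e ^ 3"
      using inner[of "sqrt (real j / real N)" "sqrt (real (N - Suc j) / real N)" ?e] by (simp only: e) simp
    also have "\<dots> \<le> V 0 1 + real (Suc j) * (C * ?e ^ 3)"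
      using Suc by (simp add: algebra_simps)
    finally show ?case .
  qed
  have "V 1 0 \<le> V 0 1 + C * (1 / sqrt (real N))" if "0 < N" for N
  proof -
    have "real N * (C * (1 / sqrt (real N)) ^ 3) = C * (1 / sqrt (real N))"
      using that by (simp add: power3_eq_cube field_simps)
    then show ?thesis using chain[OF that, of N] that by simp
  qed
  then have "eventually (\<lambda>N. V 1 0 \<le> V 0 1 + C * (1 / sqrt (real N))) sequentially"
    by (intro eventually_sequentiallyI[of 1]) auto
  moreover have "(\<lambda>N. V 0 1 + C * (1 / sqrt (real N))) \<longlonglongrightarrow> V 0 1 + C * 0"
    by (intro tendsto_add tendsto_mult tendsto_const tendsto_divide_0[OF tendsto_const]
      filterlim_at_top_imp_at_infinity filterlim_compose[OF sqrt_at_top filterlim_real_sequentially])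
  ultimately have "V 1 0 \<le> V 0 1"
    by (intro tendsto_lowerbound[OF _ _ sequentially_bot]) auto
  then show ?thesis using X.prob_space Y.prob_space by (simp add: V_def)
qed

section \<open>Third order Taylor bounds for the smooth surrogate\<close>

text \<open>The bounds are relative to f itself. Exponentials satisfy them with K = 1, and they
  survive sums, the addition of 1 and reciprocals with only K changing. This makes the Taylor error
  independent of the base point.\<close>

definition C3_bounded ::
  "real \<Rightarrow> real \<Rightarrow> (real \<Rightarrow> real) \<Rightarrow> (real \<Rightarrow> real) \<Rightarrow> (real \<Rightarrow> real) \<Rightarrow> (real \<Rightarrow> real) \<Rightarrow> bool" where
  "C3_bounded K d f f1 f2 f3 \<longleftrightarrow> (\<forall>s. 0 < f s \<and>
     (f has_real_derivative f1 s) (at s) \<and> (f1 has_real_derivative f2 s) (at s) \<and>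
     (f2 has_real_derivative f3 s) (at s) \<and>
     \<bar>f1 s\<bar> \<le> K * d * f s \<and> \<bar>f2 s\<bar> \<le> K * d ^ 2 * f s \<and> \<bar>f3 s\<bar> \<le> K * d ^ 3 * f s)"

lemma C3_bounded_exp:
  assumes "\<bar>a\<bar> \<le> d"
  shows "C3_bounded 1 d (\<lambda>s. exp (x + s * a)) (\<lambda>s. a * exp (x + s * a))
    (\<lambda>s. a ^ 2 * exp (x + s * a)) (\<lambda>s. a ^ 3 * exp (x + s * a))"
proof -
  have "\<bar>a ^ k\<bar> \<le> d ^ k" for k
    using assms by (simp add: power_abs power_mono)
  from this[of 2] this[of 3] show ?thesis
    using assms unfolding C3_bounded_def
    by (auto intro!: derivative_eq_intros mult_right_mono simp: abs_mult)
      (auto simp: power2_eq_square power3_eq_cube)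
qed

lemma C3_bounded_sum:
  assumes "finite P" "P \<noteq> {}" "\<And>p. p \<in> P \<Longrightarrow> C3_bounded K d (f p) (f1 p) (f2 p) (f3 p)"
  shows "C3_bounded K d (\<lambda>s. \<Sum>p\<in>P. f p s) (\<lambda>s. \<Sum>p\<in>P. f1 p s) (\<lambda>s. \<Sum>p\<in>P. f2 p s) (\<lambda>s. \<Sum>p\<in>P. f3 p s)"
  using assms unfolding C3_bounded_def
  by (auto intro!: sum_pos DERIV_sum order_trans[OF sum_abs] simp: sum_distrib_left intro: sum_mono)

lemma C3_bounded_one_plus:
  assumes "C3_bounded K d f f1 f2 f3" "0 \<le> K" "0 \<le> d"
  shows "C3_bounded K d (\<lambda>s. 1 + f s) f1 f2 f3"
proof -
  have "K * d ^ k * f s \<le> K * d ^ k * (1 + f s)" for k s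
    using assms by (intro mult_left_mono) auto
  from this[of 1] this[of 2] this[of 3] show ?thesis
    using assms(1) unfolding C3_bounded_def
    by (auto intro!: derivative_eq_intros add_pos_pos intro: order_trans)
qed

text \<open>With u_i = f_i / f the derivatives of 1 / f are 1 / f times - u_1, 2 u_1^2 - u_2 and -
  u_3 + 6 u_1 u_2 - 6 u_1^3. The new constant is the bound for the third one, taken for all
  orders.\<close>

lemma C3_bounded_inverse:
  assumes f: "C3_bounded K d f f1 f2 f3" and K: "0 \<le> K" and d: "0 \<le> d"
  shows "C3_bounded (K + 6 * K ^ 2 + 6 * K ^ 3) d (\<lambda>s. 1 / f s) (\<lambda>s. - f1 s / f s ^ 2)
    (\<lambda>s. - f2 s / f s ^ 2 + 2 * f1 s ^ 2 / f s ^ 3)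
    (\<lambda>s. - f3 s / f s ^ 2 + 6 * f1 s * f2 s / f s ^ 3 - 6 * f1 s ^ 3 / f s ^ 4)"
  unfolding C3_bounded_def
proof (intro allI conjI)
  fix s
  have p: "0 < f s" and D: "(f has_real_derivative f1 s) (at s)" "(f1 has_real_derivative f2 s) (at s)"
    "(f2 has_real_derivative f3 s) (at s)"
    and b: "\<bar>f1 s\<bar> \<le> K * d * f s" "\<bar>f2 s\<bar> \<le> K * d ^ 2 * f s" "\<bar>f3 s\<bar> \<le> K * d ^ 3 * f s"
    using f by (auto simp: C3_bounded_def)
  define u1 u2 u3 where "u1 = f1 s / f s" and "u2 = f2 s / f s" and "u3 = f3 s / f s"
  have u: "\<bar>u1\<bar> \<le> K * d" "\<bar>u2\<bar> \<le> K * d ^ 2" "\<bar>u3\<bar> \<le> K * d ^ 3"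
    using b p by (auto simp: u1_def u2_def u3_def abs_divide field_simps)
  have fu: "f1 s = u1 * f s" "f2 s = u2 * f s" "f3 s = u3 * f s"
    using p by (auto simp: u1_def u2_def u3_def)
  show "0 < 1 / f s" using p by simp
  show "((\<lambda>s. 1 / f s) has_real_derivative - f1 s / f s ^ 2) (at s)"
    using p D by (auto intro!: derivative_eq_intros simp: power2_eq_square field_simps)
  show "((\<lambda>s. - f1 s / f s ^ 2) has_real_derivative - f2 s / f s ^ 2 + 2 * f1 s ^ 2 / f s ^ 3) (at s)"
    using p by (auto intro!: derivative_eq_intros D simp: field_simps power2_eq_square power3_eq_cube)
  show "((\<lambda>s. - f2 s / f s ^ 2 + 2 * f1 s ^ 2 / f s ^ 3) has_real_derivative
      - f3 s / f s ^ 2 + 6 * f1 s * f2 s / f s ^ 3 - 6 * f1 s ^ 3 / f s ^ 4) (at s)"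
    using p by (auto intro!: derivative_eq_intros D simp: field_simps eval_nat_numeral)
  have Ka: "0 \<le> K ^ k" "0 \<le> d ^ k" for k using K d by auto
  have sq: "u1 ^ 2 \<le> K ^ 2 * d ^ 2" "\<bar>u1\<bar> ^ 3 \<le> K ^ 3 * d ^ 3" "\<bar>u1\<bar> * \<bar>u2\<bar> \<le> K ^ 2 * d ^ 3"
  proof -
    show "u1 ^ 2 \<le> K ^ 2 * d ^ 2"
      using power_mono[OF u(1), of 2] by (simp add: power_mult_distrib)
    show "\<bar>u1\<bar> ^ 3 \<le> K ^ 3 * d ^ 3"
      using power_mono[OF u(1), of 3] by (simp add: power_mult_distrib)
    show "\<bar>u1\<bar> * \<bar>u2\<bar> \<le> K ^ 2 * d ^ 3"
      using mult_mono[OF u(1,2)] K d by (simp add: power2_eq_square power3_eq_cube mult_ac)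
  qed
  let ?C = "K + 6 * K ^ 2 + 6 * K ^ 3"
  have C: "K * d ^ k + 6 * (K ^ 2 * d ^ k) + 6 * (K ^ 3 * d ^ k) = ?C * d ^ k" for k
    by (simp add: algebra_simps)
  have n: "0 \<le> K * d ^ k" "0 \<le> K ^ 2 * d ^ k" "0 \<le> K ^ 3 * d ^ k" for k
    using Ka K by auto
  have "\<bar>u1\<bar> \<le> ?C * d"
    using u(1) n(2,3)[of 1] C[of 1] by simp
  then show "\<bar>- f1 s / f s ^ 2\<bar> \<le> ?C * d * (1 / f s)"
    using p by (simp add: fu abs_divide abs_mult power2_eq_square divide_right_mono)
  have "\<bar>- u2 + 2 * u1 ^ 2\<bar> \<le> ?C * d ^ 2"
    using u(2) sq(1) n(1,2,3)[of 2] C[of 2] zero_le_power2[of u1] by (simp only: abs_le_iff) linarith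
  then have "\<bar>- u2 + 2 * u1 ^ 2\<bar> / f s \<le> ?C * d ^ 2 / f s"
    using p by (intro divide_right_mono) auto
  moreover have "- f2 s / f s ^ 2 + 2 * f1 s ^ 2 / f s ^ 3 = (- u2 + 2 * u1 ^ 2) / f s"
    using p by (simp add: fu field_simps power2_eq_square power3_eq_cube)
  ultimately show "\<bar>- f2 s / f s ^ 2 + 2 * f1 s ^ 2 / f s ^ 3\<bar> \<le> ?C * d ^ 2 * (1 / f s)"
    using p by (simp add: abs_divide)
  have "\<bar>- u3 + 6 * u1 * u2 - 6 * u1 ^ 3\<bar> \<le> \<bar>u3\<bar> + 6 * (\<bar>u1\<bar> * \<bar>u2\<bar>) + 6 * \<bar>u1\<bar> ^ 3"
    by (simp add: abs_mult[symmetric] power_abs[symmetric])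
  also have "\<dots> \<le> ?C * d ^ 3"
    using u(3) sq(2,3) C[of 3] by linarith
  finally have "\<bar>- u3 + 6 * u1 * u2 - 6 * u1 ^ 3\<bar> / f s \<le> ?C * d ^ 3 / f s"
    using p by (intro divide_right_mono) auto
  moreover have "- f3 s / f s ^ 2 + 6 * f1 s * f2 s / f s ^ 3 - 6 * f1 s ^ 3 / f s ^ 4
      = (- u3 + 6 * u1 * u2 - 6 * u1 ^ 3) / f s"
    using p by (simp add: fu field_simps eval_nat_numeral)
  ultimately show "\<bar>- f3 s / f s ^ 2 + 6 * f1 s * f2 s / f s ^ 3 - 6 * f1 s ^ 3 / f s ^ 4\<bar>
      \<le> ?C * d ^ 3 * (1 / f s)"
    using p by (simp add: abs_divide)
qed

text \<open>The assumption f \<le> 1 turns the relative bound into an absolute one for the Lagrange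
  remainder.\<close>

lemma C3_bounded_Taylor:
  assumes f: "C3_bounded K d f f1 f2 f3" and "\<And>s. f s \<le> 1" and K: "0 \<le> K" "0 \<le> d"
  shows "\<bar>f 1 - (f 0 + f1 0 + f2 0 / 2)\<bar> \<le> K * d ^ 3"
proof -
  define diff where "diff m = (if m = 0 then f else if m = 1 then f1 else if m = 2 then f2 else f3)" for m :: nat
  have "\<forall>m t. m < 3 \<and> (0::real) \<le> t \<and> t \<le> 1 \<longrightarrow> DERIV (diff m) t :> diff (Suc m) t"
  proof (intro allI impI)
    fix m :: nat and t :: real assume "m < 3 \<and> 0 \<le> t \<and> t \<le> 1"
    then have "m = 0 \<or> m = 1 \<or> m = 2" by auto
    then show "DERIV (diff m) t :> diff (Suc m) t"
      using f by (auto simp: diff_def C3_bounded_def)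
  qed
  from Maclaurin2[of 1 diff f 3, OF _ _ this] obtain t where
    "f 1 = (\<Sum>m<3. (diff m 0 / fact m) * 1 ^ m) + (diff 3 t / fact 3) * 1 ^ 3"
    by (auto simp: diff_def)
  then have eq: "f 1 - (f 0 + f1 0 + f2 0 / 2) = f3 t / 6"
    by (simp add: diff_def eval_nat_numeral)
  have "\<bar>f3 t\<bar> \<le> K * d ^ 3 * f t" using f by (simp add: C3_bounded_def)
  also have "\<dots> \<le> K * d ^ 3 * 1"
    using assms by (intro mult_left_mono) auto
  finally have "\<bar>f3 t\<bar> / 6 \<le> K * d ^ 3"
    using K by (simp add: mult_nonneg_nonneg)
  then show ?thesis using eq by simp
qed

text \<open>
  A smooth surrogate for the indicator of \<open>\<exists>p\<in>P. \<forall>q\<in>Q. x (p, q) < 0\<close>.  It depends on the inner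
  sums through a concave function of \<open>\<Sum>p\<in>P. 1 / R p\<close>, which fixes the sign of all mixed second
  derivatives belonging to two different elements of \<open>P\<close>.
\<close>

definition soft :: "'p set \<Rightarrow> 'q set \<Rightarrow> ('p \<times> 'q \<Rightarrow> real) \<Rightarrow> real" where
  "soft P Q x = 1 / (1 + (\<Sum>p\<in>P. 1 / (\<Sum>q\<in>Q. exp (x (p, q)))))"

context
  fixes P :: "'p set" and Q :: "'q set"
  assumes fin: "finite P" "P \<noteq> {}" "finite Q" "Q \<noteq> {}"
begin

lemma soft_inner_pos: "0 < (\<Sum>q\<in>Q. exp (x (p, q) :: real))"
  using fin by (intro sum_pos) auto

lemma soft_sum_nonneg: "0 \<le> (\<Sum>p\<in>P. 1 / (\<Sum>q\<in>Q. exp (x (p, q) :: real)))"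
  by (intro sum_nonneg less_imp_le[OF divide_pos_pos[OF zero_less_one soft_inner_pos]])

lemma soft_bounds: "0 < soft P Q x" "soft P Q x \<le> 1"
  using soft_sum_nonneg[of x] by (auto simp: soft_def field_simps intro!: divide_pos_pos add_pos_nonneg)

text \<open>Along the line x + s y the function is built from exponentials by a sum, a reciprocal, a
  sum, the addition of 1 and a reciprocal. Each reciprocal sends K to K + 6 K^2 + 6 K^3, whence 1,
  13, 14209. \<open>S1\<close> and \<open>S2\<close> are the first two derivatives of
  \<open>S\<close> along y.\<close>

lemma soft_Taylor:
  fixes x y :: "'p \<times> 'q \<Rightarrow> real"
  defines "e \<equiv> \<lambda>k. exp (x k)" and "R \<equiv> \<lambda>p. \<Sum>q\<in>Q. exp (x (p, q))"
  defines "S \<equiv> \<Sum>p\<in>P. 1 / R p"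
  defines "S1 \<equiv> \<Sum>p\<in>P. - (\<Sum>q\<in>Q. y (p, q) * e (p, q)) / R p ^ 2"
  defines "S2 \<equiv> \<Sum>p\<in>P. - (\<Sum>q\<in>Q. y (p, q) ^ 2 * e (p, q)) / R p ^ 2
      + 2 * (\<Sum>q\<in>Q. y (p, q) * e (p, q)) ^ 2 / R p ^ 3"
  shows "\<bar>soft P Q (\<lambda>k. x k + y k) - (soft P Q x + - S1 / (1 + S) ^ 2
      + (- S2 / (1 + S) ^ 2 + 2 * S1 ^ 2 / (1 + S) ^ 3) / 2)\<bar> \<le> 14209 * (\<Sum>k\<in>P \<times> Q. \<bar>y k\<bar>) ^ 3"
proof -
  let ?d = "\<Sum>k\<in>P \<times> Q. \<bar>y k\<bar>"
  have d: "\<bar>y (p, q)\<bar> \<le> ?d" if "p \<in> P" "q \<in> Q" for p q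
    using that fin by (intro member_le_sum) auto
  have d0: "0 \<le> ?d" by (simp add: sum_nonneg)
  have "C3_bounded 1 ?d (\<lambda>s. \<Sum>q\<in>Q. exp (x (p, q) + s * y (p, q)))
    (\<lambda>s. \<Sum>q\<in>Q. y (p, q) * exp (x (p, q) + s * y (p, q)))
    (\<lambda>s. \<Sum>q\<in>Q. y (p, q) ^ 2 * exp (x (p, q) + s * y (p, q)))
    (\<lambda>s. \<Sum>q\<in>Q. y (p, q) ^ 3 * exp (x (p, q) + s * y (p, q)))" if "p \<in> P" for p
    using fin that d by (intro C3_bounded_sum C3_bounded_exp) auto
  from C3_bounded_inverse[OF this _ d0]
  have "C3_bounded 13 ?d (\<lambda>s. 1 / (\<Sum>q\<in>Q. exp (x (p, q) + s * y (p, q))))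
    (\<lambda>s. - (\<Sum>q\<in>Q. y (p, q) * exp (x (p, q) + s * y (p, q))) / (\<Sum>q\<in>Q. exp (x (p, q) + s * y (p, q))) ^ 2)
    (\<lambda>s. - (\<Sum>q\<in>Q. y (p, q) ^ 2 * exp (x (p, q) + s * y (p, q))) / (\<Sum>q\<in>Q. exp (x (p, q) + s * y (p, q))) ^ 2
      + 2 * (\<Sum>q\<in>Q. y (p, q) * exp (x (p, q) + s * y (p, q))) ^ 2 / (\<Sum>q\<in>Q. exp (x (p, q) + s * y (p, q))) ^ 3)
    (\<lambda>s. - (\<Sum>q\<in>Q. y (p, q) ^ 3 * exp (x (p, q) + s * y (p, q))) / (\<Sum>q\<in>Q. exp (x (p, q) + s * y (p, q))) ^ 2
      + 6 * (\<Sum>q\<in>Q. y (p, q) * exp (x (p, q) + s * y (p, q))) * (\<Sum>q\<in>Q. y (p, q) ^ 2 * exp (x (p, q) + s * y (p, q)))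
        / (\<Sum>q\<in>Q. exp (x (p, q) + s * y (p, q))) ^ 3
      - 6 * (\<Sum>q\<in>Q. y (p, q) * exp (x (p, q) + s * y (p, q))) ^ 3 / (\<Sum>q\<in>Q. exp (x (p, q) + s * y (p, q))) ^ 4)"
    if "p \<in> P" for p
    using that by fastforce
  note 1 = C3_bounded_one_plus[OF C3_bounded_sum[OF fin(1,2) this] _ d0, simplified]
  note 2 = C3_bounded_Taylor[OF C3_bounded_inverse[OF 1 _ d0] _ _ d0, simplified]
  have le1: "1 / (1 + (\<Sum>p\<in>P. 1 / (\<Sum>q\<in>Q. exp (x (p, q) + s * y (p, q))))) \<le> 1" for s
    using soft_bounds(2)[of "\<lambda>k. x k + s * y k"] by (simp add: soft_def)
  show ?thesis
    using 2[of "\<lambda>p. p", OF _ le1] unfolding soft_def S_def R_def S1_def S2_def e_def by simp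
qed

end

section \<open>Moments of Gaussian vectors and of linear fields\<close>

lemma integrable_std_normal_power: "integrable std_normal_distribution (\<lambda>x. x ^ k)"
  by (rule integrable_std_normal_distribution_moment)

lemma integrable_std_normal_abs_power: "integrable std_normal_distribution (\<lambda>x. \<bar>x\<bar> ^ k)"
  using integrable_abs[OF integrable_std_normal_power[of k]] by (simp add: power_abs)

lemma std_normal_mean: "(\<integral>x. x \<partial>std_normal_distribution) = 0"
  using integral_std_normal_distribution_moment_odd[of 1] by simp

lemma std_normal_second_moment: "(\<integral>x. x\<^sup>2 \<partial>std_normal_distribution) = 1"
  using std_normal_distribution_even_moments(1)[of 1] by simp

lemma gauss_component:
  fixes f :: "real \<Rightarrow> real"
  assumes "i \<in> I" and f: "f \<in> borel_measurable borel"
  shows "(\<integral>z. f (z i) \<partial>gauss I) = (\<integral>x. f x \<partial>std_normal_distribution)"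
    and "integrable std_normal_distribution f \<Longrightarrow> integrable (gauss I) (\<lambda>z. f (z i))"
proof -
  have d: "distr (gauss I) std_normal_distribution (\<lambda>z. z i) = std_normal_distribution"
    by (rule distr_PiM_component) (auto intro: std_normal.prob_space_axioms assms)
  have m: "(\<lambda>z. z i) \<in> gauss I \<rightarrow>\<^sub>M std_normal_distribution"
    using assms(1) by (rule measurable_component_singleton)
  have f': "f \<in> borel_measurable std_normal_distribution" using f by simp
  show "(\<integral>z. f (z i) \<partial>gauss I) = (\<integral>x. f x \<partial>std_normal_distribution)"
    using integral_distr[OF m f'] d by simp
  show "integrable std_normal_distribution f \<Longrightarrow> integrable (gauss I) (\<lambda>z. f (z i))"
    using integrable_distr_eq[OF m f'] d by simp
qed

lemma gauss_component_mean:
  assumes "i \<in> I"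
  shows "integrable (gauss I) (\<lambda>z. z i)" "(\<integral>z. z i \<partial>gauss I) = 0"
proof -
  have "integrable std_normal_distribution (\<lambda>x. x)"
    using integrable_std_normal_power[of 1] by (simp only: power_one_right)
  then show "integrable (gauss I) (\<lambda>z. z i)"
    by (rule gauss_component(2)[OF assms, rotated]) measurable
  have "(\<lambda>x. x :: real) \<in> borel_measurable borel" by measurable
  from gauss_component(1)[OF assms this] std_normal_mean
  show "(\<integral>z. z i \<partial>gauss I) = 0" by (rule trans)
qed

lemma gauss_second_moments:
  assumes I: "finite I" and ij: "i \<in> I" "j \<in> I"
  shows "integrable (gauss I) (\<lambda>z. z i * z j)"
    and "(\<integral>z. z i * z j \<partial>gauss I) = (if i = j then 1 else 0)"
proof -
  let ?N = "std_normal_distribution"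
  show "integrable (gauss I) (\<lambda>z. z i * z j)"
  proof (cases "i = j")
    case True
    then show ?thesis
      using gauss_component(2)[OF ij(1), of "\<lambda>x. x ^ 2"] integrable_std_normal_power[of 2]
      by (simp add: power2_eq_square)
  next
    case False
    define f where "f k = (if k = i \<or> k = j then \<lambda>x. x else (\<lambda>x. 1 :: real))" for k
    have "(\<Prod>k\<in>I. f k (z k)) = z i * z j" for z
    proof -
      have "(\<Prod>k\<in>I. f k (z k)) = (\<Prod>k\<in>{i, j}. f k (z k))"
        using I ij by (intro prod.mono_neutral_right) (auto simp: f_def)
      then show ?thesis using False by (simp add: f_def)
    qed
    moreover have "integrable ?N (f k)" for k
      using integrable_std_normal_power[of 1] by (auto simp: f_def)
    ultimately show ?thesis
      using std_normal_prod.product_integrable_prod[OF I, of f] by simp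
  qed
  show "(\<integral>z. z i * z j \<partial>gauss I) = (if i = j then 1 else 0)"
  proof (cases "i = j")
    case True
    then show ?thesis
      using gauss_component(1)[OF ij(1), of "\<lambda>x. x ^ 2"] std_normal_second_moment
      by (simp add: power2_eq_square)
  next
    case False
    define f where "f k = (if k = i \<or> k = j then \<lambda>x. x else (\<lambda>x. 1 :: real))" for k
    have "(\<Prod>k\<in>I. f k (z k)) = z i * z j" for z
    proof -
      have "(\<Prod>k\<in>I. f k (z k)) = (\<Prod>k\<in>{i, j}. f k (z k))"
        using I ij by (intro prod.mono_neutral_right) (auto simp: f_def)
      then show ?thesis using False by (simp add: f_def)
    qed
    moreover have "integrable ?N (f k)" for k
      using integrable_std_normal_power[of 1] by (auto simp: f_def)
    ultimately have "(\<integral>z. z i * z j \<partial>gauss I) = (\<Prod>k\<in>I. integral\<^sup>L ?N (f k))"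
      using std_normal_prod.product_integral_prod[OF I, of f] by simp
    also have "\<dots> = 0"
      using I ij by (auto simp: f_def std_normal_mean intro!: bexI[of _ i])
    finally show ?thesis using False by simp
  qed
qed

text \<open>Replace every term by the largest one. Crude, but enough to make the Taylor error
  integrable.\<close>

lemma sum_power3_le:
  fixes y :: "'i \<Rightarrow> real"
  assumes "finite I" "\<And>i. i \<in> I \<Longrightarrow> 0 \<le> y i"
  shows "(\<Sum>i\<in>I. y i) ^ 3 \<le> real (card I) ^ 3 * (\<Sum>i\<in>I. y i ^ 3)"
proof (cases "I = {}")
  case False
  have "Max (y ` I) \<in> y ` I" using assms(1) False by simp
  then obtain j where "j \<in> I" "Max (y ` I) = y j" by auto
  with assms(1) have j: "j \<in> I" "\<And>i. i \<in> I \<Longrightarrow> y i \<le> y j"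
    by (auto simp flip: \<open>Max (y ` I) = y j\<close>)
  have "(\<Sum>i\<in>I. y i) \<le> real (card I) * y j"
    using sum_bounded_above[of I y "y j"] j by simp
  then have "(\<Sum>i\<in>I. y i) ^ 3 \<le> (real (card I) * y j) ^ 3"
    using assms by (intro power_mono sum_nonneg) auto
  also have "\<dots> \<le> real (card I) ^ 3 * (\<Sum>i\<in>I. y i ^ 3)"
    unfolding power_mult_distrib using assms j
    by (intro mult_left_mono member_le_sum) auto
  finally show ?thesis .
qed simp

definition gcov :: "'i set \<Rightarrow> ('i \<Rightarrow> 'k \<Rightarrow> real) \<Rightarrow> 'k \<Rightarrow> 'k \<Rightarrow> real" where
  "gcov I c k l = (\<Sum>i\<in>I. c i k * c i l)"

context
  fixes I :: "'i set" and c :: "'i \<Rightarrow> 'k \<Rightarrow> real"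
  assumes I: "finite I"
begin

lemma gauss_lin_mean:
  shows "integrable (gauss_lin I c) (\<lambda>y. y k)" "(\<integral>y. y k \<partial>gauss_lin I c) = 0"
proof -
  have int: "integrable (gauss I) (\<lambda>z. c i k * z i)" if "i \<in> I" for i
    by (intro integrable_mult_right gauss_component_mean(1) that)
  have int': "integrable (gauss I) (\<lambda>z. \<Sum>i\<in>I. c i k * z i)"
    by (rule Bochner_Integration.integrable_sum) (rule int)
  then show "integrable (gauss_lin I c) (\<lambda>y. y k)"
    unfolding gauss_lin_def
    by (subst integrable_distr_eq[OF measurable_lin measurable_borel_fun_component])
  have "(\<integral>y. y k \<partial>gauss_lin I c) = (\<integral>z. (\<Sum>i\<in>I. c i k * z i) \<partial>gauss I)"
    by (rule integral_gauss_lin) (rule measurable_borel_fun_component)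
  also have "\<dots> = (\<Sum>i\<in>I. \<integral>z. c i k * z i \<partial>gauss I)"
    by (rule Bochner_Integration.integral_sum) (rule int)
  also have "\<dots> = 0"
    by (intro sum.neutral ballI) (simp only: integral_mult_right_zero gauss_component_mean(2) mult_zero_right)
  finally show "(\<integral>y. y k \<partial>gauss_lin I c) = 0" .
qed

lemma gauss_lin_cov:
  shows "integrable (gauss_lin I c) (\<lambda>y. y k * y l)" "(\<integral>y. y k * y l \<partial>gauss_lin I c) = gcov I c k l"
proof -
  have eq: "(\<Sum>i\<in>I. c i k * z i) * (\<Sum>i\<in>I. c i l * z i)
      = (\<Sum>i\<in>I. \<Sum>j\<in>I. c i k * c j l * (z i * z j))" for z
    by (simp add: sum_product mult_ac)
  have int: "integrable (gauss I) (\<lambda>z. c i k * c j l * (z i * z j))" if "i \<in> I" "j \<in> I" for i j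
    using gauss_second_moments(1)[OF I that] by simp
  show "integrable (gauss_lin I c) (\<lambda>y. y k * y l)"
    unfolding gauss_lin_def by (subst integrable_distr_eq) (auto intro!: int simp: eq)
  have "(\<integral>y. y k * y l \<partial>gauss_lin I c) = (\<integral>z. (\<Sum>i\<in>I. \<Sum>j\<in>I. c i k * c j l * (z i * z j)) \<partial>gauss I)"
    by (subst integral_gauss_lin) (auto simp: eq)
  also have "\<dots> = (\<Sum>i\<in>I. \<Sum>j\<in>I. c i k * c j l * (if i = j then 1 else 0))"
    using int gauss_second_moments(2)[OF I] by simp
  also have "\<dots> = gcov I c k l"
    using I by (simp add: gcov_def if_distrib cong: if_cong)
  finally show "(\<integral>y. y k * y l \<partial>gauss_lin I c) = gcov I c k l" .
qed

lemma gauss_lin_third: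
  assumes "finite A"
  shows "integrable (gauss_lin I c) (\<lambda>y. (\<Sum>k\<in>A. \<bar>y k\<bar>) ^ 3)"
proof -
  interpret prob_space "gauss_lin I c" by (rule prob_space_gauss_lin)
  have 1: "integrable (gauss_lin I c) (\<lambda>y. \<bar>y k\<bar> ^ 3)" for k
  proof -
    have m: "integrable (gauss I) (\<lambda>z. \<bar>c i k * z i\<bar> ^ 3)" if "i \<in> I" for i
      using gauss_component(2)[OF that, of "\<lambda>x. \<bar>x\<bar> ^ 3"] integrable_std_normal_abs_power[of 3]
      by (simp add: abs_mult power_mult_distrib)
    have "integrable (gauss I) (\<lambda>z. \<bar>\<Sum>i\<in>I. c i k * z i\<bar> ^ 3)"
    proof (rule Bochner_Integration.integrable_bound)
      show "integrable (gauss I) (\<lambda>z. real (card I) ^ 3 * (\<Sum>i\<in>I. \<bar>c i k * z i\<bar> ^ 3))"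
        using m by simp
      have "\<bar>\<Sum>i\<in>I. c i k * z i\<bar> ^ 3 \<le> real (card I) ^ 3 * (\<Sum>i\<in>I. \<bar>c i k * z i\<bar> ^ 3)" for z
        by (rule order_trans[OF power_mono[OF sum_abs]], simp)
          (use I in \<open>auto intro!: sum_power3_le\<close>)
      then show "AE z in gauss I. norm (\<bar>\<Sum>i\<in>I. c i k * z i\<bar> ^ 3) \<le> norm (real (card I) ^ 3 * (\<Sum>i\<in>I. \<bar>c i k * z i\<bar> ^ 3))"
        by (auto simp: sum_nonneg)
    qed measurable
    then show ?thesis unfolding gauss_lin_def by (subst integrable_distr_eq) auto
  qed
  show ?thesis
  proof (rule Bochner_Integration.integrable_bound)
    show "integrable (gauss_lin I c) (\<lambda>y. real (card A) ^ 3 * (\<Sum>k\<in>A. \<bar>y k\<bar> ^ 3))"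
      using 1 by simp
    show "AE y in gauss_lin I c. norm ((\<Sum>k\<in>A. \<bar>y k\<bar>) ^ 3) \<le> norm (real (card A) ^ 3 * (\<Sum>k\<in>A. \<bar>y k\<bar> ^ 3))"
      using sum_power3_le[OF assms, of "\<lambda>k. \<bar>_ k\<bar>"] by (auto simp: sum_nonneg)
  qed measurable
qed

lemma gauss_lin_linear:
  assumes "finite A"
  shows "integrable (gauss_lin I c) (\<lambda>y. \<Sum>k\<in>A. a k * y k)" "(\<integral>y. (\<Sum>k\<in>A. a k * y k) \<partial>gauss_lin I c) = 0"
  using gauss_lin_mean by simp_all

lemma gauss_lin_quadratic:
  assumes "finite A"
  shows "integrable (gauss_lin I c) (\<lambda>y. (\<Sum>k\<in>A. a k * y k) ^ 2)"
    "(\<integral>y. (\<Sum>k\<in>A. a k * y k) ^ 2 \<partial>gauss_lin I c) = (\<Sum>k\<in>A. \<Sum>l\<in>A. a k * a l * gcov I c k l)"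
proof -
  have eq: "(\<Sum>k\<in>A. a k * y k) ^ 2 = (\<Sum>k\<in>A. \<Sum>l\<in>A. a k * a l * (y k * y l))" for y
    by (simp add: power2_eq_square sum_product mult_ac)
  show "integrable (gauss_lin I c) (\<lambda>y. (\<Sum>k\<in>A. a k * y k) ^ 2)"
    "(\<integral>y. (\<Sum>k\<in>A. a k * y k) ^ 2 \<partial>gauss_lin I c) = (\<Sum>k\<in>A. \<Sum>l\<in>A. a k * a l * gcov I c k l)"
    using gauss_lin_cov unfolding eq by simp_all
qed

end

section \<open>Gordon's inequality for finite index sets\<close>

context
  fixes P :: "'p set" and Q :: "'q set" and I :: "'i set" and J :: "'j set"
    and c :: "'i \<Rightarrow> 'p \<times> 'q \<Rightarrow> real" and d :: "'j \<Rightarrow> 'p \<times> 'q \<Rightarrow> real"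
  assumes fin: "finite P" "P \<noteq> {}" "finite Q" "Q \<noteq> {}" and IJ: "finite I" "finite J"
    and cov_eq: "\<And>p q q'. p \<in> P \<Longrightarrow> q \<in> Q \<Longrightarrow> q' \<in> Q \<Longrightarrow> gcov I c (p, q) (p, q') = gcov J d (p, q) (p, q')"
    and cov_le: "\<And>p p' q q'. p \<in> P \<Longrightarrow> p' \<in> P \<Longrightarrow> q \<in> Q \<Longrightarrow> q' \<in> Q \<Longrightarrow>
      gcov J d (p, q) (p', q') \<le> gcov I c (p, q) (p', q')"
begin

lemma measurable_soft: "soft P Q \<in> borel_measurable borel_fun"
  unfolding soft_def[abs_def] by measurable

text \<open>Take means of the Taylor polynomial. The linear term vanishes; \<open>S2\<close> sees
  only covariances inside one p, where both fields agree; so the fields differ only in the mean of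
  the square of \<open>S1\<close>, whose factor 2 / (1 + S)^3 is positive. All partial derivatives
  of \<open>S\<close> have the same sign, hence larger covariances give a larger mean.\<close>

lemma soft_step:
  "\<exists>C\<ge>0. \<forall>x e. 0 \<le> e \<longrightarrow>
    (\<integral>y. soft P Q (\<lambda>k. x k + e * y k) \<partial>gauss_lin J d)
      \<le> (\<integral>y. soft P Q (\<lambda>k. x k + e * y k) \<partial>gauss_lin I c) + C * e ^ 3"
proof -
  let ?D = "\<lambda>y. (\<Sum>k\<in>P \<times> Q. \<bar>y k\<bar>) ^ 3"
  let ?X = "gauss_lin I c" and ?Y = "gauss_lin J d"
  have PQ: "finite (P \<times> Q)" using fin by simp
  note [measurable] = measurable_soft
  have main: "(\<integral>y. soft P Q (\<lambda>k. x k + e * y k) \<partial>?Y)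
      \<le> (\<integral>y. soft P Q (\<lambda>k. x k + e * y k) \<partial>?X) + 14209 * (integral\<^sup>L ?X ?D + integral\<^sup>L ?Y ?D) * e ^ 3"
    if e: "0 \<le> e" for x e
  proof -
    define E where "E k = exp (x k)" for k
    define R where "R p = (\<Sum>q\<in>Q. exp (x (p, q)))" for p
    define S where "S = (\<Sum>p\<in>P. 1 / R p)"
    define S1 where "S1 y = (\<Sum>p\<in>P. - (\<Sum>q\<in>Q. y (p, q) * E (p, q)) / R p ^ 2)" for y
    define S2 where "S2 y = (\<Sum>p\<in>P. - (\<Sum>q\<in>Q. y (p, q) ^ 2 * E (p, q)) / R p ^ 2
      + 2 * (\<Sum>q\<in>Q. y (p, q) * E (p, q)) ^ 2 / R p ^ 3)" for y
    define T where "T y = soft P Q x + - e * S1 y / (1 + S) ^ 2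
      + e ^ 2 * (- S2 y / (1 + S) ^ 2 + 2 * S1 y ^ 2 / (1 + S) ^ 3) / 2" for y
    have Rp: "0 < R p" for p unfolding R_def using soft_inner_pos[OF fin] .
    have Sn: "0 \<le> S" unfolding S_def R_def using soft_sum_nonneg[OF fin] .
    define a where "a k = - (E k / R (fst k) ^ 2)" for k
    have S1: "S1 y = (\<Sum>k\<in>P \<times> Q. a k * y k)" for y
      by (simp add: S1_def a_def sum.cartesian_product' sum_negf sum_divide_distrib mult_ac)
    have an: "a k \<le> 0" for k by (simp add: a_def E_def)
    have scale: "S1 (\<lambda>k. e * y k) = e * S1 y" "S2 (\<lambda>k. e * y k) = e ^ 2 * S2 y" for y
    proof -
      have i1: "(\<Sum>q\<in>Q. e * y (p, q) * E (p, q)) = e * (\<Sum>q\<in>Q. y (p, q) * E (p, q))" for p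
        by (simp add: sum_distrib_left mult.assoc)
      have i2: "(\<Sum>q\<in>Q. (e * y (p, q)) ^ 2 * E (p, q)) = e ^ 2 * (\<Sum>q\<in>Q. y (p, q) ^ 2 * E (p, q))" for p
        by (simp add: sum_distrib_left power_mult_distrib mult.assoc)
      show "S1 (\<lambda>k. e * y k) = e * S1 y"
        unfolding S1_def i1 by (subst sum_distrib_left, intro sum.cong refl) simp
      show "S2 (\<lambda>k. e * y k) = e ^ 2 * S2 y"
        unfolding S2_def i1 i2
        by (subst sum_distrib_left, intro sum.cong refl) (simp add: power_mult_distrib right_diff_distrib)
    qed
    have tay: "\<bar>soft P Q (\<lambda>k. x k + e * y k) - T y\<bar> \<le> 14209 * e ^ 3 * ?D y" for y
    proof -
      have "\<bar>soft P Q (\<lambda>k. x k + e * y k) - (soft P Q x + - S1 (\<lambda>k. e * y k) / (1 + S) ^ 2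
          + (- S2 (\<lambda>k. e * y k) / (1 + S) ^ 2 + 2 * S1 (\<lambda>k. e * y k) ^ 2 / (1 + S) ^ 3) / 2)\<bar>
          \<le> 14209 * (\<Sum>k\<in>P \<times> Q. \<bar>e * y k\<bar>) ^ 3"
        using soft_Taylor[OF fin, of x "\<lambda>k. e * y k"]
        unfolding S_def R_def S1_def S2_def E_def .
      moreover have "T y = soft P Q x + - S1 (\<lambda>k. e * y k) / (1 + S) ^ 2
          + (- S2 (\<lambda>k. e * y k) / (1 + S) ^ 2 + 2 * S1 (\<lambda>k. e * y k) ^ 2 / (1 + S) ^ 3) / 2"
        unfolding T_def scale by (simp add: power_mult_distrib right_diff_distrib)
      ultimately have "\<bar>soft P Q (\<lambda>k. x k + e * y k) - T y\<bar> \<le> 14209 * (\<Sum>k\<in>P \<times> Q. \<bar>e * y k\<bar>) ^ 3"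
        by simp
      also have "(\<Sum>k\<in>P \<times> Q. \<bar>e * y k\<bar>) = e * (\<Sum>k\<in>P \<times> Q. \<bar>y k\<bar>)"
        using e by (simp add: abs_mult sum_distrib_left)
      finally show ?thesis by (simp add: power_mult_distrib)
    qed
    have lin: "integrable (gauss_lin I' c') S1" "integral\<^sup>L (gauss_lin I' c') S1 = 0"
      "integrable (gauss_lin I' c') (\<lambda>y. S1 y ^ 2)"
      "(\<integral>y. S1 y ^ 2 \<partial>gauss_lin I' c') = (\<Sum>k\<in>P \<times> Q. \<Sum>l\<in>P \<times> Q. a k * a l * gcov I' c' k l)"
      if "finite I'" for I' :: "'z set" and c'
      unfolding S1[abs_def] using gauss_lin_linear[OF that PQ] gauss_lin_quadratic[OF that PQ] by simp_all
    have quad: "integrable (gauss_lin I' c') S2"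
      "integral\<^sup>L (gauss_lin I' c') S2 = (\<Sum>p\<in>P. - (\<Sum>q\<in>Q. gcov I' c' (p, q) (p, q) * E (p, q)) / R p ^ 2
        + 2 * (\<Sum>q\<in>Q. \<Sum>q'\<in>Q. E (p, q) * E (p, q') * gcov I' c' (p, q) (p, q')) / R p ^ 3)"
      if I': "finite I'" for I' :: "'z set" and c'
    proof -
      have q1: "integrable (gauss_lin I' c') (\<lambda>y. y k ^ 2)"
        "(\<integral>y. y k ^ 2 \<partial>gauss_lin I' c') = gcov I' c' k k" for k
        using gauss_lin_cov[OF I', of c' k k] by (simp_all add: power2_eq_square)
      have im: "sum f (Pair p ` Q) = (\<Sum>q\<in>Q. f (p, q))" for f :: "_ \<Rightarrow> real" and p
        by (subst sum.reindex) (auto simp: inj_on_def)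
      have q2: "integrable (gauss_lin I' c') (\<lambda>y. (\<Sum>q\<in>Q. y (p, q) * E (p, q)) ^ 2)"
        "(\<integral>y. (\<Sum>q\<in>Q. y (p, q) * E (p, q)) ^ 2 \<partial>gauss_lin I' c')
          = (\<Sum>q\<in>Q. \<Sum>q'\<in>Q. E (p, q) * E (p, q') * gcov I' c' (p, q) (p, q'))" for p
        using gauss_lin_quadratic[OF I', of "Pair p ` Q" c' E] fin by (simp_all add: im mult.commute)
      show "integrable (gauss_lin I' c') S2"
        unfolding S2_def[abs_def] using q1 q2 by simp
      show "integral\<^sup>L (gauss_lin I' c') S2 = (\<Sum>p\<in>P. - (\<Sum>q\<in>Q. gcov I' c' (p, q) (p, q) * E (p, q)) / R p ^ 2
        + 2 * (\<Sum>q\<in>Q. \<Sum>q'\<in>Q. E (p, q) * E (p, q') * gcov I' c' (p, q) (p, q')) / R p ^ 3)"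
        unfolding S2_def[abs_def] using q1 q2 by simp
    qed
    have S2eq: "integral\<^sup>L ?X S2 = integral\<^sup>L ?Y S2"
      unfolding quad(2)[OF IJ(1)] quad(2)[OF IJ(2)]
      by (simp add: cov_eq cong: sum.cong)
    have S1le: "(\<integral>y. S1 y ^ 2 \<partial>?Y) \<le> (\<integral>y. S1 y ^ 2 \<partial>?X)"
      unfolding lin(4)[OF IJ(1)] lin(4)[OF IJ(2)]
    proof (intro sum_mono mult_left_mono)
      fix k l assume "k \<in> P \<times> Q" "l \<in> P \<times> Q"
      then show "gcov J d k l \<le> gcov I c k l" using cov_le by auto
      show "0 \<le> a k * a l" using an by (intro mult_nonpos_nonpos)
    qed
    have Tint: "integrable (gauss_lin I' c') T"
      "integral\<^sup>L (gauss_lin I' c') T = soft P Q x + e ^ 2 * (- integral\<^sup>L (gauss_lin I' c') S2 / (1 + S) ^ 2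
        + 2 * (\<integral>y. S1 y ^ 2 \<partial>gauss_lin I' c') / (1 + S) ^ 3) / 2"
      if I': "finite I'" for I' :: "'z set" and c'
    proof -
      interpret L: prob_space "gauss_lin I' c'" by (rule prob_space_gauss_lin)
      have L1: "L.prob UNIV = 1" using L.prob_space by simp
      show "integrable (gauss_lin I' c') T"
        unfolding T_def[abs_def] using lin(1,3)[OF I', of c'] quad(1)[OF I', of c'] by simp
      show "integral\<^sup>L (gauss_lin I' c') T = soft P Q x + e ^ 2 * (- integral\<^sup>L (gauss_lin I' c') S2 / (1 + S) ^ 2
        + 2 * (\<integral>y. S1 y ^ 2 \<partial>gauss_lin I' c') / (1 + S) ^ 3) / 2"
        unfolding T_def[abs_def] using lin[OF I', of c'] quad(1)[OF I', of c'] L1 by simp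
    qed
    have Tle: "integral\<^sup>L ?Y T \<le> integral\<^sup>L ?X T"
      unfolding Tint(2)[OF IJ(1)] Tint(2)[OF IJ(2)] S2eq
      using S1le Sn by (intro add_left_mono divide_right_mono mult_left_mono add_mono) auto
    have err: "\<bar>(\<integral>y. soft P Q (\<lambda>k. x k + e * y k) \<partial>gauss_lin I' c') - integral\<^sup>L (gauss_lin I' c') T\<bar>
        \<le> 14209 * e ^ 3 * integral\<^sup>L (gauss_lin I' c') ?D"
      if I': "finite I'" for I' :: "'z set" and c'
    proof -
      interpret L: prob_space "gauss_lin I' c'" by (rule prob_space_gauss_lin)
      have "(\<lambda>y k. x k + e * y k) \<in> gauss_lin I' c' \<rightarrow>\<^sub>M borel_fun"
        by (rule measurable_borel_fun) measurable
      then have [measurable]: "(\<lambda>y. soft P Q (\<lambda>k. x k + e * y k)) \<in> borel_measurable (gauss_lin I' c')"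
        by (rule measurable_compose[OF _ measurable_soft])
      have i: "integrable (gauss_lin I' c') (\<lambda>y. soft P Q (\<lambda>k. x k + e * y k))"
        using soft_bounds[OF fin] by (intro L.integrable_const_bound[where B=1]) (auto simp: less_imp_le)
      have "\<bar>(\<integral>y. soft P Q (\<lambda>k. x k + e * y k) \<partial>gauss_lin I' c') - integral\<^sup>L (gauss_lin I' c') T\<bar>
        = \<bar>\<integral>y. soft P Q (\<lambda>k. x k + e * y k) - T y \<partial>gauss_lin I' c'\<bar>"
        using i Tint(1)[OF I', of c'] by simp
      also have "\<dots> \<le> (\<integral>y. \<bar>soft P Q (\<lambda>k. x k + e * y k) - T y\<bar> \<partial>gauss_lin I' c')"
        by (rule integral_abs_bound)
      also have "\<dots> \<le> (\<integral>y. 14209 * e ^ 3 * ?D y \<partial>gauss_lin I' c')"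
        using i Tint(1)[OF I', of c'] gauss_lin_third[OF I' PQ, of c'] tay
        by (intro integral_mono) auto
      finally show ?thesis by simp
    qed
    show ?thesis
      using err[OF IJ(1), of c] err[OF IJ(2), of d] Tle by (simp add: algebra_simps)
  qed
  show ?thesis
  proof (intro exI conjI allI impI)
    show "0 \<le> 14209 * (integral\<^sup>L ?X ?D + integral\<^sup>L ?Y ?D)"
      by (intro mult_nonneg_nonneg add_nonneg_nonneg integral_nonneg_AE) (auto simp: sum_nonneg)
  qed (rule main)
qed

text \<open>Shift and sharpness are absorbed by the base point and the increment of
  \<open>soft_step\<close>: a step e becomes b e and the cubic constant C b^3. It may depend on b,
  since the Lindeberg limit is taken at fixed b.\<close>

lemma soft_comparison:
  "(\<integral>y. soft P Q (\<lambda>k. b * (\<psi> k + y k)) \<partial>gauss_lin J d) \<le> (\<integral>y. soft P Q (\<lambda>k. b * (\<psi> k + y k)) \<partial>gauss_lin I c)"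
  if b: "0 \<le> b"
proof -
  obtain C where C: "\<And>x e. 0 \<le> e \<Longrightarrow>
    (\<integral>y. soft P Q (\<lambda>k. x k + e * y k) \<partial>gauss_lin J d)
      \<le> (\<integral>y. soft P Q (\<lambda>k. x k + e * y k) \<partial>gauss_lin I c) + C * e ^ 3"
    using soft_step by auto
  show ?thesis
  proof (rule lindeberg_comparison[OF IJ(2,1), where B=1 and C="C * b ^ 3"])
    show "(\<lambda>y. soft P Q (\<lambda>k. b * (\<psi> k + y k))) \<in> borel_measurable borel_fun"
      by (rule measurable_compose[OF _ measurable_soft], rule measurable_borel_fun) measurable
    show "\<bar>soft P Q (\<lambda>k. b * (\<psi> k + x k))\<bar> \<le> 1" for x
      using soft_bounds[OF fin] by (auto simp: less_imp_le)
    fix x :: "'p \<times> 'q \<Rightarrow> real" and e :: real assume "0 \<le> e"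
    then show "(\<integral>y. soft P Q (\<lambda>k. b * (\<psi> k + (x k + e * y k))) \<partial>gauss_lin J d)
      \<le> (\<integral>y. soft P Q (\<lambda>k. b * (\<psi> k + (x k + e * y k))) \<partial>gauss_lin I c) + C * b ^ 3 * e ^ 3"
      using C[of "b * e" "\<lambda>k. b * (\<psi> k + x k)"] b
      by (simp add: algebra_simps power_mult_distrib)
  qed
qed

text \<open>Sharpening \<open>soft\<close> gives an indicator: the limit is 0 if some p has only
  negative entries, since then the inner sum vanishes and its reciprocal explodes, and 1, by
  \<open>soft_tendsto_1\<close>, if every p has a positive entry.\<close>

lemma soft_tendsto_0:
  assumes "p \<in> P" "\<And>q. q \<in> Q \<Longrightarrow> z (p, q) < 0"
  shows "(\<lambda>n. soft P Q (\<lambda>k. real n * z k)) \<longlonglongrightarrow> 0"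
proof (rule tendsto_sandwich[OF _ _ tendsto_const])
  have "(\<lambda>n. \<Sum>q\<in>Q. exp (real n * z (p, q))) \<longlonglongrightarrow> (\<Sum>q\<in>Q. 0)"
  proof (intro tendsto_sum)
    fix q assume "q \<in> Q"
    then have "exp (z (p, q)) < 1" using assms by simp
    then have "(\<lambda>n. exp (z (p, q)) ^ n) \<longlonglongrightarrow> 0" by (intro LIMSEQ_power_zero) simp
    then show "(\<lambda>n. exp (real n * z (p, q))) \<longlonglongrightarrow> 0" by (simp add: exp_of_nat_mult)
  qed
  then show "(\<lambda>n. \<Sum>q\<in>Q. exp (real n * z (p, q))) \<longlonglongrightarrow> 0" by simp
  show "\<forall>\<^sub>F n in sequentially. 0 \<le> soft P Q (\<lambda>k. real n * z k)"
    using soft_bounds[OF fin] by (auto intro!: always_eventually less_imp_le)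
  show "\<forall>\<^sub>F n in sequentially. soft P Q (\<lambda>k. real n * z k) \<le> (\<Sum>q\<in>Q. exp (real n * z (p, q)))"
  proof (intro always_eventually allI)
    fix n
    let ?R = "\<lambda>p. \<Sum>q\<in>Q. exp (real n * z (p, q))"
    have R: "0 < ?R p'" for p' using fin by (intro sum_pos) auto
    have "1 / ?R p \<le> (\<Sum>p\<in>P. 1 / ?R p)"
      using R assms fin by (intro member_le_sum) (auto intro: less_imp_le)
    then have "1 / (1 + (\<Sum>p\<in>P. 1 / ?R p)) \<le> 1 / (1 / ?R p)"
      using R[of p] by (intro frac_le) auto
    then show "soft P Q (\<lambda>k. real n * z k) \<le> ?R p" by (simp add: soft_def)
  qed
qed

lemma soft_tendsto_1:
  assumes "\<And>p. p \<in> P \<Longrightarrow> \<exists>q\<in>Q. 0 < z (p, q)"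
  shows "(\<lambda>n. soft P Q (\<lambda>k. real n * z k)) \<longlonglongrightarrow> 1"
proof -
  have "(\<lambda>n. 1 / (\<Sum>q\<in>Q. exp (real n * z (p, q)))) \<longlonglongrightarrow> 0" if q: "q \<in> Q" "0 < z (p, q)" for p q
  proof (rule tendsto_sandwich[OF _ _ tendsto_const])
    from q have "exp (- z (p, q)) < 1" by simp
    then have "(\<lambda>n. exp (- z (p, q)) ^ n) \<longlonglongrightarrow> 0" by (intro LIMSEQ_power_zero) simp
    then show "(\<lambda>n. exp (- (real n * z (p, q)))) \<longlonglongrightarrow> 0" by (simp add: exp_of_nat_mult[symmetric])
    show "\<forall>\<^sub>F n in sequentially. 0 \<le> 1 / (\<Sum>q\<in>Q. exp (real n * z (p, q)))"
      by (auto intro!: always_eventually sum_nonneg)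
    show "\<forall>\<^sub>F n in sequentially. 1 / (\<Sum>q\<in>Q. exp (real n * z (p, q))) \<le> exp (- (real n * z (p, q)))"
    proof (intro always_eventually allI)
      fix n
      have "exp (real n * z (p, q)) \<le> (\<Sum>q\<in>Q. exp (real n * z (p, q)))"
        using fin q by (intro member_le_sum) auto
      then have "1 / (\<Sum>q\<in>Q. exp (real n * z (p, q))) \<le> 1 / exp (real n * z (p, q))"
        using order_less_le_trans[OF exp_gt_zero] by (intro divide_left_mono mult_pos_pos) auto
      then show "1 / (\<Sum>q\<in>Q. exp (real n * z (p, q))) \<le> exp (- (real n * z (p, q)))"
        by (simp add: exp_minus inverse_eq_divide)
    qed
  qed
  then have "(\<lambda>n. 1 / (\<Sum>q\<in>Q. exp (real n * z (p, q)))) \<longlonglongrightarrow> 0" if "p \<in> P" for p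
    using assms[OF that] by blast
  then have "(\<lambda>n. 1 / (1 + (\<Sum>p\<in>P. 1 / (\<Sum>q\<in>Q. exp (real n * z (p, q)))))) \<longlonglongrightarrow> 1 / (1 + (\<Sum>p\<in>P. 0))"
    by (intro tendsto_intros) auto
  then show ?thesis by (simp add: soft_def)
qed

text \<open>Let the sharpness in \<open>soft_comparison\<close> tend to infinity. The limit of
  \<open>soft\<close> is not controlled when the decisive entries are exactly 0, so the event is
  strict on the left and weak on the right.\<close>

lemma gordon_finite:
  "measure (gauss I) {z \<in> space (gauss I). \<exists>p\<in>P. \<forall>q\<in>Q. \<psi> (p, q) + (\<Sum>i\<in>I. c i (p, q) * z i) < 0}
    \<le> measure (gauss J) {z \<in> space (gauss J). \<exists>p\<in>P. \<forall>q\<in>Q. \<psi> (p, q) + (\<Sum>j\<in>J. d j (p, q) * z j) \<le> 0}"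
proof -
  let ?X = "gauss_lin I c" and ?Y = "gauss_lin J d"
  interpret X: prob_space ?X by (rule prob_space_gauss_lin)
  interpret Y: prob_space ?Y by (rule prob_space_gauss_lin)
  define A where "A = {y. \<exists>p\<in>P. \<forall>q\<in>Q. \<psi> (p, q) + y (p, q) < 0}"
  define B where "B = {y. \<exists>p\<in>P. \<forall>q\<in>Q. \<psi> (p, q) + y (p, q) \<le> 0}"
  have A: "A \<in> sets borel_fun" and B: "B \<in> sets borel_fun"
  proof -
    have "{y \<in> space borel_fun. \<psi> k + y k < 0} \<in> sets borel_fun"
      "{y \<in> space borel_fun. \<psi> k + y k \<le> 0} \<in> sets borel_fun" for k
      by measurable
    then have 1: "{y. \<psi> k + y k < 0} \<in> sets borel_fun" "{y. \<psi> k + y k \<le> 0} \<in> sets borel_fun" for k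
      by (simp_all add: space_PiM)
    have "A = (\<Union>p\<in>P. \<Inter>q\<in>Q. {y. \<psi> (p, q) + y (p, q) < 0})"
      "B = (\<Union>p\<in>P. \<Inter>q\<in>Q. {y. \<psi> (p, q) + y (p, q) \<le> 0})"
      by (auto simp: A_def B_def)
    then show "A \<in> sets borel_fun" "B \<in> sets borel_fun"
      using fin 1 by (auto intro!: sets.finite_UN sets.finite_INT)
  qed
  note [measurable] = A B
  define f where "f n y = soft P Q (\<lambda>k. real n * (\<psi> k + y k))" for n y
  have [measurable]: "f n \<in> borel_measurable borel_fun" for n
    unfolding f_def
    by (rule measurable_compose[OF _ measurable_soft], rule measurable_borel_fun) measurable
  have fb: "0 \<le> f n y" "f n y \<le> 1" for n y
    using soft_bounds[OF fin] by (auto simp: f_def intro: less_imp_le)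
  have fi: "integrable M (f n)" if "prob_space M" "sets M = sets borel_fun" for M n
  proof -
    interpret prob_space M by fact
    note that(2)[measurable_cong]
    show ?thesis using fb by (intro integrable_const_bound[where B=1]) auto
  qed
  have le: "(\<integral>y. f n y \<partial>?Y) \<le> (\<integral>y. f n y \<partial>?X)" for n
    unfolding f_def by (rule soft_comparison) simp
  have "(\<lambda>n. \<integral>y. indicator A y * f n y \<partial>?X) \<longlonglongrightarrow> (\<integral>y. 0 \<partial>?X)"
  proof (rule integral_dominated_convergence[where w="\<lambda>_. 1"])
    show "AE y in ?X. (\<lambda>n. indicator A y * f n y) \<longlonglongrightarrow> 0"
    proof (rule AE_I2)
      fix y
      show "(\<lambda>n. indicator A y * f n y) \<longlonglongrightarrow> 0"
      proof (cases "y \<in> A")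
        case True
        then obtain p where "p \<in> P" "\<And>q. q \<in> Q \<Longrightarrow> \<psi> (p, q) + y (p, q) < 0" by (auto simp: A_def)
        then show ?thesis using True soft_tendsto_0[of p "\<lambda>k. \<psi> k + y k"] by (simp add: f_def)
      qed simp
    qed
  qed (use fb in \<open>auto simp: indicator_def\<close>)
  then have limA: "(\<lambda>n. X.prob (- A) + (\<integral>y. indicator A y * f n y \<partial>?X)) \<longlonglongrightarrow> X.prob (- A) + 0"
    by (intro tendsto_intros) simp
  have "(\<lambda>n. \<integral>y. indicator (- B) y * f n y \<partial>?Y) \<longlonglongrightarrow> (\<integral>y. indicator (- B) y \<partial>?Y)"
  proof (rule integral_dominated_convergence[where w="\<lambda>_. 1"])
    show "AE y in ?Y. (\<lambda>n. indicator (- B) y * f n y) \<longlonglongrightarrow> indicator (- B) y"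
    proof (rule AE_I2)
      fix y
      show "(\<lambda>n. indicator (- B) y * f n y) \<longlonglongrightarrow> indicator (- B) y"
      proof (cases "y \<in> B")
        case False
        then have "\<And>p. p \<in> P \<Longrightarrow> \<exists>q\<in>Q. 0 < \<psi> (p, q) + y (p, q)" by (auto simp: B_def not_le)
        then show ?thesis using False soft_tendsto_1[of "\<lambda>k. \<psi> k + y k"] by (simp add: f_def)
      qed simp
    qed
  qed (use fb in \<open>auto simp: indicator_def\<close>)
  then have limB: "(\<lambda>n. \<integral>y. indicator (- B) y * f n y \<partial>?Y) \<longlonglongrightarrow> Y.prob (- B)"
    by (simp add: Compl_eq_Diff_UNIV)
  have "(\<integral>y. indicator (- B) y * f n y \<partial>?Y) \<le> X.prob (- A) + (\<integral>y. indicator A y * f n y \<partial>?X)" for n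
  proof -
    have "(\<integral>y. indicator (- B) y * f n y \<partial>?Y) \<le> (\<integral>y. f n y \<partial>?Y)"
      using fb fi[OF Y.prob_space_axioms]
      by (intro integral_mono Y.integrable_const_bound[where B=1]) (auto simp: indicator_def)
    also have "\<dots> \<le> (\<integral>y. f n y \<partial>?X)" by (rule le)
    also have "\<dots> \<le> (\<integral>y. indicator (- A) y + indicator A y * f n y \<partial>?X)"
      using fb fi[OF X.prob_space_axioms]
      by (intro integral_mono X.integrable_const_bound[where B=1]) (auto simp: indicator_def)
    also have "\<dots> = X.prob (- A) + (\<integral>y. indicator A y * f n y \<partial>?X)"
      using fb by (subst Bochner_Integration.integral_add)
        (auto intro!: X.integrable_const_bound[where B=1] simp: indicator_def Compl_eq_Diff_UNIV)
    finally show ?thesis .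
  qed
  then have "Y.prob (- B) \<le> X.prob (- A) + 0"
    by (intro LIMSEQ_le[OF limB limA]) auto
  then have AB: "X.prob A \<le> Y.prob B"
    using X.prob_compl[of A] Y.prob_compl[of B] by (simp add: Compl_eq_Diff_UNIV)
  have "X.prob A = measure (gauss I) {z \<in> space (gauss I). \<exists>p\<in>P. \<forall>q\<in>Q. \<psi> (p, q) + (\<Sum>i\<in>I. c i (p, q) * z i) < 0}"
    unfolding gauss_lin_def
    using A by (subst measure_distr) (auto simp: A_def vimage_def Int_def conj_commute)
  moreover have "Y.prob B = measure (gauss J) {z \<in> space (gauss J). \<exists>p\<in>P. \<forall>q\<in>Q. \<psi> (p, q) + (\<Sum>j\<in>J. d j (p, q) * z j) \<le> 0}"
    unfolding gauss_lin_def
    using B by (subst measure_distr) (auto simp: B_def vimage_def Int_def conj_commute)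
  ultimately show ?thesis using AB by simp
qed

end

section \<open>The Gaussian min-max theorem for least squares\<close>

abbreviation ip :: "nat \<Rightarrow> (nat \<Rightarrow> real) \<Rightarrow> (nat \<Rightarrow> real) \<Rightarrow> real" where
  "ip k x y \<equiv> (\<Sum>i<k. x i * y i)"

abbreviation nrm :: "nat \<Rightarrow> (nat \<Rightarrow> real) \<Rightarrow> real" where
  "nrm k x \<equiv> L2_set x {..<k}"

abbreviation mv :: "nat \<Rightarrow> (nat \<times> nat \<Rightarrow> real) \<Rightarrow> (nat \<Rightarrow> real) \<Rightarrow> nat \<Rightarrow> real" where
  "mv n A w i \<equiv> (\<Sum>j<n. A (i, j) * w j)"

lemma ip_le_nrm: "ip k x y \<le> nrm k x * nrm k y"
proof -
  have "ip k x y \<le> (\<Sum>i<k. \<bar>x i\<bar> * \<bar>y i\<bar>)"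
    by (intro sum_mono) (metis abs_ge_self abs_mult)
  also have "\<dots> \<le> nrm k x * nrm k y" by (rule L2_set_mult_ineq)
  finally show ?thesis .
qed

lemma nrm_sq: "(nrm k x)\<^sup>2 = ip k x x"
  by (simp add: L2_set_def sum_nonneg power2_eq_square)

lemma nrm_scale: "nrm k (\<lambda>i. a * x i) = \<bar>a\<bar> * nrm k x"
  by (simp add: L2_set_def power_mult_distrib flip: sum_distrib_left) (simp add: real_sqrt_mult)

lemma exists_unit_attaining_nrm:
  assumes "0 < k"
  obtains u where "nrm k u = 1" "ip k u x = nrm k x"
proof (cases "nrm k x = 0")
  case True
  define u where "u i = (if i = 0 then 1 else 0 :: real)" for i :: nat
  have "x i = 0" if "i < k" for i
    using True that by (simp add: L2_set_eq_0_iff)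
  moreover have "(\<Sum>i<k. (u i)\<^sup>2) = 1"
  proof -
    have "(\<Sum>i<k. (u i)\<^sup>2) = (\<Sum>i<k. if i = 0 then 1 else 0)"
      by (intro sum.cong) (auto simp: u_def)
    then show ?thesis using assms by simp
  qed
  ultimately show ?thesis using True by (intro that[of u]) (auto simp: L2_set_def)
next
  case False
  then have p: "0 < nrm k x" using L2_set_nonneg[of x "{..<k}"] by linarith
  define u where "u i = (1 / nrm k x) * x i" for i
  have "nrm k u = 1" unfolding u_def nrm_scale using p by simp
  moreover have "ip k u x = (1 / nrm k x) * (nrm k x)\<^sup>2"
    unfolding nrm_sq u_def by (simp add: sum_distrib_left mult.assoc)
  ultimately show ?thesis using p by (intro that[of u]) (auto simp: power2_eq_square)
qed

lemma distr_std_normal_uminus: "distr std_normal_distribution lborel (\<lambda>x. - x) = std_normal_distribution"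
proof -
  have "distributed std_normal_distribution lborel (\<lambda>x. x) std_normal_density"
    by (auto simp: distributed_def) (metis distr_id2 sets_density sets_lborel)
  from std_normal.normal_density_affine[OF this, of "-1" 0] show ?thesis
    by (simp add: distributed_def)
qed

lemma std_normal_nonpos_ge_half: "1 / 2 \<le> measure std_normal_distribution {..0}"
proof -
  let ?N = "std_normal_distribution"
  have "measure ?N {..0} = measure (distr ?N lborel (\<lambda>x. - x)) {..0}" by (simp only: distr_std_normal_uminus)
  also have "\<dots> = measure ?N {0..}"
    by (subst measure_distr) (auto intro: arg_cong[where f="measure ?N"])
  finally have "measure ?N {..0} = measure ?N {0..}" .
  moreover have "measure ?N UNIV \<le> measure ?N {..0} + measure ?N {0..}"
  proof -
    have "UNIV = {..0} \<union> {0::real..}" by auto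
    then show ?thesis using measure_Un_le[of "{..0}" std_normal_distribution "{0..}"] by simp
  qed
  ultimately show ?thesis using std_normal.prob_space by simp
qed

text \<open>The additional Gaussian coordinate of the comparison is conditioned to be non-positive.\<close>

lemma gauss_insert_nonpos:
  assumes I: "finite I" "k \<notin> I" and E: "E \<in> sets (gauss I)"
    and S: "S \<in> sets (gauss (insert k I))"
    and sub: "\<And>z. z \<in> space (gauss (insert k I)) \<Longrightarrow> restrict z I \<in> E \<Longrightarrow> z k \<le> 0 \<Longrightarrow> z \<in> S"
  shows "measure (gauss I) E \<le> 2 * measure (gauss (insert k I)) S"
proof -
  let ?N = "std_normal_distribution"
  interpret G: prob_space "gauss I" by (rule prob_space_gauss)
  interpret G': prob_space "gauss (insert k I)" by (rule prob_space_gauss)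
  have "ennreal (measure (gauss I) E * measure ?N {..0}) = emeasure (gauss I) E * emeasure ?N {..0}"
    by (simp add: G.emeasure_eq_measure std_normal.emeasure_eq_measure ennreal_mult)
  also have "\<dots> = (\<integral>\<^sup>+ x. (\<integral>\<^sup>+ y. indicator E x * indicator {..0} y \<partial>?N) \<partial>gauss I)"
    using E by (subst nn_integral_cmult) (auto simp: nn_integral_multc)
  also have "\<dots> \<le> (\<integral>\<^sup>+ x. (\<integral>\<^sup>+ y. indicator S (x(k := y)) \<partial>?N) \<partial>gauss I)"
  proof (intro nn_integral_mono)
    fix x y assume x: "x \<in> space (gauss I)"
    have sp: "x(k := y) \<in> space (gauss (insert k I))"
      using x by (auto simp: space_PiM PiE_iff extensional_def)
    have "restrict (x(k := y)) I = x"
      using x I(2) by (auto simp: space_PiM PiE_iff extensional_def fun_eq_iff)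
    then show "(indicator E x * indicator {..0} y :: ennreal) \<le> indicator S (x(k := y))"
      using sub[OF sp] by (auto simp: indicator_def)
  qed
  also have "\<dots> = (\<integral>\<^sup>+ z. indicator S z \<partial>gauss (insert k I))"
    using S by (intro std_normal_prod.product_nn_integral_insert[symmetric] I) simp
  also have "\<dots> = ennreal (measure (gauss (insert k I)) S)"
    using S by (simp add: G'.emeasure_eq_measure)
  finally have "measure (gauss I) E * measure ?N {..0} \<le> measure (gauss (insert k I)) S"
    by (simp add: mult_nonneg_nonneg)
  moreover have "measure (gauss I) E * (1 / 2) \<le> measure (gauss I) E * measure ?N {..0}"
    by (intro mult_left_mono std_normal_nonpos_ge_half) simp
  ultimately show ?thesis by simp
qed

lemma sum_mat_vec_swap:
  "(\<Sum>k\<in>{..<m} \<times> {..<n}. u (fst k) * w (snd k) * A k) = ip m u (mv n A w)"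
  by (simp add: sum.cartesian_product' sum_distrib_left mult_ac)

text \<open>Compare u . A w + |w| z, with one extra standard normal z, to |w| (g . u) + h . w. For
  unit vectors u the covariances differ by (1 - u . u') (|w| |w'| - w . w'), which is nonnegative
  and vanishes if u = u' or w = w'; the term with z is there to complete this product. By
  \<open>const\<close> either vector may be the outer one, and \<open>\<epsilon>\<close> is the sign
  of the form. Restricting to z \<le> 0 removes z again and costs the factor 2.\<close>

lemma gmt_finite:
  fixes uu ww :: "'p \<times> 'q \<Rightarrow> nat \<Rightarrow> real" and \<epsilon> :: real
  assumes fin: "finite P" "P \<noteq> {}" "finite Q" "Q \<noteq> {}"
    and unit: "\<And>k. k \<in> P \<times> Q \<Longrightarrow> nrm m (uu k) = 1" and eps: "\<epsilon>\<^sup>2 = 1"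
    and const: "\<And>p q q'. p \<in> P \<Longrightarrow> q \<in> Q \<Longrightarrow> q' \<in> Q \<Longrightarrow>
      uu (p, q) = uu (p, q') \<or> ww (p, q) = ww (p, q')"
  shows "measure (gauss ({..<m} \<times> {..<n})) {A \<in> space (gauss ({..<m} \<times> {..<n})).
      \<exists>p\<in>P. \<forall>q\<in>Q. \<psi> (p, q) + \<epsilon> * ip m (uu (p, q)) (mv n A (ww (p, q))) < 0}
    \<le> 2 * measure (gauss ({..<m} <+> {..<n})) {b \<in> space (gauss ({..<m} <+> {..<n})).
      \<exists>p\<in>P. \<forall>q\<in>Q. \<psi> (p, q) + \<epsilon> * (nrm n (ww (p, q)) * ip m (uu (p, q)) (\<lambda>i. b (Inl i))
        + ip n (ww (p, q)) (\<lambda>j. b (Inr j))) \<le> 0}"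
proof -
  \<comment> \<open>The pair (m, n) lies outside the index set of the matrix and serves as the index
    of the extra coordinate.\<close>
  let ?I = "{..<m} \<times> {..<n}" and ?J = "{..<m} <+> {..<n}" and ?k = "(m, n)"
  define c where "c i k = (if i = ?k then nrm n (ww k) else \<epsilon> * uu k (fst i) * ww k (snd i))"
    for i :: "nat \<times> nat" and k
  define d where "d j k = (case j of Inl i \<Rightarrow> \<epsilon> * nrm n (ww k) * uu k i | Inr i \<Rightarrow> \<epsilon> * ww k i)"
    for j :: "nat + nat" and k
  have kI: "?k \<notin> ?I" by simp
  have e1: "\<epsilon> * \<epsilon> = 1" using eps by (simp add: power2_eq_square)
  have gX: "gcov (insert ?k ?I) c k l = nrm n (ww k) * nrm n (ww l) + ip m (uu k) (uu l) * ip n (ww k) (ww l)" for k l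
  proof -
    have "(\<Sum>i\<in>?I. c i k * c i l) = (\<Sum>i\<in>?I. (uu k (fst i) * uu l (fst i)) * (ww k (snd i) * ww l (snd i)))"
    proof (intro sum.cong refl)
      fix i assume "i \<in> ?I"
      then have "c i k * c i l = (\<epsilon> * \<epsilon>) * ((uu k (fst i) * uu l (fst i)) * (ww k (snd i) * ww l (snd i)))"
        by (auto simp: c_def)
      then show "c i k * c i l = (uu k (fst i) * uu l (fst i)) * (ww k (snd i) * ww l (snd i))"
        by (simp add: e1)
    qed
    also have "\<dots> = ip m (uu k) (uu l) * ip n (ww k) (ww l)"
      by (simp add: sum.cartesian_product' sum_product)
    finally show ?thesis unfolding gcov_def using kI by (simp add: c_def)
  qed
  have gY: "gcov ?J d k l = nrm n (ww k) * nrm n (ww l) * ip m (uu k) (uu l) + ip n (ww k) (ww l)" for k l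
  proof -
    have "gcov ?J d k l = (\<Sum>i<m. (\<epsilon> * \<epsilon>) * (nrm n (ww k) * nrm n (ww l) * (uu k i * uu l i)))
        + (\<Sum>i<n. (\<epsilon> * \<epsilon>) * (ww k i * ww l i))"
      unfolding gcov_def by (subst sum.Plus) (auto simp: d_def mult_ac)
    then show ?thesis by (simp add: e1 sum_distrib_left)
  qed
  have diff: "gcov (insert ?k ?I) c k l - gcov ?J d k l
      = (1 - ip m (uu k) (uu l)) * (nrm n (ww k) * nrm n (ww l) - ip n (ww k) (ww l))" for k l
    by (simp add: gX gY algebra_simps)
  have "measure (gauss (insert ?k ?I)) {z \<in> space (gauss (insert ?k ?I)). \<exists>p\<in>P. \<forall>q\<in>Q. \<psi> (p, q) + (\<Sum>i\<in>insert ?k ?I. c i (p, q) * z i) < 0}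
      \<le> measure (gauss ?J) {z \<in> space (gauss ?J). \<exists>p\<in>P. \<forall>q\<in>Q. \<psi> (p, q) + (\<Sum>j\<in>?J. d j (p, q) * z j) \<le> 0}"
  proof (rule gordon_finite[OF fin])
    fix p q q' assume pq: "p \<in> P" "q \<in> Q" "q' \<in> Q"
    have "ip m (uu (p, q)) (uu (p, q)) = 1"
      using unit[of "(p, q)"] pq nrm_sq[where k=m and x="uu (p, q)"] by simp
    moreover have "ip n (ww (p, q)) (ww (p, q)) = nrm n (ww (p, q)) * nrm n (ww (p, q))"
      using nrm_sq[where k=n and x="ww (p, q)"] by (simp add: power2_eq_square)
    ultimately have "(1 - ip m (uu (p, q)) (uu (p, q'))) * (nrm n (ww (p, q)) * nrm n (ww (p, q')) - ip n (ww (p, q)) (ww (p, q'))) = 0"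
      using const[OF pq] by auto
    then show "gcov (insert ?k ?I) c (p, q) (p, q') = gcov ?J d (p, q) (p, q')"
      using diff[of "(p, q)" "(p, q')"] by linarith
  next
    fix p p' q q' assume "p \<in> P" "p' \<in> P" "q \<in> Q" "q' \<in> Q"
    then have "ip m (uu (p, q)) (uu (p', q')) \<le> 1"
      using ip_le_nrm[where k=m and x="uu (p, q)" and y="uu (p', q')"] unit[of "(p, q)"] unit[of "(p', q')"] by simp
    then have "0 \<le> (1 - ip m (uu (p, q)) (uu (p', q'))) * (nrm n (ww (p, q)) * nrm n (ww (p', q')) - ip n (ww (p, q)) (ww (p', q')))"
      using ip_le_nrm by (intro mult_nonneg_nonneg) auto
    then show "gcov ?J d (p, q) (p', q') \<le> gcov (insert ?k ?I) c (p, q) (p', q')"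
      using diff[of "(p, q)" "(p', q')"] by linarith
  qed auto
  also have "{z \<in> space (gauss ?J). \<exists>p\<in>P. \<forall>q\<in>Q. \<psi> (p, q) + (\<Sum>j\<in>?J. d j (p, q) * z j) \<le> 0}
    = {b \<in> space (gauss ?J). \<exists>p\<in>P. \<forall>q\<in>Q. \<psi> (p, q) + \<epsilon> * (nrm n (ww (p, q)) * ip m (uu (p, q)) (\<lambda>i. b (Inl i))
        + ip n (ww (p, q)) (\<lambda>j. b (Inr j))) \<le> 0}"
  proof -
    have "(\<Sum>j\<in>?J. d j k * z j) = \<epsilon> * (nrm n (ww k) * ip m (uu k) (\<lambda>i. z (Inl i)) + ip n (ww k) (\<lambda>j. z (Inr j)))" for k z
      by (subst sum.Plus) (auto simp: d_def sum_distrib_left distrib_left mult.assoc)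
    then show ?thesis by simp
  qed
  finally have le: "measure (gauss (insert ?k ?I)) {z \<in> space (gauss (insert ?k ?I)). \<exists>p\<in>P. \<forall>q\<in>Q. \<psi> (p, q) + (\<Sum>i\<in>insert ?k ?I. c i (p, q) * z i) < 0}
    \<le> measure (gauss ?J) {b \<in> space (gauss ?J). \<exists>p\<in>P. \<forall>q\<in>Q. \<psi> (p, q) + \<epsilon> * (nrm n (ww (p, q)) * ip m (uu (p, q)) (\<lambda>i. b (Inl i))
        + ip n (ww (p, q)) (\<lambda>j. b (Inr j))) \<le> 0}" .
  have cs: "(\<Sum>i\<in>insert ?k ?I. c i k * z i) = nrm n (ww k) * z ?k + \<epsilon> * ip m (uu k) (mv n z (ww k))" for k z
  proof -
    have "(\<Sum>i\<in>?I. c i k * z i) = \<epsilon> * (\<Sum>i\<in>?I. uu k (fst i) * ww k (snd i) * z i)"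
      unfolding sum_distrib_left by (intro sum.cong refl) (auto simp: c_def)
    then show ?thesis using kI by (simp add: sum_mat_vec_swap) (simp add: c_def)
  qed
  have meas: "{z \<in> space M. \<exists>p\<in>P. \<forall>q\<in>Q. f p q z < (0::real)} \<in> sets M"
    if "\<And>p q. f p q \<in> borel_measurable M" for M :: "'z measure" and f
  proof -
    have "{z \<in> space M. f p q z < 0} \<in> sets M" for p q
      using that by measurable
    then have "(\<Union>p\<in>P. \<Inter>q\<in>Q. {z \<in> space M. f p q z < 0}) \<in> sets M"
      using fin by (intro sets.finite_UN sets.finite_INT) auto
    moreover have "(\<Union>p\<in>P. \<Inter>q\<in>Q. {z \<in> space M. f p q z < 0}) = {z \<in> space M. \<exists>p\<in>P. \<forall>q\<in>Q. f p q z < (0::real)}"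
      using fin by auto
    ultimately show ?thesis by simp
  qed
  have m1: "(\<lambda>z. ip m u (mv n z w)) \<in> borel_measurable (gauss ?I)" for u w
    by (intro borel_measurable_sum borel_measurable_times borel_measurable_const)
      (auto intro: measurable_gauss_component)
  have "measure (gauss ?I) {A \<in> space (gauss ?I). \<exists>p\<in>P. \<forall>q\<in>Q. \<psi> (p, q) + \<epsilon> * ip m (uu (p, q)) (mv n A (ww (p, q))) < 0}
    \<le> 2 * measure (gauss (insert ?k ?I)) {z \<in> space (gauss (insert ?k ?I)). \<exists>p\<in>P. \<forall>q\<in>Q. \<psi> (p, q) + (\<Sum>i\<in>insert ?k ?I. c i (p, q) * z i) < 0}"
  proof (rule gauss_insert_nonpos)
    show "{A \<in> space (gauss ?I). \<exists>p\<in>P. \<forall>q\<in>Q. \<psi> (p, q) + \<epsilon> * ip m (uu (p, q)) (mv n A (ww (p, q))) < 0} \<in> sets (gauss ?I)"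
      by (rule meas) (intro borel_measurable_add borel_measurable_times borel_measurable_const m1)
    show "{z \<in> space (gauss (insert ?k ?I)). \<exists>p\<in>P. \<forall>q\<in>Q. \<psi> (p, q) + (\<Sum>i\<in>insert ?k ?I. c i (p, q) * z i) < 0} \<in> sets (gauss (insert ?k ?I))"
      by (rule meas) (intro borel_measurable_add borel_measurable_sum borel_measurable_times
          borel_measurable_const measurable_gauss_component)
    fix z assume z: "z \<in> space (gauss (insert ?k ?I))"
      and r: "restrict z ?I \<in> {A \<in> space (gauss ?I). \<exists>p\<in>P. \<forall>q\<in>Q. \<psi> (p, q) + \<epsilon> * ip m (uu (p, q)) (mv n A (ww (p, q))) < 0}"
      and neg: "z ?k \<le> 0"
    have res: "ip m u (mv n (restrict z ?I) w) = ip m u (mv n z w)" for u w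
      by (intro sum.cong refl arg_cong2[where f="(*)"]) auto
    from r obtain p where p: "p \<in> P" "\<And>q. q \<in> Q \<Longrightarrow> \<psi> (p, q) + \<epsilon> * ip m (uu (p, q)) (mv n z (ww (p, q))) < 0"
      unfolding res by auto
    have "\<psi> (p, q) + (\<Sum>i\<in>insert ?k ?I. c i (p, q) * z i) < 0" if "q \<in> Q" for q
      using p(2)[OF that] mult_nonneg_nonpos[OF L2_set_nonneg neg, of "ww (p, q)" "{..<n}"] unfolding cs by linarith
    then show "z \<in> {z \<in> space (gauss (insert ?k ?I)). \<exists>p\<in>P. \<forall>q\<in>Q. \<psi> (p, q) + (\<Sum>i\<in>insert ?k ?I. c i (p, q) * z i) < 0}"
      using z p(1) by auto
  qed auto
  with le show ?thesis by linarith
qed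


text \<open>The two Gaussian vectors of the comparison are the halves \<open>b (Inl _)\<close> and \<open>b (Inr _)\<close> of one vector \<open>b\<close>.\<close>

definition gordon_obj :: "nat \<Rightarrow> nat \<Rightarrow> (nat \<Rightarrow> real) \<Rightarrow> (nat + nat \<Rightarrow> real) \<Rightarrow> (nat \<Rightarrow> real) \<Rightarrow> real" where
  "gordon_obj m n y b w = nrm m (\<lambda>i. nrm n w * b (Inl i) - y i) + ip n w (\<lambda>j. b (Inr j))"

lemma ip_gordon:
  "ip m u (\<lambda>i. nrm n w * b (Inl i) - y i) = nrm n w * ip m u (\<lambda>i. b (Inl i)) - ip m u y"
  by (simp add: right_diff_distrib sum_subtractf sum_distrib_left mult_ac)

lemma ip_diff: "ip m u (\<lambda>i. x i - y i) = ip m u x - ip m u y"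
  by (simp add: right_diff_distrib sum_subtractf)

section \<open>From finite to infinite index sets\<close>

text \<open>If every w failed at some level, all of them would fail at the largest of these finitely
  many levels. It makes w independent of the stage of an exhaustion.\<close>

lemma antimono_choice_finite:
  assumes "finite V" "\<And>k. \<exists>w\<in>V. R w k" "\<And>w k l. k \<le> l \<Longrightarrow> R w l \<Longrightarrow> R w (k :: nat)"
  shows "\<exists>w\<in>V. \<forall>k. R w k"
proof (rule ccontr)
  assume "\<not> ?thesis"
  then obtain f where f: "\<And>w. w \<in> V \<Longrightarrow> \<not> R w (f w)" by metis
  obtain w where w: "w \<in> V" "R w (Max (f ` V))" using assms(2) by auto
  have "f w \<le> Max (f ` V)" using assms(1) w by simp
  then show False using assms(3)[OF _ w(2)] f[OF w(1)] by blast
qed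

lemma le_on_closure:
  fixes f :: "(nat \<Rightarrow> real) \<Rightarrow> real"
  assumes "continuous_on UNIV f" "V \<subseteq> closure V0" "\<And>w. w \<in> V0 \<Longrightarrow> f w \<le> c" "w \<in> V"
  shows "f w \<le> c"
proof -
  have "closed {w. f w \<le> c}"
    using assms(1) by (intro closed_Collect_le) auto
  then have "closure V0 \<subseteq> {w. f w \<le> c}"
    using assms(3) by (intro closure_minimal) auto
  then show ?thesis using assms by auto
qed

lemma continuous_on_ip: "continuous_on UNIV (\<lambda>w :: nat \<Rightarrow> real. ip k w x)"
  by (intro continuous_intros continuous_on_product_coordinates)

lemma from_nat_into_images:
  assumes "countable V" "V \<noteq> {}"
  defines "V' \<equiv> \<lambda>k. from_nat_into V ` {..k::nat}"
  shows "finite (V' k)" "V' k \<noteq> {}" "V' k \<subseteq> V" "k \<le> l \<Longrightarrow> V' k \<subseteq> V' l" "(\<Union>k. V' k) = V"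
proof -
  have "from_nat_into V k \<in> V" for k using from_nat_into[OF assms(2)] .
  moreover have "\<exists>k. w = from_nat_into V k" if "w \<in> V" for w
    using from_nat_into_surj[OF assms(1) that] by metis
  ultimately show "finite (V' k)" "V' k \<noteq> {}" "V' k \<subseteq> V" "k \<le> l \<Longrightarrow> V' k \<subseteq> V' l" "(\<Union>k. V' k) = V"
    by (fastforce simp: V'_def)+
qed

lemma measurable_finite_ex_all:
  assumes "finite P" "finite Q" "Q \<noteq> {}" "\<And>p q. {z \<in> space M. R p q z} \<in> sets M"
  shows "{z \<in> space M. \<exists>p\<in>P. \<forall>q\<in>Q. R p q z} \<in> sets M"
proof -
  have "(\<Union>p\<in>P. \<Inter>q\<in>Q. {z \<in> space M. R p q z}) \<in> sets M"
    using assms by (intro sets.finite_UN sets.finite_INT) auto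
  moreover have "(\<Union>p\<in>P. \<Inter>q\<in>Q. {z \<in> space M. R p q z}) = {z \<in> space M. \<exists>p\<in>P. \<forall>q\<in>Q. R p q z}"
    using assms by auto
  ultimately show ?thesis by simp
qed

lemma measurable_ip_mv: "(\<lambda>z. ip m u (mv n z w)) \<in> borel_measurable (gauss ({..<m} \<times> {..<n}))"
  by (intro borel_measurable_sum borel_measurable_times borel_measurable_const)
    (auto intro: measurable_gauss_component)

lemma measurable_ip_Inl: "(\<lambda>b. ip m u (\<lambda>i. b (Inl i))) \<in> borel_measurable (gauss ({..<m} <+> {..<n}))"
  by (intro borel_measurable_sum borel_measurable_times borel_measurable_const measurable_gauss_component) auto

lemma measurable_ip_Inr: "(\<lambda>b. ip n w (\<lambda>j. b (Inr j))) \<in> borel_measurable (gauss ({..<m} <+> {..<n}))"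
  by (intro borel_measurable_sum borel_measurable_times borel_measurable_const measurable_gauss_component) auto

lemma measurable_nrm:
  assumes "\<And>i. i < k \<Longrightarrow> (\<lambda>z. f z i) \<in> borel_measurable M"
  shows "(\<lambda>z. nrm k (f z)) \<in> borel_measurable M"
  unfolding L2_set_def using assms
  by (intro measurable_compose[OF _ borel_measurable_sqrt] borel_measurable_sum borel_measurable_power) auto

lemma measurable_gordon_obj: "(\<lambda>b. gordon_obj m n y b w) \<in> borel_measurable (gauss ({..<m} <+> {..<n}))"
  unfolding gordon_obj_def
  by (intro borel_measurable_add measurable_nrm measurable_ip_Inr borel_measurable_diff
      borel_measurable_times borel_measurable_const measurable_gauss_component) auto

lemma measurable_nrm_mv: "(\<lambda>A. nrm m (\<lambda>i. mv n A w i - y i)) \<in> borel_measurable (gauss ({..<m} \<times> {..<n}))"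
  by (intro measurable_nrm borel_measurable_diff borel_measurable_sum
      borel_measurable_times borel_measurable_const measurable_gauss_component) auto

text \<open>The norm is a supremum over unit vectors u, approximated by finite sets
  \<open>Q k\<close> that increase to a dense subset. The comparison holds at each stage, and the
  events on the right decrease with k. V is finite so that one w can be kept for all stages at
  once.\<close>

lemma gmt_lower_finite:
  assumes m: "0 < m" and V: "finite V"
    and B: "B \<in> sets (gauss ({..<m} <+> {..<n}))"
    and sub: "\<And>b w. b \<in> space (gauss ({..<m} <+> {..<n})) \<Longrightarrow> w \<in> V \<Longrightarrow> gordon_obj m n y b w \<le> c \<Longrightarrow> b \<in> B"
  shows "measure (gauss ({..<m} \<times> {..<n})) {A \<in> space (gauss ({..<m} \<times> {..<n})).
      \<exists>w\<in>V. nrm m (\<lambda>i. mv n A w i - y i) < c} \<le> 2 * measure (gauss ({..<m} <+> {..<n})) B"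
proof (cases "V = {}")
  case False
  let ?I = "{..<m} \<times> {..<n}" and ?J = "{..<m} <+> {..<n}"
  interpret I: prob_space "gauss ?I" by (rule prob_space_gauss)
  interpret J: prob_space "gauss ?J" by (rule prob_space_gauss)
  \<comment> \<open>Vectors are functions on \<open>nat\<close> with the product topology, which is
    second countable, so the unit vectors have a countable dense subset.\<close>
  obtain S0 where S0: "countable S0" "S0 \<subseteq> {u. nrm m u = 1}" "{u. nrm m u = 1} \<subseteq> closure S0"
    using separable by metis
  obtain u0 where "nrm m u0 = 1" using exists_unit_attaining_nrm[OF m] by metis
  then have "S0 \<noteq> {}" using S0(3) by auto
  define Q where "Q k = from_nat_into S0 ` {..k}" for k :: nat
  note Q = from_nat_into_images[OF S0(1) \<open>S0 \<noteq> {}\<close>, folded Q_def]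
  define E where "E k = {b \<in> space (gauss ?J). \<exists>w\<in>V. \<forall>u\<in>Q k. (- ip m u y - c) +
    1 * (nrm n w * ip m u (\<lambda>i. b (Inl i)) + ip n w (\<lambda>j. b (Inr j))) \<le> 0}" for k
  have E: "E k \<in> sets (gauss ?J)" for k
    unfolding E_def
  proof (rule measurable_finite_ex_all[OF V Q(1,2)])
    fix w u
    have "(\<lambda>b. (- ip m u y - c) + 1 * (nrm n w * ip m u (\<lambda>i. b (Inl i)) + ip n w (\<lambda>j. b (Inr j)))) \<in> borel_measurable (gauss ?J)"
      by (intro borel_measurable_add borel_measurable_times borel_measurable_const measurable_ip_Inl measurable_ip_Inr)
    then show "{b \<in> space (gauss ?J). (- ip m u y - c) + 1 * (nrm n w * ip m u (\<lambda>i. b (Inl i)) + ip n w (\<lambda>j. b (Inr j))) \<le> 0} \<in> sets (gauss ?J)"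
      by measurable
  qed
  let ?L = "{A \<in> space (gauss ?I). \<exists>w\<in>V. nrm m (\<lambda>i. mv n A w i - y i) < c}"
  have step: "measure (gauss ?I) ?L \<le> 2 * measure (gauss ?J) (E k)" for k
  proof -
    have un: "nrm m u = 1" if "u \<in> Q k" for u using that Q(3) S0(2) by auto
    have "{A \<in> space (gauss ?I). (- ip m u y - c) + 1 * ip m u (mv n A w) < 0} \<in> sets (gauss ?I)" for u w
    proof -
      have "(\<lambda>A. (- ip m u y - c) + 1 * ip m u (mv n A w)) \<in> borel_measurable (gauss ?I)"
        by (intro borel_measurable_add borel_measurable_times borel_measurable_const measurable_ip_mv)
      then show ?thesis by measurable
    qed
    then have "measure (gauss ?I) ?L \<le> measure (gauss ?I) {A \<in> space (gauss ?I).
        \<exists>w\<in>V. \<forall>u\<in>Q k. (- ip m u y - c) + 1 * ip m u (mv n A w) < 0}"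
    proof (intro I.finite_measure_mono measurable_finite_ex_all[OF V Q(1,2)])
      show "?L \<subseteq> {A \<in> space (gauss ?I). \<exists>w\<in>V. \<forall>u\<in>Q k. (- ip m u y - c) + 1 * ip m u (mv n A w) < 0}"
      proof safe
        fix A w assume w: "w \<in> V" "nrm m (\<lambda>i. mv n A w i - y i) < c"
        have "(- ip m u y - c) + 1 * ip m u (mv n A w) < 0" if "u \<in> Q k" for u
        proof -
          have "nrm m u = 1" using that Q(3) S0(2) by auto
          then have "ip m u (\<lambda>i. mv n A w i - y i) < c"
            using ip_le_nrm[where k=m and x=u and y="\<lambda>i. mv n A w i - y i"] w(2) by simp
          then show ?thesis unfolding ip_diff by simp
        qed
        then show "\<exists>w\<in>V. \<forall>u\<in>Q k. (- ip m u y - c) + 1 * ip m u (mv n A w) < 0" using w(1) by auto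
      qed
    qed
    also have "\<dots> \<le> 2 * measure (gauss ?J) (E k)"
      unfolding E_def
      using gmt_finite[OF V False Q(1)[of k] Q(2)[of k],
        where m=m and n=n and uu=snd and ww=fst and \<epsilon>=1 and \<psi>="\<lambda>k. - ip m (snd k) y - c"] un
      by auto
    finally show ?thesis .
  qed
  have "(\<lambda>k. measure (gauss ?J) (E k)) \<longlonglongrightarrow> measure (gauss ?J) (\<Inter>k. E k)"
  proof (rule J.finite_Lim_measure_decseq)
    show "decseq E" unfolding decseq_def E_def using Q(4) by blast
  qed (use E in auto)
  then have lim: "(\<lambda>k. 2 * measure (gauss ?J) (E k)) \<longlonglongrightarrow> 2 * measure (gauss ?J) (\<Inter>k. E k)"
    by (intro tendsto_intros)
  have "measure (gauss ?I) ?L \<le> 2 * measure (gauss ?J) (\<Inter>k. E k)"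
    by (rule LIMSEQ_le_const[OF lim]) (use step in blast)
  also have "\<dots> \<le> 2 * measure (gauss ?J) B"
  proof (intro mult_left_mono J.finite_measure_mono B subsetI)
    fix b assume b: "b \<in> (\<Inter>k. E k)"
    then have bs: "b \<in> space (gauss ?J)" by (auto simp: E_def)
    have "\<exists>w\<in>V. \<forall>k. \<forall>u\<in>Q k. (- ip m u y - c) +
      1 * (nrm n w * ip m u (\<lambda>i. b (Inl i)) + ip n w (\<lambda>j. b (Inr j))) \<le> 0"
      using b Q(4) by (intro antimono_choice_finite[OF V]) (auto simp: E_def)
    then obtain w where w: "w \<in> V" and le: "\<And>u. u \<in> S0 \<Longrightarrow> (- ip m u y - c) +
      1 * (nrm n w * ip m u (\<lambda>i. b (Inl i)) + ip n w (\<lambda>j. b (Inr j))) \<le> 0"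
      using Q(5) by auto
    let ?x = "\<lambda>i. nrm n w * b (Inl i) - y i"
    have le': "ip m u ?x \<le> c - ip n w (\<lambda>j. b (Inr j))" if "u \<in> S0" for u
      using le[OF that] unfolding ip_gordon by simp
    obtain u where u: "nrm m u = 1" "ip m u ?x = nrm m ?x" using exists_unit_attaining_nrm[OF m] by metis
    have "ip m u ?x \<le> c - ip n w (\<lambda>j. b (Inr j))"
      by (rule le_on_closure[OF continuous_on_ip S0(3) le']) (use u in auto)
    then have "gordon_obj m n y b w \<le> c" unfolding gordon_obj_def u(2) by simp
    then show "b \<in> B" using sub[OF bs w] by simp
  qed simp
  finally show ?thesis .
qed simp

text \<open>A monotone limit over finite subsets of V. Convexity does not enter, so V may be the
  part of the cone off the band.\<close>

lemma gmt_lower: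
  assumes m: "0 < m" and V: "countable V"
    and B: "B \<in> sets (gauss ({..<m} <+> {..<n}))"
    and sub: "\<And>b w. b \<in> space (gauss ({..<m} <+> {..<n})) \<Longrightarrow> w \<in> V \<Longrightarrow> gordon_obj m n y b w \<le> c \<Longrightarrow> b \<in> B"
  shows "measure (gauss ({..<m} \<times> {..<n})) {A \<in> space (gauss ({..<m} \<times> {..<n})).
      \<exists>w\<in>V. nrm m (\<lambda>i. mv n A w i - y i) < c} \<le> 2 * measure (gauss ({..<m} <+> {..<n})) B"
proof (cases "V = {}")
  case False
  let ?I = "{..<m} \<times> {..<n}" and ?J = "{..<m} <+> {..<n}"
  interpret I: prob_space "gauss ?I" by (rule prob_space_gauss)
  define V' where "V' k = from_nat_into V ` {..k}" for k :: nat
  note V' = from_nat_into_images[OF V False, folded V'_def]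
  define L where "L k = {A \<in> space (gauss ?I). \<exists>w\<in>V' k. nrm m (\<lambda>i. mv n A w i - y i) < c}" for k
  have "{A \<in> space (gauss ?I). nrm m (\<lambda>i. mv n A w i - y i) < c} \<in> sets (gauss ?I)" for w
    using measurable_nrm_mv by measurable
  then have L: "L k \<in> sets (gauss ?I)" for k
    using measurable_finite_ex_all[OF V'(1), of "{()}" "gauss ?I" "\<lambda>w q A. nrm m (\<lambda>i. mv n A w i - y i) < c" k]
    by (simp add: L_def)
  have "(\<lambda>k. measure (gauss ?I) (L k)) \<longlonglongrightarrow> measure (gauss ?I) (\<Union>k. L k)"
  proof (rule I.finite_Lim_measure_incseq)
    show "incseq L" unfolding incseq_def L_def using V'(4) by blast
  qed (use L in auto)
  moreover have "measure (gauss ?I) (L k) \<le> 2 * measure (gauss ?J) B" for k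
    unfolding L_def using V'(3) sub by (intro gmt_lower_finite[OF m V'(1) B]) auto
  ultimately have "measure (gauss ?I) (\<Union>k. L k) \<le> 2 * measure (gauss ?J) B"
    by (intro LIMSEQ_le_const2) auto
  moreover have "(\<Union>k. L k) = {A \<in> space (gauss ?I). \<exists>w\<in>V. nrm m (\<lambda>i. mv n A w i - y i) < c}"
    using V'(5) by (auto simp: L_def)
  ultimately show ?thesis by simp
qed simp

text \<open>
  An almost minimal-norm point \<open>x\<close> of a bounded convex set of residuals gives an almost optimal
  separating direction \<open>x / \<parallel>x\<parallel>\<close>; no compactness is needed.
\<close>

lemma approximate_dual:
  assumes V: "V \<noteq> {}" and conv: "\<And>w w' \<theta>. w \<in> V \<Longrightarrow> w' \<in> V \<Longrightarrow> 0 \<le> \<theta> \<Longrightarrow> \<theta> \<le> 1 \<Longrightarrow>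
      (\<lambda>j. (1 - \<theta>) * w j + \<theta> * w' j) \<in> V"
    and bdd: "\<And>w. w \<in> V \<Longrightarrow> nrm m (\<lambda>i. mv n A w i - y i) \<le> D"
    and c: "0 < c" "\<And>w. w \<in> V \<Longrightarrow> c \<le> nrm m (\<lambda>i. mv n A w i - y i)" and e: "0 < e"
  shows "\<exists>u. nrm m u = 1 \<and> (\<forall>w\<in>V. c - e \<le> ip m u (\<lambda>i. mv n A w i - y i))"
proof -
  define R where "R w i = mv n A w i - y i" for w i
  define f where "f w = (nrm m (R w))\<^sup>2" for w
  have D: "0 < D" using V bdd c by force
  \<comment> \<open>A move from x towards w by \<theta> changes the squared norm by 2 \<theta> a +
    \<theta>^2 d with d \<le> 4 D^2. As x is optimal up to \<theta>^2, this gives a \<ge> - \<theta>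
    (d + 1) / 2, and the chosen \<theta> makes the right side at least - c e.\<close>
  define \<theta> where "\<theta> = min 1 (c * e / (1 + 2 * D ^ 2))"
  have th: "0 < \<theta>" "\<theta> \<le> 1" "\<theta> * (1 + 2 * D ^ 2) \<le> c * e"
  proof -
    have p: "0 < 1 + 2 * D ^ 2" by (simp add: add_pos_nonneg)
    then show "0 < \<theta>" "\<theta> \<le> 1" using c e by (auto simp: \<theta>_def)
    have "\<theta> \<le> c * e / (1 + 2 * D ^ 2)" by (simp add: \<theta>_def)
    then show "\<theta> * (1 + 2 * D ^ 2) \<le> c * e" using p by (simp add: field_simps)
  qed
  have bb: "bdd_below (f ` V)" by (rule bdd_belowI[of _ 0]) (auto simp: f_def)
  have ne: "f ` V \<noteq> {}" using V by auto
  obtain x where x: "x \<in> V" "f x < Inf (f ` V) + \<theta>\<^sup>2"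
    using cInf_lessD[OF ne, of "Inf (f ` V) + \<theta>\<^sup>2"] th by auto
  have inf: "Inf (f ` V) \<le> f w" if "w \<in> V" for w using that bb by (intro cInf_lower) auto
  let ?N = "nrm m (R x)"
  have N: "c \<le> ?N" "?N \<le> D" using c(2)[OF x(1)] bdd[OF x(1)] unfolding R_def by auto
  define u where "u i = (1 / ?N) * R x i" for i
  show ?thesis
  proof (intro exI conjI ballI)
    show "nrm m u = 1" unfolding u_def nrm_scale using N c by simp
    fix w assume w: "w \<in> V"
    let ?a = "ip m (R x) (\<lambda>i. R w i - R x i)"
    let ?d = "ip m (\<lambda>i. R w i - R x i) (\<lambda>i. R w i - R x i)"
    have Rconv: "R (\<lambda>j. (1 - \<theta>) * x j + \<theta> * w j) i = R x i + \<theta> * (R w i - R x i)" for i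
      unfolding R_def by (simp add: sum.distrib sum_subtractf algebra_simps sum_distrib_left)
    have "f (\<lambda>j. (1 - \<theta>) * x j + \<theta> * w j) = f x + 2 * \<theta> * ?a + \<theta>\<^sup>2 * ?d"
      unfolding f_def nrm_sq Rconv
      by (simp add: sum.distrib sum_subtractf algebra_simps sum_distrib_left power2_eq_square)
    then have "Inf (f ` V) \<le> f x + 2 * \<theta> * ?a + \<theta>\<^sup>2 * ?d"
      using inf[OF conv[OF x(1) w, of \<theta>]] th by simp
    then have "0 \<le> \<theta> * (2 * ?a + \<theta> * (?d + 1))"
      using x(2) by (simp add: algebra_simps power2_eq_square)
    then have a: "- \<theta> * (?d + 1) / 2 \<le> ?a" using th by (simp add: zero_le_mult_iff)
    have d: "?d \<le> 4 * D ^ 2"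
    proof -
      have "nrm m (\<lambda>i. R w i - R x i) \<le> nrm m (R w) + nrm m (\<lambda>i. (- 1) * R x i)"
        using L2_set_triangle_ineq[of "R w" "\<lambda>i. (- 1) * R x i" "{..<m}"] by simp
      also have "\<dots> \<le> 2 * D"
        unfolding nrm_scale using bdd[OF w] N unfolding R_def by simp
      finally have "(nrm m (\<lambda>i. R w i - R x i))\<^sup>2 \<le> (2 * D)\<^sup>2" by (intro power_mono) auto
      then show ?thesis unfolding nrm_sq by (simp add: power_mult_distrib)
    qed
    have "\<theta> * (?d + 1) \<le> \<theta> * (2 * (1 + 2 * D ^ 2))"
      using d th by (intro mult_left_mono) auto
    also have "\<dots> = 2 * (\<theta> * (1 + 2 * D ^ 2))" by simp
    finally have "\<theta> * (?d + 1) \<le> 2 * (c * e)" using th(3) by linarith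
    then have "- (c * e) \<le> ?a" using a by simp
    moreover have "c * e \<le> ?N * e" using N e by (intro mult_right_mono) auto
    ultimately have a': "- (?N * e) \<le> ?a" by linarith
    have "ip m u (R w) = (1 / ?N) * ip m (R x) (R w)"
      by (simp add: u_def sum_distrib_left mult.assoc)
    also have "ip m (R x) (R w) = ?N\<^sup>2 + ?a"
      unfolding nrm_sq ip_diff by simp
    finally have "ip m u (\<lambda>i. mv n A w i - y i) = (1 / ?N) * (?N\<^sup>2 + ?a)"
      unfolding R_def .
    also have "\<dots> \<ge> (1 / ?N) * (?N\<^sup>2 - ?N * e)"
      using a' N c by (intro mult_left_mono) auto
    also have "(1 / ?N) * (?N\<^sup>2 - ?N * e) = ?N - e"
      using N c by (simp add: field_simps power2_eq_square)
    finally show "c - e \<le> ip m u (\<lambda>i. mv n A w i - y i)" using N by linarith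
  qed
qed

text \<open>By \<open>approximate_dual\<close> the event says that one u works for all w, the form
  required by the comparison with u outside and the sign reversed. Both index sets are exhausted by
  finite ones: u along k, with increasing events, then w along l, with decreasing ones. One third of
  the slack e pays for duality, another for moving u into the dense set.\<close>

lemma gmt_upper:
  assumes m: "0 < m" and V: "V \<noteq> {}"
    and conv: "\<And>w w' \<theta>. w \<in> V \<Longrightarrow> w' \<in> V \<Longrightarrow> 0 \<le> \<theta> \<Longrightarrow> \<theta> \<le> 1 \<Longrightarrow>
      (\<lambda>j. (1 - \<theta>) * w j + \<theta> * w' j) \<in> V"
    and bdd: "\<And>w. w \<in> V \<Longrightarrow> nrm n w \<le> \<rho>" and c: "0 < c" and e: "0 < e"
    and B: "B \<in> sets (gauss ({..<m} <+> {..<n}))"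
    and sub: "\<And>b. b \<in> space (gauss ({..<m} <+> {..<n})) \<Longrightarrow>
      (\<And>w. w \<in> V \<Longrightarrow> c - e \<le> gordon_obj m n y b w) \<Longrightarrow> b \<in> B"
  shows "measure (gauss ({..<m} \<times> {..<n})) {A \<in> space (gauss ({..<m} \<times> {..<n})).
      \<forall>w\<in>V. c \<le> nrm m (\<lambda>i. mv n A w i - y i)} \<le> 2 * measure (gauss ({..<m} <+> {..<n})) B"
proof -
  let ?I = "{..<m} \<times> {..<n}" and ?J = "{..<m} <+> {..<n}"
  interpret I: prob_space "gauss ?I" by (rule prob_space_gauss)
  interpret J: prob_space "gauss ?J" by (rule prob_space_gauss)
  obtain S0 where S0: "countable S0" "S0 \<subseteq> {u. nrm m u = 1}" "{u. nrm m u = 1} \<subseteq> closure S0"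
    using separable by metis
  obtain u0 where "nrm m u0 = 1" using exists_unit_attaining_nrm[OF m] by metis
  then have "S0 \<noteq> {}" using S0(3) by auto
  define P where "P k = from_nat_into S0 ` {..k}" for k :: nat
  note P = from_nat_into_images[OF S0(1) \<open>S0 \<noteq> {}\<close>, folded P_def]
  obtain V0 where V0: "countable V0" "V0 \<subseteq> V" "V \<subseteq> closure V0"
    using separable by metis
  then have "V0 \<noteq> {}" using V by auto
  define Q where "Q k = from_nat_into V0 ` {..k}" for k :: nat
  note Q = from_nat_into_images[OF V0(1) \<open>V0 \<noteq> {}\<close>, folded Q_def]
  let ?L = "{A \<in> space (gauss ?I). \<forall>w\<in>V. c \<le> nrm m (\<lambda>i. mv n A w i - y i)}"
  define E where "E k l = {A \<in> space (gauss ?I). \<exists>u\<in>P k. \<forall>w\<in>Q l. (ip m u y + (c - e)) + (- 1) * ip m u (mv n A w) < 0}" for k l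
  have E: "E k l \<in> sets (gauss ?I)" for k l
    unfolding E_def
  proof (rule measurable_finite_ex_all[OF P(1) Q(1,2)])
    fix u w
    have "(\<lambda>A. (ip m u y + (c - e)) + (- 1) * ip m u (mv n A w)) \<in> borel_measurable (gauss ?I)"
      by (intro borel_measurable_add borel_measurable_times borel_measurable_const measurable_ip_mv)
    then show "{A \<in> space (gauss ?I). (ip m u y + (c - e)) + (- 1) * ip m u (mv n A w) < 0} \<in> sets (gauss ?I)"
      by measurable
  qed
  define F where "F l = {b \<in> space (gauss ?J). \<forall>w\<in>Q l. c - e \<le> gordon_obj m n y b w}" for l
  have F: "F l \<in> sets (gauss ?J)" for l
  proof -
    have "{b \<in> space (gauss ?J). c - e \<le> gordon_obj m n y b w} \<in> sets (gauss ?J)" for w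
      using measurable_gordon_obj by measurable
    then show ?thesis
      using measurable_finite_ex_all[of "{()}" "Q l" "gauss ?J" "\<lambda>p w b. c - e \<le> gordon_obj m n y b w"] Q(1,2)[of l]
      by (simp add: F_def)
  qed
  have EF: "measure (gauss ?I) (E k l) \<le> 2 * measure (gauss ?J) (F l)" for k l
  proof -
    have un: "nrm m u = 1" if "u \<in> P k" for u using that P(3) S0(2) by auto
    have "measure (gauss ?I) (E k l) \<le> 2 * measure (gauss ?J) {b \<in> space (gauss ?J). \<exists>u\<in>P k. \<forall>w\<in>Q l.
      (ip m u y + (c - e)) + (- 1) * (nrm n w * ip m u (\<lambda>i. b (Inl i)) + ip n w (\<lambda>j. b (Inr j))) \<le> 0}"
      unfolding E_def
      using gmt_finite[OF P(1)[of k] P(2)[of k] Q(1)[of l] Q(2)[of l],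
        where m=m and n=n and uu=fst and ww=snd and \<epsilon>="- 1" and \<psi>="\<lambda>k. ip m (fst k) y + (c - e)"] un
      by auto
    also have "\<dots> \<le> 2 * measure (gauss ?J) (F l)"
    proof (intro mult_left_mono J.finite_measure_mono F subsetI)
      fix b assume "b \<in> {b \<in> space (gauss ?J). \<exists>u\<in>P k. \<forall>w\<in>Q l.
        (ip m u y + (c - e)) + (- 1) * (nrm n w * ip m u (\<lambda>i. b (Inl i)) + ip n w (\<lambda>j. b (Inr j))) \<le> 0}"
      then obtain u where b: "b \<in> space (gauss ?J)" and u: "u \<in> P k" and le: "\<And>w. w \<in> Q l \<Longrightarrow>
        (ip m u y + (c - e)) + (- 1) * (nrm n w * ip m u (\<lambda>i. b (Inl i)) + ip n w (\<lambda>j. b (Inr j))) \<le> 0"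
        by auto
      have u1: "nrm m u = 1" using u P(3) S0(2) by auto
      have "c - e \<le> gordon_obj m n y b w" if "w \<in> Q l" for w
        using le[OF that] ip_le_nrm[where k=m and x=u and y="\<lambda>i. nrm n w * b (Inl i) - y i"] u1
        unfolding gordon_obj_def ip_gordon by simp
      then show "b \<in> F l" using b by (simp add: F_def)
    qed simp
    finally show ?thesis .
  qed
  have LE: "?L \<subseteq> (\<Union>k. E k l)" for l
  proof
    fix A assume A: "A \<in> ?L"
    define D where "D = (\<Sum>i<m. (\<Sum>j<n. \<bar>A (i, j)\<bar>) * \<rho> + \<bar>y i\<bar>)"
    have D: "nrm m (\<lambda>i. mv n A w i - y i) \<le> D" if w: "w \<in> V" for w
    proof -
      have "\<bar>w j\<bar> \<le> \<rho>" if "j < n" for j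
      proof -
        have "\<bar>w j\<bar> \<le> nrm n (\<lambda>j. \<bar>w j\<bar>)" using that by (intro member_le_L2_set) auto
        also have "\<dots> = nrm n w" by (simp add: L2_set_def)
        finally show ?thesis using bdd[OF w] by simp
      qed
      then have "\<bar>mv n A w i\<bar> \<le> (\<Sum>j<n. \<bar>A (i, j)\<bar>) * \<rho>" for i
        unfolding sum_distrib_right
        by (intro order_trans[OF sum_abs] sum_mono) (auto simp: abs_mult intro: mult_left_mono)
      then have "\<bar>mv n A w i - y i\<bar> \<le> (\<Sum>j<n. \<bar>A (i, j)\<bar>) * \<rho> + \<bar>y i\<bar>" for i
        by (rule order_trans[OF abs_triangle_ineq4 add_right_mono])
      then show ?thesis
        unfolding D_def by (intro order_trans[OF L2_set_le_sum_abs] sum_mono) auto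
    qed
    have D0: "0 \<le> D" using V order_trans[OF L2_set_nonneg D] by auto
    have e3: "0 < e / 3" using e by simp
    have A': "c \<le> nrm m (\<lambda>i. mv n A w i - y i)" if "w \<in> V" for w using A that by simp
    obtain u where u: "nrm m u = 1" "\<And>w. w \<in> V \<Longrightarrow> c - e / 3 \<le> ip m u (\<lambda>i. mv n A w i - y i)"
      using approximate_dual[OF V conv D c A' e3] by blast
    \<comment> \<open>A vector closer than \<eta> to u changes the product with a residual, of norm
      at most D, by at most e / 3.\<close>
    define \<eta> where "\<eta> = e / (3 * (D + 1))"
    have \<eta>: "0 < \<eta>" "\<eta> * D \<le> e / 3"
    proof -
      show "0 < \<eta>" using e D0 by (simp add: \<eta>_def)
      have "e * D \<le> e * (D + 1)" using e by (intro mult_left_mono) auto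
      then show "\<eta> * D \<le> e / 3" using D0 by (simp add: \<eta>_def field_simps)
    qed
    have "open {v. nrm m (\<lambda>i. v i - u i) < \<eta>}"
      unfolding L2_set_def
      by (intro open_Collect_less continuous_intros continuous_on_product_coordinates)
    moreover have "u \<in> {v. nrm m (\<lambda>i. v i - u i) < \<eta>}" using \<eta> by (simp add: L2_set_def)
    moreover have "u \<in> closure S0" using u(1) S0(3) by auto
    ultimately obtain v where v: "v \<in> S0" "nrm m (\<lambda>i. v i - u i) < \<eta>"
      using open_Int_closure_eq_empty by blast
    have "(ip m v y + (c - e)) + (- 1) * ip m v (mv n A w) < 0" if "w \<in> V" for w
    proof -
      let ?r = "\<lambda>i. mv n A w i - y i"
      have "ip m (\<lambda>i. - 1 * (v i - u i)) ?r \<le> nrm m (\<lambda>i. - 1 * (v i - u i)) * nrm m ?r"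
        by (rule ip_le_nrm)
      also have "\<dots> \<le> \<eta> * D"
        unfolding nrm_scale using v(2) D[OF that] \<eta> by (intro mult_mono) auto
      finally have "ip m u ?r - ip m v ?r \<le> e / 3"
        using \<eta>(2) by (simp add: left_diff_distrib sum_subtractf)
      then have "c - e < ip m v ?r" using u(2)[OF that] e by linarith
      then show ?thesis unfolding ip_diff by simp
    qed
    then have "\<forall>w\<in>Q l. (ip m v y + (c - e)) + (- 1) * ip m v (mv n A w) < 0"
      using Q(3)[of l] V0(2) by blast
    moreover obtain k where "v \<in> P k" using P(5) v(1) by auto
    ultimately have "A \<in> E k l" using A unfolding E_def by blast
    then show "A \<in> (\<Union>k. E k l)" by blast
  qed
  have "measure (gauss ?I) ?L \<le> 2 * measure (gauss ?J) (F l)" for l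
  proof -
    have "(\<lambda>k. measure (gauss ?I) (E k l)) \<longlonglongrightarrow> measure (gauss ?I) (\<Union>k. E k l)"
    proof (rule I.finite_Lim_measure_incseq)
      show "incseq (\<lambda>k. E k l)" unfolding incseq_def E_def using P(4) by blast
    qed (use E in auto)
    then have "measure (gauss ?I) (\<Union>k. E k l) \<le> 2 * measure (gauss ?J) (F l)"
      using EF by (intro LIMSEQ_le_const2) auto
    moreover have "measure (gauss ?I) ?L \<le> measure (gauss ?I) (\<Union>k. E k l)"
      using E by (intro I.finite_measure_mono LE) auto
    ultimately show ?thesis by linarith
  qed
  moreover have lim: "(\<lambda>l. 2 * measure (gauss ?J) (F l)) \<longlonglongrightarrow> 2 * measure (gauss ?J) (\<Inter>l. F l)"
  proof (intro tendsto_intros J.finite_Lim_measure_decseq)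
    show "decseq F" unfolding decseq_def F_def using Q(4) by blast
  qed (use F in auto)
  ultimately have "measure (gauss ?I) ?L \<le> 2 * measure (gauss ?J) (\<Inter>l. F l)"
    by (intro LIMSEQ_le_const[OF lim]) blast
  also have "\<dots> \<le> 2 * measure (gauss ?J) B"
  proof (intro mult_left_mono J.finite_measure_mono B subsetI)
    fix b assume b: "b \<in> (\<Inter>l. F l)"
    have le: "- gordon_obj m n y b w \<le> - (c - e)" if "w \<in> V0" for w
    proof -
      obtain l where "w \<in> Q l" using Q(5) \<open>w \<in> V0\<close> by blast
      moreover have "b \<in> F l" using b by blast
      ultimately have "c - e \<le> gordon_obj m n y b w" unfolding F_def by blast
      then show ?thesis by simp
    qed
    have cont: "continuous_on UNIV (\<lambda>w. - gordon_obj m n y b w)"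
      unfolding gordon_obj_def L2_set_def by (intro continuous_intros continuous_on_product_coordinates)
    have "c - e \<le> gordon_obj m n y b w" if "w \<in> V" for w
      using le_on_closure[OF cont V0(3) le that] by simp
    then show "b \<in> B" using b by (intro sub) (auto simp: F_def)
  qed simp
  finally show ?thesis .
qed

section \<open>The functions G and H\<close>

lemma std_normal_singleton: "measure std_normal_distribution {x} = 0"
proof -
  have "emeasure std_normal_distribution {x} = 0"
    by (subst emeasure_density) (auto simp: nn_integral_cmult_indicator mult.commute)
  then show ?thesis by (simp add: measure_def)
qed

lemma std_normal_cdf_less: "measure std_normal_distribution {..<x} = std_normal_cdf x"
proof -
  have "{..x} = {..<x} \<union> {x}" by auto
  then have "measure std_normal_distribution {..x} = measure std_normal_distribution {..<x} + measure std_normal_distribution {x}"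
    using std_normal.finite_measure_Union[of "{..<x}" "{x}"] by simp
  then show ?thesis by (simp add: cdf_def std_normal_singleton)
qed

lemma std_normal_cdf_minus: "std_normal_cdf (- x) = 1 - std_normal_cdf x"
proof -
  let ?N = "std_normal_distribution"
  have "measure ?N {..- x} = measure (distr ?N lborel (\<lambda>x. - x)) {..- x}"
    by (simp only: distr_std_normal_uminus)
  also have "\<dots> = measure ?N {x..}"
    by (subst measure_distr) (auto intro: arg_cong[where f="measure ?N"])
  also have "{x..} = UNIV - {..<x}" by auto
  also have "measure ?N (UNIV - {..<x}) = 1 - measure ?N {..<x}"
    using std_normal.prob_compl[of "{..<x}"] by simp
  finally show ?thesis unfolding std_normal_cdf_less by (simp add: cdf_def)
qed

lemma std_normal_cdf_0: "std_normal_cdf 0 = 1 / 2"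
  using std_normal_cdf_minus[of 0] by simp

lemma std_normal_density_deriv:
  "(std_normal_density has_real_derivative - x * std_normal_density x) (at x)"
proof -
  have "((\<lambda>x::real. exp (- x\<^sup>2 / 2)) has_real_derivative - x * exp (- x\<^sup>2 / 2)) (at x)"
    by (auto intro!: derivative_eq_intros)
  from DERIV_cmult[OF this, of "1 / sqrt (2 * pi)"] show ?thesis
    unfolding std_normal_density_def by (simp only: mult_ac)
qed

lemma std_normal_density_le: "std_normal_density x \<le> 1 / (1 + x\<^sup>2 / 2)"
proof -
  have "1 + x\<^sup>2 / 2 \<le> exp (x\<^sup>2 / 2)" by (rule exp_ge_add_one_self)
  then have 1: "exp (- x\<^sup>2 / 2) \<le> 1 / (1 + x\<^sup>2 / 2)"
    by (simp add: exp_minus inverse_eq_divide frac_le add_pos_nonneg)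
  have "1 / sqrt (2 * pi) \<le> 1"
    using pi_ge_two by (simp add: real_le_rsqrt)
  then have "std_normal_density x \<le> 1 * (1 / (1 + x\<^sup>2 / 2))"
    unfolding std_normal_density_def using 1 by (intro mult_mono) auto
  then show ?thesis by simp
qed

text \<open>Enough decay to remove the boundary terms at minus infinity when antiderivatives are
  evaluated.\<close>

lemma std_normal_density_decay:
  assumes "x \<noteq> 0"
  shows "std_normal_density x \<le> 2 / \<bar>x\<bar>" "\<bar>x\<bar> * std_normal_density x \<le> 2 / \<bar>x\<bar>"
proof -
  have p: "0 < 1 + x\<^sup>2 / 2" by (simp add: add_pos_nonneg)
  have "0 \<le> (\<bar>x\<bar> - 1)\<^sup>2" by simp
  then have "\<bar>x\<bar> \<le> 2 * (1 + x\<^sup>2 / 2)" by (simp add: power2_eq_square algebra_simps)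
  then have "1 / (1 + x\<^sup>2 / 2) \<le> 2 / \<bar>x\<bar>" using assms p by (simp add: field_simps)
  then show "std_normal_density x \<le> 2 / \<bar>x\<bar>" using std_normal_density_le[of x] by simp
  have "\<bar>x\<bar> * std_normal_density x \<le> \<bar>x\<bar> * (1 / (1 + x\<^sup>2 / 2))"
    by (intro mult_left_mono std_normal_density_le) simp
  also have "\<dots> \<le> 2 / \<bar>x\<bar>"
    using assms p by (simp add: field_simps power2_eq_square)
  finally show "\<bar>x\<bar> * std_normal_density x \<le> 2 / \<bar>x\<bar>" .
qed

lemma tendsto_at_bot_bound:
  assumes "\<And>x::real. x \<noteq> 0 \<Longrightarrow> \<bar>f x\<bar> \<le> C / \<bar>x\<bar>"
  shows "((f \<circ> real_of_ereal) \<longlongrightarrow> (0::real)) (at_right (- \<infinity>))"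
proof -
  have "filterlim (\<lambda>x::real. \<bar>x\<bar>) at_top at_bot"
    using filterlim_at_infinity_imp_norm_at_top[OF filterlim_at_bot_imp_at_infinity[OF filterlim_ident]]
    by (simp only: real_norm_def)
  then have "((\<lambda>x. C / \<bar>x\<bar>) \<longlongrightarrow> 0) at_bot"
    by (intro tendsto_divide_0[OF tendsto_const] filterlim_at_top_imp_at_infinity)
  moreover have "\<forall>\<^sub>F x in at_bot. norm (f x) \<le> C / \<bar>x\<bar>"
    by (rule eventually_mono[OF eventually_le_at_bot[of "-1::real"]]) (unfold real_norm_def, rule assms, simp)
  ultimately have "(f \<longlongrightarrow> 0) at_bot"
    by (intro Lim_null_comparison[of f "\<lambda>x. C / \<bar>x\<bar>"])
  then show ?thesis by (simp add: ereal_tendsto_simps)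
qed

text \<open>The antiderivatives are - \<phi>(x) for x \<phi>(x) and - x \<phi>(x) for (x^2 - 1)
  \<phi>(x). The second moment is centred as h^2 - 1 because in this form the antiderivative is
  elementary.\<close>

lemma std_normal_partial_moments:
  shows "(\<integral>h. indicator {..<a} h * h \<partial>std_normal_distribution) = - std_normal_density a"
    and "(\<integral>h. indicator {..<a} h * (h\<^sup>2 - 1) \<partial>std_normal_distribution) = - a * std_normal_density a"
proof -
  let ?N = "std_normal_distribution"
  have FTC: "(\<integral>h. indicator {..<a} h * f h \<partial>?N) = F a"
    if F: "\<And>x. (F has_real_derivative std_normal_density x * f x) (at x)"
      and f: "integrable ?N f" "continuous_on UNIV f"
      and lim: "\<And>x. x \<noteq> 0 \<Longrightarrow> \<bar>F x\<bar> \<le> C / \<bar>x\<bar>" for F f :: "real \<Rightarrow> real" and C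
  proof -
    have fm [measurable]: "f \<in> borel_measurable borel"
      using f(2) by (rule borel_measurable_continuous_onI)
    have "(LBINT x=-\<infinity>..ereal a. std_normal_density x * f x) = F a - 0"
    proof (rule interval_integral_FTC_integrable)
      show "- \<infinity> < ereal a" by simp
      show "(F has_vector_derivative std_normal_density x * f x) (at x)" for x
        using F by (simp add: has_real_derivative_iff_has_vector_derivative)
      show "isCont (\<lambda>x. std_normal_density x * f x) x" for x
        using f(2) DERIV_isCont[OF std_normal_density_deriv]
        by (intro continuous_intros) (auto simp: continuous_on_eq_continuous_at)
      have "integrable lborel (\<lambda>x. std_normal_density x * f x)"
        using f(1) by (subst (asm) integrable_density) (auto simp: normal_density_nonneg)
      then show "set_integrable lborel (einterval (- \<infinity>) (ereal a)) (\<lambda>x. std_normal_density x * f x)"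
        unfolding set_integrable_def by (intro integrable_mult_indicator) auto
      show "((F \<circ> real_of_ereal) \<longlongrightarrow> 0) (at_right (- \<infinity>))"
        by (rule tendsto_at_bot_bound[OF lim])
      have "isCont F a" using F DERIV_isCont by blast
      then have "(F \<longlongrightarrow> F a) (at_left a)"
        by (simp add: isCont_def filterlim_at_split)
      then show "((F \<circ> real_of_ereal) \<longlongrightarrow> F a) (at_left (ereal a))"
        by (simp add: ereal_tendsto_simps)
    qed
    then have "(\<integral>x. indicator {..<a} x * (std_normal_density x * f x) \<partial>lborel) = F a"
      by (simp add: interval_lebesgue_integral_def set_lebesgue_integral_def)
    then show ?thesis
      by (subst integral_density) (auto simp: normal_density_nonneg mult_ac)
  qed
  show "(\<integral>h. indicator {..<a} h * h \<partial>?N) = - std_normal_density a"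
  proof -
    have i: "integrable ?N (\<lambda>h. h)" using integrable_std_normal_power[of 1] by simp
    have F: "((\<lambda>x. - std_normal_density x) has_real_derivative std_normal_density x * x) (at x)" for x
      using DERIV_minus[OF std_normal_density_deriv[of x]] by (simp add: mult.commute)
    have b: "\<bar>- std_normal_density x\<bar> \<le> 2 / \<bar>x\<bar>" if "x \<noteq> 0" for x
      using std_normal_density_decay(1)[OF that] by (simp add: normal_density_nonneg)
    show ?thesis by (rule FTC[OF F i _ b]) (intro continuous_intros)
  qed
  have i: "integrable ?N (\<lambda>h. h\<^sup>2 - 1)" using integrable_std_normal_power[of 2] by simp
  have F: "((\<lambda>x. - (x * std_normal_density x)) has_real_derivative std_normal_density x * (x\<^sup>2 - 1)) (at x)" for x
    by (auto intro!: derivative_eq_intros std_normal_density_deriv simp: algebra_simps power2_eq_square)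
  have b: "\<bar>- (x * std_normal_density x)\<bar> \<le> 2 / \<bar>x\<bar>" if "x \<noteq> 0" for x
    using std_normal_density_decay(2)[OF that] by (simp add: abs_mult normal_density_nonneg)
  show "(\<integral>h. indicator {..<a} h * (h\<^sup>2 - 1) \<partial>?N) = - a * std_normal_density a"
    using FTC[OF F i _ b] by (simp add: continuous_intros)
qed


section \<open>Integral representations of G and of the distribution function\<close>

text \<open>Split at h = - x into pieces whose means are constants, values of the distribution
  function, or the truncated moments of \<open>std_normal_partial_moments\<close>;
  \<open>max_gauss_prod\<close> does the same.\<close>

lemma max_gauss_sq:
  "(max h (- x))\<^sup>2 = 1 + (h\<^sup>2 - 1) - indicator {..<- x} h * (h\<^sup>2 - 1) + (x\<^sup>2 - 1) * indicator {..<- x} h" for h x :: real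
  by (auto simp: indicator_def max_def power2_eq_square)

lemma max_gauss_prod:
  "h * max h (- x) = 1 + (h\<^sup>2 - 1) - indicator {..<- x} h * (h\<^sup>2 - 1) - indicator {..<- x} h - x * (indicator {..<- x} h * h)" for h x :: real
  by (auto simp: indicator_def max_def power2_eq_square)

lemma std_normal_integrable_aux:
  "integrable std_normal_distribution (\<lambda>h. h\<^sup>2 - 1)"
  "integrable std_normal_distribution (\<lambda>h. indicator {..<a} h * (h\<^sup>2 - 1))"
  "integrable std_normal_distribution (\<lambda>h. indicator {..<a} h * h)"
  "integrable std_normal_distribution (\<lambda>h. indicator {..<a} h :: real)"
  "(\<integral>h. indicator {..<a} h \<partial>std_normal_distribution) = std_normal_cdf a"
proof -
  show 1: "integrable std_normal_distribution (\<lambda>h. h\<^sup>2 - 1)"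
    using integrable_std_normal_power[of 2] by simp
  have 2: "integrable std_normal_distribution (\<lambda>h. h)"
    using integrable_std_normal_power[of 1] by simp
  show "integrable std_normal_distribution (\<lambda>h. indicator {..<a} h * (h\<^sup>2 - 1))"
    "integrable std_normal_distribution (\<lambda>h. indicator {..<a} h * h)"
    using integrable_real_mult_indicator[OF _ 1, of "{..<a}"] integrable_real_mult_indicator[OF _ 2, of "{..<a}"]
    by (simp_all add: mult.commute)
  show "integrable std_normal_distribution (\<lambda>h. indicator {..<a} h :: real)"
    by (rule std_normal.integrable_const_bound[where B=1]) auto
  show "(\<integral>h. indicator {..<a} h \<partial>std_normal_distribution) = std_normal_cdf a"
    using std_normal_cdf_less[of a] by simp
qed

lemma integrable_max_gauss:
  "integrable std_normal_distribution (\<lambda>h. (max h (- x))\<^sup>2)"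
  "integrable std_normal_distribution (\<lambda>h. h * max h (- x))"
  unfolding max_gauss_sq max_gauss_prod
  by (intro Bochner_Integration.integrable_add Bochner_Integration.integrable_diff
      integrable_mult_right std_normal_integrable_aux std_normal.integrable_const)+

text \<open>Since \<open>max h (- x)\<close> is the displacement max 0 (x + h) - x of the projection
  onto the half line, G is the risk of this projection at signal x under unit noise. Bounds,
  monotonicity and limits of G are read off the integrand.\<close>

lemma G_fun_eq: "G_fun x = (\<integral>h. (max h (- x))\<^sup>2 \<partial>std_normal_distribution)"
proof -
  have "(\<integral>h. (max h (- x))\<^sup>2 \<partial>std_normal_distribution)
    = 1 - - (- x) * std_normal_density (- x) + (x\<^sup>2 - 1) * std_normal_cdf (- x)"
    unfolding max_gauss_sq
    using std_normal_integrable_aux(1) std_normal_integrable_aux(2-5)[of "- x"] std_normal_partial_moments(2)[of "- x"]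
      std_normal.prob_space integrable_std_normal_power[of 2] std_normal_second_moment
    by simp
  also have "\<dots> = G_fun x"
  proof -
    have "std_normal_density (- x) = std_normal_density x" by (simp add: std_normal_density_def)
    then show ?thesis by (simp add: G_fun_def std_normal_cdf_minus algebra_simps)
  qed
  finally show ?thesis by simp
qed

text \<open>Stein's identity for the same displacement: its correlation with h is the probability
  that the constraint is inactive. This is how the distribution function, and with it H, enters the
  comparison objective.\<close>

lemma cdf_eq_max_gauss: "std_normal_cdf x = (\<integral>h. h * max h (- x) \<partial>std_normal_distribution)"
proof -
  have "(\<integral>h. h * max h (- x) \<partial>std_normal_distribution)
    = 1 - - (- x) * std_normal_density (- x) - std_normal_cdf (- x) - x * (- std_normal_density (- x))"
    unfolding max_gauss_prod
    using std_normal_integrable_aux(1) std_normal_integrable_aux(2-5)[of "- x"] std_normal_partial_moments[of "- x"]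
      std_normal.prob_space integrable_std_normal_power[of 2] std_normal_second_moment
    by simp
  also have "\<dots> = std_normal_cdf x"
    by (simp add: std_normal_cdf_minus)
  finally show ?thesis by simp
qed

section \<open>Bounds, monotonicity and limits of G\<close>

lemma G_fun_0: "G_fun 0 = 1 / 2"
  by (simp add: G_fun_def std_normal_cdf_0)

lemma G_fun_mono:
  assumes "0 \<le> x" "x \<le> y" shows "G_fun x \<le> G_fun y"
  unfolding G_fun_eq
proof (intro integral_mono integrable_max_gauss)
  fix h
  have "\<bar>max h (- x)\<bar> \<le> \<bar>max h (- y)\<bar>" using assms by (auto simp: max_def abs_if)
  then show "(max h (- x))\<^sup>2 \<le> (max h (- y))\<^sup>2" by (rule abs_le_square_iff[THEN iffD1])
qed

lemma G_fun_ge_half: "0 \<le> x \<Longrightarrow> 1 / 2 \<le> G_fun x"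
  using G_fun_mono[of 0 x] by (simp add: G_fun_0)

lemma max_gauss_abs_le: "0 \<le> x \<Longrightarrow> \<bar>max h (- x)\<bar> \<le> \<bar>h\<bar>" for h x :: real
  by (auto simp: max_def abs_if)

lemma G_fun_le_1: "0 \<le> x \<Longrightarrow> G_fun x \<le> 1"
proof -
  assume x: "0 \<le> x"
  have "G_fun x \<le> (\<integral>h. h\<^sup>2 \<partial>std_normal_distribution)"
    unfolding G_fun_eq
    using max_gauss_abs_le[OF x] integrable_std_normal_power[of 2]
    by (intro integral_mono integrable_max_gauss) (auto intro: abs_le_square_iff[THEN iffD1])
  then show ?thesis by (simp add: std_normal_second_moment)
qed

lemma isCont_std_normal_cdf: "isCont std_normal_cdf x"
proof -
  interpret real_distribution std_normal_distribution by (rule real_dist_normal_dist)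
  show ?thesis by (simp add: isCont_cdf std_normal_singleton)
qed

lemma isCont_G_fun: "isCont G_fun x"
proof -
  have "isCont (\<lambda>x. std_normal_cdf (- x)) x"
    by (rule isCont_o2[OF _ isCont_std_normal_cdf]) simp
  then show ?thesis
    unfolding G_fun_def[abs_def] using isCont_std_normal_cdf DERIV_isCont[OF std_normal_density_deriv]
    by (intro continuous_intros) auto
qed

lemma measurable_G_fun [measurable]: "G_fun \<in> borel_measurable borel"
  by (rule borel_measurable_continuous_onI) (simp add: continuous_on_eq_continuous_at isCont_G_fun)

lemma measurable_std_normal_cdf [measurable]: "std_normal_cdf \<in> borel_measurable borel"
  by (rule borel_measurable_continuous_onI) (simp add: continuous_on_eq_continuous_at isCont_std_normal_cdf)

lemma std_normal_cdf_bounds: "0 \<le> std_normal_cdf x" "std_normal_cdf x \<le> 1"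
  by (auto simp: cdf_def)

lemma G_fun_tendsto_1: "(G_fun \<longlongrightarrow> 1) at_top"
proof -
  have "((\<lambda>x. \<integral>h. (max h (- x))\<^sup>2 \<partial>std_normal_distribution) \<longlongrightarrow> (\<integral>h. h\<^sup>2 \<partial>std_normal_distribution)) at_top"
  proof (rule integral_dominated_convergence_at_top)
    show "integrable std_normal_distribution (\<lambda>h. h\<^sup>2)" using integrable_std_normal_power[of 2] by simp
    show "\<forall>\<^sub>F x in at_top. AE h in std_normal_distribution. norm ((max h (- x))\<^sup>2) \<le> h\<^sup>2"
      using eventually_ge_at_top[of 0]
      by eventually_elim (use max_gauss_abs_le in \<open>auto intro: abs_le_square_iff[THEN iffD1]\<close>)
    show "AE h in std_normal_distribution. ((\<lambda>x. (max h (- x))\<^sup>2) \<longlongrightarrow> h\<^sup>2) at_top"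
    proof (rule AE_I2)
      fix h :: real
      have "\<forall>\<^sub>F x in at_top. (max h (- x))\<^sup>2 = h\<^sup>2"
        using eventually_ge_at_top[of "- h"] by eventually_elim (simp add: max_absorb1)
      then show "((\<lambda>x. (max h (- x))\<^sup>2) \<longlongrightarrow> h\<^sup>2) at_top" by (rule tendsto_eventually)
    qed
  qed auto
  then show ?thesis by (simp add: G_fun_eq[symmetric, abs_def] std_normal_second_moment)
qed

lemma G_fun_scaled:
  assumes "0 < s"
  shows "s\<^sup>2 * G_fun (x / s) = (\<integral>h. (max (s * h) (- x))\<^sup>2 \<partial>std_normal_distribution)"
    "integrable std_normal_distribution (\<lambda>h. (max (s * h) (- x))\<^sup>2)"
proof -
  have eq: "(max (s * h) (- x))\<^sup>2 = s\<^sup>2 * (max h (- (x / s)))\<^sup>2" for h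
  proof -
    have "max (s * h) (- x) = s * max h (- (x / s))"
      using assms by (simp add: max_mult_distrib_left)
    then show ?thesis by (simp add: power_mult_distrib)
  qed
  show "s\<^sup>2 * G_fun (x / s) = (\<integral>h. (max (s * h) (- x))\<^sup>2 \<partial>std_normal_distribution)"
    unfolding eq G_fun_eq by simp
  show "integrable std_normal_distribution (\<lambda>h. (max (s * h) (- x))\<^sup>2)"
    unfolding eq by (intro integrable_mult_right integrable_max_gauss)
qed

text \<open>True pointwise, as the absolute value of \<open>max (s * h) (- x)\<close> grows with s.
  Thus G(x / w) decreases in w while w^2 G(x / w) increases: the former makes the fixed point
  unique, the latter makes it monotone in the aspect ratio.\<close>

lemma G_fun_scaled_mono:
  assumes "0 \<le> x" "0 < s" "s \<le> t"
  shows "s\<^sup>2 * G_fun (x / s) \<le> t\<^sup>2 * G_fun (x / t)"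
proof -
  have t: "0 < t" using assms by simp
  show ?thesis
    unfolding G_fun_scaled[OF assms(2)] G_fun_scaled[OF t]
  proof (intro integral_mono G_fun_scaled(2) assms(2) t)
    fix h
    have "\<bar>max (s * h) (- x)\<bar> \<le> \<bar>max (t * h) (- x)\<bar>"
    proof (cases "0 \<le> h")
      case True
      then have "s * h \<le> t * h" "0 \<le> s * h" using assms by (auto intro: mult_right_mono)
      then show ?thesis using assms by (auto simp: max_def)
    next
      case False
      then have "t * h \<le> s * h" "s * h \<le> 0" using assms by (auto intro: mult_right_mono_neg mult_nonneg_nonpos)
      then show ?thesis using assms by (auto simp: max_def)
    qed
    then show "(max (s * h) (- x))\<^sup>2 \<le> (max (t * h) (- x))\<^sup>2" by (rule abs_le_square_iff[THEN iffD1])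
  qed
qed

section \<open>The fixed point equation\<close>

text \<open>Instantiated with the law of U, and also with the uniform distribution on the
  coordinates of a fixed signal, which brings \<open>r_signal\<close> under the same theory.\<close>

locale signal_law = prob_space D for D :: "'b measure" +
  fixes U :: "'b \<Rightarrow> real" and \<sigma> :: real
  assumes U [measurable]: "U \<in> borel_measurable D" and U_nonneg: "AE u in D. 0 \<le> U u" and \<sigma>: "0 < \<sigma>"
begin

definition EG :: "real \<Rightarrow> real" where "EG w = (\<integral>u. G_fun (U u / w) \<partial>D)"

definition E\<Phi> :: "real \<Rightarrow> real" where "E\<Phi> w = (\<integral>u. std_normal_cdf (U u / w) \<partial>D)"

text \<open>In the variable w = \<omega>(r) one has r^2 = \<delta> w^2 - \<sigma>^2, and division by
  w^2 turns the fixed point equation into \<open>ratio_at w = \<delta>\<close>. The left side is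
  free of \<delta> and strictly decreasing, which gives uniqueness and governs the dependence on
  \<delta>.\<close>

definition ratio_at :: "real \<Rightarrow> real" where "ratio_at w = EG w + \<sigma>\<^sup>2 / w\<^sup>2"

lemma AE_G_bounds: "0 < w \<Longrightarrow> AE u in D. 1 / 2 \<le> G_fun (U u / w) \<and> G_fun (U u / w) \<le> 1"
  using U_nonneg by eventually_elim (intro conjI G_fun_ge_half G_fun_le_1 divide_nonneg_nonneg, auto)

lemma integrable_G: "0 < w \<Longrightarrow> integrable D (\<lambda>u. G_fun (U u / w))"
  by (rule integrable_const_bound[where B=1]) (use AE_G_bounds[of w] in auto)

lemma integrable_cdf: "integrable D (\<lambda>u. std_normal_cdf (U u / w))"
  by (rule integrable_const_bound[where B=1]) (use std_normal_cdf_bounds in auto)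

lemma EG_bounds: assumes "0 < w" shows "1 / 2 \<le> EG w" "EG w \<le> 1"
  unfolding EG_def
  using integral_ge_const[OF integrable_G[OF assms], of "1 / 2"] integral_le_const[OF integrable_G[OF assms], of 1]
    AE_G_bounds[OF assms] by auto

lemma E\<Phi>_bounds: "0 \<le> E\<Phi> w" "E\<Phi> w \<le> 1"
  unfolding E\<Phi>_def
  using std_normal_cdf_bounds
  by (auto intro!: integral_nonneg_AE integral_le_const[OF integrable_cdf])

lemma EG_antimono: assumes "0 < w" "w \<le> w'" shows "EG w' \<le> EG w"
  unfolding EG_def
proof (rule integral_mono_AE)
  show "AE u in D. G_fun (U u / w') \<le> G_fun (U u / w)"
    using U_nonneg by eventually_elim (use assms in \<open>auto intro!: G_fun_mono divide_left_mono\<close>)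
qed (use assms integrable_G in auto)

lemma EG_scaled_mono: assumes "0 < w" "w \<le> w'" shows "w\<^sup>2 * EG w \<le> w'\<^sup>2 * EG w'"
proof -
  have w': "0 < w'" using assms by simp
  have "(\<integral>u. w\<^sup>2 * G_fun (U u / w) \<partial>D) \<le> (\<integral>u. w'\<^sup>2 * G_fun (U u / w') \<partial>D)"
  proof (rule integral_mono_AE)
    show "AE u in D. w\<^sup>2 * G_fun (U u / w) \<le> w'\<^sup>2 * G_fun (U u / w')"
      using U_nonneg by eventually_elim (intro G_fun_scaled_mono assms)
  qed (use assms w' integrable_G in auto)
  then show ?thesis by (simp add: EG_def)
qed

lemma isCont_EG: assumes "0 < w" shows "isCont EG w"
proof (rule continuous_at_sequentiallyI)
  fix X assume X: "X \<longlonglongrightarrow> w"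
  \<comment> \<open>A tail of the sequence stays positive, where the bounds on G hold.\<close>
  then have "eventually (\<lambda>n. w / 2 < X n) sequentially"
    using assms by (intro order_tendstoD) auto
  then obtain N where N: "\<And>n. n \<ge> N \<Longrightarrow> w / 2 < X n" by (auto simp: eventually_sequentially)
  have "(\<lambda>n. EG (X (n + N))) \<longlonglongrightarrow> EG w"
    unfolding EG_def
  proof (rule integral_dominated_convergence[where w="\<lambda>_. 1"])
    have XN: "(\<lambda>n. X (n + N)) \<longlonglongrightarrow> w" using X by (rule LIMSEQ_ignore_initial_segment)
    show "AE u in D. (\<lambda>n. G_fun (U u / X (n + N))) \<longlonglongrightarrow> G_fun (U u / w)"
      using assms by (intro AE_I2 isCont_tendsto_compose[OF isCont_G_fun] tendsto_intros XN) auto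
    fix n
    have "0 < X (n + N)" using N[of "n + N"] assms by simp
    from AE_G_bounds[OF this] show "AE u in D. norm (G_fun (U u / X (n + N))) \<le> 1" by auto
  qed auto
  then show "(\<lambda>n. EG (X n)) \<longlonglongrightarrow> EG w" by (rule LIMSEQ_offset)
qed

lemma isCont_E\<Phi>: assumes "0 < w" shows "isCont E\<Phi> w"
proof (rule continuous_at_sequentiallyI)
  fix X assume X: "X \<longlonglongrightarrow> w"
  show "(\<lambda>n. E\<Phi> (X n)) \<longlonglongrightarrow> E\<Phi> w"
    unfolding E\<Phi>_def
  proof (rule integral_dominated_convergence[where w="\<lambda>_. 1"])
    show "AE u in D. (\<lambda>n. std_normal_cdf (U u / X n)) \<longlonglongrightarrow> std_normal_cdf (U u / w)"
      using assms by (intro AE_I2 isCont_tendsto_compose[OF isCont_std_normal_cdf] tendsto_intros X) auto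
  qed (use std_normal_cdf_bounds in auto)
qed

lemma EG_at_top: "(EG \<longlongrightarrow> 1 / 2) at_top"
proof -
  have "((\<lambda>w. \<integral>u. G_fun (U u / w) \<partial>D) \<longlongrightarrow> (\<integral>u. G_fun 0 \<partial>D)) at_top"
  proof (rule integral_dominated_convergence_at_top[where w="\<lambda>_. 1"])
    show "\<forall>\<^sub>F w in at_top. AE u in D. norm (G_fun (U u / w)) \<le> 1"
      using eventually_gt_at_top[of 0]
    proof eventually_elim
      case (elim w)
      from AE_G_bounds[OF elim] show ?case by auto
    qed
    show "AE u in D. ((\<lambda>w. G_fun (U u / w)) \<longlongrightarrow> G_fun 0) at_top"
      by (intro AE_I2 isCont_tendsto_compose[OF isCont_G_fun] tendsto_divide_0[OF tendsto_const]
          filterlim_at_top_imp_at_infinity filterlim_ident)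
  qed auto
  then show ?thesis by (simp add: EG_def[abs_def] G_fun_0 prob_space)
qed

text \<open>As w tends to 0, U / w tends to infinity where U > 0 and stays 0 where U = 0; G takes
  there the values 1 in the limit and 1 / 2. This is the origin of the factor 1 - p_0 / 2.\<close>

lemma EG_at_0:
  "(EG \<longlongrightarrow> 1 - measure D {u \<in> space D. U u = 0} / 2) (at_right 0)"
proof -
  let ?p = "measure D {u \<in> space D. U u = 0}"
  let ?f = "\<lambda>u. 1 - indicator {u \<in> space D. U u = 0} u / 2"
  have "((\<lambda>t. \<integral>u. G_fun (U u * t) \<partial>D) \<longlongrightarrow> (\<integral>u. ?f u \<partial>D)) at_top"
  proof (rule integral_dominated_convergence_at_top[where w="\<lambda>_. 1"])
    show "\<forall>\<^sub>F w in at_top. AE u in D. norm (G_fun (U u * w)) \<le> 1"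
      using eventually_gt_at_top[of 0]
    proof eventually_elim
      case (elim w)
      then show ?case using AE_G_bounds[of "1 / w"] by auto
    qed
    show "AE u in D. ((\<lambda>w. G_fun (U u * w)) \<longlongrightarrow> ?f u) at_top"
      using U_nonneg AE_space
    proof eventually_elim
      case (elim u)
      show ?case
      proof (cases "U u = 0")
        case True
        then show ?thesis using elim by (simp add: G_fun_0)
      next
        case False
        then have "filterlim (\<lambda>w. U u * w) at_top at_top"
          using elim by (intro filterlim_tendsto_pos_mult_at_top[OF tendsto_const _ filterlim_ident]) auto
        from filterlim_compose[OF G_fun_tendsto_1 this] False show ?thesis by simp
      qed
    qed
  qed auto
  also have "(\<integral>u. ?f u \<partial>D) = 1 - ?p / 2"
  proof -
    have "{u \<in> space D. U u = 0} \<in> sets D" by measurable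
    then have "(\<integral>u. 1 - indicator E u / 2 \<partial>D) = 1 - prob E / 2" if "E = {u \<in> space D. U u = 0}" for E
      using that by (subst Bochner_Integration.integral_diff) (auto simp: prob_space less_top[symmetric] intro!: integrable_real_indicator)
    then show ?thesis by simp
  qed
  finally have lim: "((\<lambda>t. \<integral>u. G_fun (U u * t) \<partial>D) \<longlongrightarrow> 1 - ?p / 2) at_top" .
  have "((\<lambda>w. \<integral>u. G_fun (U u * inverse w) \<partial>D) \<longlongrightarrow> 1 - ?p / 2) (at_right 0)"
    by (rule filterlim_compose[OF lim filterlim_inverse_at_top_right])
  moreover have "EG = (\<lambda>w. \<integral>u. G_fun (U u * inverse w) \<partial>D)"
    by (rule ext) (simp only: EG_def divide_inverse)
  ultimately show ?thesis by (simp only:)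
qed

section \<open>Unique solvability of the fixed point equation\<close>

lemma ratio_at_strict:
  assumes "0 < w" "w < w'" shows "ratio_at w' < ratio_at w"
proof -
  have "w\<^sup>2 < w'\<^sup>2" "0 < w\<^sup>2" using assms by (auto intro!: power_strict_mono)
  then have "\<sigma>\<^sup>2 / w'\<^sup>2 < \<sigma>\<^sup>2 / w\<^sup>2" using \<sigma> by (intro divide_strict_left_mono mult_pos_pos) auto
  then show ?thesis using EG_antimono[of w w'] assms by (simp add: ratio_at_def)
qed

text \<open>The noise term makes \<open>ratio_at\<close> unbounded at 0, and at infinity
  \<open>ratio_at\<close> tends to 1 / 2, the value of G at 0; hence the threshold 1 / 2.\<close>

lemma ex1_ratio:
  assumes "1 / 2 < \<delta>"
  shows "\<exists>!w. 0 < w \<and> ratio_at w = \<delta>"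
proof -
  have "((\<lambda>w. EG w + \<sigma>\<^sup>2 / w\<^sup>2) \<longlongrightarrow> 1 / 2 + 0) at_top"
    by (intro tendsto_add EG_at_top tendsto_divide_0[OF tendsto_const] filterlim_at_top_imp_at_infinity
        filterlim_pow_at_top filterlim_ident) auto
  then have "\<forall>\<^sub>F w in at_top. EG w + \<sigma>\<^sup>2 / w\<^sup>2 < \<delta>"
    using assms by (intro order_tendstoD) auto
  from eventually_conj[OF this eventually_gt_at_top[of 0]]
  obtain b where b: "0 < b" "ratio_at b < \<delta>"
    by (auto simp: ratio_at_def dest: eventually_happens)
  \<comment> \<open>Small enough for the noise term alone to reach \<delta>.\<close>
  define a where "a = min b (\<sigma> / sqrt \<delta>)"
  have \<delta>: "0 < \<delta>" using assms by simp
  have a: "0 < a" "a \<le> b" "\<delta> \<le> ratio_at a"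
  proof -
    show "0 < a" "a \<le> b" using b \<sigma> \<delta> by (auto simp: a_def)
    have "a\<^sup>2 \<le> (\<sigma> / sqrt \<delta>)\<^sup>2" using \<open>0 < a\<close> by (intro power_mono) (auto simp: a_def)
    then have "a\<^sup>2 * \<delta> \<le> \<sigma>\<^sup>2" using \<delta> by (simp add: power_divide field_simps)
    then have "\<delta> \<le> \<sigma>\<^sup>2 / a\<^sup>2" using \<open>0 < a\<close> by (simp add: field_simps)
    then show "\<delta> \<le> ratio_at a" using EG_bounds[OF \<open>0 < a\<close>] by (simp add: ratio_at_def)
  qed
  have "\<exists>w\<ge>a. w \<le> b \<and> ratio_at w = \<delta>"
  proof (rule IVT2)
    show "\<forall>w. a \<le> w \<and> w \<le> b \<longrightarrow> isCont ratio_at w"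
      unfolding ratio_at_def[abs_def] using a by (auto intro!: continuous_intros isCont_EG)
  qed (use a b in auto)
  then obtain w where w: "a \<le> w" "ratio_at w = \<delta>" by auto
  show ?thesis
  proof (rule ex1I[of _ w])
    show "0 < w \<and> ratio_at w = \<delta>" using a w by simp
    fix v assume v: "0 < v \<and> ratio_at v = \<delta>"
    show "v = w"
      using ratio_at_strict[of v w] ratio_at_strict[of w v] v w a by (cases v w rule: linorder_cases) auto
  qed
qed

lemma omega_pos: "0 < \<delta> \<Longrightarrow> 0 < omega \<sigma> \<delta> r"
  using \<sigma> by (simp add: omega_def add_nonneg_pos)

lemma omega_sq: "0 < \<delta> \<Longrightarrow> (omega \<sigma> \<delta> r)\<^sup>2 = (r\<^sup>2 + \<sigma>\<^sup>2) / \<delta>"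
  by (simp add: omega_def)

lemma is_fixed_point_iff:
  assumes "0 < \<delta>"
  shows "is_fixed_point D U \<sigma> \<delta> r \<longleftrightarrow> ratio_at (omega \<sigma> \<delta> r) = \<delta>"
proof -
  let ?w = "omega \<sigma> \<delta> r"
  have w: "0 < ?w" by (rule omega_pos[OF assms])
  have r: "r\<^sup>2 = \<delta> * ?w\<^sup>2 - \<sigma>\<^sup>2" using omega_sq[OF assms, of r] assms by (simp add: field_simps)
  show ?thesis
    unfolding is_fixed_point_def ratio_at_def EG_def[symmetric] unfolding r
    using w by (auto simp: field_simps)
qed

lemma ex1_fixed_point:
  assumes "1 / 2 < \<delta>"
  shows "\<exists>!r. 0 < r \<and> is_fixed_point D U \<sigma> \<delta> r"
proof -
  have \<delta>: "0 < \<delta>" using assms by simp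
  obtain w where w: "0 < w" "ratio_at w = \<delta>" and uniq: "\<And>v. 0 < v \<Longrightarrow> ratio_at v = \<delta> \<Longrightarrow> v = w"
    using ex1_ratio[OF assms] by blast
  define r where "r = sqrt (w\<^sup>2 * EG w)"
  have EG: "0 < EG w" using EG_bounds[OF w(1)] by simp
  have r: "0 < r" "r\<^sup>2 = w\<^sup>2 * EG w" using w EG by (auto simp: r_def)
  have "r\<^sup>2 + \<sigma>\<^sup>2 = w\<^sup>2 * \<delta>" using w r by (simp add: ratio_at_def field_simps)
  then have om: "omega \<sigma> \<delta> r = w" using w \<delta> by (simp add: omega_def)
  show ?thesis
  proof (rule ex1I[of _ r])
    show "0 < r \<and> is_fixed_point D U \<sigma> \<delta> r" using r om w by (simp add: is_fixed_point_iff[OF \<delta>])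
    fix s assume s: "0 < s \<and> is_fixed_point D U \<sigma> \<delta> s"
    then have "omega \<sigma> \<delta> s = w" using uniq omega_pos[OF \<delta>] by (simp add: is_fixed_point_iff[OF \<delta>])
    then have "(omega \<sigma> \<delta> s)\<^sup>2 = (omega \<sigma> \<delta> r)\<^sup>2" using om by simp
    then have "s\<^sup>2 = r\<^sup>2" using \<delta> by (simp add: omega_sq field_simps)
    then show "s = r"
      by (rule power2_eq_imp_eq) (use s r(1) in simp_all)
  qed
qed

section \<open>Dependence of the fixed point on the aspect ratio\<close>

text \<open>The value of \<omega> at the fixed point. As a function of \<delta> it inverts
  \<open>ratio_at\<close>, so limits in \<delta> reduce to \<open>wroot_less_iff\<close>.\<close>

definition wroot :: "real \<Rightarrow> real" where "wroot \<delta> = omega \<sigma> \<delta> (r_plus D U \<sigma> \<delta>)"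

lemma r_plus_props:
  assumes "1 / 2 < \<delta>"
  shows "0 < r_plus D U \<sigma> \<delta>" "0 < wroot \<delta>" "ratio_at (wroot \<delta>) = \<delta>"
    "(r_plus D U \<sigma> \<delta>)\<^sup>2 = (wroot \<delta>)\<^sup>2 * EG (wroot \<delta>)"
    "(r_plus D U \<sigma> \<delta>)\<^sup>2 + \<sigma>\<^sup>2 = \<delta> * (wroot \<delta>)\<^sup>2"
proof -
  have \<delta>: "0 < \<delta>" using assms by simp
  have 1: "0 < r_plus D U \<sigma> \<delta> \<and> is_fixed_point D U \<sigma> \<delta> (r_plus D U \<sigma> \<delta>)"
    unfolding r_plus_def by (rule theI'[OF ex1_fixed_point[OF assms]])
  then show "0 < r_plus D U \<sigma> \<delta>" "0 < wroot \<delta>" "ratio_at (wroot \<delta>) = \<delta>"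
    using omega_pos[OF \<delta>] is_fixed_point_iff[OF \<delta>] unfolding wroot_def by blast+
  show "(r_plus D U \<sigma> \<delta>)\<^sup>2 = (wroot \<delta>)\<^sup>2 * EG (wroot \<delta>)"
    using 1 unfolding is_fixed_point_def wroot_def EG_def by simp
  show "(r_plus D U \<sigma> \<delta>)\<^sup>2 + \<sigma>\<^sup>2 = \<delta> * (wroot \<delta>)\<^sup>2"
    using omega_sq[OF \<delta>] \<delta> by (simp add: wroot_def)
qed

lemma wroot_less_iff:
  assumes "1 / 2 < \<delta>" "0 < w"
  shows "wroot \<delta> < w \<longleftrightarrow> ratio_at w < \<delta>" "w < wroot \<delta> \<longleftrightarrow> \<delta> < ratio_at w"
proof -
  note p = r_plus_props(2,3)[OF assms(1)]
  have 1: "ratio_at w < \<delta>" if "wroot \<delta> < w"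
    using ratio_at_strict[OF p(1) that] p(2) by simp
  have 2: "\<delta> < ratio_at w" if "w < wroot \<delta>"
    using ratio_at_strict[OF assms(2) that] p(2) by simp
  have 3: "ratio_at w = \<delta>" if "w = wroot \<delta>"
    unfolding that by (rule p(2))
  show "wroot \<delta> < w \<longleftrightarrow> ratio_at w < \<delta>" "w < wroot \<delta> \<longleftrightarrow> \<delta> < ratio_at w"
    using 1 2 3 by fastforce+
qed

lemma wroot_antimono:
  assumes "1 / 2 < \<delta>" "\<delta> \<le> \<delta>'" shows "wroot \<delta>' \<le> wroot \<delta>"
proof (rule ccontr)
  assume "\<not> ?thesis"
  then have "wroot \<delta> < wroot \<delta>'" by simp
  then have "ratio_at (wroot \<delta>') < ratio_at (wroot \<delta>)"
    by (rule ratio_at_strict[OF r_plus_props(2)[OF assms(1)]])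
  then show False using r_plus_props(3)[OF assms(1)] r_plus_props(3)[of \<delta>'] assms by linarith
qed

text \<open>From 1 / 2 \<le> \<open>EG\<close> \<le> 1. Errors of order \<omega>^2 are thus as good
  as errors of order r^2.\<close>

lemma r_plus_le_wroot:
  assumes "1 / 2 < \<delta>" shows "r_plus D U \<sigma> \<delta> \<le> wroot \<delta>" "(wroot \<delta>)\<^sup>2 \<le> 2 * (r_plus D U \<sigma> \<delta>)\<^sup>2"
proof -
  note p = r_plus_props[OF assms]
  have "(r_plus D U \<sigma> \<delta>)\<^sup>2 \<le> (wroot \<delta>)\<^sup>2"
    unfolding p(4) by (rule mult_left_le[OF EG_bounds(2)[OF p(2)] zero_le_power2])
  then show "r_plus D U \<sigma> \<delta> \<le> wroot \<delta>" by (rule power2_le_imp_le[OF _ less_imp_le[OF p(2)]])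
  have "(wroot \<delta>)\<^sup>2 * (1 / 2) \<le> (r_plus D U \<sigma> \<delta>)\<^sup>2"
    unfolding p(4) by (rule mult_left_mono[OF EG_bounds(1)[OF p(2)] zero_le_power2])
  then show "(wroot \<delta>)\<^sup>2 \<le> 2 * (r_plus D U \<sigma> \<delta>)\<^sup>2" by linarith
qed

text \<open>The square of r is w^2 \<open>EG w\<close>, which grows with w, and w =
  \<open>wroot \<delta>\<close> decreases in \<delta>.\<close>

lemma r_plus_antimono: "antimono_on {1 / 2<..} (r_plus D U \<sigma>)"
proof (rule monotone_onI)
  fix \<delta> \<delta>' :: real assume a: "\<delta> \<in> {1 / 2<..}" "\<delta>' \<in> {1 / 2<..}" "\<delta> \<le> \<delta>'"
  then have d: "1 / 2 < \<delta>" "1 / 2 < \<delta>'" by auto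
  have "(r_plus D U \<sigma> \<delta>')\<^sup>2 \<le> (r_plus D U \<sigma> \<delta>)\<^sup>2"
    unfolding r_plus_props(4)[OF d(1)] r_plus_props(4)[OF d(2)]
    using r_plus_props(2)[OF d(2)] wroot_antimono[OF d(1) a(3)] by (rule EG_scaled_mono)
  then show "r_plus D U \<sigma> \<delta>' \<le> r_plus D U \<sigma> \<delta>"
    by (rule power2_le_imp_le[OF _ less_imp_le[OF r_plus_props(1)[OF d(1)]]])
qed

lemma wroot_at_top: "(wroot \<longlongrightarrow> 0) at_top"
proof (rule order_tendstoI)
  fix a :: real assume a: "a < 0"
  show "\<forall>\<^sub>F \<delta> in at_top. a < wroot \<delta>"
    using eventually_gt_at_top[of "1 / 2"]
  proof eventually_elim
    case (elim \<delta>)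
    then show ?case using r_plus_props(2)[OF elim] a by simp
  qed
next
  fix a :: real assume a: "0 < a"
  show "\<forall>\<^sub>F \<delta> in at_top. wroot \<delta> < a"
    using eventually_gt_at_top[of "1 / 2"] eventually_gt_at_top[of "ratio_at a"]
    by eventually_elim (simp add: wroot_less_iff a)
qed

lemma r_plus_at_top: "(r_plus D U \<sigma> \<longlongrightarrow> 0) at_top"
proof (rule order_tendstoI)
  fix a :: real assume a: "a < 0"
  show "\<forall>\<^sub>F \<delta> in at_top. a < r_plus D U \<sigma> \<delta>"
    using eventually_gt_at_top[of "1 / 2"]
  proof eventually_elim
    case (elim \<delta>)
    then show ?case using r_plus_props(1)[OF elim] a by linarith
  qed
next
  fix a :: real assume "0 < a"
  from order_tendstoD(2)[OF wroot_at_top this] eventually_gt_at_top[of "1 / 2"]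
  show "\<forall>\<^sub>F \<delta> in at_top. r_plus D U \<sigma> \<delta> < a"
  proof eventually_elim
    case (elim \<delta>)
    then show ?case using r_plus_le_wroot(1)[OF elim(2)] by linarith
  qed
qed

lemma wroot_at_half: "filterlim wroot at_top (at_right (1 / 2))"
  unfolding filterlim_at_top_dense
proof
  fix Z :: real
  define W where "W = max Z 1"
  have W: "0 < W" by (simp add: W_def)
  have "1 / 2 < ratio_at W" 
  proof -
    have "0 < \<sigma>\<^sup>2 / W\<^sup>2" using \<sigma> W by simp
    then show ?thesis unfolding ratio_at_def using EG_bounds(1)[OF W] by linarith
  qed
  then have "\<forall>\<^sub>F \<delta> in at_right (1 / 2). \<delta> < ratio_at W"
    by (rule order_tendstoD(2)[OF tendsto_ident_at])
  moreover have "\<forall>\<^sub>F \<delta> in at_right (1 / 2). (1 / 2 :: real) < \<delta>"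
    by (rule eventually_at_right_less)
  ultimately show "\<forall>\<^sub>F \<delta> in at_right (1 / 2). Z < wroot \<delta>"
  proof eventually_elim
    case (elim \<delta>)
    then have "W < wroot \<delta>" using W by (simp add: wroot_less_iff)
    then show ?case by (simp add: W_def)
  qed
qed

lemma r_plus_at_half: "filterlim (r_plus D U \<sigma>) at_top (at_right (1 / 2))"
proof -
  have "filterlim (\<lambda>\<delta>. (1 / 2) * wroot \<delta>) at_top (at_right (1 / 2))"
    by (rule filterlim_tendsto_pos_mult_at_top[OF tendsto_const _ wroot_at_half]) simp
  moreover have "\<forall>\<^sub>F \<delta> in at_right (1 / 2). (1 / 2) * wroot \<delta> \<le> r_plus D U \<sigma> \<delta>"
    unfolding eventually_at_right_field
  proof (intro exI[of _ 1] conjI allI impI)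
    fix \<delta> :: real assume "1 / 2 < \<delta>"
    note p = r_plus_props[OF this] r_plus_le_wroot[OF this]
    have "((1 / 2) * wroot \<delta>)\<^sup>2 = (wroot \<delta>)\<^sup>2 / 4" by (simp add: power_mult_distrib power_divide)
    then have "((1 / 2) * wroot \<delta>)\<^sup>2 \<le> (r_plus D U \<sigma> \<delta>)\<^sup>2"
      using p(7) zero_le_power2[of "r_plus D U \<sigma> \<delta>"] by linarith
    then show "(1 / 2) * wroot \<delta> \<le> r_plus D U \<sigma> \<delta>"
      by (rule power2_le_imp_le[OF _ less_imp_le[OF p(1)]])
  qed simp
  ultimately show ?thesis by (rule filterlim_at_top_mono)
qed

lemma wroot_tendsto:
  assumes "1 / 2 < \<delta>" "X \<longlonglongrightarrow> \<delta>"
  shows "(\<lambda>n. wroot (X n)) \<longlonglongrightarrow> wroot \<delta>"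
proof -
  note p = r_plus_props[OF assms(1)]
  have X: "\<forall>\<^sub>F n in sequentially. 1 / 2 < X n" using assms by (rule order_tendstoD(1)[rotated])
  show ?thesis
  proof (rule order_tendstoI)
    fix a assume a: "a < wroot \<delta>"
    define b where "b = max a (wroot \<delta> / 2)"
    have b: "0 < b" "b < wroot \<delta>" using a p(2) by (auto simp: b_def)
    then have "\<delta> < ratio_at b" using wroot_less_iff(2)[OF assms(1) b(1)] by simp
    then have "\<forall>\<^sub>F n in sequentially. X n < ratio_at b" using assms(2) by (rule order_tendstoD(2)[rotated])
    with X show "\<forall>\<^sub>F n in sequentially. a < wroot (X n)"
    proof eventually_elim
      case (elim n)
      then have "b < wroot (X n)" using b by (simp add: wroot_less_iff)
      then show ?case by (simp add: b_def)
    qed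
  next
    fix a assume a: "wroot \<delta> < a"
    then have a0: "0 < a" using p(2) by simp
    then have "ratio_at a < \<delta>" using wroot_less_iff(1)[OF assms(1) a0] a by simp
    then have "\<forall>\<^sub>F n in sequentially. ratio_at a < X n" using assms(2) by (rule order_tendstoD(1)[rotated])
    with X show "\<forall>\<^sub>F n in sequentially. wroot (X n) < a"
      by eventually_elim (simp add: wroot_less_iff a0)
  qed
qed

lemma r_plus_tendsto:
  assumes "1 / 2 < \<delta>" "X \<longlonglongrightarrow> \<delta>"
  shows "(\<lambda>n. (r_plus D U \<sigma> (X n))\<^sup>2) \<longlonglongrightarrow> (r_plus D U \<sigma> \<delta>)\<^sup>2"
proof -
  note p = r_plus_props[OF assms(1)]
  have X: "\<forall>\<^sub>F n in sequentially. 1 / 2 < X n" using assms by (rule order_tendstoD(1)[rotated])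
  have "(\<lambda>n. (wroot (X n))\<^sup>2 * EG (wroot (X n))) \<longlonglongrightarrow> (wroot \<delta>)\<^sup>2 * EG (wroot \<delta>)"
    by (intro tendsto_intros isCont_tendsto_compose[OF isCont_EG[OF p(2)]] wroot_tendsto[OF assms])
  then show ?thesis
    unfolding p(4)
    by (rule Lim_transform_eventually) (use X in \<open>eventually_elim, simp add: r_plus_props(4)\<close>)
qed

lemma omega2_EH_eq:
  "omega2_EH D U \<sigma> \<delta> = (wroot \<delta>)\<^sup>2 * (E\<Phi> (wroot \<delta>) - EG (wroot \<delta>))" if "1 / 2 < \<delta>"
  unfolding omega2_EH_def wroot_def[symmetric] Let_def H_fun_def E\<Phi>_def EG_def
  using integrable_cdf integrable_G[OF r_plus_props(2)[OF that]] by simp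

lemma omega2_EH_tendsto:
  assumes "1 / 2 < \<delta>" "X \<longlonglongrightarrow> \<delta>"
  shows "(\<lambda>n. omega2_EH D U \<sigma> (X n)) \<longlonglongrightarrow> omega2_EH D U \<sigma> \<delta>"
proof -
  note p = r_plus_props[OF assms(1)]
  have X: "\<forall>\<^sub>F n in sequentially. 1 / 2 < X n" using assms by (rule order_tendstoD(1)[rotated])
  have "(\<lambda>n. (wroot (X n))\<^sup>2 * (E\<Phi> (wroot (X n)) - EG (wroot (X n)))) \<longlonglongrightarrow> (wroot \<delta>)\<^sup>2 * (E\<Phi> (wroot \<delta>) - EG (wroot \<delta>))"
    by (intro tendsto_intros isCont_tendsto_compose[OF isCont_EG[OF p(2)]]
        isCont_tendsto_compose[OF isCont_E\<Phi>[OF p(2)]] wroot_tendsto[OF assms])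
  then show ?thesis
    unfolding omega2_EH_eq[OF assms(1)]
    by (rule Lim_transform_eventually) (use X in \<open>eventually_elim, simp add: omega2_EH_eq\<close>)
qed

text \<open>Since \<delta> w^2 = r^2 + \<sigma>^2, the product r^2 \<delta> equals EG(w) (w^2 EG(w)
  + \<sigma>^2), and w tends to 0, where \<open>EG_at_0\<close> applies.\<close>

lemma r_plus_large_ratio:
  assumes "filterlim X at_top sequentially"
  shows "(\<lambda>n. (r_plus D U \<sigma> (X n))\<^sup>2 * X n / \<sigma>\<^sup>2) \<longlonglongrightarrow> 1 - measure D {u \<in> space D. U u = 0} / 2"
proof -
  let ?p = "measure D {u \<in> space D. U u = 0}"
  have X: "\<forall>\<^sub>F n in sequentially. 1 / 2 < X n" using assms by (rule filterlim_at_top_dense[THEN iffD1, rule_format])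
  have w: "(\<lambda>n. wroot (X n)) \<longlonglongrightarrow> 0" by (rule filterlim_compose[OF wroot_at_top assms])
  have "filterlim (\<lambda>n. wroot (X n)) (at_right 0) sequentially"
    unfolding filterlim_at
  proof
    show "\<forall>\<^sub>F n in sequentially. wroot (X n) \<in> {0<..} \<and> wroot (X n) \<noteq> 0"
      using X
    proof eventually_elim
      case (elim n)
      then show ?case using r_plus_props(2)[OF elim] by simp
    qed
  qed (rule w)
  then have E: "(\<lambda>n. EG (wroot (X n))) \<longlonglongrightarrow> 1 - ?p / 2" by (rule filterlim_compose[OF EG_at_0])
  have "(\<lambda>n. EG (wroot (X n)) * ((wroot (X n))\<^sup>2 * EG (wroot (X n)) + \<sigma>\<^sup>2) / \<sigma>\<^sup>2) \<longlonglongrightarrow> (1 - ?p / 2) * (0\<^sup>2 * (1 - ?p / 2) + \<sigma>\<^sup>2) / \<sigma>\<^sup>2"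
    using \<sigma> by (intro tendsto_intros E w) auto
  then have l: "(\<lambda>n. EG (wroot (X n)) * ((wroot (X n))\<^sup>2 * EG (wroot (X n)) + \<sigma>\<^sup>2) / \<sigma>\<^sup>2) \<longlonglongrightarrow> 1 - ?p / 2"
    using \<sigma> by simp
  show ?thesis
  proof (rule Lim_transform_eventually[OF l])
    show "\<forall>\<^sub>F n in sequentially. EG (wroot (X n)) * ((wroot (X n))\<^sup>2 * EG (wroot (X n)) + \<sigma>\<^sup>2) / \<sigma>\<^sup>2 = (r_plus D U \<sigma> (X n))\<^sup>2 * X n / \<sigma>\<^sup>2"
      using X
    proof eventually_elim
      case (elim n)
      note p = r_plus_props[OF elim]
      have "EG (wroot (X n)) * ((wroot (X n))\<^sup>2 * EG (wroot (X n)) + \<sigma>\<^sup>2) = EG (wroot (X n)) * (X n * (wroot (X n))\<^sup>2)"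
        using p(4,5) by simp
      also have "\<dots> = (r_plus D U \<sigma> (X n))\<^sup>2 * X n" unfolding p(4) by simp
      finally show ?case by simp
    qed
  qed
qed

end

section \<open>The comparison objective over the cone\<close>

lemma sqrt_diff_bound:
  assumes "0 \<le> x" "0 \<le> y" "0 < c" "c \<le> sqrt y"
  shows "\<bar>sqrt x - sqrt y\<bar> \<le> \<bar>x - y\<bar> / c"
proof -
  have "\<bar>x - y\<bar> = \<bar>sqrt x - sqrt y\<bar> * (sqrt x + sqrt y)"
  proof -
    have "x - y = (sqrt x - sqrt y) * (sqrt x + sqrt y)"
      using assms by (simp add: algebra_simps)
    then show ?thesis using assms by (simp add: abs_mult)
  qed
  also have "\<dots> \<ge> \<bar>sqrt x - sqrt y\<bar> * c"
    using assms by (intro mult_left_mono) (simp_all add: add_increasing)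
  finally show ?thesis using assms by (simp add: field_simps)
qed

text \<open>Each difference of roots is \<rho>^2 - r^2 divided by the sum of the two roots, and
  these sums differ by at most 2 e. The factor \<rho>^2 - r^2 survives, so the cost of replacing
  \<sigma> by s is small even against r^2.\<close>

lemma sqrt_shift_diff:
  assumes "0 < \<sigma>" "\<sigma> / 2 \<le> s" "\<bar>s - \<sigma>\<bar> \<le> e" "0 \<le> r" "0 \<le> \<rho>"
  shows "\<bar>(sqrt (\<rho>\<^sup>2 + s\<^sup>2) - sqrt (r\<^sup>2 + s\<^sup>2)) - (sqrt (\<rho>\<^sup>2 + \<sigma>\<^sup>2) - sqrt (r\<^sup>2 + \<sigma>\<^sup>2))\<bar>
    \<le> \<bar>\<rho>\<^sup>2 - r\<^sup>2\<bar> * e / \<sigma>\<^sup>2"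
proof -
  define d where "d s = sqrt (\<rho>\<^sup>2 + s\<^sup>2) + sqrt (r\<^sup>2 + s\<^sup>2)" for s
  have q: "sqrt (\<rho>\<^sup>2 + s\<^sup>2) - sqrt (r\<^sup>2 + s\<^sup>2) = (\<rho>\<^sup>2 - r\<^sup>2) / d s" if "0 < s" for s
  proof -
    have "0 < d s" using that by (auto simp: d_def intro!: add_pos_pos add_nonneg_pos)
    moreover have "(sqrt (\<rho>\<^sup>2 + s\<^sup>2) - sqrt (r\<^sup>2 + s\<^sup>2)) * d s = \<rho>\<^sup>2 - r\<^sup>2"
      by (simp add: d_def algebra_simps)
    ultimately show ?thesis by (simp add: field_simps)
  qed
  have ge: "2 * s \<le> d s" if "0 < s" for s
  proof -
    have "s \<le> sqrt (x\<^sup>2 + s\<^sup>2)" for x by (rule real_le_rsqrt) simp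
    from this[of \<rho>] this[of r] show ?thesis unfolding d_def by linarith
  qed
  have s: "0 < s" using assms by simp
  have lip: "\<bar>sqrt (x\<^sup>2 + s\<^sup>2) - sqrt (x\<^sup>2 + \<sigma>\<^sup>2)\<bar> \<le> \<bar>s - \<sigma>\<bar>" for x :: real
  proof -
    have "\<bar>norm (x, s) - norm (x, \<sigma>)\<bar> \<le> norm ((x, s) - (x, \<sigma>))" by (rule norm_triangle_ineq3)
    then show ?thesis by (simp add: norm_prod_def)
  qed
  have dd: "\<bar>d \<sigma> - d s\<bar> \<le> 2 * e"
    using lip[of \<rho>] lip[of r] assms(3) unfolding d_def by linarith
  have pos: "0 < d s" "0 < d \<sigma>" using ge[OF s] ge[OF assms(1)] s assms(1) by auto
  have "(\<rho>\<^sup>2 - r\<^sup>2) / d s - (\<rho>\<^sup>2 - r\<^sup>2) / d \<sigma> = (\<rho>\<^sup>2 - r\<^sup>2) * (d \<sigma> - d s) / (d s * d \<sigma>)"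
    using pos by (simp add: field_simps)
  then have "\<bar>(\<rho>\<^sup>2 - r\<^sup>2) / d s - (\<rho>\<^sup>2 - r\<^sup>2) / d \<sigma>\<bar> = \<bar>\<rho>\<^sup>2 - r\<^sup>2\<bar> * \<bar>d \<sigma> - d s\<bar> / (d s * d \<sigma>)"
    using pos by (simp add: abs_mult abs_divide)
  also have "\<dots> \<le> \<bar>\<rho>\<^sup>2 - r\<^sup>2\<bar> * (2 * e) / (\<sigma> * (2 * \<sigma>))"
    using pos dd ge[OF s] ge[OF assms(1)] assms
    by (intro frac_le mult_left_mono mult_mono mult_pos_pos) (auto intro!: mult_nonneg_nonneg)
  also have "\<dots> = \<bar>\<rho>\<^sup>2 - r\<^sup>2\<bar> * e / \<sigma>\<^sup>2" by (simp add: power2_eq_square)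
  finally show ?thesis unfolding q[OF s] q[OF assms(1)] .
qed

text \<open>The tangent of q(\<rho>) = sqrt (\<rho>^2 + \<sigma>^2) at r is \<tau> + r (\<rho> - r)
  / \<tau>. The gap above it is found by rationalising, since (q \<tau>)^2 - (r \<rho> +
  \<sigma>^2)^2 = \<sigma>^2 (r - \<rho>)^2; the denominator is at most 4 \<tau>^2 because \<rho>
  \<le> 2 r.\<close>

lemma sqrt_tangent_gap:
  assumes "0 < \<sigma>" "0 \<le> r" "0 \<le> \<rho>" "\<rho> \<le> 2 * r" "\<tau> = sqrt (r\<^sup>2 + \<sigma>\<^sup>2)"
  shows "\<sigma>\<^sup>2 * (r - \<rho>)\<^sup>2 / (4 * \<tau> ^ 3) \<le> sqrt (\<rho>\<^sup>2 + \<sigma>\<^sup>2) - \<tau> + (r\<^sup>2 - r * \<rho>) / \<tau>"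
proof -
  define q where "q = sqrt (\<rho>\<^sup>2 + \<sigma>\<^sup>2)"
  have \<tau>: "0 < \<tau>" "\<tau>\<^sup>2 = r\<^sup>2 + \<sigma>\<^sup>2" using assms by (auto simp: add_nonneg_pos)
  have q: "0 < q" "q\<^sup>2 = \<rho>\<^sup>2 + \<sigma>\<^sup>2" using assms by (auto simp: q_def add_nonneg_pos)
  define S where "S = q * \<tau> + (r * \<rho> + \<sigma>\<^sup>2)"
  have S: "0 < S" using q \<tau> assms by (auto simp: S_def intro!: add_pos_nonneg)
  have "\<rho>\<^sup>2 \<le> (2 * r)\<^sup>2" using assms by (intro power_mono) auto
  moreover have "(2 * r)\<^sup>2 = 4 * r\<^sup>2" "(2 * \<tau>)\<^sup>2 = 4 * \<tau>\<^sup>2"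
    by (simp_all add: power_mult_distrib)
  ultimately have "q\<^sup>2 \<le> (2 * \<tau>)\<^sup>2"
    using zero_le_power2[of \<sigma>] q(2) \<tau>(2) by linarith
  then have q2: "q \<le> 2 * \<tau>" by (rule power2_le_imp_le) (use \<tau> in simp)
  have "r * \<rho> \<le> r * (2 * r)" using assms by (intro mult_left_mono) auto
  moreover have "r * (2 * r) = 2 * r\<^sup>2" by (simp add: power2_eq_square)
  ultimately have "r * \<rho> + \<sigma>\<^sup>2 \<le> 2 * \<tau>\<^sup>2" using \<tau>(2) zero_le_power2[of \<sigma>] by linarith
  moreover have "q * \<tau> \<le> 2 * \<tau> * \<tau>" using q2 \<tau> by (intro mult_right_mono) auto
  ultimately have S2: "S \<le> 4 * \<tau>\<^sup>2" by (simp add: S_def power2_eq_square)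
  have "(q * \<tau>)\<^sup>2 - (r * \<rho> + \<sigma>\<^sup>2)\<^sup>2 = \<sigma>\<^sup>2 * (r - \<rho>)\<^sup>2"
    unfolding power_mult_distrib q(2) \<tau>(2) by (simp add: power2_eq_square algebra_simps)
  then have "(q * \<tau> - (r * \<rho> + \<sigma>\<^sup>2)) * S = \<sigma>\<^sup>2 * (r - \<rho>)\<^sup>2"
    by (simp add: S_def power2_eq_square algebra_simps)
  then have eq: "q * \<tau> - (r * \<rho> + \<sigma>\<^sup>2) = \<sigma>\<^sup>2 * (r - \<rho>)\<^sup>2 / S" using S by (simp add: field_simps)
  have "\<sigma>\<^sup>2 * (r - \<rho>)\<^sup>2 / (4 * \<tau>\<^sup>2) \<le> \<sigma>\<^sup>2 * (r - \<rho>)\<^sup>2 / S"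
    using S S2 \<tau> by (intro divide_left_mono) auto
  then have "\<sigma>\<^sup>2 * (r - \<rho>)\<^sup>2 / (4 * \<tau>\<^sup>2) / \<tau> \<le> (q * \<tau> - (r * \<rho> + \<sigma>\<^sup>2)) / \<tau>"
    unfolding eq using \<tau> by (intro divide_right_mono) auto
  also have "(q * \<tau> - (r * \<rho> + \<sigma>\<^sup>2)) / \<tau> = q - (r * \<rho> + \<sigma>\<^sup>2) / \<tau>" using \<tau> by (simp add: field_simps)
  also have "\<dots> = q - \<tau> + (r\<^sup>2 - r * \<rho>) / \<tau>"
  proof -
    have "\<tau> = (r\<^sup>2 + \<sigma>\<^sup>2) / \<tau>" using \<tau> by (simp add: field_simps power2_eq_square)
    then show ?thesis by (simp add: diff_divide_distrib add_divide_distrib)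
  qed
  finally show ?thesis by (simp add: q_def power2_eq_square power3_eq_cube mult_ac)
qed

text \<open>
  Here \<open>t\<close> stands for \<open>\<omega>\<close> at the fixed point \<open>r\<close>, \<open>s\<close> for the empirical noise level, \<open>P\<close> for the
  displacement of the projection of \<open>\<mu> - t h\<close> onto the cone, and \<open>base\<close> for the limiting value of
  the comparison objective, where \<open>\<Phi>\<close> approximates the mean of \<open>\<Phi>(\<mu>\<^sub>j / t)\<close>.
\<close>

locale scalar_problem =
  fixes m n :: nat and \<sigma> r t \<Phi> e s :: real and \<mu> y :: "nat \<Rightarrow> real" and b :: "nat + nat \<Rightarrow> real"
  assumes mn: "0 < m" "0 < n" and \<sigma>: "0 < \<sigma>" and r: "0 < r" and t: "0 < t" and e: "0 < e" "e < 1"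
    and rt: "r\<^sup>2 \<le> t\<^sup>2" "t\<^sup>2 \<le> 2 * r\<^sup>2" and tau: "r\<^sup>2 + \<sigma>\<^sup>2 = real m / real n * t\<^sup>2"
    and \<mu>: "\<And>j. j < n \<Longrightarrow> 0 \<le> \<mu> j"
    and s: "s = nrm m y / sqrt (real m)" "\<sigma> / 2 \<le> s" "\<bar>s - \<sigma>\<bar> \<le> e"
begin

definition "\<tau> = sqrt (r\<^sup>2 + \<sigma>\<^sup>2)"

definition "base = sqrt (r\<^sup>2 + s\<^sup>2) - t\<^sup>2 * \<Phi> / \<tau>"

definition "P j = max (- t * b (Inr j)) (- \<mu> j)"

text \<open>Laws of large numbers for |g|^2, g . y, |P|^2 and P . h, where g and h are the halves of
  b. The powers of t in the last two are the natural scale of P. The tolerance for g . y carries a t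
  because this term is multiplied by some \<rho> \<le> 2 t and has to end up of order e t^2.\<close>

definition concentrated :: bool where
  "concentrated \<longleftrightarrow> \<bar>ip m (\<lambda>i. b (Inl i)) (\<lambda>i. b (Inl i)) - real m\<bar> \<le> e * real m \<and>
     \<bar>ip m (\<lambda>i. b (Inl i)) y\<bar> \<le> e * t * real m \<and>
     \<bar>ip n P P - real n * r\<^sup>2\<bar> \<le> e * t\<^sup>2 * real n \<and>
     \<bar>ip n P (\<lambda>j. b (Inr j)) + real n * t * \<Phi>\<bar> \<le> e * t * real n"

text \<open>The comparison is made for a matrix with standard normal entries, so displacements of
  the signal are divided by sqrt n.\<close>

definition "w_opt j = P j / sqrt (real n)"

lemma tau_pos: "0 < \<tau>" "\<tau>\<^sup>2 = r\<^sup>2 + \<sigma>\<^sup>2" "\<sigma> \<le> \<tau>" "sqrt (real n) / sqrt (real m) = t / \<tau>"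
proof -
  show p: "0 < \<tau>" "\<tau>\<^sup>2 = r\<^sup>2 + \<sigma>\<^sup>2" using r \<sigma> by (auto simp: \<tau>_def add_pos_pos)
  show "\<sigma> \<le> \<tau>" unfolding \<tau>_def by (rule real_le_rsqrt) simp
  have "(sqrt (real n) / sqrt (real m))\<^sup>2 = (t / \<tau>)\<^sup>2"
    unfolding power_divide p(2) tau using mn t by simp
  then show "sqrt (real n) / sqrt (real m) = t / \<tau>"
    by (rule power2_eq_imp_eq) (use mn t p in auto)
qed

lemma rt': "r \<le> t"
  by (rule power2_le_imp_le[OF rt(1)]) (use t in simp)

text \<open>Expand the square: |\<rho> g - y|^2 / m is close to \<rho>^2 + s^2. With \<rho> \<le> 2
  t both error terms are at most 4 e t^2, and as the root of the limit is at least \<sigma> / 2,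
  taking roots costs a factor 2 / \<sigma>; together 16.\<close>

lemma residual_approx:
  assumes concentrated and "0 \<le> \<rho>" "\<rho> \<le> 2 * r"
  shows "\<bar>nrm m (\<lambda>i. \<rho> * b (Inl i) - y i) / sqrt (real m) - sqrt (\<rho>\<^sup>2 + s\<^sup>2)\<bar> \<le> 16 * e * t\<^sup>2 / \<sigma>"
proof -
  let ?g = "\<lambda>i. b (Inl i)"
  define x where "x = ip m (\<lambda>i. \<rho> * b (Inl i) - y i) (\<lambda>i. \<rho> * b (Inl i) - y i) / real m"
  have m: "0 < real m" using mn by simp
  have x: "nrm m (\<lambda>i. \<rho> * b (Inl i) - y i) / sqrt (real m) = sqrt x"
    unfolding x_def L2_set_def real_sqrt_divide by (simp add: power2_eq_square)
  have "ip m (\<lambda>i. \<rho> * b (Inl i) - y i) (\<lambda>i. \<rho> * b (Inl i) - y i)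
      = \<rho>\<^sup>2 * ip m ?g ?g - 2 * \<rho> * ip m ?g y + ip m y y"
  proof -
    have "(\<rho> * ?g i - y i) * (\<rho> * ?g i - y i) = \<rho>\<^sup>2 * (?g i * ?g i) - 2 * \<rho> * (?g i * y i) + y i * y i" for i
      by (simp add: algebra_simps power2_eq_square)
    then show ?thesis by (simp add: sum.distrib sum_subtractf sum_distrib_left)
  qed
  moreover have sy: "ip m y y = s\<^sup>2 * real m"
    unfolding s(1) power_divide nrm_sq using m by simp
  ultimately have "x - (\<rho>\<^sup>2 + s\<^sup>2) = \<rho>\<^sup>2 * ((ip m ?g ?g - real m) / real m) - 2 * \<rho> * (ip m ?g y / real m)"
    using m by (simp add: x_def add_divide_distrib diff_divide_distrib right_diff_distrib)
  also have "\<bar>\<dots>\<bar> \<le> \<rho>\<^sup>2 * e + 2 * \<rho> * (e * t)"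
  proof -
    have 1: "\<bar>(ip m ?g ?g - real m) / real m\<bar> \<le> e" "\<bar>ip m ?g y / real m\<bar> \<le> e * t"
      using assms(1) m by (auto simp: concentrated_def abs_divide field_simps)
    have "\<bar>\<rho>\<^sup>2 * ((ip m ?g ?g - real m) / real m)\<bar> \<le> \<rho>\<^sup>2 * e"
      unfolding abs_mult using 1(1) by (intro mult_mono) auto
    moreover have "\<bar>2 * \<rho> * (ip m ?g y / real m)\<bar> \<le> 2 * \<rho> * (e * t)"
      unfolding abs_mult using 1(2) assms(2) by (intro mult_mono) auto
    ultimately show ?thesis by linarith
  qed
  also have "\<dots> \<le> 8 * e * t\<^sup>2"
  proof -
    have \<rho>: "\<rho> \<le> 2 * t" using assms(3) rt' by simp
    have "\<rho>\<^sup>2 * e \<le> (2 * t)\<^sup>2 * e" using \<rho> assms(2) e by (intro mult_right_mono power_mono) auto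
    moreover have "2 * \<rho> * (e * t) \<le> 2 * (2 * t) * (e * t)" using \<rho> e t by (intro mult_right_mono) auto
    ultimately show ?thesis by (simp add: power2_eq_square algebra_simps)
  qed
  finally have d: "\<bar>x - (\<rho>\<^sup>2 + s\<^sup>2)\<bar> \<le> 8 * e * t\<^sup>2" .
  have s2: "\<sigma> / 2 \<le> sqrt (\<rho>\<^sup>2 + s\<^sup>2)"
  proof -
    have "s \<le> sqrt (\<rho>\<^sup>2 + s\<^sup>2)" by (rule real_le_rsqrt) simp
    then show ?thesis using s(2) by linarith
  qed
  have "\<bar>sqrt x - sqrt (\<rho>\<^sup>2 + s\<^sup>2)\<bar> \<le> \<bar>x - (\<rho>\<^sup>2 + s\<^sup>2)\<bar> / (\<sigma> / 2)"
    using m \<sigma> by (intro sqrt_diff_bound s2) (auto simp: x_def sum_nonneg)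
  also have "\<dots> \<le> 8 * e * t\<^sup>2 / (\<sigma> / 2)"
    using \<sigma> by (intro divide_right_mono d) auto
  finally show ?thesis unfolding x by simp
qed

lemma w_opt_bounds:
  assumes concentrated
  shows "nrm n w_opt \<le> r + e * t\<^sup>2 / (2 * r)" "\<bar>(nrm n w_opt)\<^sup>2 - r\<^sup>2\<bar> \<le> e * t\<^sup>2" "nrm n w_opt < 2 * r"
    "\<bar>ip n w_opt (\<lambda>j. b (Inr j)) / sqrt (real m) + t\<^sup>2 * \<Phi> / \<tau>\<bar> \<le> e * t\<^sup>2 / \<tau>"
proof -
  have n: "0 < real n" using mn by simp
  have "(nrm n w_opt)\<^sup>2 = ip n P P / real n"
    unfolding nrm_sq w_opt_def using n by (simp add: sum_divide_distrib)
  moreover have "\<bar>ip n P P - real n * r\<^sup>2\<bar> \<le> e * t\<^sup>2 * real n" using assms by (simp add: concentrated_def)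
  moreover have "ip n P P / real n - r\<^sup>2 = (ip n P P - real n * r\<^sup>2) / real n"
    using n by (simp add: diff_divide_distrib)
  ultimately show 2: "\<bar>(nrm n w_opt)\<^sup>2 - r\<^sup>2\<bar> \<le> e * t\<^sup>2"
    using n by (simp add: abs_divide pos_divide_le_eq)
  have "(r + e * t\<^sup>2 / (2 * r))\<^sup>2 = r\<^sup>2 + e * t\<^sup>2 + (e * t\<^sup>2 / (2 * r))\<^sup>2"
    using r by (simp add: power2_sum)
  then have "(nrm n w_opt)\<^sup>2 \<le> (r + e * t\<^sup>2 / (2 * r))\<^sup>2" using 2 zero_le_power2[of "e * t\<^sup>2 / (2 * r)"] by linarith
  then show "nrm n w_opt \<le> r + e * t\<^sup>2 / (2 * r)"
    by (rule power2_le_imp_le) (use r e in auto)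
  \<comment> \<open>The square of the norm is then at most 3 r^2.\<close>
  have "e * t\<^sup>2 \<le> 1 * (2 * r\<^sup>2)" using e rt by (intro mult_mono) auto
  then have "(nrm n w_opt)\<^sup>2 < (2 * r)\<^sup>2" using 2 r by (simp add: power_mult_distrib) (smt (verit) zero_less_power)
  then show "nrm n w_opt < 2 * r" by (rule power2_less_imp_less) (use r in simp)
  have "ip n w_opt (\<lambda>j. b (Inr j)) = ip n P (\<lambda>j. b (Inr j)) / sqrt (real n)"
    by (simp add: w_opt_def sum_divide_distrib)
  then have "ip n w_opt (\<lambda>j. b (Inr j)) / sqrt (real m) = (ip n P (\<lambda>j. b (Inr j)) / real n) * (sqrt (real n) / sqrt (real m))"
  proof -
    have "x / q / Q = (x / (q * q)) * (q / Q)" if "0 < q" for x q Q :: real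
      using that by simp
    from this[of "sqrt (real n)" "ip n P (\<lambda>j. b (Inr j))" "sqrt (real m)"] n
      \<open>ip n w_opt (\<lambda>j. b (Inr j)) = _\<close> show ?thesis by simp
  qed
  also have "\<dots> = (ip n P (\<lambda>j. b (Inr j)) / real n) * (t / \<tau>)" by (simp only: tau_pos(4))
  finally have eq: "ip n w_opt (\<lambda>j. b (Inr j)) / sqrt (real m) = ip n P (\<lambda>j. b (Inr j)) / real n * (t / \<tau>)" .
  have "ip n w_opt (\<lambda>j. b (Inr j)) / sqrt (real m) + t\<^sup>2 * \<Phi> / \<tau>
      = (ip n P (\<lambda>j. b (Inr j)) + real n * t * \<Phi>) / real n * (t / \<tau>)"
    unfolding eq using n by (simp add: add_divide_distrib distrib_right power2_eq_square)
  also have "\<bar>\<dots>\<bar> \<le> (e * t) * (t / \<tau>)"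
  proof -
    have "\<bar>(ip n P (\<lambda>j. b (Inr j)) + real n * t * \<Phi>) / real n\<bar> \<le> e * t"
      using assms n by (simp add: concentrated_def abs_divide field_simps)
    then show ?thesis unfolding abs_mult[of _ "t / \<tau>"] using t tau_pos(1) e by (intro mult_mono) auto
  qed
  finally show "\<bar>ip n w_opt (\<lambda>j. b (Inr j)) / sqrt (real m) + t\<^sup>2 * \<Phi> / \<tau>\<bar> \<le> e * t\<^sup>2 / \<tau>"
    by (simp add: power2_eq_square)
qed

text \<open>Variational inequality: \<open>w_opt\<close> is the rescaled displacement of the projection of \<open>\<mu> - t h\<close> onto the cone.\<close>

lemma kkt:
  assumes "\<And>j. j < n \<Longrightarrow> - \<mu> j \<le> sqrt (real n) * w j"
  shows "ip n w_opt (\<lambda>j. b (Inr j)) / sqrt (real m) + ((nrm n w_opt)\<^sup>2 - nrm n w_opt * nrm n w) / \<tau>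
    \<le> ip n w (\<lambda>j. b (Inr j)) / sqrt (real m)"
proof -
  define q where "q = sqrt (real n)"
  let ?q = q and ?h = "\<lambda>j. b (Inr j)"
  have q: "0 < ?q" using mn by (simp add: q_def)
  have P: "P j = ?q * w_opt j" for j using q by (simp add: w_opt_def q_def)
  \<comment> \<open>Coordinatewise: either the constraint is inactive and P + t h = 0, or P = -
    \<mu> and both factors are nonnegative.\<close>
  have "0 \<le> (P j + t * ?h j) * (?q * w j - P j)" if "j < n" for j
  proof (cases "P j = - t * ?h j")
    case False
    then have "P j = - \<mu> j" "- t * ?h j \<le> - \<mu> j" by (auto simp: P_def max_def split: if_splits)
    then show ?thesis using assms[OF that] unfolding q_def[symmetric] by (intro mult_nonneg_nonneg) auto
  qed simp
  then have "0 \<le> (\<Sum>j<n. (P j + t * ?h j) * (?q * w j - P j))" by (intro sum_nonneg) auto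
  also have "\<dots> = ?q\<^sup>2 * ip n w_opt w - ?q\<^sup>2 * ip n w_opt w_opt + t * ?q * ip n w ?h - t * ?q * ip n w_opt ?h"
  proof -
    have "(P j + t * ?h j) * (?q * w j - P j) = ?q\<^sup>2 * (w_opt j * w j) - ?q\<^sup>2 * (w_opt j * w_opt j)
        + t * ?q * (w j * ?h j) - t * ?q * (w_opt j * ?h j)" for j
      unfolding P by (simp add: algebra_simps power2_eq_square)
    then show ?thesis by (simp add: sum.distrib sum_subtractf sum_distrib_left)
  qed
  finally have "0 \<le> ?q * (?q * (ip n w_opt w - ip n w_opt w_opt) + t * (ip n w ?h - ip n w_opt ?h))"
    by (simp add: algebra_simps power2_eq_square)
  then have "0 \<le> ?q * (ip n w_opt w - ip n w_opt w_opt) + t * (ip n w ?h - ip n w_opt ?h)"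
    using q by (simp add: zero_le_mult_iff)
  then have "0 \<le> (?q * (ip n w_opt w - ip n w_opt w_opt) + t * (ip n w ?h - ip n w_opt ?h)) / (t * sqrt (real m))"
    using t by (intro divide_nonneg_nonneg) auto
  also have "\<dots> = (?q / sqrt (real m)) / t * (ip n w_opt w - ip n w_opt w_opt) + (ip n w ?h - ip n w_opt ?h) / sqrt (real m)"
  proof -
    have "(x * A + t * B) / (t * Q) = x / Q / t * A + B / Q" if "0 < Q" for x A B Q :: real
      using t that by (simp add: field_simps)
    from this[of "sqrt (real m)"] show ?thesis using mn by simp
  qed
  also have "(?q / sqrt (real m)) / t = 1 / \<tau>" unfolding q_def tau_pos(4) using t by simp
  finally have 1: "(ip n w_opt w_opt - ip n w_opt w) / \<tau> \<le> ip n w ?h / sqrt (real m) - ip n w_opt ?h / sqrt (real m)"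
    by (simp add: diff_divide_distrib)
  have "ip n w_opt w \<le> nrm n w_opt * nrm n w" by (rule ip_le_nrm)
  then have "((nrm n w_opt)\<^sup>2 - nrm n w_opt * nrm n w) / \<tau> \<le> (ip n w_opt w_opt - ip n w_opt w) / \<tau>"
    unfolding nrm_sq using tau_pos(1) by (intro divide_right_mono) auto
  with 1 show ?thesis by linarith
qed

text \<open>By \<open>kkt\<close> the linear part stays above its value at \<open>w_opt\<close> plus
  a term affine in |w|, which matches the tangent of the norm part at r; what remains is the gap of
  \<open>sqrt_tangent_gap\<close>. Errors: 16 from the residual, 3 from \<open>w_opt\<close> and its
  norm, 3 / \<sigma>^2 from replacing \<sigma> by s. The 22 is rounded up and shared with the upper
  bound.\<close>

lemma gordon_obj_lower:
  assumes concentrated and w: "\<And>j. j < n \<Longrightarrow> - \<mu> j \<le> sqrt (real n) * w j" and \<rho>: "nrm n w \<le> 2 * r"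
  shows "base + \<sigma>\<^sup>2 * (r - nrm n w)\<^sup>2 / (4 * \<tau> ^ 3) - (22 / \<sigma> + 3 / \<sigma>\<^sup>2) * e * t\<^sup>2
    \<le> gordon_obj m n y b w / sqrt (real m)"
proof -
  define \<rho>' where "\<rho>' = nrm n w"
  have \<rho>': "0 \<le> \<rho>'" "\<rho>' \<le> 2 * r" using \<rho> by (auto simp: \<rho>'_def)
  note wf = w_opt_bounds[OF assms(1)]
  have a: "sqrt (\<rho>'\<^sup>2 + s\<^sup>2) - 16 * e * t\<^sup>2 / \<sigma> \<le> nrm m (\<lambda>i. \<rho>' * b (Inl i) - y i) / sqrt (real m)"
    using residual_approx[OF assms(1) \<rho>'] by linarith
  have "\<bar>\<rho>'\<^sup>2 - r\<^sup>2\<bar> \<le> 3 * t\<^sup>2"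
  proof -
    have "\<rho>'\<^sup>2 \<le> (2 * r)\<^sup>2" using \<rho>' by (intro power_mono) auto
    then have "\<rho>'\<^sup>2 \<le> 4 * r\<^sup>2" by (simp add: power_mult_distrib)
    then show ?thesis using rt(1) zero_le_power2[of \<rho>'] zero_le_power2[of r] unfolding abs_le_iff by linarith
  qed
  then have "\<bar>\<rho>'\<^sup>2 - r\<^sup>2\<bar> * e / \<sigma>\<^sup>2 \<le> 3 * t\<^sup>2 * e / \<sigma>\<^sup>2"
    using e by (intro divide_right_mono mult_right_mono) auto
  then have c: "sqrt (\<rho>'\<^sup>2 + \<sigma>\<^sup>2) - \<tau> - 3 * t\<^sup>2 * e / \<sigma>\<^sup>2 \<le> sqrt (\<rho>'\<^sup>2 + s\<^sup>2) - sqrt (r\<^sup>2 + s\<^sup>2)"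
    using sqrt_shift_diff[OF \<sigma> s(2,3) _ \<rho>'(1), of r] r unfolding \<tau>_def by linarith
  have d: "\<sigma>\<^sup>2 * (r - \<rho>')\<^sup>2 / (4 * \<tau> ^ 3) \<le> sqrt (\<rho>'\<^sup>2 + \<sigma>\<^sup>2) - \<tau> + (r\<^sup>2 - r * \<rho>') / \<tau>"
    by (rule sqrt_tangent_gap[OF \<sigma> _ \<rho>' \<tau>_def]) (use r in simp)
  have "nrm n w_opt * \<rho>' \<le> (r + e * t\<^sup>2 / (2 * r)) * \<rho>'"
    using wf(1) \<rho>'(1) by (rule mult_right_mono)
  also have "\<dots> = r * \<rho>' + e * t\<^sup>2 / (2 * r) * \<rho>'" by (simp add: algebra_simps)
  also have "e * t\<^sup>2 / (2 * r) * \<rho>' \<le> e * t\<^sup>2 / (2 * r) * (2 * r)"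
    using \<rho>'(2) e r by (intro mult_left_mono) auto
  also have "e * t\<^sup>2 / (2 * r) * (2 * r) = e * t\<^sup>2" using r by simp
  finally have "r\<^sup>2 - r * \<rho>' - 2 * e * t\<^sup>2 \<le> (nrm n w_opt)\<^sup>2 - nrm n w_opt * \<rho>'"
    using wf(2) by linarith
  then have "(r\<^sup>2 - r * \<rho>' - 2 * e * t\<^sup>2) / \<tau> \<le> ((nrm n w_opt)\<^sup>2 - nrm n w_opt * \<rho>') / \<tau>"
    using tau_pos(1) by (intro divide_right_mono) auto
  moreover have "(r\<^sup>2 - r * \<rho>' - 2 * e * t\<^sup>2) / \<tau> = (r\<^sup>2 - r * \<rho>') / \<tau> - 2 * (e * t\<^sup>2 / \<tau>)"
    by (simp add: diff_divide_distrib)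
  ultimately have f: "(r\<^sup>2 - r * \<rho>') / \<tau> - 2 * (e * t\<^sup>2 / \<tau>) - e * t\<^sup>2 / \<tau> - t\<^sup>2 * \<Phi> / \<tau> \<le> ip n w (\<lambda>j. b (Inr j)) / sqrt (real m)"
    using kkt[OF w] wf(4) unfolding \<rho>'_def[symmetric] abs_le_iff by linarith
  have g: "e * t\<^sup>2 / \<tau> \<le> e * t\<^sup>2 / \<sigma>" using tau_pos(3) \<sigma> e by (intro divide_left_mono mult_pos_pos) (use tau_pos(1) in auto)
  define E K where "E = e * t\<^sup>2 / \<sigma>" and "K = 3 * t\<^sup>2 * e / \<sigma>\<^sup>2"
  have h: "(22 / \<sigma> + 3 / \<sigma>\<^sup>2) * e * t\<^sup>2 = 22 * E + K" "16 * e * t\<^sup>2 / \<sigma> = 16 * E"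
    using \<sigma> by (simp_all add: field_simps E_def K_def)
  have k: "0 \<le> e * t\<^sup>2 / \<sigma>" using e \<sigma> by simp
  have "gordon_obj m n y b w / sqrt (real m) = nrm m (\<lambda>i. \<rho>' * b (Inl i) - y i) / sqrt (real m) + ip n w (\<lambda>j. b (Inr j)) / sqrt (real m)"
    by (simp add: gordon_obj_def \<rho>'_def add_divide_distrib)
  then show ?thesis using a c d f g k unfolding base_def \<rho>'_def[symmetric] h E_def[symmetric] K_def[symmetric] by linarith
qed

lemma gordon_obj_upper:
  assumes concentrated
  shows "gordon_obj m n y b w_opt / sqrt (real m) \<le> base + (22 / \<sigma> + 3 / \<sigma>\<^sup>2) * e * t\<^sup>2"
proof -
  define \<rho>' where "\<rho>' = nrm n w_opt"
  note wf = w_opt_bounds[OF assms(1), folded \<rho>'_def]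
  have \<rho>': "0 \<le> \<rho>'" "\<rho>' \<le> 2 * r" using wf(3) by (auto simp: \<rho>'_def)
  have a: "nrm m (\<lambda>i. \<rho>' * b (Inl i) - y i) / sqrt (real m) \<le> sqrt (\<rho>'\<^sup>2 + s\<^sup>2) + 16 * e * t\<^sup>2 / \<sigma>"
    using residual_approx[OF assms(1) \<rho>'] by linarith
  have s2: "\<sigma> / 2 \<le> sqrt (r\<^sup>2 + s\<^sup>2)"
  proof -
    have "s \<le> sqrt (r\<^sup>2 + s\<^sup>2)" by (rule real_le_rsqrt) simp
    then show ?thesis using s(2) by linarith
  qed
  have "\<bar>sqrt (\<rho>'\<^sup>2 + s\<^sup>2) - sqrt (r\<^sup>2 + s\<^sup>2)\<bar> \<le> \<bar>(\<rho>'\<^sup>2 + s\<^sup>2) - (r\<^sup>2 + s\<^sup>2)\<bar> / (\<sigma> / 2)"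
    using \<sigma> by (intro sqrt_diff_bound s2) auto
  also have "\<dots> \<le> e * t\<^sup>2 / (\<sigma> / 2)"
    using wf(2) \<sigma> by (intro divide_right_mono) auto
  also have "\<dots> = 2 * (e * t\<^sup>2 / \<sigma>)" by simp
  finally have c: "sqrt (\<rho>'\<^sup>2 + s\<^sup>2) \<le> sqrt (r\<^sup>2 + s\<^sup>2) + 2 * (e * t\<^sup>2 / \<sigma>)" by linarith
  have g: "e * t\<^sup>2 / \<tau> \<le> e * t\<^sup>2 / \<sigma>" using tau_pos(3) \<sigma> e by (intro divide_left_mono mult_pos_pos) (use tau_pos(1) in auto)
  define E K where "E = e * t\<^sup>2 / \<sigma>" and "K = 3 * t\<^sup>2 * e / \<sigma>\<^sup>2"
  have h: "(22 / \<sigma> + 3 / \<sigma>\<^sup>2) * e * t\<^sup>2 = 22 * E + K" "16 * e * t\<^sup>2 / \<sigma> = 16 * E"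
    using \<sigma> by (simp_all add: field_simps E_def K_def)
  have k: "0 \<le> e * t\<^sup>2 / \<sigma>" "0 \<le> 3 * t\<^sup>2 * e / \<sigma>\<^sup>2" using e \<sigma> by auto
  have "gordon_obj m n y b w_opt / sqrt (real m) = nrm m (\<lambda>i. \<rho>' * b (Inl i) - y i) / sqrt (real m) + ip n w_opt (\<lambda>j. b (Inr j)) / sqrt (real m)"
    by (simp add: gordon_obj_def \<rho>'_def add_divide_distrib)
  moreover have "ip n w_opt (\<lambda>j. b (Inr j)) / sqrt (real m) \<le> e * t\<^sup>2 / \<tau> - t\<^sup>2 * \<Phi> / \<tau>"
    using wf(4) unfolding abs_le_iff by linarith
  ultimately show ?thesis using a c g k unfolding base_def h E_def[symmetric] K_def[symmetric] by linarith
qed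

end

section \<open>Laws of large numbers and independence\<close>

lemma (in prob_space) chebyshev_indep_sum:
  fixes Z :: "'i \<Rightarrow> 'a \<Rightarrow> real"
  assumes J: "finite J" and ind: "indep_vars (\<lambda>_. borel) Z J"
    and int: "\<And>i. i \<in> J \<Longrightarrow> integrable M (\<lambda>x. (Z i x)\<^sup>2)" and a: "0 < a"
  shows "prob {x \<in> space M. a < \<bar>(\<Sum>i\<in>J. Z i x) - (\<Sum>i\<in>J. expectation (Z i))\<bar>}
    \<le> (\<Sum>i\<in>J. expectation (\<lambda>x. (Z i x)\<^sup>2)) / a\<^sup>2"
proof -
  define W where "W i x = Z i x - expectation (Z i)" for i x
  have m [measurable]: "random_variable borel (Z i)" if "i \<in> J" for i
    using ind that by (auto simp: indep_vars_def)
  have Zi: "integrable M (Z i)" if "i \<in> J" for i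
    using square_integrable_imp_integrable[OF m[OF that] int[OF that]] .
  have mW: "random_variable borel (W i)" if "i \<in> J" for i
    unfolding W_def using m[OF that] by measurable
  have indW: "indep_vars (\<lambda>_. borel) W J"
    unfolding W_def by (rule indep_vars_compose2[OF ind, where Y="\<lambda>i z. z - expectation (Z i)"]) measurable
  have W2: "integrable M (\<lambda>x. (W i x)\<^sup>2)" if "i \<in> J" for i
    unfolding W_def power2_diff using int[OF that] Zi[OF that] by simp
  have W1: "integrable M (W i)" "expectation (W i) = 0" if "i \<in> J" for i
    unfolding W_def using Zi[OF that] by (auto simp: prob_space)
  have Wsq: "expectation (\<lambda>x. (W i x)\<^sup>2) \<le> expectation (\<lambda>x. (Z i x)\<^sup>2)" if "i \<in> J" for i
    using variance_eq[OF Zi[OF that] int[OF that]] by (simp add: W_def)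
  have cross: "integrable M (\<lambda>x. W i x * W j x)" "expectation (\<lambda>x. W i x * W j x) = (if i = j then expectation (\<lambda>x. (W i x)\<^sup>2) else 0)"
    if "i \<in> J" "j \<in> J" for i j
  proof -
    have "integrable M (\<lambda>x. W i x * W j x) \<and> expectation (\<lambda>x. W i x * W j x) = (if i = j then expectation (\<lambda>x. (W i x)\<^sup>2) else 0)"
    proof (cases "i = j")
      case True
      then show ?thesis using W2[OF that(1)] by (simp add: power2_eq_square)
    next
      case False
      have iv: "indep_vars (\<lambda>_. borel) W {i, j}"
        using that by (intro indep_vars_subset[OF indW]) auto
      have W1': "integrable M (W k)" if "k \<in> {i, j}" for k
        using W1(1) \<open>i \<in> J\<close> \<open>j \<in> J\<close> that by auto
      show ?thesis
        using indep_vars_integrable[OF _ iv W1'] indep_vars_lebesgue_integral[OF _ iv W1'] that False W1(2)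
        by simp
    qed
    then show "integrable M (\<lambda>x. W i x * W j x)" "expectation (\<lambda>x. W i x * W j x) = (if i = j then expectation (\<lambda>x. (W i x)\<^sup>2) else 0)"
      by auto
  qed
  define S where "S x = (\<Sum>i\<in>J. W i x)" for x
  have S2: "(S x)\<^sup>2 = (\<Sum>i\<in>J. \<Sum>j\<in>J. W i x * W j x)" for x
    by (simp add: S_def power2_eq_square sum_product)
  have mS: "random_variable borel S" unfolding S_def using mW by (rule borel_measurable_sum)
  have iS: "integrable M (\<lambda>x. (S x)\<^sup>2)" unfolding S2 using cross(1) by simp
  have "expectation (\<lambda>x. (S x)\<^sup>2) = (\<Sum>i\<in>J. \<Sum>j\<in>J. if i = j then expectation (\<lambda>x. (W i x)\<^sup>2) else 0)"
    unfolding S2 using cross by simp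
  also have "\<dots> = (\<Sum>i\<in>J. expectation (\<lambda>x. (W i x)\<^sup>2))" using J by simp
  also have "\<dots> \<le> (\<Sum>i\<in>J. expectation (\<lambda>x. (Z i x)\<^sup>2))" by (intro sum_mono Wsq)
  finally have ES: "expectation (\<lambda>x. (S x)\<^sup>2) \<le> (\<Sum>i\<in>J. expectation (\<lambda>x. (Z i x)\<^sup>2))" .
  have "prob {x \<in> space M. a < \<bar>S x\<bar>} \<le> prob {x \<in> space M. \<bar>S x\<bar> \<ge> a}"
    using mS by (intro finite_measure_mono) auto
  also have "\<dots> \<le> expectation (\<lambda>x. (S x)\<^sup>2) / a\<^sup>2"
    by (rule second_moment_method[OF mS iS a])
  also have "\<dots> \<le> (\<Sum>i\<in>J. expectation (\<lambda>x. (Z i x)\<^sup>2)) / a\<^sup>2"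
    using ES by (intro divide_right_mono) auto
  also have "S = (\<lambda>x. (\<Sum>i\<in>J. Z i x) - (\<Sum>i\<in>J. expectation (Z i)))"
    by (simp add: S_def W_def fun_eq_iff sum_subtractf)
  finally show ?thesis .
qed

section \<open>Averages of independent Gaussian coordinates\<close>

lemma indep_vars_gauss:
  assumes J: "J \<noteq> {}" "J' \<subseteq> J" and f: "\<And>j. f j \<in> borel_measurable borel"
  shows "prob_space.indep_vars (gauss J) (\<lambda>_. borel) (\<lambda>j b. f j (b j) :: real) J'"
proof -
  interpret prob_space "gauss J" by (rule prob_space_gauss)
  let ?N = "std_normal_distribution"
  have "indep_vars (\<lambda>_. ?N) (\<lambda>j b. b j) J"
  proof (subst indep_vars_iff_distr_eq_PiM'[OF J(1)])
    show "random_variable ?N (\<lambda>b. b i)" if "i \<in> J" for i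
      using measurable_component_singleton[OF that, of "\<lambda>_. ?N"] .
    have "distr (gauss J) (gauss J) (\<lambda>x. \<lambda>i\<in>J. x i) = distr (gauss J) (gauss J) (\<lambda>x. x)"
      by (intro distr_cong) (auto simp: space_PiM)
    also have "\<dots> = gauss J" by simp
    also have "\<dots> = (\<Pi>\<^sub>M i\<in>J. distr (gauss J) ?N (\<lambda>b. b i))"
      by (intro PiM_cong refl distr_PiM_component[symmetric] std_normal.prob_space_axioms)
    finally show "distr (gauss J) (gauss J) (\<lambda>x. \<lambda>i\<in>J. x i) = (\<Pi>\<^sub>M i\<in>J. distr (gauss J) ?N (\<lambda>b. b i))" .
  qed
  then have "indep_vars (\<lambda>_. ?N) (\<lambda>j b. b j) J'" using J(2) by (rule indep_vars_subset)
  then show ?thesis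
    by (rule indep_vars_compose2[where Y=f]) (use f in simp)
qed

lemma gauss_weak_law:
  assumes J: "finite K" "K \<noteq> {}" "J' \<subseteq> K" and f: "\<And>j. f j \<in> borel_measurable borel"
    and int: "\<And>j. j \<in> J' \<Longrightarrow> integrable std_normal_distribution (\<lambda>h. (f j h)\<^sup>2)" and a: "0 < a"
  shows "measure (gauss K) {b \<in> space (gauss K). a < \<bar>(\<Sum>j\<in>J'. f j (b j)) - (\<Sum>j\<in>J'. \<integral>h. f j h \<partial>std_normal_distribution)\<bar>}
    \<le> (\<Sum>j\<in>J'. \<integral>h. (f j h)\<^sup>2 \<partial>std_normal_distribution) / a\<^sup>2"
proof -
  interpret prob_space "gauss K" by (rule prob_space_gauss)
  have f2: "(\<lambda>h. (f j h)\<^sup>2) \<in> borel_measurable borel" for j using f[of j] by measurable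
  have J': "finite J'" using J finite_subset by auto
  have e: "expectation (\<lambda>b. f j (b j)) = (\<integral>h. f j h \<partial>std_normal_distribution)"
    "expectation (\<lambda>b. (f j (b j))\<^sup>2) = (\<integral>h. (f j h)\<^sup>2 \<partial>std_normal_distribution)"
    "integrable (gauss K) (\<lambda>b. (f j (b j))\<^sup>2)" if "j \<in> J'" for j
    using gauss_component(1)[OF _ f, of j K j] gauss_component[OF _ f2, of j K j] int[OF that] that J(3) by auto
  have "prob {b \<in> space (gauss K). a < \<bar>(\<Sum>j\<in>J'. f j (b j)) - (\<Sum>j\<in>J'. expectation (\<lambda>b. f j (b j)))\<bar>}
    \<le> (\<Sum>j\<in>J'. expectation (\<lambda>b. (f j (b j))\<^sup>2)) / a\<^sup>2"
    using indep_vars_gauss[OF J(2,3) f] e(3) a by (intro chebyshev_indep_sum J') auto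
  then show ?thesis using e by (simp cong: sum.cong)
qed

lemma std_normal_integral_uminus:
  fixes f :: "real \<Rightarrow> real"
  assumes [measurable]: "f \<in> borel_measurable borel"
  shows "(\<integral>h. f (- h) \<partial>std_normal_distribution) = (\<integral>h. f h \<partial>std_normal_distribution)"
    "integrable std_normal_distribution f \<Longrightarrow> integrable std_normal_distribution (\<lambda>h. f (- h))"
proof -
  have "(\<integral>h. f h \<partial>distr std_normal_distribution lborel (\<lambda>x. - x)) = (\<integral>h. f (- h) \<partial>std_normal_distribution)"
    by (subst integral_distr) auto
  then show "(\<integral>h. f (- h) \<partial>std_normal_distribution) = (\<integral>h. f h \<partial>std_normal_distribution)"
    by (simp only: distr_std_normal_uminus)
  assume "integrable std_normal_distribution f"
  then have "integrable (distr std_normal_distribution lborel (\<lambda>x. - x)) f" by (simp only: distr_std_normal_uminus)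
  then show "integrable std_normal_distribution (\<lambda>h. f (- h))"
    by (subst (asm) integrable_distr_eq) auto
qed

text \<open>P is the displacement of one coordinate at noise scale t. Its two means are
  \<open>G_fun_scaled\<close> and Stein's identity after the reflection h to - h; |P| \<le> t |h|
  and the fourth moment 3 of h give the variance bounds.\<close>

lemma soft_threshold_moments:
  assumes t: "0 < t" and x: "0 \<le> x"
  defines "P \<equiv> \<lambda>h. max (- t * h) (- x)"
  shows "(\<integral>h. (P h)\<^sup>2 \<partial>std_normal_distribution) = t\<^sup>2 * G_fun (x / t)"
    "(\<integral>h. P h * h \<partial>std_normal_distribution) = - t * std_normal_cdf (x / t)"
    "integrable std_normal_distribution (\<lambda>h. ((P h)\<^sup>2)\<^sup>2)" "(\<integral>h. ((P h)\<^sup>2)\<^sup>2 \<partial>std_normal_distribution) \<le> 3 * t ^ 4"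
    "integrable std_normal_distribution (\<lambda>h. (P h * h)\<^sup>2)" "(\<integral>h. (P h * h)\<^sup>2 \<partial>std_normal_distribution) \<le> 3 * t\<^sup>2"
proof -
  let ?N = "std_normal_distribution"
  have [measurable]: "P \<in> borel_measurable borel" unfolding P_def by measurable
  have P: "P h = t * max (- h) (- (x / t))" for h
    using t by (simp add: P_def max_mult_distrib_left)
  have "(\<integral>h. (P h)\<^sup>2 \<partial>?N) = (\<integral>h. (max (t * - h) (- x))\<^sup>2 \<partial>?N)" by (simp add: P_def)
  also have "\<dots> = (\<integral>h. (max (t * h) (- x))\<^sup>2 \<partial>?N)"
    by (rule std_normal_integral_uminus(1)[where f="\<lambda>h. (max (t * h) (- x))\<^sup>2"]) measurable
  finally show "(\<integral>h. (P h)\<^sup>2 \<partial>?N) = t\<^sup>2 * G_fun (x / t)" using G_fun_scaled(1)[OF t] by simp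
  have "(\<integral>h. P h * h \<partial>?N) = (\<integral>h. - t * (- h * max (- h) (- (x / t))) \<partial>?N)"
    by (simp add: P mult_ac)
  also have "\<dots> = - t * (\<integral>h. - h * max (- h) (- (x / t)) \<partial>?N)" by (rule integral_mult_right_zero)
  also have "(\<integral>h. - h * max (- h) (- (x / t)) \<partial>?N) = (\<integral>h. h * max h (- (x / t)) \<partial>?N)"
    by (rule std_normal_integral_uminus(1)[where f="\<lambda>h. h * max h (- (x / t))"]) measurable
  finally show "(\<integral>h. P h * h \<partial>?N) = - t * std_normal_cdf (x / t)" by (simp only: cdf_eq_max_gauss)
  have Ph: "\<bar>P h\<bar> \<le> t * \<bar>h\<bar>" for h
    unfolding P abs_mult using t x max_gauss_abs_le[of "x / t" "- h"] by (auto intro: mult_left_mono)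
  have b2: "(P h)\<^sup>2 \<le> t\<^sup>2 * h\<^sup>2" for h
    using power_mono[OF Ph[of h], of 2] by (simp add: power_mult_distrib)
  have b4: "((P h)\<^sup>2)\<^sup>2 \<le> t ^ 4 * h ^ 4" for h
    using power_mono[OF b2[of h], of 2] by (simp add: power_mult_distrib flip: power_mult)
  have bh: "(P h * h)\<^sup>2 \<le> t\<^sup>2 * h ^ 4" for h
  proof -
    have "(P h)\<^sup>2 * h\<^sup>2 \<le> (t\<^sup>2 * h\<^sup>2) * h\<^sup>2" by (intro mult_right_mono b2) simp
    then show ?thesis by (simp add: power_mult_distrib eval_nat_numeral mult_ac)
  qed
  have h4: "integrable ?N (\<lambda>h. h ^ 4)" "(\<integral>h. h ^ 4 \<partial>?N) = 3"
    using integrable_std_normal_power[of 4] std_normal_distribution_even_moments(1)[of 2]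
    by (simp_all add: fact_numeral)
  show i1: "integrable ?N (\<lambda>h. ((P h)\<^sup>2)\<^sup>2)"
    by (rule Bochner_Integration.integrable_bound[where f="\<lambda>h. t ^ 4 * h ^ 4"]) (use h4 b4 in auto)
  show i2: "integrable ?N (\<lambda>h. (P h * h)\<^sup>2)"
    by (rule Bochner_Integration.integrable_bound[where f="\<lambda>h. t\<^sup>2 * h ^ 4"]) (use h4 bh in auto)
  have "(\<integral>h. ((P h)\<^sup>2)\<^sup>2 \<partial>?N) \<le> (\<integral>h. t ^ 4 * h ^ 4 \<partial>?N)"
    using h4 b4 by (intro integral_mono i1) auto
  then show "(\<integral>h. ((P h)\<^sup>2)\<^sup>2 \<partial>?N) \<le> 3 * t ^ 4" using h4 by simp
  have "(\<integral>h. (P h * h)\<^sup>2 \<partial>?N) \<le> (\<integral>h. t\<^sup>2 * h ^ 4 \<partial>?N)"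
    using h4 bh by (intro integral_mono i2) auto
  then show "(\<integral>h. (P h * h)\<^sup>2 \<partial>?N) \<le> 3 * t\<^sup>2" using h4 by simp
qed

text \<open>The noise has two moments only, so its square has just a mean and Chebyshev's inequality
  is available only after truncation; the remainder is nonnegative and falls to Markov's inequality.
  The bound \<open>m0\<close> depends on the law alone, because the probability space changes with
  n.\<close>

lemma weak_law_truncation:
  fixes L :: "real measure"
  assumes L: "prob_space L" "sets L = sets borel" and f: "f \<in> borel_measurable borel" "\<And>x. 0 \<le> f x" "integrable L f"
    and a: "0 < a" and \<eta>: "0 < \<eta>"
  shows "\<exists>m0. \<forall>m\<ge>m0. \<forall>(M :: 'a measure) \<xi>. prob_space M \<longrightarrow> iid_with_law M {..<m} \<xi> L \<longrightarrow>
    measure M {\<omega> \<in> space M. a * real m < \<bar>(\<Sum>i<m. f (\<xi> \<omega> i)) - real m * (\<integral>x. f x \<partial>L)\<bar>} \<le> \<eta>"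
proof -
  interpret L: prob_space L by fact
  note L(2) [measurable_cong] f(1) [measurable]
  define fK where "fK k x = min (f x) (real k)" for k :: nat and x
  have fKm [measurable]: "fK k \<in> borel_measurable borel" for k unfolding fK_def by measurable
  have fKL: "fK k \<in> borel_measurable L" "(\<lambda>x. (fK k x)\<^sup>2) \<in> borel_measurable L" for k
    using fKm[of k] by (simp_all add: measurable_cong_sets[OF L(2) refl])
  have fK: "0 \<le> fK k x" "fK k x \<le> f x" "fK k x \<le> real k" for k x using f(2) by (auto simp: fK_def)
  have ifK: "integrable L (fK k)" for k
    by (rule L.integrable_const_bound[where B="real k"]) (use fK fKL in auto)
  have "(\<lambda>k. \<integral>x. fK k x \<partial>L) \<longlonglongrightarrow> (\<integral>x. f x \<partial>L)"
  proof (rule integral_dominated_convergence[where w=f])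
    show "AE x in L. (\<lambda>k. fK k x) \<longlonglongrightarrow> f x"
    proof (rule AE_I2)
      fix x
      obtain k0 where "f x \<le> real k0" using real_arch_simple by blast
      then have "\<forall>\<^sub>F k in sequentially. fK k x = f x"
        by (intro eventually_sequentiallyI[of k0]) (auto simp: fK_def)
      then show "(\<lambda>k. fK k x) \<longlonglongrightarrow> f x" by (rule tendsto_eventually)
    qed
    show "AE x in L. norm (fK k x) \<le> f x" for k using fK by auto
  qed (use f fKL in auto)
  \<comment> \<open>The part a / 3 bounds the bias of the truncation, a \<eta> / 6 makes Markov's
    bound for the remainder at most \<eta> / 2.\<close>
  moreover define d where "d = min (a / 3) (a * \<eta> / 6)"
  have d: "0 < d" "d \<le> a / 3" "d \<le> a * \<eta> / 6" using a \<eta> by (auto simp: d_def)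
  ultimately have "\<forall>\<^sub>F k in sequentially. (\<integral>x. f x \<partial>L) - d < (\<integral>x. fK k x \<partial>L)"
    using d by (intro order_tendstoD) auto
  then obtain k where k: "(\<integral>x. f x \<partial>L) - d < (\<integral>x. fK k x \<partial>L)" by (auto dest: eventually_happens)
  define e where "e = (\<integral>x. f x \<partial>L) - (\<integral>x. fK k x \<partial>L)"
  have e: "0 \<le> e" "e \<le> d" using k integral_mono[OF ifK[of k] f(3) fK(2)] by (auto simp: e_def)
  \<comment> \<open>Makes Chebyshev's bound 9 k^2 / (a^2 m) for the truncated part at most \<eta> /
    2.\<close>
  obtain m0 where m0: "18 * (real k)\<^sup>2 / (a\<^sup>2 * \<eta>) < real m0" using reals_Archimedean2 by blast
  show ?thesis
  proof (intro exI[of _ "max m0 1"] allI impI)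
    fix m :: nat and M :: "'a measure" and \<xi>
    assume m: "max m0 1 \<le> m" and M: "prob_space M" and iid: "iid_with_law M {..<m} \<xi> L"
    interpret prob_space M by fact
    have ind: "indep_vars (\<lambda>_. borel) (\<lambda>i \<omega>. \<xi> \<omega> i) {..<m}" and law: "\<And>i. i < m \<Longrightarrow> distr M borel (\<lambda>\<omega>. \<xi> \<omega> i) = L"
      using iid by (auto simp: iid_with_law_def)
    have \<xi>m [measurable]: "random_variable borel (\<lambda>\<omega>. \<xi> \<omega> i)" if "i < m" for i
      using ind that by (auto simp: indep_vars_def)
    have ex: "expectation (\<lambda>\<omega>. g (\<xi> \<omega> i)) = (\<integral>x. g x \<partial>L)" "integrable L g \<Longrightarrow> integrable M (\<lambda>\<omega>. g (\<xi> \<omega> i))"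
      if "i < m" "g \<in> borel_measurable borel" for i and g :: "real \<Rightarrow> real"
      using integral_distr[OF \<xi>m[OF that(1)] that(2)] integrable_distr_eq[OF \<xi>m[OF that(1)] that(2)]
      unfolding law[OF that(1)] by auto
    have rm: "0 < real m" using m by simp
    let ?S = "\<lambda>\<omega>. \<Sum>i<m. fK k (\<xi> \<omega> i)" and ?R = "\<lambda>\<omega>. \<Sum>i<m. (f (\<xi> \<omega> i) - fK k (\<xi> \<omega> i))"
    have mS: "random_variable borel ?S" "random_variable borel ?R"
    proof -
      have "random_variable borel (\<lambda>\<omega>. fK k (\<xi> \<omega> i))" "random_variable borel (\<lambda>\<omega>. f (\<xi> \<omega> i) - fK k (\<xi> \<omega> i))"
        if "i < m" for i using \<xi>m[OF that] by measurable
      then show "random_variable borel ?S" "random_variable borel ?R"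
        by (auto intro!: borel_measurable_sum)
    qed
    let ?A = "{\<omega> \<in> space M. a * real m / 3 < \<bar>?S \<omega> - real m * (\<integral>x. fK k x \<partial>L)\<bar>}"
    let ?B = "{\<omega> \<in> space M. a * real m / 3 \<le> ?R \<omega>}"
    have AB: "?A \<in> events" "?B \<in> events" using mS by measurable
    have "{\<omega> \<in> space M. a * real m < \<bar>(\<Sum>i<m. f (\<xi> \<omega> i)) - real m * (\<integral>x. f x \<partial>L)\<bar>} \<subseteq> ?A \<union> ?B"
    proof
      fix \<omega> assume w: "\<omega> \<in> {\<omega> \<in> space M. a * real m < \<bar>(\<Sum>i<m. f (\<xi> \<omega> i)) - real m * (\<integral>x. f x \<partial>L)\<bar>}"
      have R0: "0 \<le> ?R \<omega>" using fK by (intro sum_nonneg) auto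
      have eq: "(\<Sum>i<m. f (\<xi> \<omega> i)) - real m * (\<integral>x. f x \<partial>L) = (?S \<omega> - real m * (\<integral>x. fK k x \<partial>L)) + ?R \<omega> - real m * e"
        by (simp add: sum_subtractf e_def algebra_simps)
      have me: "0 \<le> real m * e" "real m * e \<le> a * real m / 3"
        using e d rm mult_left_mono[of e "a / 3" "real m"] by (auto simp: mult.commute)
      show "\<omega> \<in> ?A \<union> ?B"
      proof (rule ccontr)
        assume "\<omega> \<notin> ?A \<union> ?B"
        then have "\<bar>?S \<omega> - real m * (\<integral>x. fK k x \<partial>L)\<bar> \<le> a * real m / 3" "?R \<omega> < a * real m / 3"
          using w by auto
        moreover have "a * real m < \<bar>(\<Sum>i<m. f (\<xi> \<omega> i)) - real m * (\<integral>x. f x \<partial>L)\<bar>" using w by blast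
        ultimately show False using me R0 unfolding eq by linarith
      qed
    qed
    then have "prob {\<omega> \<in> space M. a * real m < \<bar>(\<Sum>i<m. f (\<xi> \<omega> i)) - real m * (\<integral>x. f x \<partial>L)\<bar>} \<le> prob (?A \<union> ?B)"
      using AB by (intro finite_measure_mono) auto
    also have "\<dots> \<le> prob ?A + prob ?B" using AB by (rule measure_Un_le)
    also have "prob ?A \<le> \<eta> / 2"
    proof -
      have i2: "integrable L (\<lambda>x. (fK k x)\<^sup>2)"
        by (rule L.integrable_const_bound[where B="(real k)\<^sup>2"]) (use fK fKL in \<open>auto intro!: power_mono\<close>)
      have f2: "(\<lambda>x. (fK k x)\<^sup>2) \<in> borel_measurable borel" by measurable
      have iv: "indep_vars (\<lambda>_. borel) (\<lambda>i \<omega>. fK k (\<xi> \<omega> i)) {..<m}"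
        by (rule indep_vars_compose2[OF ind, where Y="\<lambda>_. fK k"]) measurable
      have "prob {\<omega> \<in> space M. a * real m / 3 < \<bar>?S \<omega> - (\<Sum>i<m. expectation (\<lambda>\<omega>. fK k (\<xi> \<omega> i)))\<bar>}
        \<le> (\<Sum>i<m. expectation (\<lambda>\<omega>. (fK k (\<xi> \<omega> i))\<^sup>2)) / (a * real m / 3)\<^sup>2"
        using rm a ex(2)[OF _ f2 i2] by (intro chebyshev_indep_sum iv) auto
      also have "(\<Sum>i<m. expectation (\<lambda>\<omega>. fK k (\<xi> \<omega> i))) = real m * (\<integral>x. fK k x \<partial>L)"
        using ex(1)[of _ "fK k"] by simp
      also have "(\<Sum>i<m. expectation (\<lambda>\<omega>. (fK k (\<xi> \<omega> i))\<^sup>2)) = real m * (\<integral>x. (fK k x)\<^sup>2 \<partial>L)"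
        using ex(1)[OF _ f2] by simp
      also have "real m * (\<integral>x. (fK k x)\<^sup>2 \<partial>L) / (a * real m / 3)\<^sup>2 \<le> real m * (real k)\<^sup>2 / (a * real m / 3)\<^sup>2"
        using fK by (intro divide_right_mono mult_left_mono L.integral_le_const i2) (auto intro!: power_mono)
      also have "\<dots> = 9 * (real k)\<^sup>2 / (a\<^sup>2 * real m)"
        using rm a by (simp add: power2_eq_square field_simps)
      also have "\<dots> \<le> \<eta> / 2"
      proof -
        have "18 * (real k)\<^sup>2 / (a\<^sup>2 * \<eta>) \<le> real m" using m0 m by simp
        then have "18 * (real k)\<^sup>2 \<le> real m * (a\<^sup>2 * \<eta>)" using a \<eta> by (simp add: pos_divide_le_eq)
        then have "9 * (real k)\<^sup>2 \<le> \<eta> / 2 * (a\<^sup>2 * real m)" by (simp add: algebra_simps)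
        then show ?thesis using a rm by (simp add: pos_divide_le_eq)
      qed
      finally show ?thesis .
    qed
    also have "prob ?B \<le> \<eta> / 2"
    proof -
      have iR: "integrable M (\<lambda>\<omega>. f (\<xi> \<omega> i) - fK k (\<xi> \<omega> i))" "expectation (\<lambda>\<omega>. f (\<xi> \<omega> i) - fK k (\<xi> \<omega> i)) = e" if "i < m" for i
        using ex[OF that f(1)] ex[OF that, of "fK k"] f(3) ifK[of k] by (auto simp: e_def)
      have "prob ?B \<le> expectation ?R / (a * real m / 3)"
        using iR(1) fK a rm by (intro integral_Markov_inequality_measure[where A="space M", simplified] )
          (auto intro!: sum_nonneg)
      also have "expectation ?R = real m * e" using iR by simp
      also have "real m * e / (a * real m / 3) = 3 * e / a" using rm a by (simp add: field_simps)
      also have "\<dots> \<le> \<eta> / 2"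
      proof -
        have "e \<le> a * \<eta> / 6" using e d by linarith
        then show ?thesis using a by (simp add: field_simps)
      qed
      finally show ?thesis .
    qed
    finally show "prob {\<omega> \<in> space M. a * real m < \<bar>(\<Sum>i<m. f (\<xi> \<omega> i)) - real m * (\<integral>x. f x \<partial>L)\<bar>} \<le> \<eta>"
      by simp
  qed
qed

section \<open>Independence as a product law\<close>

lemma indep_elements_distr:
  assumes M: "prob_space M" and ind: "indep_elements M A Z B W"
  shows "distr M (A \<Otimes>\<^sub>M B) (\<lambda>\<omega>. (Z \<omega>, W \<omega>)) = distr M A Z \<Otimes>\<^sub>M distr M B W"
proof -
  interpret prob_space M by fact
  have Z [measurable]: "Z \<in> M \<rightarrow>\<^sub>M A" and W [measurable]: "W \<in> M \<rightarrow>\<^sub>M B"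
    and ind': "indep_set {Z -` S \<inter> space M | S. S \<in> sets A} {W -` S \<inter> space M | S. S \<in> sets B}"
    using ind by (auto simp: indep_elements_def)
  interpret Z: prob_space "distr M A Z" by (rule prob_space_distr) measurable
  interpret W: prob_space "distr M B W" by (rule prob_space_distr) measurable
  interpret ZW: pair_prob_space "distr M A Z" "distr M B W" ..
  show ?thesis
  proof (rule pair_measure_eqI[symmetric])
    show "sigma_finite_measure (distr M A Z)" "sigma_finite_measure (distr M B W)" by unfold_locales
    show "sets (distr M A Z \<Otimes>\<^sub>M distr M B W) = sets (distr M (A \<Otimes>\<^sub>M B) (\<lambda>\<omega>. (Z \<omega>, W \<omega>)))"
      by (simp add: sets_pair_measure_cong[of "distr M A Z" A "distr M B W" B])
    fix S T assume "S \<in> sets (distr M A Z)" "T \<in> sets (distr M B W)"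
    then have S: "S \<in> sets A" and T: "T \<in> sets B" by auto
    have "emeasure (distr M A Z) S * emeasure (distr M B W) T
        = ennreal (prob (Z -` S \<inter> space M) * prob (W -` T \<inter> space M))"
      using S T by (simp add: emeasure_distr emeasure_eq_measure ennreal_mult)
    also have "prob (Z -` S \<inter> space M) * prob (W -` T \<inter> space M) = prob ((Z -` S \<inter> space M) \<inter> (W -` T \<inter> space M))"
      using S T by (intro indep_setD[OF ind', symmetric]) auto
    also have "(Z -` S \<inter> space M) \<inter> (W -` T \<inter> space M) = (\<lambda>\<omega>. (Z \<omega>, W \<omega>)) -` (S \<times> T) \<inter> space M" by auto
    also have "ennreal (prob \<dots>) = emeasure (distr M (A \<Otimes>\<^sub>M B) (\<lambda>\<omega>. (Z \<omega>, W \<omega>))) (S \<times> T)"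
      using S T by (subst emeasure_distr) (auto simp: emeasure_eq_measure)
    finally show "emeasure (distr M A Z) S * emeasure (distr M B W) T = emeasure (distr M (A \<Otimes>\<^sub>M B) (\<lambda>\<omega>. (Z \<omega>, W \<omega>))) (S \<times> T)" .
  qed
qed

text \<open>Fubini for an independent pair: a bound on every section passes to the joint event. It
  serves to freeze first the signal and then the noise.\<close>

lemma indep_elements_prob_le:
  assumes M: "prob_space M" and ind: "indep_elements M A Z B W"
    and E: "E \<in> sets (A \<Otimes>\<^sub>M B)"
    and le: "\<And>w. w \<in> space B \<Longrightarrow> measure (distr M A Z) {z \<in> space A. (z, w) \<in> E} \<le> p"
  shows "measure M {\<omega> \<in> space M. (Z \<omega>, W \<omega>) \<in> E} \<le> p"
proof -
  interpret prob_space M by fact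
  have Z [measurable]: "Z \<in> M \<rightarrow>\<^sub>M A" and W [measurable]: "W \<in> M \<rightarrow>\<^sub>M B"
    using ind by (auto simp: indep_elements_def)
  interpret Z: prob_space "distr M A Z" by (rule prob_space_distr) measurable
  interpret W: prob_space "distr M B W" by (rule prob_space_distr) measurable
  interpret ZW: pair_prob_space "distr M A Z" "distr M B W" ..
  have p: "0 \<le> p"
  proof -
    obtain \<omega> where "\<omega> \<in> space M" using not_empty by auto
    then have "W \<omega> \<in> space B" using measurable_space[OF W] by auto
    from le[OF this] show ?thesis using measure_nonneg order_trans by blast
  qed
  have sE: "E \<in> sets (distr M A Z \<Otimes>\<^sub>M distr M B W)"
    using E by (simp add: sets_pair_measure_cong[of "distr M A Z" A "distr M B W" B])
  have "emeasure M {\<omega> \<in> space M. (Z \<omega>, W \<omega>) \<in> E} = emeasure (distr M (A \<Otimes>\<^sub>M B) (\<lambda>\<omega>. (Z \<omega>, W \<omega>))) E"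
    using E by (subst emeasure_distr) (auto intro: arg_cong[where f="emeasure M"])
  also have "\<dots> = emeasure (distr M A Z \<Otimes>\<^sub>M distr M B W) E" by (simp only: indep_elements_distr[OF M ind])
  also have "\<dots> = (\<integral>\<^sup>+ w. emeasure (distr M A Z) ((\<lambda>z. (z, w)) -` E) \<partial>distr M B W)"
    by (rule ZW.emeasure_pair_measure_alt2[OF sE])
  also have "\<dots> \<le> (\<integral>\<^sup>+ w. ennreal p \<partial>distr M B W)"
  proof (rule nn_integral_mono)
    fix w assume "w \<in> space (distr M B W)"
    then have w: "w \<in> space B" by simp
    have "(\<lambda>z. (z, w)) -` E = {z \<in> space A. (z, w) \<in> E}"
      using sets.sets_into_space[OF E] by (auto simp: space_pair_measure)
    then show "emeasure (distr M A Z) ((\<lambda>z. (z, w)) -` E) \<le> ennreal p"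
      using le[OF w] by (simp add: Z.emeasure_eq_measure ennreal_leI)
  qed
  also have "\<dots> = ennreal p" using W.emeasure_space_1 by simp
  finally show ?thesis using p by (simp add: emeasure_eq_measure)
qed

section \<open>Deterministic noise and signal\<close>

lemma measure_Un4_le:
  assumes "A \<in> sets M" "B \<in> sets M" "C \<in> sets M" "D \<in> sets M"
  shows "measure M (A \<union> B \<union> C \<union> D) \<le> measure M A + measure M B + measure M C + measure M D"
proof -
  have "measure M (A \<union> B \<union> C \<union> D) \<le> measure M (A \<union> B \<union> C) + measure M D" using assms by (intro measure_Un_le) auto
  also have "measure M (A \<union> B \<union> C) \<le> measure M (A \<union> B) + measure M C" using assms by (intro measure_Un_le) auto
  also have "measure M (A \<union> B) \<le> measure M A + measure M B" using assms by (intro measure_Un_le) auto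
  finally show ?thesis by simp
qed

text \<open>Noise y and signal \<mu> are fixed vectors; \<gamma> and \<Phi> stand for the means of G
  and of the distribution function at scale t. The averages over the coordinates of \<mu> may be off
  by e / 2, the Gaussian fluctuations by another e / 2, which adds up to the tolerance of
  \<open>concentrated\<close>.\<close>

locale design =
  fixes m n :: nat and \<sigma> r t \<Phi> e s :: real and \<mu> y :: "nat \<Rightarrow> real" and \<gamma> :: real
  assumes mn: "0 < m" "0 < n" and ratio: "1 / 2 < real m / real n"
    and \<sigma>: "0 < \<sigma>" and r: "0 < r" and t: "0 < t" and e: "0 < e" "e < 1"
    and rt: "r\<^sup>2 = t\<^sup>2 * \<gamma>" "1 / 2 \<le> \<gamma>" "\<gamma> \<le> 1" and tau: "r\<^sup>2 + \<sigma>\<^sup>2 = real m / real n * t\<^sup>2"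
    and \<mu>: "\<And>j. j < n \<Longrightarrow> 0 \<le> \<mu> j"
    and s: "s = nrm m y / sqrt (real m)" "\<sigma> / 2 \<le> s" "\<bar>s - \<sigma>\<bar> \<le> e"
    and G: "\<bar>(\<Sum>j<n. G_fun (\<mu> j / t)) - real n * \<gamma>\<bar> \<le> e * real n / 2"
    and \<Phi>: "\<bar>(\<Sum>j<n. std_normal_cdf (\<mu> j / t)) - real n * \<Phi>\<bar> \<le> e * real n / 2"
begin

lemma scalar: "scalar_problem m n \<sigma> r t e s \<mu> y"
proof
  show "r\<^sup>2 \<le> t\<^sup>2" unfolding rt(1) using rt(3) by (simp add: mult_left_le)
  have "t\<^sup>2 * (1 / 2) \<le> t\<^sup>2 * \<gamma>" using rt(2) by (intro mult_left_mono) auto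
  then show "t\<^sup>2 \<le> 2 * r\<^sup>2" unfolding rt(1) by simp
qed (use mn \<sigma> r t e tau \<mu> s in auto)

sublocale sp: scalar_problem m n \<sigma> r t \<Phi> e s \<mu> y b for b by (rule scalar)

abbreviation J :: "(nat + nat) set" where "J \<equiv> {..<m} <+> {..<n}"
abbreviation I :: "(nat \<times> nat) set" where "I \<equiv> {..<m} \<times> {..<n}"

text \<open>Chebyshev's bounds added up: 6 for |g|^2, (1 + 1 / \<sigma>)^2 for g . y, and 12 each
  for |P|^2 and P . h.\<close>

definition fail :: real where "fail = (30 + (1 + 1 / \<sigma>)\<^sup>2) / (e\<^sup>2 * real n)"

lemma exceptional_set:
  obtains B where "B \<in> sets (gauss J)" "measure (gauss J) B \<le> fail"
    "\<And>b. b \<in> space (gauss J) \<Longrightarrow> b \<notin> B \<Longrightarrow> sp.concentrated b"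
proof -
  let ?N = "std_normal_distribution"
  have n: "0 < real n" and m: "0 < real m" using mn by auto
  have J: "finite J" "J \<noteq> {}" using mn by (auto simp: Plus_def)
  define JL JR :: "(nat + nat) set" where "JL = Inl ` {..<m}" and "JR = Inr ` {..<n}"
  have JLR: "JL \<subseteq> J" "JR \<subseteq> J" by (auto simp: JL_def JR_def)
  define P where "P j h = max (- t * h) (- \<mu> j)" for j and h :: real
  have sumL: "(\<Sum>j\<in>JL. F j) = (\<Sum>i<m. F (Inl i))" and sumR: "(\<Sum>j\<in>JR. F j) = (\<Sum>i<n. F (Inr i))"
    for F :: "nat + nat \<Rightarrow> real"
    unfolding JL_def JR_def by (subst sum.reindex; simp)+
  have h2: "integrable ?N (\<lambda>h. h\<^sup>2)" "(\<integral>h. h\<^sup>2 \<partial>?N) = 1"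
    using integrable_std_normal_power[of 2] std_normal_second_moment by auto
  have h4: "integrable ?N (\<lambda>h. (h\<^sup>2)\<^sup>2)" "(\<integral>h. (h\<^sup>2)\<^sup>2 \<partial>?N) = 3"
    using integrable_std_normal_power[of 4] std_normal_distribution_even_moments(1)[of 2]
    by (simp_all add: fact_numeral flip: power_mult)
  have mom: "(\<integral>h. (P j h)\<^sup>2 \<partial>?N) = t\<^sup>2 * G_fun (\<mu> j / t)"
    "(\<integral>h. P j h * h \<partial>?N) = - t * std_normal_cdf (\<mu> j / t)"
    "integrable ?N (\<lambda>h. ((P j h)\<^sup>2)\<^sup>2)" "(\<integral>h. ((P j h)\<^sup>2)\<^sup>2 \<partial>?N) \<le> 3 * t ^ 4"
    "integrable ?N (\<lambda>h. (P j h * h)\<^sup>2)" "(\<integral>h. (P j h * h)\<^sup>2 \<partial>?N) \<le> 3 * t\<^sup>2" if "j < n" for j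
    unfolding P_def using soft_threshold_moments[OF t \<mu>[OF that]] by auto
  define f1 where "f1 j h = h\<^sup>2" for j :: "nat + nat" and h :: real
  define f2 where "f2 j h = y (projl j) * h" for j :: "nat + nat" and h
  define f3 where "f3 j h = (P (projr j) h)\<^sup>2" for j :: "nat + nat" and h
  define f4 where "f4 j h = P (projr j) h * h" for j :: "nat + nat" and h
  have fm: "f1 j \<in> borel_measurable borel" "f2 j \<in> borel_measurable borel"
    "f3 j \<in> borel_measurable borel" "f4 j \<in> borel_measurable borel" for j
    unfolding f1_def f2_def f3_def f4_def P_def by measurable
  define B where "B K f a = {b \<in> space (gauss J). a < \<bar>(\<Sum>j\<in>K. f j (b j)) - (\<Sum>j\<in>K. \<integral>h. f j h \<partial>?N)\<bar>}"
    for K and f :: "nat + nat \<Rightarrow> real \<Rightarrow> real" and a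
  have Bm: "B K f a \<in> sets (gauss J)" if "K \<subseteq> J" "\<And>j. f j \<in> borel_measurable borel" for a f K
  proof -
    have "(\<lambda>b. \<Sum>j\<in>K. f j (b j)) \<in> borel_measurable (gauss J)"
      using that by (intro borel_measurable_sum measurable_compose[OF measurable_gauss_component that(2)]) auto
    then show ?thesis unfolding B_def by measurable
  qed
  note wl = gauss_weak_law[OF J, folded B_def]
  have e1: "0 < e\<^sup>2 * real n" using e n by simp
  have b1: "measure (gauss J) (B JL f1 (e * real m)) \<le> 6 / (e\<^sup>2 * real n)"
  proof -
    have "measure (gauss J) (B JL f1 (e * real m)) \<le> (\<Sum>j\<in>JL. \<integral>h. (f1 j h)\<^sup>2 \<partial>?N) / (e * real m)\<^sup>2"
      using h4 e m by (intro wl JLR fm) (auto simp: f1_def)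
    also have "\<dots> = 3 / (e\<^sup>2 * real m)"
      unfolding sumL f1_def h4 using m e by (simp add: power2_eq_square)
    also have "\<dots> \<le> 6 / (e\<^sup>2 * real n)"
    proof -
      \<comment> \<open>The assumption m / n > 1 / 2 converts the rate 1 / m into 1 / n.\<close>
      have "real n \<le> 2 * real m" using ratio n by (simp add: field_simps)
      then have "e\<^sup>2 * real n \<le> e\<^sup>2 * (2 * real m)" by (intro mult_left_mono) auto
      then have "6 / (e\<^sup>2 * (2 * real m)) \<le> 6 / (e\<^sup>2 * real n)"
        using e m n by (intro divide_left_mono mult_pos_pos) auto
      then show ?thesis by (simp add: mult.commute)
    qed
    finally show ?thesis .
  qed
  have b2: "measure (gauss J) (B JL f2 (e * t * real m)) \<le> (1 + 1 / \<sigma>)\<^sup>2 / (e\<^sup>2 * real n)"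
  proof -
    have "measure (gauss J) (B JL f2 (e * t * real m)) \<le> (\<Sum>j\<in>JL. \<integral>h. (f2 j h)\<^sup>2 \<partial>?N) / (e * t * real m)\<^sup>2"
      using h2 e m t by (intro wl JLR fm) (auto simp: f2_def power_mult_distrib)
    also have "(\<Sum>j\<in>JL. \<integral>h. (f2 j h)\<^sup>2 \<partial>?N) = ip m y y"
      unfolding sumL f2_def using h2 by (simp add: power_mult_distrib) (simp add: power2_eq_square)
    also have "ip m y y = s\<^sup>2 * real m"
      unfolding s(1) power_divide nrm_sq using m by simp
    also have "s\<^sup>2 * real m / (e * t * real m)\<^sup>2 = s\<^sup>2 / (e\<^sup>2 * (t\<^sup>2 * real m))"
      using m by (simp add: power2_eq_square)
    also have "\<dots> \<le> s\<^sup>2 / (e\<^sup>2 * (\<sigma>\<^sup>2 * real n))"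
    proof -
      \<comment> \<open>The equation for t gives t^2 m \<ge> \<sigma>^2 n, so the factor t in the
        tolerance does no harm when t is small.\<close>
      have "\<sigma>\<^sup>2 \<le> real m / real n * t\<^sup>2" unfolding tau[symmetric] by simp
      then have "\<sigma>\<^sup>2 * real n \<le> t\<^sup>2 * real m" using n by (simp add: field_simps)
      then have "e\<^sup>2 * (\<sigma>\<^sup>2 * real n) \<le> e\<^sup>2 * (t\<^sup>2 * real m)" by (intro mult_left_mono) auto
      then show ?thesis
        using e \<sigma> n t m by (intro divide_left_mono) (auto intro!: mult_pos_pos)
    qed
    also have "\<dots> = (s / \<sigma>)\<^sup>2 / (e\<^sup>2 * real n)" by (simp add: power_divide mult_ac)
    also have "\<dots> \<le> (1 + 1 / \<sigma>)\<^sup>2 / (e\<^sup>2 * real n)"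
    proof (intro divide_right_mono power_mono)
      have "s \<le> \<sigma> + 1" using s(3) e by linarith
      then have "s / \<sigma> \<le> (\<sigma> + 1) / \<sigma>" using \<sigma> by (intro divide_right_mono) auto
      then show "s / \<sigma> \<le> 1 + 1 / \<sigma>" using \<sigma> by (simp add: add_divide_distrib)
      show "0 \<le> s / \<sigma>" using s(2) \<sigma> by simp
    qed (use e1 in simp)
    finally show ?thesis .
  qed
  have b3: "measure (gauss J) (B JR f3 (e * t\<^sup>2 * real n / 2)) \<le> 12 / (e\<^sup>2 * real n)"
  proof -
    have "measure (gauss J) (B JR f3 (e * t\<^sup>2 * real n / 2)) \<le> (\<Sum>j\<in>JR. \<integral>h. (f3 j h)\<^sup>2 \<partial>?N) / (e * t\<^sup>2 * real n / 2)\<^sup>2"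
      using mom e n t by (intro wl JLR fm) (auto simp: f3_def JR_def)
    also have "\<dots> \<le> (real n * (3 * t ^ 4)) / (e * t\<^sup>2 * real n / 2)\<^sup>2"
      unfolding sumR using sum_bounded_above[of "{..<n}" "\<lambda>i. \<integral>h. (f3 (Inr i) h)\<^sup>2 \<partial>?N" "3 * t ^ 4"] mom(4)
      by (intro divide_right_mono) (auto simp: f3_def)
    also have "\<dots> = 12 / (e\<^sup>2 * real n)"
      using e t n by (simp add: power2_eq_square eval_nat_numeral)
    finally show ?thesis .
  qed
  have b4: "measure (gauss J) (B JR f4 (e * t * real n / 2)) \<le> 12 / (e\<^sup>2 * real n)"
  proof -
    have "measure (gauss J) (B JR f4 (e * t * real n / 2)) \<le> (\<Sum>j\<in>JR. \<integral>h. (f4 j h)\<^sup>2 \<partial>?N) / (e * t * real n / 2)\<^sup>2"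
      using mom e n t by (intro wl JLR fm) (auto simp: f4_def JR_def)
    also have "\<dots> \<le> (real n * (3 * t\<^sup>2)) / (e * t * real n / 2)\<^sup>2"
      unfolding sumR using sum_bounded_above[of "{..<n}" "\<lambda>i. \<integral>h. (f4 (Inr i) h)\<^sup>2 \<partial>?N" "3 * t\<^sup>2"] mom(6)
      by (intro divide_right_mono) (auto simp: f4_def)
    also have "\<dots> = 12 / (e\<^sup>2 * real n)"
      using e t n by (simp add: power2_eq_square)
    finally show ?thesis .
  qed
  define BB where "BB = B JL f1 (e * real m) \<union> B JL f2 (e * t * real m) \<union> B JR f3 (e * t\<^sup>2 * real n / 2) \<union> B JR f4 (e * t * real n / 2)"
  show ?thesis
  proof (rule that[of BB])
    show "BB \<in> sets (gauss J)" unfolding BB_def by (intro sets.Un Bm JLR fm)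
    have "measure (gauss J) BB \<le> 6 / (e\<^sup>2 * real n) + (1 + 1 / \<sigma>)\<^sup>2 / (e\<^sup>2 * real n) + 12 / (e\<^sup>2 * real n) + 12 / (e\<^sup>2 * real n)"
      unfolding BB_def
      by (rule order_trans[OF measure_Un4_le]) (intro Bm JLR fm add_mono b1 b2 b3 b4)+
    also have "\<dots> = fail" by (simp add: fail_def add_divide_distrib)
    finally show "measure (gauss J) BB \<le> fail" .
    fix b assume b: "b \<in> space (gauss J)" "b \<notin> BB"
    have P: "sp.P b j = P j (b (Inr j))" for j by (simp add: sp.P_def P_def)
    have nB: "\<bar>(\<Sum>j\<in>K. f j (b j)) - (\<Sum>j\<in>K. \<integral>h. f j h \<partial>?N)\<bar> \<le> a" if "b \<notin> B K f a" for K f a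
      using that b(1) by (simp add: B_def)
    have nBB: "b \<notin> B JL f1 (e * real m)" "b \<notin> B JL f2 (e * t * real m)"
      "b \<notin> B JR f3 (e * t\<^sup>2 * real n / 2)" "b \<notin> B JR f4 (e * t * real n / 2)"
      using b(2) by (auto simp: BB_def)
    have int: "(\<Sum>j\<in>JL. \<integral>h. f1 j h \<partial>?N) = real m" "(\<Sum>j\<in>JL. \<integral>h. f2 j h \<partial>?N) = 0"
      "(\<Sum>j\<in>JR. \<integral>h. f3 j h \<partial>?N) = t\<^sup>2 * (\<Sum>j<n. G_fun (\<mu> j / t))"
      "(\<Sum>j\<in>JR. \<integral>h. f4 j h \<partial>?N) = - t * (\<Sum>j<n. std_normal_cdf (\<mu> j / t))"
      unfolding sumL sumR f1_def f2_def f3_def f4_def h2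
      by (simp_all add: std_normal_mean mom sum_distrib_left sum_negf)
    have g1: "\<bar>(\<Sum>i<m. (b (Inl i))\<^sup>2) - real m\<bar> \<le> e * real m"
      using nB[OF nBB(1), unfolded int(1), unfolded sumL f1_def] by simp
    have g2: "\<bar>(\<Sum>i<m. y i * b (Inl i))\<bar> \<le> e * t * real m"
      using nB[OF nBB(2), unfolded int(2), unfolded sumL f2_def] by simp
    have g3: "\<bar>(\<Sum>j<n. (P j (b (Inr j)))\<^sup>2) - t\<^sup>2 * (\<Sum>j<n. G_fun (\<mu> j / t))\<bar> \<le> e * t\<^sup>2 * real n / 2"
      using nB[OF nBB(3), unfolded int(3), unfolded sumR f3_def] by simp
    have g4: "\<bar>(\<Sum>j<n. P j (b (Inr j)) * b (Inr j)) + t * (\<Sum>j<n. std_normal_cdf (\<mu> j / t))\<bar> \<le> e * t * real n / 2"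
      using nB[OF nBB(4), unfolded int(4), unfolded sumR f4_def] by simp
    have "t\<^sup>2 * \<bar>(\<Sum>j<n. G_fun (\<mu> j / t)) - real n * \<gamma>\<bar> \<le> t\<^sup>2 * (e * real n / 2)"
      using G by (intro mult_left_mono) auto
    then have g3': "\<bar>t\<^sup>2 * (\<Sum>j<n. G_fun (\<mu> j / t)) - real n * r\<^sup>2\<bar> \<le> e * t\<^sup>2 * real n / 2"
      unfolding rt(1) abs_mult_pos[OF zero_le_power2] by (simp add: abs_mult_pos' right_diff_distrib mult_ac)
    have "t * \<bar>(\<Sum>j<n. std_normal_cdf (\<mu> j / t)) - real n * \<Phi>\<bar> \<le> t * (e * real n / 2)"
      using \<Phi> t by (intro mult_left_mono) auto
    then have g4': "\<bar>t * (\<Sum>j<n. std_normal_cdf (\<mu> j / t)) - real n * t * \<Phi>\<bar> \<le> e * t * real n / 2"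
      using t by (simp add: abs_mult_pos' right_diff_distrib mult_ac)
    have "\<bar>(\<Sum>j<n. (P j (b (Inr j)))\<^sup>2) - real n * r\<^sup>2\<bar> \<le> e * t\<^sup>2 * real n"
      using g3 g3' unfolding abs_le_iff by linarith
    moreover have "\<bar>(\<Sum>j<n. P j (b (Inr j)) * b (Inr j)) + real n * t * \<Phi>\<bar> \<le> e * t * real n"
      using g4 g4' unfolding abs_le_iff by linarith
    ultimately show "sp.concentrated b" using g1 g2
      unfolding sp.concentrated_def P power2_eq_square[symmetric] by (simp add: mult.commute[of "y _"])
  qed
qed

text \<open>Rescaled displacements that keep the signal in the cone, within the ball of radius 2 r
  on which the deterministic bounds are valid.\<close>

definition feasible :: "(nat \<Rightarrow> real) \<Rightarrow> bool" where
  "feasible w \<longleftrightarrow> (\<forall>j<n. - \<mu> j \<le> sqrt (real n) * w j) \<and> nrm n w < 2 * r"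

text \<open>Off the band the gap is at least \<sigma>^2 \<epsilon>^2 r^2 / (4 \<tau>^3), and r^2
  \<ge> t^2 / 2 and \<tau> \<le> T make this at least \<kappa> t^2, which is the origin of \<kappa>.
  Errors take at most a quarter of it, so the threshold \<kappa> t^2 / 2 is still exceeded.\<close>

lemma off_band_prob:
  assumes \<epsilon>: "0 < \<epsilon>" and T: "sp.\<tau> \<le> T" and \<kappa>: "\<kappa> = \<sigma>\<^sup>2 * \<epsilon>\<^sup>2 / (8 * T ^ 3)" and small: "(22 / \<sigma> + 3 / \<sigma>\<^sup>2) * e \<le> \<kappa> / 4"
    and W: "countable W" "\<And>w. w \<in> W \<Longrightarrow> feasible w \<and> \<epsilon> * r < \<bar>nrm n w - r\<bar>"
  shows "measure (gauss I) {A \<in> space (gauss I). \<exists>w\<in>W. nrm m (\<lambda>i. mv n A w i - y i) < sqrt (real m) * (sp.base + \<kappa> * t\<^sup>2 / 2)}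
    \<le> 2 * fail"
proof -
  obtain B where B: "B \<in> sets (gauss J)" "measure (gauss J) B \<le> fail"
    "\<And>b. b \<in> space (gauss J) \<Longrightarrow> b \<notin> B \<Longrightarrow> sp.concentrated b"
    using exceptional_set by metis
  have \<tau>: "0 < sp.\<tau>" by (rule sp.tau_pos)
  then have T0: "0 < T" using T by simp
  have \<kappa>0: "0 < \<kappa>" unfolding \<kappa> using \<sigma> \<epsilon> T0 by simp
  have "measure (gauss I) {A \<in> space (gauss I). \<exists>w\<in>W. nrm m (\<lambda>i. mv n A w i - y i) < sqrt (real m) * (sp.base + \<kappa> * t\<^sup>2 / 2)}
      \<le> 2 * measure (gauss J) B"
  proof (rule gmt_lower[OF mn(1) W(1) B(1)])
    fix b w assume b: "b \<in> space (gauss J)" and w: "w \<in> W"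
      and le: "gordon_obj m n y b w \<le> sqrt (real m) * (sp.base + \<kappa> * t\<^sup>2 / 2)"
    have fw: "\<And>j. j < n \<Longrightarrow> - \<mu> j \<le> sqrt (real n) * w j" "nrm n w \<le> 2 * r" "\<epsilon> * r \<le> \<bar>nrm n w - r\<bar>"
      using W(2)[OF w] by (auto simp: feasible_def)
    show "b \<in> B"
    proof (rule ccontr)
      assume "b \<notin> B"
      then have concentrated: "sp.concentrated b" using B(3) b by simp
      have "(\<epsilon> * r)\<^sup>2 \<le> (r - nrm n w)\<^sup>2"
        using fw(3) \<epsilon> r by (intro abs_le_square_iff[THEN iffD1]) (simp add: abs_mult)
      moreover have "\<epsilon>\<^sup>2 * (t\<^sup>2 / 2) \<le> (\<epsilon> * r)\<^sup>2"
        unfolding power_mult_distrib using sp.rt(2) by (intro mult_left_mono) auto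
      ultimately have "\<sigma>\<^sup>2 * (\<epsilon>\<^sup>2 * (t\<^sup>2 / 2)) \<le> \<sigma>\<^sup>2 * (r - nrm n w)\<^sup>2"
        by (intro mult_left_mono) auto
      moreover have "4 * sp.\<tau> ^ 3 \<le> 4 * T ^ 3" using T \<tau> by (intro mult_left_mono power_mono) auto
      ultimately have "\<sigma>\<^sup>2 * (\<epsilon>\<^sup>2 * (t\<^sup>2 / 2)) / (4 * T ^ 3) \<le> \<sigma>\<^sup>2 * (r - nrm n w)\<^sup>2 / (4 * sp.\<tau> ^ 3)"
        using \<tau> by (intro frac_le) auto
      moreover have "\<kappa> * t\<^sup>2 = \<sigma>\<^sup>2 * (\<epsilon>\<^sup>2 * (t\<^sup>2 / 2)) / (4 * T ^ 3)" by (simp add: \<kappa>)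
      ultimately have gap: "\<kappa> * t\<^sup>2 \<le> \<sigma>\<^sup>2 * (r - nrm n w)\<^sup>2 / (4 * sp.\<tau> ^ 3)" by simp
      have sm: "(22 / \<sigma> + 3 / \<sigma>\<^sup>2) * e * t\<^sup>2 \<le> \<kappa> / 4 * t\<^sup>2" using small by (intro mult_right_mono) auto
      have "0 < \<kappa> * t\<^sup>2" using \<kappa>0 t by simp
      then have "sp.base + \<kappa> * t\<^sup>2 / 2 < gordon_obj m n y b w / sqrt (real m)"
        using sp.gordon_obj_lower[OF concentrated fw(1,2)] gap sm by simp
      then show False using le mn by (simp add: pos_less_divide_eq mult.commute)
    qed
  qed
  then show ?thesis using B(2) by simp
qed

text \<open>On the good event \<open>w_opt\<close> is feasible and exceeds \<open>base\<close> by at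
  most \<kappa> t^2 / 4, less than the fraction 3 / 8 - 1 / 16 = 5 / 16, where 1 / 16 is the slack
  of \<open>gmt_upper\<close>. The distance from 3 / 8 to the 1 / 2 of \<open>off_band_prob\<close>
  is what a near minimizer may waste. Positivity of \<open>base\<close> makes the threshold
  positive, as duality requires.\<close>

lemma feasible_prob:
  assumes \<kappa>0: "0 < \<kappa>" and small: "(22 / \<sigma> + 3 / \<sigma>\<^sup>2) * e \<le> \<kappa> / 4" and base: "0 < sp.base"
  shows "measure (gauss I) {A \<in> space (gauss I). \<forall>w. feasible w \<longrightarrow>
      sqrt (real m) * (sp.base + 3 / 8 * \<kappa> * t\<^sup>2) \<le> nrm m (\<lambda>i. mv n A w i - y i)} \<le> 2 * fail"
proof -
  obtain B where B: "B \<in> sets (gauss J)" "measure (gauss J) B \<le> fail"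
    "\<And>b. b \<in> space (gauss J) \<Longrightarrow> b \<notin> B \<Longrightarrow> sp.concentrated b"
    using exceptional_set by metis
  have kt: "0 < \<kappa> * t\<^sup>2" using \<kappa>0 t by simp
  have m: "0 < sqrt (real m)" and n: "0 < sqrt (real n)" using mn by auto
  have "measure (gauss I) {A \<in> space (gauss I). \<forall>w\<in>{w. feasible w}.
      sqrt (real m) * (sp.base + 3 / 8 * \<kappa> * t\<^sup>2) \<le> nrm m (\<lambda>i. mv n A w i - y i)} \<le> 2 * measure (gauss J) B"
  proof (rule gmt_upper[OF mn(1), where \<rho>="2 * r" and e="sqrt (real m) * (\<kappa> * t\<^sup>2 / 16)"])
    have "feasible (\<lambda>_. 0)" using \<mu> r by (simp add: feasible_def L2_set_def)
    then show "{w. feasible w} \<noteq> {}" by auto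
    show "0 < sqrt (real m) * (sp.base + 3 / 8 * \<kappa> * t\<^sup>2)" "0 < sqrt (real m) * (\<kappa> * t\<^sup>2 / 16)"
      using m base kt by (auto intro!: mult_pos_pos add_pos_pos)
    show "nrm n w \<le> 2 * r" if "w \<in> {w. feasible w}" for w using that by (simp add: feasible_def)
    fix w w' \<theta> assume w: "w \<in> {w. feasible w}" "w' \<in> {w. feasible w}" and \<theta>: "0 \<le> \<theta>" "\<theta> \<le> (1::real)"
    have "- \<mu> j \<le> sqrt (real n) * ((1 - \<theta>) * w j + \<theta> * w' j)" if "j < n" for j
    proof -
      have "- \<mu> j \<le> sqrt (real n) * w j" "- \<mu> j \<le> sqrt (real n) * w' j"
        using w that by (auto simp: feasible_def)
      then have "(1 - \<theta>) * (- \<mu> j) \<le> (1 - \<theta>) * (sqrt (real n) * w j)" "\<theta> * (- \<mu> j) \<le> \<theta> * (sqrt (real n) * w' j)"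
        using \<theta> by (intro mult_left_mono; simp)+
      then show ?thesis by (simp add: algebra_simps)
    qed
    moreover have "nrm n (\<lambda>j. (1 - \<theta>) * w j + \<theta> * w' j) < 2 * r"
    proof -
      have "nrm n (\<lambda>j. (1 - \<theta>) * w j + \<theta> * w' j) \<le> nrm n (\<lambda>j. (1 - \<theta>) * w j) + nrm n (\<lambda>j. \<theta> * w' j)"
        by (rule L2_set_triangle_ineq)
      also have "\<dots> = (1 - \<theta>) * nrm n w + \<theta> * nrm n w'" unfolding nrm_scale using \<theta> by simp
      also have "\<dots> < 2 * r"
        by (rule convex_bound_lt) (use w \<theta> in \<open>auto simp: feasible_def\<close>)
      finally show ?thesis .
    qed
    ultimately show "(\<lambda>j. (1 - \<theta>) * w j + \<theta> * w' j) \<in> {w. feasible w}" by (simp add: feasible_def)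
  next
    fix b assume b: "b \<in> space (gauss J)"
      and le: "\<And>w. w \<in> {w. feasible w} \<Longrightarrow> sqrt (real m) * (sp.base + 3 / 8 * \<kappa> * t\<^sup>2) - sqrt (real m) * (\<kappa> * t\<^sup>2 / 16) \<le> gordon_obj m n y b w"
    show "b \<in> B"
    proof (rule ccontr)
      assume "b \<notin> B"
      then have concentrated: "sp.concentrated b" using B(3) b by simp
      have "feasible (sp.w_opt b)"
        using sp.w_opt_bounds(3)[OF concentrated] n by (auto simp: feasible_def sp.w_opt_def sp.P_def)
      then have "sqrt (real m) * (sp.base + 5 / 16 * (\<kappa> * t\<^sup>2)) \<le> gordon_obj m n y b (sp.w_opt b)"
        using le[of "sp.w_opt b"] by (simp add: algebra_simps)
      then have "sp.base + 5 / 16 * (\<kappa> * t\<^sup>2) \<le> gordon_obj m n y b (sp.w_opt b) / sqrt (real m)"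
        using m by (simp add: pos_le_divide_eq mult.commute)
      moreover have "(22 / \<sigma> + 3 / \<sigma>\<^sup>2) * e * t\<^sup>2 \<le> \<kappa> / 4 * t\<^sup>2" using small by (intro mult_right_mono) auto
      ultimately show False using sp.gordon_obj_upper[OF concentrated] kt by simp
    qed
  qed (rule B(1))
  then show ?thesis using B(2) by simp
qed

end

section \<open>Typical designs as measurable events\<close>

lemma closure_meets_open:
  assumes "K \<subseteq> closure K0" "open O'" "x \<in> K" "x \<in> O'"
  obtains x' where "x' \<in> K0" "x' \<in> O'"
  using open_Int_closure_eq_empty[OF assms(2), of K0] assms by blast

text \<open>The numbers that stay fixed while noise and signal vary; what \<open>design\<close> asks
  of the two vectors becomes the predicate \<open>regular\<close>.\<close>

locale design_params =
  fixes m n :: nat and \<sigma> r t \<Phi> e \<gamma> \<epsilon> T \<kappa> :: real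
  assumes mn: "0 < m" "0 < n" and ratio: "1 / 2 < real m / real n"
    and \<sigma>: "0 < \<sigma>" and r: "0 < r" and t: "0 < t" and e: "0 < e" "e < 1"
    and rt: "r\<^sup>2 = t\<^sup>2 * \<gamma>" "1 / 2 \<le> \<gamma>" "\<gamma> \<le> 1" and tau: "r\<^sup>2 + \<sigma>\<^sup>2 = real m / real n * t\<^sup>2"
    and \<epsilon>: "0 < \<epsilon>" and T: "sqrt (r\<^sup>2 + \<sigma>\<^sup>2) \<le> T" and \<kappa>: "\<kappa> = \<sigma>\<^sup>2 * \<epsilon>\<^sup>2 / (8 * T ^ 3)"
    and small: "(22 / \<sigma> + 3 / \<sigma>\<^sup>2) * e \<le> \<kappa> / 4"
begin

definition "noise_level y = nrm m y / sqrt (real m)"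

text \<open>The value \<open>base\<close> belonging to the noise y.\<close>

definition "level y = sqrt (r\<^sup>2 + (noise_level y)\<^sup>2) - t\<^sup>2 * \<Phi> / sqrt (r\<^sup>2 + \<sigma>\<^sup>2)"

definition "dist_to \<mu> \<mu>' = nrm n (\<lambda>j. \<mu>' j - \<mu> j)"

definition "resid x y \<mu> \<mu>' = nrm m (\<lambda>i. mv n x (\<lambda>j. \<mu>' j - \<mu> j) i - y i)"

definition regular :: "(nat \<Rightarrow> real) \<Rightarrow> (nat \<Rightarrow> real) \<Rightarrow> bool" where
  "regular y \<mu> \<longleftrightarrow> (\<forall>j<n. 0 \<le> \<mu> j) \<and> \<sigma> / 2 \<le> noise_level y \<and> \<bar>noise_level y - \<sigma>\<bar> \<le> e \<and>
     \<bar>(\<Sum>j<n. G_fun (\<mu> j / t)) - real n * \<gamma>\<bar> \<le> e * real n / 2 \<and>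
     \<bar>(\<Sum>j<n. std_normal_cdf (\<mu> j / t)) - real n * \<Phi>\<bar> \<le> e * real n / 2 \<and> 0 < level y"

definition cone :: "(nat \<Rightarrow> real) set" where "cone = {\<mu>. \<forall>j<n. 0 \<le> \<mu> j}"

text \<open>This set and \<open>near\<close> are given by strict inequalities, hence open, and
  whether they meet the cone is decided on a countable dense subset. That yields measurability and
  the countable V of \<open>gmt_lower\<close>.\<close>

definition off_band :: "(nat \<times> nat \<Rightarrow> real) \<Rightarrow> (nat \<Rightarrow> real) \<Rightarrow> (nat \<Rightarrow> real) \<Rightarrow> (nat \<Rightarrow> real) set" where
  "off_band x y \<mu> = {\<mu>'. dist_to \<mu> \<mu>' < 2 * r * sqrt (real n) \<and> \<epsilon> * r * sqrt (real n) < \<bar>dist_to \<mu> \<mu>' - r * sqrt (real n)\<bar> \<and>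
     resid x y \<mu> \<mu>' < sqrt (real m) * (level y + \<kappa> * t\<^sup>2 / 2)}"

definition near :: "(nat \<times> nat \<Rightarrow> real) \<Rightarrow> (nat \<Rightarrow> real) \<Rightarrow> (nat \<Rightarrow> real) \<Rightarrow> (nat \<Rightarrow> real) set" where
  "near x y \<mu> = {\<mu>'. dist_to \<mu> \<mu>' < 2 * r * sqrt (real n) \<and>
     resid x y \<mu> \<mu>' < sqrt (real m) * (level y + 3 / 8 * \<kappa> * t\<^sup>2)}"

text \<open>Regularity is part of the event, so that its probability is bounded for every value of
  noise and signal, as conditioning by sections demands.\<close>

definition atypical :: "(nat \<times> nat \<Rightarrow> real) \<Rightarrow> (nat \<Rightarrow> real) \<Rightarrow> (nat \<Rightarrow> real) \<Rightarrow> bool" where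
  "atypical x y \<mu> \<longleftrightarrow> regular y \<mu> \<and> (cone \<inter> off_band x y \<mu> \<noteq> {} \<or> cone \<inter> near x y \<mu> = {})"

text \<open>Two events, each bounded by twice the \<open>fail\<close> of
  \<open>design\<close>.\<close>

definition fail_prob :: real where "fail_prob = 4 * ((30 + (1 + 1 / \<sigma>)\<^sup>2) / (e\<^sup>2 * real n))"

lemma continuous_dist_resid:
  "continuous_on UNIV (\<lambda>\<mu>'. dist_to \<mu> \<mu>')" "continuous_on UNIV (\<lambda>\<mu>'. resid x y \<mu> \<mu>')"
  unfolding dist_to_def resid_def L2_set_def
  by (intro continuous_intros continuous_on_product_coordinates)+

lemma open_off_band: "open (off_band x y \<mu>)"
proof -
  have "off_band x y \<mu> = {\<mu>'. dist_to \<mu> \<mu>' < 2 * r * sqrt (real n)}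
    \<inter> {\<mu>'. \<epsilon> * r * sqrt (real n) < \<bar>dist_to \<mu> \<mu>' - r * sqrt (real n)\<bar>}
    \<inter> {\<mu>'. resid x y \<mu> \<mu>' < sqrt (real m) * (level y + \<kappa> * t\<^sup>2 / 2)}"
    by (auto simp: off_band_def)
  then show ?thesis
    by (simp only:) (intro open_Int open_Collect_less continuous_intros continuous_dist_resid)
qed

lemma open_near: "open (near x y \<mu>)"
proof -
  have "near x y \<mu> = {\<mu>'. dist_to \<mu> \<mu>' < 2 * r * sqrt (real n)}
    \<inter> {\<mu>'. resid x y \<mu> \<mu>' < sqrt (real m) * (level y + 3 / 8 * \<kappa> * t\<^sup>2)}"
    by (auto simp: near_def)
  then show ?thesis
    by (simp only:) (intro open_Int open_Collect_less continuous_intros continuous_dist_resid)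
qed

text \<open>A change of variables: the design is a standard matrix divided by sqrt n, and
  \<open>scl\<close> shifts this factor to the displacement. For the lower bound the cone is
  replaced by the countable set \<open>K0\<close>, for the upper bound it is kept whole, since
  convexity is needed.\<close>

lemma gaussian_atypical:
  assumes reg: "regular y \<mu>" and K0: "countable K0" "K0 \<subseteq> cone" "cone \<subseteq> closure K0"
  shows "measure (gauss ({..<m} \<times> {..<n})) {z \<in> space (gauss ({..<m} \<times> {..<n})).
      cone \<inter> off_band (\<lambda>k\<in>{..<m} \<times> {..<n}. z k / sqrt (real n)) y \<mu> \<noteq> {}} \<le> fail_prob / 2" (is ?off)
    and "measure (gauss ({..<m} \<times> {..<n})) {z \<in> space (gauss ({..<m} \<times> {..<n})).
      cone \<inter> near (\<lambda>k\<in>{..<m} \<times> {..<n}. z k / sqrt (real n)) y \<mu> = {}} \<le> fail_prob / 2" (is ?near)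
proof -
  interpret d: design m n \<sigma> r t \<Phi> e "noise_level y" \<mu> y \<gamma>
    by unfold_locales
      (fact mn ratio \<sigma> r t e rt tau noise_level_def | use reg in \<open>simp only: regular_def\<close>)+
  have base: "d.sp.base = level y" by (simp add: d.sp.base_def level_def d.sp.\<tau>_def)
  have q: "0 < sqrt (real n)" using mn by simp
  define scl where "scl \<mu>' j = (\<mu>' j - \<mu> j) / sqrt (real n)" for \<mu>' :: "nat \<Rightarrow> real" and j
  define R where "R z = (\<lambda>k\<in>{..<m} \<times> {..<n}. z k / sqrt (real n))" for z :: "nat \<times> nat \<Rightarrow> real"
  have dist: "dist_to \<mu> \<mu>' = sqrt (real n) * nrm n (scl \<mu>')" for \<mu>'
  proof -
    have "scl \<mu>' = (\<lambda>j. (1 / sqrt (real n)) * (\<mu>' j - \<mu> j))" by (simp add: scl_def fun_eq_iff)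
    then have "nrm n (scl \<mu>') = \<bar>1 / sqrt (real n)\<bar> * nrm n (\<lambda>j. \<mu>' j - \<mu> j)"
      by (simp only: nrm_scale)
    then show ?thesis using q by (simp add: dist_to_def)
  qed
  have res: "resid (R z) y \<mu> \<mu>' = nrm m (\<lambda>i. mv n z (scl \<mu>') i - y i)" for z \<mu>'
    unfolding resid_def by (intro L2_set_cong refl) (auto simp: R_def scl_def intro!: sum.cong)
  have scl_onto: "scl (\<lambda>j. \<mu> j + sqrt (real n) * w j) = w" for w
    using q by (simp add: scl_def fun_eq_iff)
  have feas: "d.feasible (scl \<mu>') \<longleftrightarrow> \<mu>' \<in> cone \<and> dist_to \<mu> \<mu>' < 2 * r * sqrt (real n)" for \<mu>'
    unfolding d.feasible_def dist cone_def using q by (auto simp: scl_def mult.commute)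
  have band: "\<epsilon> * r * sqrt (real n) < \<bar>dist_to \<mu> \<mu>' - r * sqrt (real n)\<bar> \<longleftrightarrow> \<epsilon> * r < \<bar>nrm n (scl \<mu>') - r\<bar>" for \<mu>'
  proof -
    have "dist_to \<mu> \<mu>' - r * sqrt (real n) = sqrt (real n) * (nrm n (scl \<mu>') - r)" by (simp add: dist algebra_simps)
    then have "\<bar>dist_to \<mu> \<mu>' - r * sqrt (real n)\<bar> = sqrt (real n) * \<bar>nrm n (scl \<mu>') - r\<bar>" using q by (simp add: abs_mult)
    then show ?thesis using q by (simp add: mult.commute)
  qed
  define W where "W = scl ` {\<mu>' \<in> K0. dist_to \<mu> \<mu>' < 2 * r * sqrt (real n) \<and> \<epsilon> * r * sqrt (real n) < \<bar>dist_to \<mu> \<mu>' - r * sqrt (real n)\<bar>}"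
  have W: "countable W" unfolding W_def
    by (intro countable_image countable_subset[OF _ K0(1)]) auto
  have Wf: "d.feasible w \<and> \<epsilon> * r < \<bar>nrm n w - r\<bar>" if "w \<in> W" for w
    using that K0(2) feas band by (auto simp: W_def)
  have off: "cone \<inter> off_band (R z) y \<mu> \<noteq> {} \<longleftrightarrow> (\<exists>w\<in>W. nrm m (\<lambda>i. mv n z w i - y i) < sqrt (real m) * (level y + \<kappa> * t\<^sup>2 / 2))" for z
  proof
    assume "cone \<inter> off_band (R z) y \<mu> \<noteq> {}"
    then obtain \<mu>' where "\<mu>' \<in> cone" "\<mu>' \<in> off_band (R z) y \<mu>" by auto
    from closure_meets_open[OF K0(3) open_off_band this] obtain \<nu> where "\<nu> \<in> K0" "\<nu> \<in> off_band (R z) y \<mu>" .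
    then show "\<exists>w\<in>W. nrm m (\<lambda>i. mv n z w i - y i) < sqrt (real m) * (level y + \<kappa> * t\<^sup>2 / 2)"
      by (intro bexI[of _ "scl \<nu>"]) (auto simp: W_def off_band_def res)
  next
    assume "\<exists>w\<in>W. nrm m (\<lambda>i. mv n z w i - y i) < sqrt (real m) * (level y + \<kappa> * t\<^sup>2 / 2)"
    then show "cone \<inter> off_band (R z) y \<mu> \<noteq> {}"
      using K0(2) by (auto simp: W_def off_band_def res)
  qed
  have nr: "cone \<inter> near (R z) y \<mu> = {} \<longleftrightarrow> (\<forall>w. d.feasible w \<longrightarrow> sqrt (real m) * (level y + 3 / 8 * \<kappa> * t\<^sup>2) \<le> nrm m (\<lambda>i. mv n z w i - y i))" for z
  proof
    assume em: "cone \<inter> near (R z) y \<mu> = {}"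
    show "\<forall>w. d.feasible w \<longrightarrow> sqrt (real m) * (level y + 3 / 8 * \<kappa> * t\<^sup>2) \<le> nrm m (\<lambda>i. mv n z w i - y i)"
    proof (intro allI impI)
      fix w assume w: "d.feasible w"
      let ?\<mu> = "\<lambda>j. \<mu> j + sqrt (real n) * w j"
      have "?\<mu> \<in> cone" "dist_to \<mu> ?\<mu> < 2 * r * sqrt (real n)" using feas[of ?\<mu>] w unfolding scl_onto by auto
      moreover have "?\<mu> \<notin> near (R z) y \<mu>" using em calculation(1) by auto
      ultimately show "sqrt (real m) * (level y + 3 / 8 * \<kappa> * t\<^sup>2) \<le> nrm m (\<lambda>i. mv n z w i - y i)"
        by (auto simp: near_def res scl_onto not_less)
    qed
  next
    assume "\<forall>w. d.feasible w \<longrightarrow> sqrt (real m) * (level y + 3 / 8 * \<kappa> * t\<^sup>2) \<le> nrm m (\<lambda>i. mv n z w i - y i)"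
    then show "cone \<inter> near (R z) y \<mu> = {}"
      using feas by (fastforce simp: near_def res)
  qed
  have "fail_prob = 4 * d.fail" by (simp only: fail_prob_def d.fail_def)
  then have fp: "fail_prob / 2 = 2 * d.fail" by simp
  have T': "d.sp.\<tau> \<le> T" using T by (simp add: d.sp.\<tau>_def)
  have T0: "0 < T" using d.sp.tau_pos(1) T' by simp
  have \<kappa>0: "0 < \<kappa>" unfolding \<kappa> using \<sigma> \<epsilon> T0 by simp
  show ?off
    unfolding fp R_def[symmetric] off base[symmetric] by (rule d.off_band_prob[OF \<epsilon> T' \<kappa> small W Wf])
  have "0 < d.sp.base" using reg by (simp add: base regular_def)
  then show ?near
    unfolding fp R_def[symmetric] nr base[symmetric] by (rule d.feasible_prob[OF \<kappa>0 small])
qed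

lemma measurable_atypical:
  defines "S \<equiv> (borel_vec ({..<m} \<times> {..<n}) \<Otimes>\<^sub>M borel_vec {..<m}) \<Otimes>\<^sub>M borel_vec {..<n}"
  shows "{z \<in> space S. regular (snd (fst z)) (snd z)} \<in> sets S"
    "{z \<in> space S. cone \<inter> off_band (fst (fst z)) (snd (fst z)) (snd z) \<noteq> {}} \<in> sets S"
    "{z \<in> space S. cone \<inter> near (fst (fst z)) (snd (fst z)) (snd z) = {}} \<in> sets S"
proof -
  have mx: "(\<lambda>z. fst (fst z) k) \<in> borel_measurable S" if "k \<in> {..<m} \<times> {..<n}" for k
    unfolding S_def using that by (intro measurable_compose[OF measurable_compose[OF measurable_fst measurable_fst] measurable_component_singleton])
  have my: "(\<lambda>z. snd (fst z) i) \<in> borel_measurable S" if "i < m" for i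
    unfolding S_def using that by (intro measurable_compose[OF measurable_compose[OF measurable_fst measurable_snd] measurable_component_singleton]) auto
  have m\<mu>: "(\<lambda>z. snd z j) \<in> borel_measurable S" if "j < n" for j
    unfolding S_def using that by (intro measurable_compose[OF measurable_snd measurable_component_singleton]) auto
  have mnl [measurable]: "(\<lambda>z. noise_level (snd (fst z))) \<in> borel_measurable S"
    unfolding noise_level_def by (intro borel_measurable_divide borel_measurable_const measurable_nrm my)
  have mlev [measurable]: "(\<lambda>z. level (snd (fst z))) \<in> borel_measurable S"
    unfolding level_def by measurable
  have mdist [measurable]: "(\<lambda>z. dist_to (snd z) \<mu>') \<in> borel_measurable S" for \<mu>'
    unfolding dist_to_def by (intro measurable_nrm borel_measurable_diff borel_measurable_const m\<mu>)
  have mres [measurable]: "(\<lambda>z. resid (fst (fst z)) (snd (fst z)) (snd z) \<mu>') \<in> borel_measurable S" for \<mu>'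
    unfolding resid_def
    by (intro measurable_nrm borel_measurable_diff borel_measurable_sum borel_measurable_times borel_measurable_const m\<mu> my mx) auto
  have mG [measurable]: "(\<lambda>z. \<Sum>j<n. G_fun (snd z j / t)) \<in> borel_measurable S" "(\<lambda>z. \<Sum>j<n. std_normal_cdf (snd z j / t)) \<in> borel_measurable S"
    using m\<mu> by (auto intro!: borel_measurable_sum measurable_compose[OF _ measurable_G_fun] measurable_compose[OF _ measurable_std_normal_cdf] borel_measurable_divide)
  have 1: "{z \<in> space S. \<forall>j<n. 0 \<le> snd z j} \<in> sets S"
  proof -
    have "{z \<in> space S. 0 \<le> snd z j} \<in> sets S" if "j < n" for j using m\<mu>[OF that] by measurable
    then have "{z \<in> space S. \<forall>j\<in>{..<n}. 0 \<le> snd z j} \<in> sets S"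
      by (intro sets.sets_Collect_finite_All) auto
    then show ?thesis by (simp only: lessThan_iff Ball_def)
  qed
  have 2: "{z \<in> space S. \<sigma> / 2 \<le> noise_level (snd (fst z)) \<and> \<bar>noise_level (snd (fst z)) - \<sigma>\<bar> \<le> e \<and>
     \<bar>(\<Sum>j<n. G_fun (snd z j / t)) - real n * \<gamma>\<bar> \<le> e * real n / 2 \<and>
     \<bar>(\<Sum>j<n. std_normal_cdf (snd z j / t)) - real n * \<Phi>\<bar> \<le> e * real n / 2 \<and> 0 < level (snd (fst z))} \<in> sets S"
    by (intro sets.sets_Collect_conj borel_measurable_le borel_measurable_less borel_measurable_const
        borel_measurable_abs borel_measurable_diff mnl mlev mG)
  show "{z \<in> space S. regular (snd (fst z)) (snd z)} \<in> sets S"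
  proof -
    have "{z \<in> space S. regular (snd (fst z)) (snd z)} = {z \<in> space S. \<forall>j<n. 0 \<le> snd z j} \<inter>
      {z \<in> space S. \<sigma> / 2 \<le> noise_level (snd (fst z)) \<and> \<bar>noise_level (snd (fst z)) - \<sigma>\<bar> \<le> e \<and>
       \<bar>(\<Sum>j<n. G_fun (snd z j / t)) - real n * \<gamma>\<bar> \<le> e * real n / 2 \<and>
       \<bar>(\<Sum>j<n. std_normal_cdf (snd z j / t)) - real n * \<Phi>\<bar> \<le> e * real n / 2 \<and> 0 < level (snd (fst z))}"
      unfolding regular_def by blast
    then show ?thesis using sets.Int[OF 1 2] by (simp only:)
  qed
  obtain K0 where K0: "countable K0" "K0 \<subseteq> cone" "cone \<subseteq> closure K0" by (rule separable[of cone])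
  have eq: "cone \<inter> O' \<noteq> {} \<longleftrightarrow> (\<exists>\<mu>'\<in>K0. \<mu>' \<in> O')" if "open O'" for O'
  proof
    assume "cone \<inter> O' \<noteq> {}"
    then obtain \<mu>' where "\<mu>' \<in> cone" "\<mu>' \<in> O'" by auto
    from closure_meets_open[OF K0(3) that this] show "\<exists>\<mu>'\<in>K0. \<mu>' \<in> O'" by auto
  qed (use K0(2) in auto)
  have "{z \<in> space S. \<exists>\<mu>'\<in>K0. \<mu>' \<in> off_band (fst (fst z)) (snd (fst z)) (snd z)} \<in> sets S"
  proof (rule sets.sets_Collect_countable_Ex'[OF _ K0(1)])
    fix \<mu>'
    show "{z \<in> space S. \<mu>' \<in> off_band (fst (fst z)) (snd (fst z)) (snd z)} \<in> sets S"
      unfolding off_band_def mem_Collect_eq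
      by (intro sets.sets_Collect_conj borel_measurable_less borel_measurable_const borel_measurable_times
          borel_measurable_abs borel_measurable_diff borel_measurable_add mdist mres mlev)
  qed
  then show "{z \<in> space S. cone \<inter> off_band (fst (fst z)) (snd (fst z)) (snd z) \<noteq> {}} \<in> sets S"
    by (simp only: eq[OF open_off_band])
  have "{z \<in> space S. \<exists>\<mu>'\<in>K0. \<mu>' \<in> near (fst (fst z)) (snd (fst z)) (snd z)} \<in> sets S"
  proof (rule sets.sets_Collect_countable_Ex'[OF _ K0(1)])
    fix \<mu>'
    show "{z \<in> space S. \<mu>' \<in> near (fst (fst z)) (snd (fst z)) (snd z)} \<in> sets S"
      unfolding near_def mem_Collect_eq
      by (intro sets.sets_Collect_conj borel_measurable_less borel_measurable_const borel_measurable_times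
          borel_measurable_add mdist mres mlev)
  qed
  then have "{z \<in> space S. \<not> (\<exists>\<mu>'\<in>K0. \<mu>' \<in> near (fst (fst z)) (snd (fst z)) (snd z))} \<in> sets S"
    by (rule sets.sets_Collect_neg)
  then show "{z \<in> space S. cone \<inter> near (fst (fst z)) (snd (fst z)) (snd z) = {}} \<in> sets S"
    by (simp only: eq[OF open_near, symmetric] not_not)
qed

end

section \<open>The linear model\<close>

lemma iid_distr:
  assumes M: "prob_space M" and iid: "iid_with_law M I X L" and I: "I \<noteq> {}" and X: "X \<in> M \<rightarrow>\<^sub>M borel_vec I"
  shows "distr M (borel_vec I) X = (\<Pi>\<^sub>M i\<in>I. L)"
proof -
  interpret prob_space M by fact
  have ind: "indep_vars (\<lambda>_. borel) (\<lambda>i \<omega>. X \<omega> i) I" and law: "\<And>i. i \<in> I \<Longrightarrow> distr M borel (\<lambda>\<omega>. X \<omega> i) = L"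
    using iid by (auto simp: iid_with_law_def)
  have "distr M (borel_vec I) (\<lambda>\<omega>. \<lambda>i\<in>I. X \<omega> i) = (\<Pi>\<^sub>M i\<in>I. distr M borel (\<lambda>\<omega>. X \<omega> i))"
    using ind by (subst indep_vars_iff_distr_eq_PiM'[OF I, symmetric]) (auto simp: indep_vars_def)
  also have "\<dots> = (\<Pi>\<^sub>M i\<in>I. L)" by (intro PiM_cong refl law)
  also have "distr M (borel_vec I) (\<lambda>\<omega>. \<lambda>i\<in>I. X \<omega> i) = distr M (borel_vec I) X"
  proof (rule distr_cong[OF refl refl])
    fix \<omega> assume "\<omega> \<in> space M"
    then have "X \<omega> \<in> space (borel_vec I)" using measurable_space[OF X] by auto
    then show "(\<lambda>i\<in>I. X \<omega> i) = X \<omega>" by (auto simp: space_PiM)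
  qed
  finally show ?thesis .
qed

context design_params
begin

text \<open>By independence the signal is frozen first and the noise second. For fixed regular
  values only the Gaussian matrix is random, and each bound of \<open>gaussian_atypical\<close>
  contributes half of \<open>fail_prob\<close>.\<close>

lemma atypical_prob:
  assumes lm: "linear_model m n L L0 M X \<xi> \<mu>0 Y"
  shows "{\<omega> \<in> space M. atypical (X \<omega>) (\<xi> \<omega>) (\<mu>0 \<omega>)} \<in> sets M"
    "measure M {\<omega> \<in> space M. atypical (X \<omega>) (\<xi> \<omega>) (\<mu>0 \<omega>)} \<le> fail_prob"
proof -
  let ?I = "{..<m} \<times> {..<n}"
  let ?BX = "borel_vec ?I" and ?B\<xi> = "borel_vec {..<m}" and ?B\<mu> = "borel_vec {..<n}"
  define S where "S = (?BX \<Otimes>\<^sub>M ?B\<xi>) \<Otimes>\<^sub>M ?B\<mu>"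
  have M: "prob_space M" and iidX: "iid_with_law M ?I X (density lborel (normal_density 0 (sqrt (1 / real n))))"
    and ind1: "indep_elements M ?BX X ?B\<xi> \<xi>" and ind2: "indep_elements M (?BX \<Otimes>\<^sub>M ?B\<xi>) (\<lambda>\<omega>. (X \<omega>, \<xi> \<omega>)) ?B\<mu> \<mu>0"
    using lm by (auto simp: linear_model_def)
  interpret prob_space M by fact
  have X: "X \<in> M \<rightarrow>\<^sub>M ?BX" and \<xi>: "\<xi> \<in> M \<rightarrow>\<^sub>M ?B\<xi>" and \<mu>0: "\<mu>0 \<in> M \<rightarrow>\<^sub>M ?B\<mu>"
    using ind1 ind2 by (auto simp: indep_elements_def)
  define R O' N where "R = {z \<in> space S. regular (snd (fst z)) (snd z)}"
    and "O' = {z \<in> space S. cone \<inter> off_band (fst (fst z)) (snd (fst z)) (snd z) \<noteq> {}}"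
    and "N = {z \<in> space S. cone \<inter> near (fst (fst z)) (snd (fst z)) (snd z) = {}}"
  have sets: "R \<in> sets S" "O' \<in> sets S" "N \<in> sets S"
    using measurable_atypical unfolding R_def O'_def N_def S_def by simp_all
  define E where "E = R \<inter> (O' \<union> N)"
  have E: "E \<in> sets S" using sets by (auto simp: E_def)
  have joint: "(\<lambda>\<omega>. ((X \<omega>, \<xi> \<omega>), \<mu>0 \<omega>)) \<in> M \<rightarrow>\<^sub>M S" unfolding S_def using X \<xi> \<mu>0 by measurable
  have ev: "{\<omega> \<in> space M. atypical (X \<omega>) (\<xi> \<omega>) (\<mu>0 \<omega>)} = {\<omega> \<in> space M. ((X \<omega>, \<xi> \<omega>), \<mu>0 \<omega>) \<in> E}"
    using measurable_space[OF joint] by (auto simp: E_def R_def O'_def N_def atypical_def)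
  have "(\<lambda>\<omega>. ((X \<omega>, \<xi> \<omega>), \<mu>0 \<omega>)) -` E \<inter> space M \<in> sets M" by (rule measurable_sets[OF joint E])
  moreover have "(\<lambda>\<omega>. ((X \<omega>, \<xi> \<omega>), \<mu>0 \<omega>)) -` E \<inter> space M = {\<omega> \<in> space M. ((X \<omega>, \<xi> \<omega>), \<mu>0 \<omega>) \<in> E}" by auto
  ultimately show "{\<omega> \<in> space M. atypical (X \<omega>) (\<xi> \<omega>) (\<mu>0 \<omega>)} \<in> sets M" by (simp only: ev)
  have fp0: "0 \<le> fail_prob" by (simp add: fail_prob_def add_nonneg_nonneg)
  have I: "?I \<noteq> {}" "finite ?I" using mn by auto
  define scl where "scl z = (\<lambda>k\<in>?I. z k / sqrt (real n))" for z :: "nat \<times> nat \<Rightarrow> real"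
  have scl: "scl \<in> gauss ?I \<rightarrow>\<^sub>M ?BX" unfolding scl_def
    by (intro measurable_restrict borel_measurable_divide measurable_gauss_component borel_measurable_const)
  have lawX: "distr M ?BX X = distr (gauss ?I) ?BX scl"
  proof -
    have "distr M ?BX X = (\<Pi>\<^sub>M i\<in>?I. density lborel (normal_density 0 (sqrt (1 / real n))))"
      by (rule iid_distr[OF M iidX I(1) X])
    also have "\<dots> = distr (gauss ?I) ?BX (\<lambda>z. \<lambda>k\<in>?I. sqrt (1 / real n) * z k)"
      by (subst distr_gauss_scaled[OF I(2)], subst distr_scaled_std_normal) (use mn in auto)
    also have "(\<lambda>z. \<lambda>k\<in>?I. sqrt (1 / real n) * z k) = scl"
      by (simp add: scl_def fun_eq_iff real_sqrt_divide)
    finally show ?thesis .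
  qed
  interpret G: prob_space "gauss ?I" by (rule prob_space_gauss)
  have core: "measure (distr M ?BX X) {x \<in> space ?BX. ((x, y), \<mu>) \<in> E} \<le> fail_prob"
    if y: "y \<in> space ?B\<xi>" and \<mu>: "\<mu> \<in> space ?B\<mu>" for y \<mu>
  proof (cases "regular y \<mu>")
    case False
    then have "{x \<in> space ?BX. ((x, y), \<mu>) \<in> E} = {}" by (auto simp: E_def R_def)
    show ?thesis by (simp only: \<open>{x \<in> space ?BX. ((x, y), \<mu>) \<in> E} = {}\<close> measure_empty fp0)
  next
    case True
    have pm: "(\<lambda>x. ((x, y), \<mu>)) \<in> ?BX \<rightarrow>\<^sub>M S" unfolding S_def using y \<mu> by measurable
    have sec: "{x \<in> space ?BX. ((x, y), \<mu>) \<in> F} \<in> sets ?BX" if "F \<in> sets S" for F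
      using measurable_sets[OF pm that] by (simp add: vimage_def Int_def conj_commute)
    have sc: "{z \<in> space (gauss ?I). ((scl z, y), \<mu>) \<in> F} \<in> sets (gauss ?I)" if "F \<in> sets S" for F
      using measurable_sets[OF measurable_comp[OF scl pm] that] by (simp add: vimage_def Int_def conj_commute)
    have sp: "((scl z, y), \<mu>) \<in> space S" if "z \<in> space (gauss ?I)" for z
      using measurable_space[OF scl that] y \<mu> by (simp add: S_def space_pair_measure)
    have "measure (distr M ?BX X) {x \<in> space ?BX. ((x, y), \<mu>) \<in> E} = measure (gauss ?I) {z \<in> space (gauss ?I). ((scl z, y), \<mu>) \<in> E}"
      unfolding lawX using measurable_space[OF scl] by (subst measure_distr[OF scl sec[OF E]]) (auto intro!: arg_cong[where f="measure (gauss ?I)"])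
    also have "\<dots> \<le> measure (gauss ?I) ({z \<in> space (gauss ?I). ((scl z, y), \<mu>) \<in> O'} \<union> {z \<in> space (gauss ?I). ((scl z, y), \<mu>) \<in> N})"
      by (rule G.finite_measure_mono) (auto simp: E_def intro!: sets.Un sc sets)
    also have "\<dots> \<le> measure (gauss ?I) {z \<in> space (gauss ?I). ((scl z, y), \<mu>) \<in> O'} + measure (gauss ?I) {z \<in> space (gauss ?I). ((scl z, y), \<mu>) \<in> N}"
      by (intro measure_Un_le sc sets)
    also have "\<dots> \<le> fail_prob / 2 + fail_prob / 2"
    proof (rule add_mono)
      obtain K0 where K0: "countable K0" "K0 \<subseteq> cone" "cone \<subseteq> closure K0" by (rule separable[of cone])
      note ga = gaussian_atypical[OF True K0]
      have "{z \<in> space (gauss ?I). ((scl z, y), \<mu>) \<in> O'} = {z \<in> space (gauss ?I). cone \<inter> off_band (scl z) y \<mu> \<noteq> {}}"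
        using sp by (auto simp: O'_def)
      then show "measure (gauss ?I) {z \<in> space (gauss ?I). ((scl z, y), \<mu>) \<in> O'} \<le> fail_prob / 2"
        using ga(1) unfolding scl_def by simp
      have "{z \<in> space (gauss ?I). ((scl z, y), \<mu>) \<in> N} = {z \<in> space (gauss ?I). cone \<inter> near (scl z) y \<mu> = {}}"
        using sp by (auto simp: N_def)
      then show "measure (gauss ?I) {z \<in> space (gauss ?I). ((scl z, y), \<mu>) \<in> N} \<le> fail_prob / 2"
        using ga(2) unfolding scl_def by simp
    qed
    finally show ?thesis by simp
  qed
  have "measure M {\<omega> \<in> space M. ((X \<omega>, \<xi> \<omega>), \<mu>0 \<omega>) \<in> E} \<le> fail_prob"
  proof (rule indep_elements_prob_le[OF M ind2])
    show "E \<in> sets ((?BX \<Otimes>\<^sub>M ?B\<xi>) \<Otimes>\<^sub>M ?B\<mu>)" using E by (simp add: S_def)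
    fix \<mu> assume \<mu>: "\<mu> \<in> space ?B\<mu>"
    define E\<mu> where "E\<mu> = {z \<in> space (?BX \<Otimes>\<^sub>M ?B\<xi>). (z, \<mu>) \<in> E}"
    have pm: "(\<lambda>z. (z, \<mu>)) \<in> ?BX \<Otimes>\<^sub>M ?B\<xi> \<rightarrow>\<^sub>M S" unfolding S_def using \<mu> by measurable
    have E\<mu>: "E\<mu> \<in> sets (?BX \<Otimes>\<^sub>M ?B\<xi>)"
      using measurable_sets[OF pm E] by (simp add: E\<mu>_def vimage_def Int_def conj_commute)
    have X\<xi>: "(\<lambda>\<omega>. (X \<omega>, \<xi> \<omega>)) \<in> M \<rightarrow>\<^sub>M ?BX \<Otimes>\<^sub>M ?B\<xi>" using X \<xi> by measurable
    have "measure (distr M (?BX \<Otimes>\<^sub>M ?B\<xi>) (\<lambda>\<omega>. (X \<omega>, \<xi> \<omega>))) E\<mu> = measure M {\<omega> \<in> space M. (X \<omega>, \<xi> \<omega>) \<in> E\<mu>}"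
      by (subst measure_distr[OF X\<xi> E\<mu>]) (auto intro!: arg_cong[where f="measure M"])
    also have "\<dots> \<le> fail_prob"
    proof (rule indep_elements_prob_le[OF M ind1 E\<mu>])
      fix y assume y: "y \<in> space ?B\<xi>"
      have "{x \<in> space ?BX. (x, y) \<in> E\<mu>} = {x \<in> space ?BX. ((x, y), \<mu>) \<in> E}"
        using y by (auto simp: E\<mu>_def space_pair_measure)
      then show "measure (distr M ?BX X) {x \<in> space ?BX. (x, y) \<in> E\<mu>} \<le> fail_prob" using core[OF y \<mu>] by simp
    qed
    finally show "measure (distr M (?BX \<Otimes>\<^sub>M ?B\<xi>) (\<lambda>\<omega>. (X \<omega>, \<xi> \<omega>))) {z \<in> space (?BX \<Otimes>\<^sub>M ?B\<xi>). (z, \<mu>) \<in> E} \<le> fail_prob"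
      unfolding E\<mu>_def .
  qed
  then show "measure M {\<omega> \<in> space M. atypical (X \<omega>) (\<xi> \<omega>) (\<mu>0 \<omega>)} \<le> fail_prob" by (simp only: ev)
qed

lemma kappa_pos: "0 < \<kappa>"
proof -
  have "0 < sqrt (r\<^sup>2 + \<sigma>\<^sup>2)" using r by (simp add: add_pos_nonneg)
  then have "0 < T" using T by linarith
  then show ?thesis unfolding \<kappa> using \<sigma> \<epsilon> by simp
qed

text \<open>
  Only a neighbourhood of the signal is controlled by the comparison; a near minimizer outside of it
  would produce, by convexity, an off-band point of small loss inside it.
\<close>

lemma near_minimizer_in_band:
  assumes reg: "regular y \<mu>" and typl: "\<not> atypical x y \<mu>" and hat: "\<mu>h \<in> cone" and \<epsilon>': "\<epsilon> < 1 / 2"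
    and low: "\<And>\<mu>'. \<mu>' \<in> cone \<Longrightarrow> l \<le> (resid x y \<mu> \<mu>')\<^sup>2 / real m"
    and near: "(resid x y \<mu> \<mu>h)\<^sup>2 / real m \<le> l + d" and d: "d \<le> \<kappa> * t\<^sup>2 * level y / 4"
  shows "\<bar>dist_to \<mu> \<mu>h - r * sqrt (real n)\<bar> \<le> \<epsilon> * r * sqrt (real n)"
proof -
  let ?D = "r * sqrt (real n)"
  define k where "k = \<kappa> * t\<^sup>2"
  have k: "0 < k" using kappa_pos t by (simp add: k_def)
  have D: "0 < ?D" using r mn by simp
  have m: "0 < real m" using mn by simp
  define \<beta> where "\<beta> = level y"
  have \<beta>: "0 < \<beta>" using reg by (simp add: regular_def \<beta>_def)
  have em: "cone \<inter> off_band x y \<mu> = {}" and ne: "cone \<inter> near x y \<mu> \<noteq> {}"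
    using typl reg by (auto simp: atypical_def)
  define hi where "hi = sqrt (real m) * (\<beta> + k / 2)"
  define lo where "lo = sqrt (real m) * (\<beta> + 3 / 8 * k)"
  have band: "\<bar>dist_to \<mu> p - ?D\<bar> \<le> \<epsilon> * r * sqrt (real n)"
    if "p \<in> cone" "dist_to \<mu> p < 2 * ?D" "resid x y \<mu> p < hi" for p
  proof (rule ccontr)
    assume "\<not> ?thesis"
    then have "p \<in> off_band x y \<mu>" using that by (simp add: off_band_def hi_def \<beta>_def k_def)
    then show False using that em by auto
  qed
  obtain \<nu> where \<nu>: "\<nu> \<in> cone" "dist_to \<mu> \<nu> < 2 * ?D" "resid x y \<mu> \<nu> < lo"
    using ne unfolding near_def lo_def \<beta>_def k_def by (auto simp: mult.assoc)
  have hilo: "lo < hi" unfolding lo_def hi_def using k m by (intro mult_strict_left_mono) auto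
  have \<nu>b: "\<bar>dist_to \<mu> \<nu> - ?D\<bar> \<le> \<epsilon> * r * sqrt (real n)" using band[OF \<nu>(1,2)] \<nu>(3) hilo by simp
  have res0: "0 \<le> resid x y \<mu> p" for p by (simp add: resid_def)
  have sq: "hi\<^sup>2 / real m = (\<beta> + k / 2)\<^sup>2" "lo\<^sup>2 / real m = (\<beta> + 3 / 8 * k)\<^sup>2"
    using m by (simp_all add: hi_def lo_def power_mult_distrib)
  have "(resid x y \<mu> \<mu>h)\<^sup>2 / real m < hi\<^sup>2 / real m"
  proof -
    have "(resid x y \<mu> \<nu>)\<^sup>2 < lo\<^sup>2" using \<nu>(3) res0 by (intro power_strict_mono) auto
    then have "(resid x y \<mu> \<nu>)\<^sup>2 / real m < lo\<^sup>2 / real m" using m by (rule divide_strict_right_mono)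
    moreover have "(resid x y \<mu> \<mu>h)\<^sup>2 / real m \<le> (resid x y \<mu> \<nu>)\<^sup>2 / real m + k * \<beta> / 4"
      using near low[OF \<nu>(1)] d unfolding k_def \<beta>_def by linarith
    \<comment> \<open>The squares differ by at least 2 \<beta> times k / 8, the gap between the two
      levels; this is the origin of the bound on d.\<close>
    moreover have "(\<beta> + 3 / 8 * k)\<^sup>2 + k * \<beta> / 4 \<le> (\<beta> + k / 2)\<^sup>2"
      using k \<beta> by (simp add: power2_eq_square algebra_simps)
    ultimately show ?thesis unfolding sq by linarith
  qed
  then have "(resid x y \<mu> \<mu>h)\<^sup>2 < hi\<^sup>2" using m by (simp add: divide_less_cancel)
  moreover have hi0: "0 < hi" unfolding hi_def using m \<beta> k by simp
  ultimately have hath: "resid x y \<mu> \<mu>h < hi" by (meson power2_less_imp_less less_imp_le)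
  show ?thesis
  proof (cases "dist_to \<mu> \<mu>h < 2 * ?D")
    case True
    show ?thesis by (rule band[OF hat True hath])
  next
    case False
    define p where "p \<theta> j = (1 - \<theta>) * \<nu> j + \<theta> * \<mu>h j" for \<theta> :: real and j
    have eD: "\<epsilon> * r * sqrt (real n) < 1 / 2 * ?D" using mult_strict_right_mono[OF \<epsilon>' D] by (simp only: mult.assoc)
    \<comment> \<open>Radius 7 / 4 is inside the ball of radius 2, and off the band because 3 / 4 >
      1 / 2 > \<epsilon>. Both ends of the segment have residual below \<open>hi\<close>, hence so
      has this point.\<close>
    have "\<exists>\<theta>\<ge>0. \<theta> \<le> 1 \<and> dist_to \<mu> (p \<theta>) = 7 / 4 * ?D"
    proof (rule IVT'[of "\<lambda>\<theta>. dist_to \<mu> (p \<theta>)" 0 _ 1])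
      show "dist_to \<mu> (p 0) \<le> 7 / 4 * ?D" using \<nu>b eD D by (simp add: p_def[abs_def] abs_le_iff)
      show "7 / 4 * ?D \<le> dist_to \<mu> (p 1)" using False D by (simp add: p_def[abs_def])
      show "continuous_on {0..1} (\<lambda>\<theta>. dist_to \<mu> (p \<theta>))"
        unfolding dist_to_def L2_set_def p_def by (intro continuous_intros)
    qed simp
    then obtain \<theta> where \<theta>: "0 \<le> \<theta>" "\<theta> \<le> 1" "dist_to \<mu> (p \<theta>) = 7 / 4 * ?D" by auto
    have pc: "p \<theta> \<in> cone" using \<nu>(1) hat \<theta> by (auto simp: cone_def p_def)
    have "resid x y \<mu> (p \<theta>) = nrm m (\<lambda>i. (1 - \<theta>) * (mv n x (\<lambda>j. \<nu> j - \<mu> j) i - y i) + \<theta> * (mv n x (\<lambda>j. \<mu>h j - \<mu> j) i - y i))"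
      unfolding resid_def p_def
      by (intro L2_set_cong refl) (simp add: algebra_simps sum.distrib sum_subtractf sum_distrib_left)
    also have "\<dots> \<le> nrm m (\<lambda>i. (1 - \<theta>) * (mv n x (\<lambda>j. \<nu> j - \<mu> j) i - y i)) + nrm m (\<lambda>i. \<theta> * (mv n x (\<lambda>j. \<mu>h j - \<mu> j) i - y i))"
      by (rule L2_set_triangle_ineq)
    also have "\<dots> = (1 - \<theta>) * resid x y \<mu> \<nu> + \<theta> * resid x y \<mu> \<mu>h"
      unfolding nrm_scale resid_def using \<theta> by simp
    also have "\<dots> < hi" using \<nu>(3) hilo hath \<theta> by (intro convex_bound_lt) auto
    finally have "resid x y \<mu> (p \<theta>) < hi" .
    from band[OF pc _ this] have "\<bar>dist_to \<mu> (p \<theta>) - ?D\<bar> \<le> \<epsilon> * r * sqrt (real n)" using \<theta>(3) D by simp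
    then have False using \<theta>(3) D eD by linarith
    then show ?thesis ..
  qed
qed

end

section \<open>The radius attached to a fixed signal\<close>

text \<open>The projection is a chosen minimiser, so its value is known only through uniqueness,
  which holds coordinate by coordinate; outside the index range both sides are
  \<open>undefined\<close>.\<close>

lemma metric_proj_Kplus:
  "metric_proj n (Kplus n) x = (\<lambda>i\<in>{..<n}. max 0 (x i))"
proof -
  define p where "p = (\<lambda>i\<in>{..<n}. max 0 (x i))"
  let ?f = "\<lambda>y. L2_set (\<lambda>i. x i - y i) {..<n}"
  have pK: "p \<in> Kplus n" by (auto simp: p_def Kplus_def)
  have le: "\<bar>x i - p i\<bar> \<le> \<bar>x i - y i\<bar>" if "y \<in> Kplus n" "i < n" for y i
    using PiE_mem[of y "{..<n}" "\<lambda>_. {0..}" i] that by (auto simp: p_def Kplus_def max_def)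
  have sqle: "(x i - p i)\<^sup>2 \<le> (x i - y i)\<^sup>2" if "y \<in> Kplus n" "i < n" for y i
    using le[OF that] by (rule abs_le_square_iff[THEN iffD1])
  have fle: "?f p \<le> ?f y" if "y \<in> Kplus n" for y
    unfolding L2_set_def using sqle[OF that] by (intro real_sqrt_le_mono sum_mono) auto
  have uniq: "y = p" if y: "y \<in> Kplus n" "?f y \<le> ?f p" for y
  proof
    fix i
    show "y i = p i"
    proof (cases "i < n")
      case True
      have "(\<Sum>i<n. (x i - y i)\<^sup>2) \<le> (\<Sum>i<n. (x i - p i)\<^sup>2)" using y(2) by (simp add: L2_set_def)
      then have "(\<Sum>i<n. (x i - y i)\<^sup>2 - (x i - p i)\<^sup>2) = 0"
        using sum_mono[of "{..<n}" "\<lambda>i. (x i - p i)\<^sup>2" "\<lambda>i. (x i - y i)\<^sup>2"] sqle[OF y(1)]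
        by (simp add: sum_subtractf)
      then have "(x i - y i)\<^sup>2 - (x i - p i)\<^sup>2 = 0"
        using True sqle[OF y(1)] by (subst (asm) sum_nonneg_eq_0_iff) auto
      then have "\<bar>x i - y i\<bar> = \<bar>x i - p i\<bar>" by (simp add: power2_eq_iff abs_eq_iff)
      moreover have "0 \<le> y i" using y(1) True by (auto simp: Kplus_def PiE_iff)
      ultimately show ?thesis using True by (auto simp: p_def max_def abs_if split: if_splits)
    next
      case False
      then show ?thesis using y(1) by (auto simp: p_def Kplus_def PiE_iff extensional_def)
    qed
  qed
  have "is_arg_min ?f (\<lambda>y. y \<in> Kplus n) p"
    unfolding is_arg_min_def using pK fle by (auto simp: not_less)
  then have "is_arg_min ?f (\<lambda>y. y \<in> Kplus n) (arg_min ?f (\<lambda>y. y \<in> Kplus n))"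
    unfolding arg_min_def by (rule someI[of "is_arg_min ?f (\<lambda>y. y \<in> Kplus n)"])
  then have "metric_proj n (Kplus n) x \<in> Kplus n" "?f (metric_proj n (Kplus n) x) \<le> ?f p"
    unfolding metric_proj_def arg_min_on_def is_arg_min_def using pK by (auto simp: not_less)
  from uniq[OF this] show ?thesis by (simp add: p_def)
qed

lemma projected_risk:
  assumes \<mu>: "\<And>j. j < n \<Longrightarrow> 0 \<le> \<mu> j" and w: "0 < w"
  shows "(\<integral>h. (L2_set (\<lambda>i. metric_proj n (Kplus n) (\<lambda>j. \<mu> j + w * h j) i - \<mu> i) {..<n})\<^sup>2 \<partial>gauss {..<n})
    = w\<^sup>2 * (\<Sum>j<n. G_fun (\<mu> j / w))"
proof -
  have "(L2_set (\<lambda>i. metric_proj n (Kplus n) (\<lambda>j. \<mu> j + w * h j) i - \<mu> i) {..<n})\<^sup>2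
      = (\<Sum>i<n. (max (w * h i) (- \<mu> i))\<^sup>2)" for h
  proof -
    have "max 0 (\<mu> i + w * h i) - \<mu> i = max (w * h i) (- \<mu> i)" for i by (auto simp: max_def)
    then show ?thesis
      by (simp add: metric_proj_Kplus L2_set_def sum_nonneg)
  qed
  moreover have m: "(\<lambda>x. (max (w * x) (- \<mu> i))\<^sup>2) \<in> borel_measurable borel" for i by measurable
  ultimately have "(\<integral>h. (L2_set (\<lambda>i. metric_proj n (Kplus n) (\<lambda>j. \<mu> j + w * h j) i - \<mu> i) {..<n})\<^sup>2 \<partial>gauss {..<n})
      = (\<Sum>i<n. \<integral>h. (max (w * h i) (- \<mu> i))\<^sup>2 \<partial>gauss {..<n})"
    using gauss_component(2)[OF _ m, of _ "{..<n}"] G_fun_scaled(2)[OF w]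
    by simp
  also have "\<dots> = (\<Sum>i<n. w\<^sup>2 * G_fun (\<mu> i / w))"
    using gauss_component(1)[OF _ m, of _ "{..<n}"] G_fun_scaled(1)[OF w] by simp
  finally show ?thesis by (simp add: sum_distrib_left)
qed

text \<open>The error of a near minimizer is measured in the radius of the given signal, which is
  compared here with t. Apply the fixed point theory to the uniform law on the coordinates: at 2 t
  the noise term is \<sigma>^2 / (4 t^2), and with the tolerated 3 / 4 of \<sigma>^2 / t^2 this
  gives \<open>ratio_at\<close> at most \<delta>. So the root, and with it the radius, is at most 2
  t.\<close>

lemma r_signal_bound:
  assumes n: "0 < n" and \<delta>: "1 / 2 < \<delta>" and \<sigma>: "0 < \<sigma>" and \<mu>: "\<And>j. j < n \<Longrightarrow> 0 \<le> \<mu> j" and t: "0 < t"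
    and \<delta>t: "\<delta> = \<gamma> + \<sigma>\<^sup>2 / t\<^sup>2" and G: "(\<Sum>j<n. G_fun (\<mu> j / t)) \<le> real n * (\<gamma> + 3 / 4 * \<sigma>\<^sup>2 / t\<^sup>2)"
  shows "(r_signal n \<sigma> \<delta> \<mu>)\<^sup>2 \<le> 4 * t\<^sup>2"
proof -
  let ?D = "measure_pmf (pmf_of_set {..<n})"
  have ne: "{..<n} \<noteq> {}" "finite {..<n}" using n by auto
  interpret E: signal_law ?D \<mu> \<sigma>
    by unfold_locales (auto simp: AE_measure_pmf_iff set_pmf_of_set[OF ne] \<mu> \<sigma>)
  have EG: "E.EG w = (\<Sum>j<n. G_fun (\<mu> j / w)) / real n" for w
    unfolding E.EG_def by (subst integral_pmf_of_set[OF ne]) simp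
  have \<delta>0: "0 < \<delta>" using \<delta> by simp
  have "(1 / real n) * (\<integral>h. (L2_set (\<lambda>i. metric_proj n (Kplus n) (\<lambda>j. \<mu> j + omega \<sigma> \<delta> r * h j) i - \<mu> i) {..<n})\<^sup>2 \<partial>gauss {..<n}) = r\<^sup>2
      \<longleftrightarrow> is_fixed_point ?D \<mu> \<sigma> \<delta> r" for r
  proof -
    have w: "0 < omega \<sigma> \<delta> r" by (rule E.omega_pos[OF \<delta>0])
    have "is_fixed_point ?D \<mu> \<sigma> \<delta> r \<longleftrightarrow> (omega \<sigma> \<delta> r)\<^sup>2 * E.EG (omega \<sigma> \<delta> r) = r\<^sup>2"
      by (simp only: is_fixed_point_def E.EG_def)
    then show ?thesis by (subst projected_risk[OF _ w]) (simp_all add: EG \<mu>)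
  qed
  then have eq: "r_signal n \<sigma> \<delta> \<mu> = r_plus ?D \<mu> \<sigma> \<delta>" by (simp add: r_signal_def r_plus_def)
  note p = E.r_plus_props[OF \<delta>] E.r_plus_le_wroot[OF \<delta>]
  have "E.EG (2 * t) \<le> E.EG t" using t by (intro E.EG_antimono) auto
  also have "\<dots> \<le> \<gamma> + 3 / 4 * \<sigma>\<^sup>2 / t\<^sup>2" using G n by (simp add: EG pos_divide_le_eq mult.commute)
  finally have "E.ratio_at (2 * t) \<le> \<delta>"
    by (simp add: E.ratio_at_def \<delta>t power_mult_distrib)
  then have "E.wroot \<delta> \<le> 2 * t" using E.wroot_less_iff(2)[OF \<delta>, of "2 * t"] t by simp
  then have "r_plus ?D \<mu> \<sigma> \<delta> \<le> 2 * t" using p(6) by linarith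
  then have "(r_plus ?D \<mu> \<sigma> \<delta>)\<^sup>2 \<le> (2 * t)\<^sup>2" using p(1) by (intro power_mono) auto
  then show ?thesis by (simp add: eq power_mult_distrib)
qed

lemma avg_loss_eq:
  assumes "\<And>i. i < m \<Longrightarrow> y i = mat_vec n x \<mu> i + \<xi> i"
  shows "avg_loss m n x y \<mu>' = (L2_set (\<lambda>i. (\<Sum>j<n. x (i, j) * (\<mu>' j - \<mu> j)) - \<xi> i) {..<m})\<^sup>2 / real m"
proof -
  have "L2_set (\<lambda>i. y i - mat_vec n x \<mu>' i) {..<m} = L2_set (\<lambda>i. (\<Sum>j<n. x (i, j) * (\<mu>' j - \<mu> j)) - \<xi> i) {..<m}"
    unfolding L2_set_def
    by (intro arg_cong[where f=sqrt] sum.cong refl, subst power2_commute)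
      (simp add: assms mat_vec_def right_diff_distrib sum_subtractf algebra_simps)
  then show ?thesis by (simp add: avg_loss_def)
qed

section \<open>Deviation of the risk and passage to the limit\<close>

context signal_law
begin

text \<open>Chebyshev's inequality. The truncation \<open>max 0\<close> appears because f is bounded
  on nonnegative arguments, while the coordinates are nonnegative only almost surely.\<close>

lemma empirical_mean:
  assumes M: "prob_space M" and iid: "iid_with_law M {..<n} Z (distr D borel U)" and n: "0 < n"
    and f [measurable]: "f \<in> borel_measurable borel" and f1: "\<And>x. 0 \<le> x \<Longrightarrow> \<bar>f x\<bar> \<le> 1" and a: "0 < a"
  shows "measure M {\<omega> \<in> space M. a * real n < \<bar>(\<Sum>j<n. f (max 0 (Z \<omega> j))) - real n * (\<integral>u. f (U u) \<partial>D)\<bar>} \<le> 1 / (a\<^sup>2 * real n)"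
proof -
  interpret M: prob_space M by fact
  have ind: "M.indep_vars (\<lambda>_. borel) (\<lambda>i \<omega>. Z \<omega> i) {..<n}" and law: "\<And>i. i < n \<Longrightarrow> distr M borel (\<lambda>\<omega>. Z \<omega> i) = distr D borel U"
    using iid by (auto simp: iid_with_law_def)
  have Z [measurable]: "(\<lambda>\<omega>. Z \<omega> j) \<in> borel_measurable M" if "j < n" for j
    using ind that by (auto simp: M.indep_vars_def)
  define g where "g x = f (max 0 x)" for x
  have g [measurable]: "g \<in> borel_measurable borel" unfolding g_def by measurable
  have g1: "\<bar>g x\<bar> \<le> 1" for x using f1[of "max 0 x"] by (simp add: g_def)
  have ex: "(\<integral>\<omega>. g (Z \<omega> j) \<partial>M) = (\<integral>u. f (U u) \<partial>D)" if "j < n" for j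
  proof -
    have "(\<integral>\<omega>. g (Z \<omega> j) \<partial>M) = (\<integral>x. g x \<partial>distr M borel (\<lambda>\<omega>. Z \<omega> j))"
      using Z[OF that] by (subst integral_distr) auto
    also have "\<dots> = (\<integral>u. g (U u) \<partial>D)" unfolding law[OF that] by (subst integral_distr) auto
    also have "\<dots> = (\<integral>u. f (U u) \<partial>D)"
      by (rule integral_cong_AE) (use U_nonneg in \<open>auto simp: g_def elim!: eventually_mono\<close>)
    finally show ?thesis .
  qed
  have i2: "integrable M (\<lambda>\<omega>. (g (Z \<omega> j))\<^sup>2)" and le: "(\<integral>\<omega>. (g (Z \<omega> j))\<^sup>2 \<partial>M) \<le> 1" if "j < n" for j
  proof -
    have b: "(g x)\<^sup>2 \<le> 1" for x using g1[of x] by (simp add: abs_square_le_1)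
    show "integrable M (\<lambda>\<omega>. (g (Z \<omega> j))\<^sup>2)"
      using Z[OF that] b by (intro M.integrable_const_bound[where B=1]) auto
    then show "(\<integral>\<omega>. (g (Z \<omega> j))\<^sup>2 \<partial>M) \<le> 1" using b by (intro M.integral_le_const) auto
  qed
  have iv: "M.indep_vars (\<lambda>_. borel) (\<lambda>j \<omega>. g (Z \<omega> j)) {..<n}"
    by (rule M.indep_vars_compose2[OF ind]) simp
  have "measure M {\<omega> \<in> space M. a * real n < \<bar>(\<Sum>j<n. g (Z \<omega> j)) - (\<Sum>j<n. \<integral>\<omega>. g (Z \<omega> j) \<partial>M)\<bar>}
      \<le> (\<Sum>j<n. \<integral>\<omega>. (g (Z \<omega> j))\<^sup>2 \<partial>M) / (a * real n)\<^sup>2"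
    using i2 a n by (intro M.chebyshev_indep_sum iv) auto
  also have "(\<Sum>j<n. \<integral>\<omega>. g (Z \<omega> j) \<partial>M) = real n * (\<integral>u. f (U u) \<partial>D)" by (simp add: ex)
  also have "(\<Sum>j<n. \<integral>\<omega>. (g (Z \<omega> j))\<^sup>2 \<partial>M) / (a * real n)\<^sup>2 \<le> real n / (a * real n)\<^sup>2"
    using sum_bounded_above[of "{..<n}" "\<lambda>j. \<integral>\<omega>. (g (Z \<omega> j))\<^sup>2 \<partial>M" 1] le by (intro divide_right_mono) auto
  also have "real n / (a * real n)\<^sup>2 = 1 / (a\<^sup>2 * real n)" using n by (simp add: power2_eq_square)
  finally show ?thesis by (simp add: g_def)
qed

text \<open>The conditions on e keep \<open>level\<close> above \<beta>, keep the noise level above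
  \<sigma> / 2, make \<open>r_signal_bound\<close> applicable, and keep the errors below the gap.
  The constants are tied to B and c, not to n, so they can be fixed before n grows. The factor 3
  comes from |q^2 - 1| = |q - 1| |q + 1| for the normalised distance q.\<close>

lemma risk_deviation:
  fixes m n :: nat and B c \<epsilon> e T \<kappa> \<beta> \<eta>0 :: real
  assumes n: "0 < n" and \<delta>: "1 / 2 < real m / real n"
    and lm: "linear_model m n L (distr D borel U) M X \<xi> \<mu>0 Y"
    and hat: "\<mu>h \<in> M \<rightarrow>\<^sub>M borel_vec {..<n}" "AE \<omega> in M. \<mu>h \<omega> \<in> Kplus n"
    and \<eta>: "\<eta> \<in> borel_measurable M"
    and near: "AE \<omega> in M. avg_loss m n (X \<omega>) (Y \<omega>) (\<mu>h \<omega>)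
      \<le> (INF \<mu>\<in>Kplus n. avg_loss m n (X \<omega>) (Y \<omega>) \<mu>) + \<eta> \<omega> * (r_signal n \<sigma> (real m / real n) (\<mu>0 \<omega>))\<^sup>2"
    and B: "wroot (real m / real n) \<le> B" and c: "omega2_EH D U \<sigma> (real m / real n) \<le> c * \<sigma>\<^sup>2" "c < 1"
    and \<epsilon>: "0 < \<epsilon>" "\<epsilon> < 1 / 2" and T: "T = sqrt (B\<^sup>2 + \<sigma>\<^sup>2)" and \<kappa>: "\<kappa> = \<sigma>\<^sup>2 * \<epsilon>\<^sup>2 / (8 * T ^ 3)"
    and \<beta>: "\<beta> = (1 - c) * \<sigma>\<^sup>2 / (2 * T)"
    and e: "0 < e" "e < 1" "e \<le> \<beta>" "e \<le> \<sigma> / 2" "e \<le> \<sigma>\<^sup>2 / B\<^sup>2" "(22 / \<sigma> + 3 / \<sigma>\<^sup>2) * e \<le> \<kappa> / 4"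
    and \<eta>0: "\<eta>0 = \<kappa> * \<beta> / 16"
  shows "measure M {\<omega> \<in> space M. 3 * \<epsilon> < \<bar>risk n (\<mu>h \<omega>) (\<mu>0 \<omega>) / (r_plus D U \<sigma> (real m / real n))\<^sup>2 - 1\<bar>}
    \<le> 4 * ((30 + (1 + 1 / \<sigma>)\<^sup>2) / (e\<^sup>2 * real n)) + 8 / (e\<^sup>2 * real n)
      + measure M {\<omega> \<in> space M. (e * \<sigma>) * real m < \<bar>(\<Sum>i<m. (\<xi> \<omega> i)\<^sup>2) - real m * \<sigma>\<^sup>2\<bar>}
      + measure M {\<omega> \<in> space M. \<eta>0 < \<bar>\<eta> \<omega> - 0\<bar>}"
proof -
  define t r where "t = wroot (real m / real n)" and "r = r_plus D U \<sigma> (real m / real n)"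
  note p = r_plus_props[OF \<delta>, folded t_def r_def]
  have rB: "r \<le> t" "t \<le> B" using r_plus_le_wroot[OF \<delta>] B by (simp_all add: t_def r_def)
  have rT: "sqrt (r\<^sup>2 + \<sigma>\<^sup>2) \<le> T" unfolding T using rB p(1) by (intro real_sqrt_le_mono add_right_mono power_mono) auto
  have m: "0 < m" using \<delta> by (cases m) auto
  interpret d: design_params m n \<sigma> r t "E\<Phi> t" e "EG t" \<epsilon> T \<kappa>
    using m n \<delta> \<sigma> p e EG_bounds[OF p(2)] \<epsilon> rT \<kappa> by unfold_locales auto
  have M: "prob_space M" and iid\<xi>: "iid_with_law M {..<m} \<xi> L" and iid\<mu>: "iid_with_law M {..<n} \<mu>0 (distr D borel U)"
    and Y: "\<And>\<omega> i. \<omega> \<in> space M \<Longrightarrow> i < m \<Longrightarrow> Y \<omega> i = mat_vec n (X \<omega>) (\<mu>0 \<omega>) i + \<xi> \<omega> i"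
    using lm by (auto simp: linear_model_def)
  interpret M: prob_space M by fact
  have \<xi>m: "(\<lambda>\<omega>. \<xi> \<omega> i) \<in> borel_measurable M" if "i < m" for i
    using iid\<xi> that by (auto simp: iid_with_law_def M.indep_vars_def)
  have \<mu>m: "(\<lambda>\<omega>. \<mu>0 \<omega> j) \<in> borel_measurable M" and \<mu>law: "distr M borel (\<lambda>\<omega>. \<mu>0 \<omega> j) = distr D borel U" if "j < n" for j
    using iid\<mu> that by (auto simp: iid_with_law_def M.indep_vars_def)
  have "AE \<omega> in M. 0 \<le> \<mu>0 \<omega> j" if "j < n" for j
  proof -
    have "AE x in distr M borel (\<lambda>\<omega>. \<mu>0 \<omega> j). 0 \<le> x" unfolding \<mu>law[OF that]
      by (subst AE_distr_iff) (use U_nonneg in auto)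
    then show ?thesis by (subst (asm) AE_distr_iff) (use \<mu>m[OF that] in auto)
  qed
  then have \<mu>pos: "AE \<omega> in M. \<forall>j\<in>{..<n}. 0 \<le> \<mu>0 \<omega> j" by (intro AE_finite_allI) auto
  define N where "N = {\<omega> \<in> space M. (e * \<sigma>) * real m < \<bar>(\<Sum>i<m. (\<xi> \<omega> i)\<^sup>2) - real m * \<sigma>\<^sup>2\<bar>}"
  define SG where "SG = {\<omega> \<in> space M. e / 2 * real n < \<bar>(\<Sum>j<n. G_fun (max 0 (\<mu>0 \<omega> j) / t)) - real n * EG t\<bar>}"
  define SC where "SC = {\<omega> \<in> space M. e / 2 * real n < \<bar>(\<Sum>j<n. std_normal_cdf (max 0 (\<mu>0 \<omega> j) / t)) - real n * E\<Phi> t\<bar>}"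
  define H where "H = {\<omega> \<in> space M. \<eta>0 < \<bar>\<eta> \<omega> - 0\<bar>}"
  define A where "A = {\<omega> \<in> space M. d.atypical (X \<omega>) (\<xi> \<omega>) (\<mu>0 \<omega>)}"
  note [measurable] = \<xi>m \<mu>m \<eta>
  have As: "A \<in> sets M" and Ap: "measure M A \<le> d.fail_prob" unfolding A_def using d.atypical_prob[OF lm] by auto
  have Ns: "N \<in> sets M" unfolding N_def by measurable
  have SGs: "SG \<in> sets M" unfolding SG_def by measurable
  have SCs: "SC \<in> sets M" unfolding SC_def by measurable
  have Hs: "H \<in> sets M" unfolding H_def by measurable
  have t0: "0 < t" by (rule p(2))
  have Gb: "\<bar>G_fun (x / t)\<bar> \<le> 1" if "0 \<le> x" for x
    using G_fun_ge_half[of "x / t"] G_fun_le_1[of "x / t"] that t0 by simp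
  have SGp: "measure M SG \<le> 1 / ((e / 2)\<^sup>2 * real n)"
    unfolding SG_def EG_def
    by (rule empirical_mean[OF M iid\<mu> n, of "\<lambda>x. G_fun (x / t)"])
      (use e Gb in auto)
  have SCp: "measure M SC \<le> 1 / ((e / 2)\<^sup>2 * real n)"
    unfolding SC_def E\<Phi>_def
    by (rule empirical_mean[OF M iid\<mu> n, of "\<lambda>x. std_normal_cdf (x / t)"])
      (use e std_normal_cdf_bounds in auto)
  have T0: "0 < T" unfolding T using \<sigma> by (simp add: add_nonneg_pos)
  have tau: "0 < sqrt (r\<^sup>2 + \<sigma>\<^sup>2)" using \<sigma> by (simp add: add_nonneg_pos)
  have \<beta>0: "0 < \<beta>" unfolding \<beta> using c \<sigma> T0 by simp
  have close: "\<bar>risk n (\<mu>h \<omega>) (\<mu>0 \<omega>) / r\<^sup>2 - 1\<bar> \<le> 3 * \<epsilon>"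
    if \<omega>: "\<omega> \<in> space M" and hatK: "\<mu>h \<omega> \<in> Kplus n" and pos: "\<forall>j\<in>{..<n}. 0 \<le> \<mu>0 \<omega> j"
      and nm: "avg_loss m n (X \<omega>) (Y \<omega>) (\<mu>h \<omega>)
      \<le> (INF \<mu>\<in>Kplus n. avg_loss m n (X \<omega>) (Y \<omega>) \<mu>) + \<eta> \<omega> * (r_signal n \<sigma> (real m / real n) (\<mu>0 \<omega>))\<^sup>2"
      and nA: "\<omega> \<notin> A" and nN: "\<omega> \<notin> N" and nG: "\<omega> \<notin> SG" and nC: "\<omega> \<notin> SC" and nH: "\<omega> \<notin> H" for \<omega>
  proof -
    let ?s = "d.noise_level (\<xi> \<omega>)"
    have pos': "0 \<le> \<mu>0 \<omega> j" if "j < n" for j using pos that by simp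
    have mx: "(\<Sum>j<n. G_fun (\<mu>0 \<omega> j / t)) = (\<Sum>j<n. G_fun (max 0 (\<mu>0 \<omega> j) / t))"
      "(\<Sum>j<n. std_normal_cdf (\<mu>0 \<omega> j / t)) = (\<Sum>j<n. std_normal_cdf (max 0 (\<mu>0 \<omega> j) / t))"
      by (rule sum.cong, rule refl, simp add: pos' max_absorb2)+
    have G: "\<bar>(\<Sum>j<n. G_fun (\<mu>0 \<omega> j / t)) - real n * EG t\<bar> \<le> e * real n / 2"
      using nG \<omega> unfolding mx(1) by (simp add: SG_def not_less)
    have C: "\<bar>(\<Sum>j<n. std_normal_cdf (\<mu>0 \<omega> j / t)) - real n * E\<Phi> t\<bar> \<le> e * real n / 2"
      using nC \<omega> unfolding mx(2) by (simp add: SC_def not_less)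
    have s0: "0 \<le> ?s" by (simp add: d.noise_level_def)
    have s2: "?s\<^sup>2 * real m = (\<Sum>i<m. (\<xi> \<omega> i)\<^sup>2)"
      using m by (simp add: d.noise_level_def power_divide L2_set_def sum_nonneg)
    \<comment> \<open>As |s^2 - \<sigma>^2| \<ge> \<sigma> |s - \<sigma>|, a tolerance e \<sigma>
      for the squares is enough; hence the event \<open>N\<close>.\<close>
    have s: "\<bar>?s - \<sigma>\<bar> \<le> e"
    proof (rule ccontr)
      assume "\<not> ?thesis"
      then have "e * \<sigma> < \<bar>?s - \<sigma>\<bar> * (?s + \<sigma>)" using \<sigma> s0 e by (intro mult_less_le_imp_less) auto
      also have "\<dots> = \<bar>?s\<^sup>2 - \<sigma>\<^sup>2\<bar>" using s0 \<sigma> by (simp add: power2_eq_square square_diff_square_factored abs_mult mult.commute)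
      finally have "e * \<sigma> * real m < \<bar>?s\<^sup>2 - \<sigma>\<^sup>2\<bar> * real m" using m by simp
      also have "\<dots> = \<bar>(\<Sum>i<m. (\<xi> \<omega> i)\<^sup>2) - real m * \<sigma>\<^sup>2\<bar>" unfolding s2[symmetric]
        by (simp add: abs_mult_pos' left_diff_distrib[symmetric] mult.commute[of "real m"] abs_mult)
      finally show False using nN \<omega> by (simp add: N_def)
    qed
    \<comment> \<open>With s = \<sigma> the level would be (\<tau>^2 - t^2 E\<Phi>(t)) / \<tau>, and
      t^2 E\<Phi>(t) = r^2 + \<open>omega2_EH\<close>, so it equals (\<sigma>^2 -
      \<open>omega2_EH\<close>) / \<tau> \<ge> (1 - c) \<sigma>^2 / T = 2 \<beta>. One \<beta> pays
      for the difference of s and \<sigma>.\<close>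
    have lev: "\<beta> \<le> d.level (\<xi> \<omega>)"
    proof -
      let ?\<tau> = "sqrt (r\<^sup>2 + \<sigma>\<^sup>2)"
      have lip: "?\<tau> \<le> sqrt (r\<^sup>2 + ?s\<^sup>2) + \<bar>\<sigma> - ?s\<bar>"
        using real_sqrt_sum_squares_triangle_ineq[of r 0 ?s "\<sigma> - ?s"] by simp
      have "t\<^sup>2 * E\<Phi> t = r\<^sup>2 + omega2_EH D U \<sigma> (real m / real n)"
        unfolding omega2_EH_eq[OF \<delta>] t_def[symmetric] p(4) by (simp add: right_diff_distrib)
      then have "t\<^sup>2 * E\<Phi> t / ?\<tau> \<le> (?\<tau>\<^sup>2 - (1 - c) * \<sigma>\<^sup>2) / ?\<tau>"
        using c(1) tau by (intro divide_right_mono) (simp_all add: left_diff_distrib)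
      also have "\<dots> = ?\<tau> - (1 - c) * \<sigma>\<^sup>2 / ?\<tau>" by (simp add: diff_divide_distrib real_div_sqrt)
      also have "\<dots> \<le> ?\<tau> - (1 - c) * \<sigma>\<^sup>2 / T"
        using rT tau c by (intro diff_left_mono divide_left_mono mult_nonneg_nonneg mult_pos_pos T0) auto
      also have "(1 - c) * \<sigma>\<^sup>2 / T = 2 * \<beta>" unfolding \<beta> using T0 by (simp add: field_simps)
      finally have "t\<^sup>2 * E\<Phi> t / ?\<tau> \<le> ?\<tau> - 2 * \<beta>" .
      then show ?thesis unfolding d.level_def using lip s e(3) by (simp add: abs_minus_commute)
    qed
    have reg: "d.regular (\<xi> \<omega>) (\<mu>0 \<omega>)"
      unfolding d.regular_def using pos' s G C lev \<beta>0 e(4) by (auto simp: abs_le_iff)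
    have nat: "\<not> d.atypical (X \<omega>) (\<xi> \<omega>) (\<mu>0 \<omega>)" using nA \<omega> by (simp add: A_def)
    have loss: "avg_loss m n (X \<omega>) (Y \<omega>) \<mu>' = (d.resid (X \<omega>) (\<xi> \<omega>) (\<mu>0 \<omega>) \<mu>')\<^sup>2 / real m" for \<mu>'
      unfolding d.resid_def by (rule avg_loss_eq) (rule Y[OF \<omega>])
    let ?l = "INF \<mu>\<in>Kplus n. avg_loss m n (X \<omega>) (Y \<omega>) \<mu>"
    let ?d = "\<eta> \<omega> * (r_signal n \<sigma> (real m / real n) (\<mu>0 \<omega>))\<^sup>2"
    have low: "?l \<le> (d.resid (X \<omega>) (\<xi> \<omega>) (\<mu>0 \<omega>) \<mu>')\<^sup>2 / real m" if "\<mu>' \<in> d.cone" for \<mu>'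
    proof -
      have "?l \<le> avg_loss m n (X \<omega>) (Y \<omega>) (restrict \<mu>' {..<n})"
        using that by (intro cINF_lower bdd_belowI2[of _ 0]) (auto simp: Kplus_def d.cone_def avg_loss_def)
      also have "\<dots> = avg_loss m n (X \<omega>) (Y \<omega>) \<mu>'"
      proof -
        have "mat_vec n (X \<omega>) (restrict \<mu>' {..<n}) = mat_vec n (X \<omega>) \<mu>'"
          unfolding mat_vec_def by (intro ext sum.cong) auto
        then show ?thesis by (simp only: avg_loss_def)
      qed
      finally show ?thesis by (simp add: loss)
    qed
    \<comment> \<open>The squared radius of the signal is at most 4 t^2, and \<eta>0 times this is
      \<kappa> t^2 \<beta> / 4, within the tolerance of \<open>near_minimizer_in_band\<close>; hence
      the 16 in \<eta>0.\<close>
    have dle: "?d \<le> \<kappa> * t\<^sup>2 * d.level (\<xi> \<omega>) / 4"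
    proof -
      have "e / 2 \<le> 3 / 4 * \<sigma>\<^sup>2 / t\<^sup>2"
      proof -
        have "\<sigma>\<^sup>2 / B\<^sup>2 \<le> \<sigma>\<^sup>2 / t\<^sup>2" using rB t0 by (intro divide_left_mono power_mono mult_pos_pos) auto
        then have "e \<le> \<sigma>\<^sup>2 / t\<^sup>2" using e(5) by linarith
        moreover have "3 / 4 * \<sigma>\<^sup>2 / t\<^sup>2 = 3 / 4 * (\<sigma>\<^sup>2 / t\<^sup>2)" by simp
        ultimately show ?thesis using e(1) by linarith
      qed
      then have "real n * (e / 2) \<le> real n * (3 / 4 * \<sigma>\<^sup>2 / t\<^sup>2)" by (intro mult_left_mono) auto
      then have "(\<Sum>j<n. G_fun (\<mu>0 \<omega> j / t)) \<le> real n * (EG t + 3 / 4 * \<sigma>\<^sup>2 / t\<^sup>2)"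
        using G by (simp only: distrib_left abs_le_iff) (simp add: mult.commute)
      then have "(r_signal n \<sigma> (real m / real n) (\<mu>0 \<omega>))\<^sup>2 \<le> 4 * t\<^sup>2"
        using p(3) by (intro r_signal_bound[OF n \<delta> \<sigma> pos' t0, where \<gamma>="EG t"]) (auto simp: ratio_at_def)
      then have "\<bar>\<eta> \<omega>\<bar> * (r_signal n \<sigma> (real m / real n) (\<mu>0 \<omega>))\<^sup>2 \<le> \<eta>0 * (4 * t\<^sup>2)"
        using nH \<omega> by (intro mult_mono) (auto simp: H_def)
      moreover have "?d \<le> \<bar>\<eta> \<omega>\<bar> * (r_signal n \<sigma> (real m / real n) (\<mu>0 \<omega>))\<^sup>2" by (intro mult_right_mono) auto
      moreover have "\<eta>0 * (4 * t\<^sup>2) = \<kappa> * t\<^sup>2 * \<beta> / 4" by (simp add: \<eta>0)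
      moreover have "\<dots> \<le> \<kappa> * t\<^sup>2 * d.level (\<xi> \<omega>) / 4"
        using lev d.kappa_pos by (intro divide_right_mono mult_left_mono) auto
      ultimately show ?thesis by linarith
    qed
    have hatc: "\<mu>h \<omega> \<in> d.cone" using hatK by (auto simp: d.cone_def Kplus_def)
    define q where "q = d.dist_to (\<mu>0 \<omega>) (\<mu>h \<omega>) / (r * sqrt (real n))"
    have rn: "0 < r * sqrt (real n)" using p(1) n by simp
    have "\<bar>d.dist_to (\<mu>0 \<omega>) (\<mu>h \<omega>) - r * sqrt (real n)\<bar> \<le> \<epsilon> * r * sqrt (real n)"
      by (rule d.near_minimizer_in_band[OF reg nat hatc \<epsilon>(2) low nm[unfolded loss[of "\<mu>h \<omega>"]] dle])
    moreover have "d.dist_to (\<mu>0 \<omega>) (\<mu>h \<omega>) - r * sqrt (real n) = (q - 1) * (r * sqrt (real n))"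
      using p(1) n by (simp add: q_def left_diff_distrib)
    ultimately have "\<bar>q - 1\<bar> * (r * sqrt (real n)) \<le> \<epsilon> * (r * sqrt (real n))"
      by (simp only: abs_mult[of "q - 1"] abs_of_pos[OF rn] mult.assoc)
    then have q: "\<bar>q - 1\<bar> \<le> \<epsilon>" using rn by (rule mult_right_le_imp_le)
    have "risk n (\<mu>h \<omega>) (\<mu>0 \<omega>) / r\<^sup>2 = q\<^sup>2"
      using n by (simp add: risk_def q_def d.dist_to_def power_divide power_mult_distrib)
    moreover have "\<bar>q\<^sup>2 - 1\<bar> = \<bar>q - 1\<bar> * \<bar>(q - 1) + 2\<bar>"
      by (simp add: abs_mult[symmetric] power2_eq_square algebra_simps)
    moreover have "\<dots> \<le> \<epsilon> * 3" using q \<epsilon> by (intro mult_mono) auto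
    ultimately show ?thesis by simp
  qed
  have "measure M {\<omega> \<in> space M. 3 * \<epsilon> < \<bar>risk n (\<mu>h \<omega>) (\<mu>0 \<omega>) / r\<^sup>2 - 1\<bar>} \<le> measure M (A \<union> SG \<union> SC \<union> N \<union> H)"
  proof (rule M.finite_measure_mono_AE)
    show "AE \<omega> in M. \<omega> \<in> {\<omega> \<in> space M. 3 * \<epsilon> < \<bar>risk n (\<mu>h \<omega>) (\<mu>0 \<omega>) / r\<^sup>2 - 1\<bar>} \<longrightarrow> \<omega> \<in> A \<union> SG \<union> SC \<union> N \<union> H"
      using hat(2) \<mu>pos near
    proof eventually_elim
      case (elim \<omega>)
      show ?case
      proof (intro impI, rule ccontr)
        assume a: "\<omega> \<in> {\<omega> \<in> space M. 3 * \<epsilon> < \<bar>risk n (\<mu>h \<omega>) (\<mu>0 \<omega>) / r\<^sup>2 - 1\<bar>}" "\<omega> \<notin> A \<union> SG \<union> SC \<union> N \<union> H"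
        then show False using close[of \<omega>] elim by auto
      qed
    qed
  qed (use As Ns SGs SCs Hs in auto)
  also have "\<dots> \<le> measure M A + measure M SG + measure M SC + measure M N + measure M H"
    by (intro order_trans[OF measure_Un_le] add_right_mono sets.Un As Ns SGs SCs Hs order_refl)
  also have "\<dots> \<le> 4 * ((30 + (1 + 1 / \<sigma>)\<^sup>2) / (e\<^sup>2 * real n)) + 8 / (e\<^sup>2 * real n) + measure M N + measure M H"
  proof -
    have "1 / ((e / 2)\<^sup>2 * real n) = 4 / (e\<^sup>2 * real n)" by (simp add: power_divide)
    moreover have "8 / (e\<^sup>2 * real n) = 4 / (e\<^sup>2 * real n) + 4 / (e\<^sup>2 * real n)" by (simp add: add_divide_distrib[symmetric])
    ultimately show ?thesis using Ap SGp SCp unfolding d.fail_prob_def by linarith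
  qed
  finally show ?thesis unfolding N_def H_def r_def .
qed

text \<open>Since \<open>wroot\<close> decreases, B = \<open>wroot a\<close> bounds \<omega> for all
  large n, and every constant of \<open>risk_deviation\<close> can be chosen before n. Then all four
  probabilities in its bound tend to 0.\<close>

lemma risk_ratio_converges:
  fixes m :: "nat \<Rightarrow> nat" and L :: "real measure" and M :: "nat \<Rightarrow> 'c measure"
  assumes ratio: "\<And>n. n \<ge> 1 \<Longrightarrow> real (m n) / real n > 1 / 2"
    and noise: "real_distribution L" "integrable L (\<lambda>x. x\<^sup>2)" "(\<integral>x. x\<^sup>2 \<partial>L) = \<sigma>\<^sup>2"
    and model: "\<And>n. n \<ge> 1 \<Longrightarrow>
      linear_model (m n) n L (distr D borel U) (M n) (X n) (\<xi> n) (\<mu>0 n) (Y n)"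
    and near_min: "near_minimizers m \<sigma> M X \<mu>0 Y \<mu>hat"
    and a: "1 / 2 < a" "\<forall>\<^sub>F n in sequentially. a \<le> real (m n) / real n"
    and c: "c < 1" "\<forall>\<^sub>F n in sequentially. omega2_EH D U \<sigma> (real (m n) / real n) \<le> c * \<sigma>\<^sup>2"
  shows "converges_in_prob M
    (\<lambda>n \<omega>. risk n (\<mu>hat n \<omega>) (\<mu>0 n \<omega>) / (r_plus D U \<sigma> (real (m n) / real n))\<^sup>2) 1"
  unfolding converges_in_prob_def
proof (intro allI impI)
  fix \<epsilon>1 :: real assume \<epsilon>1: "0 < \<epsilon>1"
  obtain \<eta> where \<eta>: "\<And>n. n \<ge> 1 \<Longrightarrow> \<eta> n \<in> borel_measurable (M n)" "converges_in_prob M \<eta> 0"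
    "\<And>n. n \<ge> 1 \<Longrightarrow> AE \<omega> in M n. avg_loss (m n) n (X n \<omega>) (Y n \<omega>) (\<mu>hat n \<omega>)
          \<le> (INF \<mu>\<in>Kplus n. avg_loss (m n) n (X n \<omega>) (Y n \<omega>) \<mu>)
             + \<eta> n \<omega> * (r_signal n \<sigma> (real (m n) / real n) (\<mu>0 n \<omega>))\<^sup>2"
    and hat: "\<And>n. n \<ge> 1 \<Longrightarrow> \<mu>hat n \<in> M n \<rightarrow>\<^sub>M borel_vec {..<n}" "\<And>n. n \<ge> 1 \<Longrightarrow> AE \<omega> in M n. \<mu>hat n \<omega> \<in> Kplus n"
    using near_min unfolding near_minimizers_def by blast
  define B where "B = wroot a"
  have B: "0 < B" unfolding B_def by (rule r_plus_props(2)[OF a(1)])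
  define T where "T = sqrt (B\<^sup>2 + \<sigma>\<^sup>2)"
  have T: "0 < T" unfolding T_def using \<sigma> by (simp add: add_nonneg_pos)
  \<comment> \<open>Below 1 / 2 as the band argument demands, and with 3 \<epsilon> \<le>
    \<epsilon>1.\<close>
  define \<epsilon> where "\<epsilon> = min (1 / 4) (\<epsilon>1 / 3)"
  have \<epsilon>: "0 < \<epsilon>" "\<epsilon> < 1 / 2" "3 * \<epsilon> \<le> \<epsilon>1" using \<epsilon>1 by (auto simp: \<epsilon>_def)
  define \<kappa> where "\<kappa> = \<sigma>\<^sup>2 * \<epsilon>\<^sup>2 / (8 * T ^ 3)"
  have \<kappa>: "0 < \<kappa>" unfolding \<kappa>_def using \<sigma> \<epsilon> T by simp
  define \<beta> where "\<beta> = (1 - c) * \<sigma>\<^sup>2 / (2 * T)"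
  have \<beta>: "0 < \<beta>" unfolding \<beta>_def using \<sigma> c T by simp
  define b where "b = 22 / \<sigma> + 3 / \<sigma>\<^sup>2"
  have b: "0 < b" unfolding b_def using \<sigma> by (intro add_pos_pos) auto
  define e where "e = Min {1 / 2, \<beta>, \<sigma> / 2, \<sigma>\<^sup>2 / B\<^sup>2, \<kappa> / 4 / b}"
  have e: "0 < e" "e < 1" "e \<le> \<beta>" "e \<le> \<sigma> / 2" "e \<le> \<sigma>\<^sup>2 / B\<^sup>2" "e \<le> \<kappa> / 4 / b"
  proof -
    show "0 < e" unfolding e_def using \<beta> \<sigma> B \<kappa> b by simp
    have "e \<le> x" if "x \<in> {1 / 2, \<beta>, \<sigma> / 2, \<sigma>\<^sup>2 / B\<^sup>2, \<kappa> / 4 / b}" for x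
      unfolding e_def using that by (intro Min_le) auto
    from this[of "1 / 2"] this[of \<beta>] this[of "\<sigma> / 2"] this[of "\<sigma>\<^sup>2 / B\<^sup>2"] this[of "\<kappa> / 4 / b"]
    show "e < 1" "e \<le> \<beta>" "e \<le> \<sigma> / 2" "e \<le> \<sigma>\<^sup>2 / B\<^sup>2" "e \<le> \<kappa> / 4 / b" by auto
  qed
  have e6: "(22 / \<sigma> + 3 / \<sigma>\<^sup>2) * e \<le> \<kappa> / 4"
    using e(6) b unfolding b_def[symmetric] by (simp add: pos_le_divide_eq mult.commute mult.left_commute)
  define \<eta>0 where "\<eta>0 = \<kappa> * \<beta> / 16"
  have \<eta>0: "0 < \<eta>0" unfolding \<eta>0_def using \<kappa> \<beta> by simp
  define V where "V n = measure (M n) {\<omega> \<in> space (M n). (e * \<sigma>) * real (m n) < \<bar>(\<Sum>i<m n. (\<xi> n \<omega> i)\<^sup>2) - real (m n) * \<sigma>\<^sup>2\<bar>}" for n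
  define H where "H n = measure (M n) {\<omega> \<in> space (M n). \<eta>0 < \<bar>\<eta> n \<omega> - 0\<bar>}" for n
  define F where "F n = 4 * ((30 + (1 + 1 / \<sigma>)\<^sup>2) / (e\<^sup>2 * real n)) + 8 / (e\<^sup>2 * real n)" for n
  have Hlim: "H \<longlonglongrightarrow> 0" using \<eta>(2) \<eta>0 unfolding converges_in_prob_def H_def by blast
  have Flim: "F \<longlonglongrightarrow> 0"
  proof -
    have "(\<lambda>n. (4 * (30 + (1 + 1 / \<sigma>)\<^sup>2) / e\<^sup>2) / real n + (8 / e\<^sup>2) / real n) \<longlonglongrightarrow> 0 + 0"
      by (intro tendsto_add lim_const_over_n)
    then show ?thesis by (simp add: F_def[abs_def])
  qed
  have Vlim: "V \<longlonglongrightarrow> 0"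
  proof (rule tendstoI)
    fix \<zeta> :: real assume \<zeta>: "0 < \<zeta>"
    interpret L: real_distribution L by fact
    have "0 < e * \<sigma>" "0 < \<zeta> / 2" using e(1) \<sigma> \<zeta> by auto
    from weak_law_truncation[OF L.prob_space_axioms L.events_eq_borel _ _ noise(2) this, where 'a='c]
    obtain m0 where m0: "\<And>k (N :: 'c measure) Z. k \<ge> m0 \<Longrightarrow> prob_space N \<Longrightarrow> iid_with_law N {..<k} Z L \<Longrightarrow>
      measure N {\<omega> \<in> space N. e * \<sigma> * real k < \<bar>(\<Sum>i<k. (Z \<omega> i)\<^sup>2) - real k * \<sigma>\<^sup>2\<bar>} \<le> \<zeta> / 2"
      unfolding noise(3) by auto
    \<comment> \<open>From n > 2 \<open>m0\<close> and m > n / 2 there are at least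
      \<open>m0\<close> noise coordinates.\<close>
    show "\<forall>\<^sub>F n in sequentially. dist (V n) 0 < \<zeta>"
      using eventually_ge_at_top[of "2 * m0 + 1"]
    proof eventually_elim
      case (elim n)
      then have n: "1 \<le> n" by simp
      have "m0 \<le> m n" using ratio[OF n] elim n by (simp add: field_simps)
      then have "V n \<le> \<zeta> / 2" unfolding V_def using model[OF n] by (intro m0) (auto simp: linear_model_def)
      then show ?case using \<zeta> by (simp add: V_def)
    qed
  qed
  show "(\<lambda>n. measure (M n) {\<omega> \<in> space (M n).
      \<epsilon>1 < \<bar>risk n (\<mu>hat n \<omega>) (\<mu>0 n \<omega>) / (r_plus D U \<sigma> (real (m n) / real n))\<^sup>2 - 1\<bar>}) \<longlonglongrightarrow> 0"
  proof (rule tendsto_sandwich[where f="\<lambda>_. 0"])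
    show "(\<lambda>n. F n + V n + H n) \<longlonglongrightarrow> 0" using tendsto_add[OF tendsto_add[OF Flim Vlim] Hlim] by simp
    show "\<forall>\<^sub>F n in sequentially. measure (M n) {\<omega> \<in> space (M n).
      \<epsilon>1 < \<bar>risk n (\<mu>hat n \<omega>) (\<mu>0 n \<omega>) / (r_plus D U \<sigma> (real (m n) / real n))\<^sup>2 - 1\<bar>} \<le> F n + V n + H n"
      using a(2) c(2) eventually_ge_at_top[of 1]
    proof eventually_elim
      case (elim n)
      have Mn: "prob_space (M n)" using model[OF elim(3)] by (simp add: linear_model_def)
      interpret Mn: prob_space "M n" by fact
      have hm: "(\<lambda>\<omega>. \<mu>hat n \<omega> j) \<in> borel_measurable (M n)" if "j < n" for j
        using measurable_compose[OF hat(1)[OF elim(3)] measurable_component_singleton[of j]] that by simp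
      have sm: "(\<lambda>\<omega>. \<mu>0 n \<omega> j) \<in> borel_measurable (M n)" if "j < n" for j
        using model[OF elim(3)] that by (auto simp: linear_model_def iid_with_law_def Mn.indep_vars_def)
      note [measurable] = hm sm
      have "measure (M n) {\<omega> \<in> space (M n).
          \<epsilon>1 < \<bar>risk n (\<mu>hat n \<omega>) (\<mu>0 n \<omega>) / (r_plus D U \<sigma> (real (m n) / real n))\<^sup>2 - 1\<bar>}
        \<le> measure (M n) {\<omega> \<in> space (M n).
          3 * \<epsilon> < \<bar>risk n (\<mu>hat n \<omega>) (\<mu>0 n \<omega>) / (r_plus D U \<sigma> (real (m n) / real n))\<^sup>2 - 1\<bar>}"
        using \<epsilon>(3) by (intro Mn.finite_measure_mono) (auto simp: risk_def L2_set_def)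
      also have "\<dots> \<le> F n + V n + H n"
        unfolding F_def V_def H_def
        using elim wroot_antimono[OF a(1) elim(1)] ratio[of n] c(1)
        by (intro risk_deviation[OF _ _ model hat(1) hat(2) \<eta>(1) \<eta>(3) _ _ _ \<epsilon>(1,2) T_def \<kappa>_def \<beta>_def e(1-5) e6 \<eta>0_def])
          (auto simp: B_def)
      finally show ?case .
    qed
  qed simp_all
qed

end

text \<open>Slutsky's lemma with a deterministic factor: Z s - l = (Z - 1) s + (s - l), and
  eventually |s| \<le> |l| + 1.\<close>

lemma converges_in_prob_scale:
  assumes Z: "converges_in_prob M Z 1" and M: "\<forall>\<^sub>F n in sequentially. prob_space (M n) \<and> Z n \<in> borel_measurable (M n)"
    and s: "s \<longlonglongrightarrow> l" and W: "\<forall>\<^sub>F n in sequentially. \<forall>\<omega>\<in>space (M n). W n \<omega> = Z n \<omega> * s n"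
  shows "converges_in_prob M W l"
  unfolding converges_in_prob_def
proof (intro allI impI)
  fix \<epsilon> :: real assume \<epsilon>: "0 < \<epsilon>"
  define K where "K = \<bar>l\<bar> + 1"
  have K: "0 < K" by (simp add: K_def)
  define \<zeta> where "\<zeta> = \<epsilon> / (2 * K)"
  have \<zeta>: "0 < \<zeta>" using \<epsilon> K by (simp add: \<zeta>_def)
  have s': "\<forall>\<^sub>F n in sequentially. dist (s n) l < min 1 (\<epsilon> / 2)" using \<epsilon> by (intro tendstoD[OF s]) auto
  show "(\<lambda>n. measure (M n) {\<omega> \<in> space (M n). \<epsilon> < \<bar>W n \<omega> - l\<bar>}) \<longlonglongrightarrow> 0"
  proof (rule tendsto_sandwich[where f="\<lambda>_. 0"])
    show "(\<lambda>n. measure (M n) {\<omega> \<in> space (M n). \<zeta> < \<bar>Z n \<omega> - 1\<bar>}) \<longlonglongrightarrow> 0"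
      using Z \<zeta> by (simp add: converges_in_prob_def)
    show "\<forall>\<^sub>F n in sequentially. measure (M n) {\<omega> \<in> space (M n). \<epsilon> < \<bar>W n \<omega> - l\<bar>}
        \<le> measure (M n) {\<omega> \<in> space (M n). \<zeta> < \<bar>Z n \<omega> - 1\<bar>}"
      using M W s'
    proof eventually_elim
      case (elim n)
      interpret Mn: prob_space "M n" using elim(1) by simp
      have [measurable]: "Z n \<in> borel_measurable (M n)" using elim(1) by simp
      show ?case
      proof (rule Mn.finite_measure_mono)
        show "{\<omega> \<in> space (M n). \<epsilon> < \<bar>W n \<omega> - l\<bar>} \<subseteq> {\<omega> \<in> space (M n). \<zeta> < \<bar>Z n \<omega> - 1\<bar>}"
        proof safe
          fix \<omega> assume \<omega>: "\<omega> \<in> space (M n)" "\<epsilon> < \<bar>W n \<omega> - l\<bar>"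
          show "\<zeta> < \<bar>Z n \<omega> - 1\<bar>"
          proof (rule ccontr)
            assume "\<not> ?thesis"
            then have "\<bar>(Z n \<omega> - 1) * s n\<bar> \<le> \<zeta> * K"
              unfolding abs_mult using elim(3) \<zeta> by (intro mult_mono) (auto simp: K_def dist_real_def)
            also have "\<zeta> * K = \<epsilon> / 2" using K by (simp add: \<zeta>_def)
            finally have "\<bar>(Z n \<omega> - 1) * s n\<bar> + \<bar>s n - l\<bar> \<le> \<epsilon>" using elim(3) by (simp add: dist_real_def)
            moreover have "W n \<omega> - l = (Z n \<omega> - 1) * s n + (s n - l)"
              using elim(2) \<omega>(1) by (simp add: left_diff_distrib)
            ultimately show False using \<omega>(2) abs_triangle_ineq[of "(Z n \<omega> - 1) * s n" "s n - l"] by linarith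
          qed
        qed
      qed measurable
    qed
  qed simp_all
qed

theorem theorem3p1:
  fixes m :: "nat \<Rightarrow> nat" and \<sigma> :: real
    and L :: "real measure"
    and D :: "'b measure" and U :: "'b \<Rightarrow> real"
    and M :: "nat \<Rightarrow> 'a measure"
    and X :: "nat \<Rightarrow> 'a \<Rightarrow> nat \<times> nat \<Rightarrow> real"
    and \<xi> \<mu>0 Y \<mu>hat :: "nat \<Rightarrow> 'a \<Rightarrow> nat \<Rightarrow> real"
  assumes sigma: "0 < \<sigma>"
    and ratio: "\<And>n. n \<ge> 1 \<Longrightarrow> real (m n) / real n > 1 / 2"
    and noise: "real_distribution L" "integrable L (\<lambda>x. x\<^sup>2)"
      "(\<integral>x. x \<partial>L) = 0" "(\<integral>x. x\<^sup>2 \<partial>L) = \<sigma>\<^sup>2"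
    and signal: "prob_space D" "U \<in> borel_measurable D" "AE u in D. 0 \<le> U u"
      "integrable D (\<lambda>u. (U u)\<^sup>2)"
    and model: "\<And>n. n \<ge> 1 \<Longrightarrow>
      linear_model (m n) n L (distr D borel U) (M n) (X n) (\<xi> n) (\<mu>0 n) (Y n)"
    and near_min: "near_minimizers m \<sigma> M X \<mu>0 Y \<mu>hat"
  shows
    "((\<forall>n\<ge>1. \<exists>!r. 0 < r \<and> is_fixed_point D U \<sigma> (real (m n) / real n) r) \<and>
     (liminf (\<lambda>n. ereal (real (m n) / real n)) > ereal (1 / 2) \<longrightarrow>
      ereal (1 / \<sigma>\<^sup>2) * limsup (\<lambda>n. ereal (omega2_EH D U \<sigma> (real (m n) / real n))) < 1 \<longrightarrow>
      converges_in_prob M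
        (\<lambda>n \<omega>. risk n (\<mu>hat n \<omega>) (\<mu>0 n \<omega>) / (r_plus D U \<sigma> (real (m n) / real n))\<^sup>2) 1)) \<and>
     ((\<forall>\<delta>>1 / 2. \<exists>!r. 0 < r \<and> is_fixed_point D U \<sigma> \<delta> r) \<and>
     antimono_on {1 / 2<..} (r_plus D U \<sigma>) \<and>
     (r_plus D U \<sigma> \<longlongrightarrow> 0) at_top \<and>
     filterlim (r_plus D U \<sigma>) at_top (at_right (1 / 2)) \<and>
     (\<forall>\<delta>>1 / 2. (\<lambda>n. real (m n) / real n) \<longlonglongrightarrow> \<delta> \<longrightarrow>
        omega2_EH D U \<sigma> \<delta> < \<sigma>\<^sup>2 \<longrightarrow>
        converges_in_prob M (\<lambda>n \<omega>. risk n (\<mu>hat n \<omega>) (\<mu>0 n \<omega>)) ((r_plus D U \<sigma> \<delta>)\<^sup>2))) \<and>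
     (filterlim (\<lambda>n. real (m n) / real n) at_top sequentially \<longrightarrow>
     (let p0 = measure D {u \<in> space D. U u = 0} in
      converges_in_prob M
        (\<lambda>n \<omega>. risk n (\<mu>hat n \<omega>) (\<mu>0 n \<omega>)
                 / ((1 - p0 / 2) * \<sigma>\<^sup>2 * (real n / real (m n)))) 1))"
proof -
  interpret signal_law D U \<sigma>
    using signal sigma by (simp add: signal_law_def signal_law_axioms_def)
  let ?X = "\<lambda>n. real (m n) / real n"
  let ?p0 = "measure D {u \<in> space D. U u = 0}"
  let ?Z = "\<lambda>n \<omega>. risk n (\<mu>hat n \<omega>) (\<mu>0 n \<omega>) / (r_plus D U \<sigma> (?X n))\<^sup>2"
  have conv: "converges_in_prob M ?Z 1"
    if "1 / 2 < a" "\<forall>\<^sub>F n in sequentially. a \<le> ?X n"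
      "c < 1" "\<forall>\<^sub>F n in sequentially. omega2_EH D U \<sigma> (?X n) \<le> c * \<sigma>\<^sup>2" for a c
    by (rule risk_ratio_converges[OF _ noise(1,2,4) _ near_min that]) (use ratio model in auto)
  have meas: "\<forall>\<^sub>F n in sequentially. prob_space (M n) \<and> ?Z n \<in> borel_measurable (M n)"
    using eventually_ge_at_top[of 1]
  proof eventually_elim
    case (elim n)
    have Mn: "prob_space (M n)" using model[OF elim] by (simp add: linear_model_def)
    interpret Mn: prob_space "M n" by fact
    have "\<mu>hat n \<in> M n \<rightarrow>\<^sub>M borel_vec {..<n}" using near_min elim by (simp add: near_minimizers_def)
    from measurable_compose[OF this measurable_component_singleton]
    have hm: "(\<lambda>\<omega>. \<mu>hat n \<omega> j) \<in> borel_measurable (M n)" if "j < n" for j using that by simp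
    have sm: "(\<lambda>\<omega>. \<mu>0 n \<omega> j) \<in> borel_measurable (M n)" if "j < n" for j
      using model[OF elim] that by (auto simp: linear_model_def iid_with_law_def Mn.indep_vars_def)
    note [measurable] = hm sm
    show ?case using Mn by (simp add: risk_def L2_set_def)
  qed
  \<comment> \<open>A change of normalisation multiplies by a deterministic factor. Used with s = 1
    in the second part and with the explicit rate in the third.\<close>
  have resc: "\<forall>\<^sub>F n in sequentially. \<forall>\<omega>\<in>space (M n).
      risk n (\<mu>hat n \<omega>) (\<mu>0 n \<omega>) / s n = ?Z n \<omega> * ((r_plus D U \<sigma> (?X n))\<^sup>2 / s n)" for s
    using eventually_ge_at_top[of 1]
  proof eventually_elim
    case (elim n)
    then show ?case using r_plus_props(1)[OF ratio[OF elim]] by simp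
  qed
  have part1: "converges_in_prob M ?Z 1"
    if li: "liminf (\<lambda>n. ereal (?X n)) > ereal (1 / 2)"
      and ls: "ereal (1 / \<sigma>\<^sup>2) * limsup (\<lambda>n. ereal (omega2_EH D U \<sigma> (?X n))) < 1"
  proof -
    obtain a where a: "1 / 2 < a" "ereal a < liminf (\<lambda>n. ereal (?X n))" using ereal_dense2[OF li] by auto
    let ?l = "limsup (\<lambda>n. ereal (omega2_EH D U \<sigma> (?X n)))"
    \<comment> \<open>A real c strictly between the extended limsup and \<sigma>^2 turns the
      condition into a bound that holds eventually, with c / \<sigma>^2 below 1.\<close>
    have "?l < ereal (\<sigma>\<^sup>2)"
      using ls sigma by (cases ?l) (auto simp: one_ereal_def field_simps)
    then obtain c where c: "?l < ereal c" "c < \<sigma>\<^sup>2" using ereal_dense2 by force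
    show ?thesis
    proof (rule conv)
      show "\<forall>\<^sub>F n in sequentially. a \<le> ?X n"
        using less_LiminfD[OF a(2)] by eventually_elim simp
      show "c / \<sigma>\<^sup>2 < 1" using c sigma by simp
      show "\<forall>\<^sub>F n in sequentially. omega2_EH D U \<sigma> (?X n) \<le> c / \<sigma>\<^sup>2 * \<sigma>\<^sup>2"
        using Limsup_lessD[OF c(1)] by eventually_elim (use sigma in simp)
    qed (rule a)
  qed
  have part2: "converges_in_prob M (\<lambda>n \<omega>. risk n (\<mu>hat n \<omega>) (\<mu>0 n \<omega>)) ((r_plus D U \<sigma> \<delta>)\<^sup>2)"
    if \<delta>: "1 / 2 < \<delta>" and lim: "?X \<longlonglongrightarrow> \<delta>" and om: "omega2_EH D U \<sigma> \<delta> < \<sigma>\<^sup>2" for \<delta>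
  proof -
    define c where "c = (omega2_EH D U \<sigma> \<delta> + \<sigma>\<^sup>2) / 2"
    have c: "omega2_EH D U \<sigma> \<delta> < c" "c < \<sigma>\<^sup>2" using om by (auto simp: c_def)
    have "converges_in_prob M ?Z 1"
    proof (rule conv)
      show "1 / 2 < (\<delta> + 1 / 2) / 2" using \<delta> by simp
      have "(\<delta> + 1 / 2) / 2 < \<delta>" using \<delta> by simp
      from order_tendstoD(1)[OF lim this]
      show "\<forall>\<^sub>F n in sequentially. (\<delta> + 1 / 2) / 2 \<le> ?X n" by eventually_elim simp
      show "c / \<sigma>\<^sup>2 < 1" using c sigma by simp
      show "\<forall>\<^sub>F n in sequentially. omega2_EH D U \<sigma> (?X n) \<le> c / \<sigma>\<^sup>2 * \<sigma>\<^sup>2"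
        using order_tendstoD(2)[OF omega2_EH_tendsto[OF \<delta> lim] c(1)] by eventually_elim (use sigma in simp)
    qed
    from converges_in_prob_scale[OF this meas r_plus_tendsto[OF \<delta> lim]] resc[of "\<lambda>_. 1"]
    show ?thesis by simp
  qed
  have part3: "converges_in_prob M
        (\<lambda>n \<omega>. risk n (\<mu>hat n \<omega>) (\<mu>0 n \<omega>) / ((1 - ?p0 / 2) * \<sigma>\<^sup>2 * (real n / real (m n)))) 1"
    if lim: "filterlim ?X at_top sequentially"
  proof -
    have X1: "\<forall>\<^sub>F n in sequentially. 1 \<le> ?X n" using lim by (rule filterlim_at_top[THEN iffD1, rule_format])
    have w: "(\<lambda>n. (wroot (?X n))\<^sup>2) \<longlonglongrightarrow> 0"
      using tendsto_power[OF filterlim_compose[OF wroot_at_top lim], of 2] by simp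
    have Z: "converges_in_prob M ?Z 1"
    proof (rule conv[of 1 "1 / 2"])
      \<comment> \<open>For large ratios the condition on H holds by itself: the term is at most
        \<omega>^2, which tends to 0.\<close>
      have "0 < \<sigma>\<^sup>2 / 2" using sigma by simp
      from order_tendstoD(2)[OF w this] X1
      show "\<forall>\<^sub>F n in sequentially. omega2_EH D U \<sigma> (?X n) \<le> 1 / 2 * \<sigma>\<^sup>2"
      proof eventually_elim
        case (elim n)
        have d: "1 / 2 < ?X n" using elim(2) by linarith
        have "E\<Phi> (wroot (?X n)) - EG (wroot (?X n)) \<le> 1"
          using E\<Phi>_bounds(2)[of "wroot (?X n)"] EG_bounds(1)[OF r_plus_props(2)[OF d]] by linarith
        then have "omega2_EH D U \<sigma> (?X n) \<le> (wroot (?X n))\<^sup>2"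
          unfolding omega2_EH_eq[OF d] by (rule mult_left_le) simp
        then show ?case using elim(1) by linarith
      qed
    qed (use X1 in simp_all)
    \<comment> \<open>Since p_0 \<le> 1 the factor is at least 1 / 2, so it may be divided
      by.\<close>
    have q: "0 < 1 - ?p0 / 2" using prob_le_1[of "{u \<in> space D. U u = 0}"] by linarith
    have "(\<lambda>n. (r_plus D U \<sigma> (?X n))\<^sup>2 * ?X n / \<sigma>\<^sup>2 / (1 - ?p0 / 2)) \<longlonglongrightarrow> (1 - ?p0 / 2) / (1 - ?p0 / 2)"
      using q by (intro tendsto_divide r_plus_large_ratio[OF lim] tendsto_const) auto
    also have "(\<lambda>n. (r_plus D U \<sigma> (?X n))\<^sup>2 * ?X n / \<sigma>\<^sup>2 / (1 - ?p0 / 2))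
        = (\<lambda>n. (r_plus D U \<sigma> (?X n))\<^sup>2 / ((1 - ?p0 / 2) * \<sigma>\<^sup>2 * (real n / real (m n))))"
      by (simp add: fun_eq_iff mult.commute mult.left_commute)
    also have "(1 - ?p0 / 2) / (1 - ?p0 / 2) = 1" using q by (intro divide_self) linarith
    finally show ?thesis by (rule converges_in_prob_scale[OF Z meas _ resc])
  qed
  show ?thesis
    unfolding Let_def
    using part1 part2 part3 ex1_fixed_point[OF ratio] ex1_fixed_point r_plus_antimono r_plus_at_top r_plus_at_half
    by blast
qed

end
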